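(* Let $\mathcal C$ be a $BTC^*$ whose subcategory $\mathcal D=\mathcal D(\mathcal C)$ of degenerate objects is even. Then $\mathcal C\rtimes\mathcal D$ is non-degenerate; thus every irreducible degenerate object of $\mathcal C\rtimes\mathcal D$ is equivalent to $\iota$. If $\mathcal C\rtimes\mathcal D$ is rational (which follows if $\mathcal C$ is rational) then $\mathcal C\rtimes\mathcal D$ is modular.
   Context: Tensor categories. All are small and strict; $\rho\sigma$ is the tensor product of objects, $\times$ that of arrows, $\circ$ is composition, $\iota$ the unit. A tensor $*$-category has complex vector spaces as Hom-sets, bilinear $\circ,\times$, and a positive $*$-operation (antilinear, involutive, contravariant, monoidal, and $X^*\circ X=0\Rightarrow X=0$). $\rho$ is irreducible if $\mathrm{Hom}(\rho,\rho)=\mathbb C\,\mathrm{id}_\rho$. Subobjects (for every projection $E=E^*=E^2\in\mathrm{Hom}(\rho,\rho)$ an isometry $V$ with $VV^*=E$), direct sums (isometries $V_i\in\mathrm{Hom}(\rho_i,\tau)$ with $V_1V_1^*+V_2V_2^*=\mathrm{id}_\tau$) and conjugates ($R\in\mathrm{Hom}(\iota,\bar\rho\rho)$, $\bar R\in\mathrm{Hom}(\iota,\rho\bar\rho)$ with $(\bar R^*\times\mathrm{id}_\rho)\circ(\mathrm{id}_\rho\times R)=\mathrm{id}_\rho$, $(R^*\times\mathrm{id}_{\bar\rho})\circ(\mathrm{id}_{\bar\rho}\times\bar R)=\mathrm{id}_{\bar\rho}$, normalized by $R^*R=\bar R^*\bar R=d(\rho)\mathrm{id}_\iota$ for $\rho$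 irreducible) are meant in the $*$-sense. For reducible $\rho$ only standard solutions $R_\rho=\sum_i(\bar W_i\times W_i)\circ R_i$, built from a decomposition into irreducibles, are used. A $TC^*$ is a tensor $*$-category with conjugates, direct sums, subobjects, finite dimensional Hom-spaces and irreducible unit; a $BTC^*$ is a $TC^*$ with unitary braiding $\varepsilon$. Write $\varepsilon_M(\rho,\sigma)=\varepsilon(\sigma,\rho)\circ\varepsilon(\rho,\sigma)$. An object $\rho$ is degenerate if $\varepsilon_M(\rho,\eta)=\mathrm{id}_{\rho\eta}$ for all $\eta$; $\mathcal D(\mathcal C)$ is the full subcategory of degenerate objects (a symmetric replete full subcategory closed under tensor products, conjugates, direct sums, subobjects). A braided tensor category is degenerate if it has an irreducible degenerate object not isomorphic to $\iota$. The twist is $\kappa(\rho)=(R_\rho^*\times\mathrm{id}_\rho)\circ(\mathrm{id}_{\bar\rho}\times\varepsilon(\rho,\rho))\circ(R_\rho\times\mathrm{id}_\rho)$; $\mathcal D$ is even if $\kappa(\rho)=\mathrm{id}_\rho$ for all $\rho\in\mathcal D$. A $BTC^*$ is rational if it has finitely many isomorphism classes of irreducible objects; a rational $BTC^*$ is modular if the matrix $Y_{\rho,\sigma}$ indexed by these classes is invertible, where $Y_{\rho,\sigma}\mathrm{id}_\iota=(R_\rho^*\times\bar R_\sigma^* )\circ(\mathrm{id}_{\bar\rho}\times\varepsilon_M(\rho,\sigma)\times\mathrm{id}_{\bar\sigma})\circ(R_\rho\times\bar R_\sigma)$. Crossed product (here with $\mathcal S=\mathcal D$). By Doplicher–Roberts,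 for an even symmetric replete full subcategory $\mathcal S\subset\mathcal C$ closed under tensor products, conjugates, direct sums and subobjects there are a compact group $G$, unique up to isomorphism, and an isomorphism $F:\mathcal S\to U(G)$ of symmetric tensor $*$-categories onto a category of finite dimensional continuous unitary representations of $G$ closed under direct sums and subrepresentations and containing members of all classes of irreducibles. Tensor product in $U(G)$ is $\boxtimes$; $F(\iota)=\mathbb C$ contains a unit vector $\Omega$ with $\Omega\boxtimes\psi=\psi\boxtimes\Omega=\psi$. Let $\hat G$ be the set of isomorphism classes of irreducible objects of $\mathcal S$, $\gamma_k$ ($k\in\hat G$) representatives with $\gamma_0=\iota$, $\mathcal H_k=F(\gamma_k)$; choose orthonormal bases $\{V_{k,l}^{m,\alpha}\}_{\alpha=1}^{N_{k,l}^m}$ of $\mathrm{Hom}(\gamma_m,\gamma_k\gamma_l)$ ($V^*\circ W=\langle V,W\rangle\mathrm{id}$), and normalized solutions $R_k\in\mathrm{Hom}(\iota,\gamma_{\bar k}\gamma_k)$, $\bar R_k\in\mathrm{Hom}(\iota,\gamma_k\gamma_{\bar k})$ of the conjugate equations with $R_{\bar k}=\bar R_k$, $\bar R_{\bar k}=R_k$ if $\bar k\neq k$ and $\bar R_k=\pm R_k$ if $\bar k=k$. $\mathcal C\rtimes_0\mathcal S$ has the objects and tensor product of objects of $\mathcal C$, and $\mathrm{Hom}_{\mathcal C\rtimes_0\mathcal S}(\rho,\sigma)=\bigoplus_{k\in\hat G}\mathrm{Hom}_{\mathcal C}(\gamma_k\rho,\sigma)\otimes\mathcal H_k$. For $S\in\mathrm{Hom}(\gamma_k\sigma,\delta)$,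 $T\in\mathrm{Hom}(\gamma_l\rho,\sigma)$, $\psi_k\in\mathcal H_k,\psi_l\in\mathcal H_l$, $$(S\otimes\psi_k)\circ(T\otimes\psi_l)=\bigoplus_{m}\sum_\alpha\big[S\circ(\mathrm{id}_{\gamma_k}\times T)\circ(V_{k,l}^{m,\alpha}\times\mathrm{id}_\rho)\big]\otimes F(V_{k,l}^{m,\alpha})^*(\psi_k\boxtimes\psi_l);$$ for $S\in\mathrm{Hom}(\gamma_k\rho_1,\sigma_1)$, $T\in\mathrm{Hom}(\gamma_l\rho_2,\sigma_2)$, $$(S\otimes\psi_k)\times(T\otimes\psi_l)=\bigoplus_{m}\sum_\alpha\big[(S\times T)\circ(\mathrm{id}_{\gamma_k}\times\varepsilon(\gamma_l,\rho_1)\times\mathrm{id}_{\rho_2})\circ(V_{k,l}^{m,\alpha}\times\mathrm{id}_{\rho_1\rho_2})\big]\otimes F(V_{k,l}^{m,\alpha})^*(\psi_k\boxtimes\psi_l);$$ for $S\in\mathrm{Hom}(\gamma_k\rho,\sigma)$, $(S\otimes\psi_k)^*=\big[(R_k^*\times\mathrm{id}_\rho)\circ(\mathrm{id}_{\gamma_{\bar k}}\times S^* )\big]\otimes\bar\psi$, where $\bar\psi\in\mathcal H_{\bar k}$ is defined by $\langle a,\bar\psi\rangle=\langle\psi_k\boxtimes a,F(\bar R_k)\Omega\rangle$ for all $a\in\mathcal H_{\bar k}$ (inner products antilinear in the first variable). $\mathcal C$ is a subcategory via $S\mapsto S\otimes\Omega$. $\mathcal C\rtimes\mathcal S$ is the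 closure of $\mathcal C\rtimes_0\mathcal S$ under subobjects: objects are pairs $(\rho,E)$ with $E=E^2=E^*\in\mathrm{Hom}_{\mathcal C\rtimes_0\mathcal S}(\rho,\rho)$, $\mathrm{Hom}((\rho,E),(\sigma,E'))=E'\circ\mathrm{Hom}_{\mathcal C\rtimes_0\mathcal S}(\rho,\sigma)\circ E$, $\mathrm{id}_{(\rho,E)}=E$, $(\rho,E)(\sigma,E')=(\rho\sigma,E\times E')$, with $\circ,\times,*$ of arrows as in $\mathcal C\rtimes_0\mathcal S$; $\rho$ is identified with $(\rho,\mathrm{id}_\rho)$. For $\mathcal S\subset\mathcal D(\mathcal C)$ it is a $BTC^*$ with braiding $\varepsilon((\rho,E),(\sigma,E'))=(E'\times E)\circ(\varepsilon(\rho,\sigma)\otimes\Omega)\circ(E\times E')$. *)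

theory Defs
  imports
    "HOL-Analysis.T1_Spaces"
    "HOL-Algebra.Group"
    "HOL-Library.Function_Algebras"
begin

section \<open>Strict tensor star-categories\<close>

text \<open>
  An arrow carries its source, its target and a vector. All Hom-spaces are linear subspaces of one
  ambient complex vector space (the type \<open>'a\<close> with scalar multiplication \<open>scl\<close>); they may overlap,
  because arrows with different sources or targets are different anyway. A category with arbitrary
  complex vector spaces as Hom-sets is brought into this form by taking the direct sum of all of them.
\<close>

datatype ('o, 'a) arrow = Arrow (src: 'o) (tgt: 'o) (vect: 'a)

record ('o, 'a) tcat =
  Obj :: "'o set"
  HomV :: "'o \<Rightarrow> 'o \<Rightarrow> 'a set"
  scl :: "complex \<Rightarrow> 'a \<Rightarrow> 'a"
  idn :: "'o \<Rightarrow> ('o, 'a) arrow"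
  cmp :: "('o, 'a) arrow \<Rightarrow> ('o, 'a) arrow \<Rightarrow> ('o, 'a) arrow"  (infixl "\<cdot>\<index>" 65)
  unt :: "'o"
  tob :: "'o \<Rightarrow> 'o \<Rightarrow> 'o"  (infixl "\<odot>\<index>" 75)
  tar :: "('o, 'a) arrow \<Rightarrow> ('o, 'a) arrow \<Rightarrow> ('o, 'a) arrow"  (infixl "\<boxtimes>\<index>" 75)
  star :: "('o, 'a) arrow \<Rightarrow> ('o, 'a) arrow"
  brd :: "'o \<Rightarrow> 'o \<Rightarrow> ('o, 'a) arrow"

definition Hom :: "('o, 'a, 'm) tcat_scheme \<Rightarrow> 'o \<Rightarrow> 'o \<Rightarrow> ('o, 'a) arrow set" where
  "Hom C \<rho> \<sigma> = Arrow \<rho> \<sigma> ` HomV C \<rho> \<sigma>"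

definition arr_add :: "('o, 'a::ab_group_add) arrow \<Rightarrow> ('o, 'a) arrow \<Rightarrow> ('o, 'a) arrow" where
  "arr_add f g = Arrow (src f) (tgt f) (vect f + vect g)"

definition arr_scl :: "('o, 'a, 'm) tcat_scheme \<Rightarrow> complex \<Rightarrow> ('o, 'a) arrow \<Rightarrow> ('o, 'a) arrow" where
  "arr_scl C c f = Arrow (src f) (tgt f) (scl C c (vect f))"

definition arr_zero :: "'o \<Rightarrow> 'o \<Rightarrow> ('o, 'a::ab_group_add) arrow" where
  "arr_zero \<rho> \<sigma> = Arrow \<rho> \<sigma> 0"

definition arr_sum :: "'o \<Rightarrow> 'o \<Rightarrow> ('i \<Rightarrow> ('o, 'a::ab_group_add) arrow) \<Rightarrow> 'i set \<Rightarrow> ('o, 'a) arrow" where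
  "arr_sum \<rho> \<sigma> f I = Arrow \<rho> \<sigma> (\<Sum>i\<in>I. vect (f i))"

locale tensor_star_category =
  fixes C :: "('o, 'a::ab_group_add, 'm) tcat_scheme" (structure)
  assumes vs: "vector_space (scl C)"
    and Hom_subspace: "\<lbrakk>\<rho> \<in> Obj C; \<sigma> \<in> Obj C\<rbrakk> \<Longrightarrow> module.subspace (scl C) (HomV C \<rho> \<sigma>)"
    and idn_Hom: "\<rho> \<in> Obj C \<Longrightarrow> idn C \<rho> \<in> Hom C \<rho> \<rho>"
    and cmp_Hom: "\<lbrakk>\<rho> \<in> Obj C; \<sigma> \<in> Obj C; \<delta> \<in> Obj C; f \<in> Hom C \<sigma> \<delta>; g \<in> Hom C \<rho> \<sigma>\<rbrakk>
      \<Longrightarrow> f \<cdot> g \<in> Hom C \<rho> \<delta>"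
    and cmp_idn_left: "\<lbrakk>\<rho> \<in> Obj C; \<sigma> \<in> Obj C; f \<in> Hom C \<rho> \<sigma>\<rbrakk> \<Longrightarrow> idn C \<sigma> \<cdot> f = f"
    and cmp_idn_right: "\<lbrakk>\<rho> \<in> Obj C; \<sigma> \<in> Obj C; f \<in> Hom C \<rho> \<sigma>\<rbrakk> \<Longrightarrow> f \<cdot> idn C \<rho> = f"
    and cmp_assoc: "\<lbrakk>\<rho> \<in> Obj C; \<sigma> \<in> Obj C; \<tau> \<in> Obj C; \<delta> \<in> Obj C;
        f \<in> Hom C \<tau> \<delta>; g \<in> Hom C \<sigma> \<tau>; h \<in> Hom C \<rho> \<sigma>\<rbrakk> \<Longrightarrow> f \<cdot> g \<cdot> h = f \<cdot> (g \<cdot> h)"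
    and cmp_add_left: "\<lbrakk>\<rho> \<in> Obj C; \<sigma> \<in> Obj C; \<delta> \<in> Obj C;
        f \<in> Hom C \<sigma> \<delta>; f' \<in> Hom C \<sigma> \<delta>; g \<in> Hom C \<rho> \<sigma>\<rbrakk>
      \<Longrightarrow> arr_add f f' \<cdot> g = arr_add (f \<cdot> g) (f' \<cdot> g)"
    and cmp_add_right: "\<lbrakk>\<rho> \<in> Obj C; \<sigma> \<in> Obj C; \<delta> \<in> Obj C;
        f \<in> Hom C \<sigma> \<delta>; g \<in> Hom C \<rho> \<sigma>; g' \<in> Hom C \<rho> \<sigma>\<rbrakk>
      \<Longrightarrow> f \<cdot> arr_add g g' = arr_add (f \<cdot> g) (f \<cdot> g')"
    and cmp_scl_left: "\<lbrakk>\<rho> \<in> Obj C; \<sigma> \<in> Obj C; \<delta> \<in> Obj C; f \<in> Hom C \<sigma> \<delta>; g \<in> Hom C \<rho> \<sigma>\<rbrakk>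
      \<Longrightarrow> arr_scl C c f \<cdot> g = arr_scl C c (f \<cdot> g)"
    and cmp_scl_right: "\<lbrakk>\<rho> \<in> Obj C; \<sigma> \<in> Obj C; \<delta> \<in> Obj C; f \<in> Hom C \<sigma> \<delta>; g \<in> Hom C \<rho> \<sigma>\<rbrakk>
      \<Longrightarrow> f \<cdot> arr_scl C c g = arr_scl C c (f \<cdot> g)"
    and unt_Obj: "unt C \<in> Obj C"
    and tob_Obj: "\<lbrakk>\<rho> \<in> Obj C; \<sigma> \<in> Obj C\<rbrakk> \<Longrightarrow> \<rho> \<odot> \<sigma> \<in> Obj C"
    and tob_assoc: "\<lbrakk>\<rho> \<in> Obj C; \<sigma> \<in> Obj C; \<tau> \<in> Obj C\<rbrakk> \<Longrightarrow> \<rho> \<odot> \<sigma> \<odot> \<tau> = \<rho> \<odot> (\<sigma> \<odot> \<tau>)"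
    and tob_unt_left: "\<rho> \<in> Obj C \<Longrightarrow> unt C \<odot> \<rho> = \<rho>"
    and tob_unt_right: "\<rho> \<in> Obj C \<Longrightarrow> \<rho> \<odot> unt C = \<rho>"
    and tar_Hom: "\<lbrakk>\<rho> \<in> Obj C; \<sigma> \<in> Obj C; \<rho>' \<in> Obj C; \<sigma>' \<in> Obj C; f \<in> Hom C \<rho> \<sigma>; g \<in> Hom C \<rho>' \<sigma>'\<rbrakk>
      \<Longrightarrow> f \<boxtimes> g \<in> Hom C (\<rho> \<odot> \<rho>') (\<sigma> \<odot> \<sigma>')"
    and tar_assoc: "\<lbrakk>\<rho> \<in> Obj C; \<sigma> \<in> Obj C; \<rho>' \<in> Obj C; \<sigma>' \<in> Obj C; \<rho>'' \<in> Obj C; \<sigma>'' \<in> Obj C;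
        f \<in> Hom C \<rho> \<sigma>; g \<in> Hom C \<rho>' \<sigma>'; h \<in> Hom C \<rho>'' \<sigma>''\<rbrakk> \<Longrightarrow> f \<boxtimes> g \<boxtimes> h = f \<boxtimes> (g \<boxtimes> h)"
    and tar_unt_left: "\<lbrakk>\<rho> \<in> Obj C; \<sigma> \<in> Obj C; f \<in> Hom C \<rho> \<sigma>\<rbrakk> \<Longrightarrow> idn C (unt C) \<boxtimes> f = f"
    and tar_unt_right: "\<lbrakk>\<rho> \<in> Obj C; \<sigma> \<in> Obj C; f \<in> Hom C \<rho> \<sigma>\<rbrakk> \<Longrightarrow> f \<boxtimes> idn C (unt C) = f"
    and tar_idn: "\<lbrakk>\<rho> \<in> Obj C; \<sigma> \<in> Obj C\<rbrakk> \<Longrightarrow> idn C \<rho> \<boxtimes> idn C \<sigma> = idn C (\<rho> \<odot> \<sigma>)"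
    and interchange: "\<lbrakk>\<rho> \<in> Obj C; \<sigma> \<in> Obj C; \<delta> \<in> Obj C; \<rho>' \<in> Obj C; \<sigma>' \<in> Obj C; \<delta>' \<in> Obj C;
        f \<in> Hom C \<sigma> \<delta>; g \<in> Hom C \<rho> \<sigma>; f' \<in> Hom C \<sigma>' \<delta>'; g' \<in> Hom C \<rho>' \<sigma>'\<rbrakk>
      \<Longrightarrow> (f \<boxtimes> f') \<cdot> (g \<boxtimes> g') = (f \<cdot> g) \<boxtimes> (f' \<cdot> g')"
    and tar_add_left: "\<lbrakk>\<rho> \<in> Obj C; \<sigma> \<in> Obj C; \<rho>' \<in> Obj C; \<sigma>' \<in> Obj C;
        f \<in> Hom C \<rho> \<sigma>; f' \<in> Hom C \<rho> \<sigma>; g \<in> Hom C \<rho>' \<sigma>'\<rbrakk>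
      \<Longrightarrow> arr_add f f' \<boxtimes> g = arr_add (f \<boxtimes> g) (f' \<boxtimes> g)"
    and tar_add_right: "\<lbrakk>\<rho> \<in> Obj C; \<sigma> \<in> Obj C; \<rho>' \<in> Obj C; \<sigma>' \<in> Obj C;
        f \<in> Hom C \<rho> \<sigma>; g \<in> Hom C \<rho>' \<sigma>'; g' \<in> Hom C \<rho>' \<sigma>'\<rbrakk>
      \<Longrightarrow> f \<boxtimes> arr_add g g' = arr_add (f \<boxtimes> g) (f \<boxtimes> g')"
    and tar_scl_left: "\<lbrakk>\<rho> \<in> Obj C; \<sigma> \<in> Obj C; \<rho>' \<in> Obj C; \<sigma>' \<in> Obj C;
        f \<in> Hom C \<rho> \<sigma>; g \<in> Hom C \<rho>' \<sigma>'\<rbrakk> \<Longrightarrow> arr_scl C c f \<boxtimes> g = arr_scl C c (f \<boxtimes> g)"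
    and tar_scl_right: "\<lbrakk>\<rho> \<in> Obj C; \<sigma> \<in> Obj C; \<rho>' \<in> Obj C; \<sigma>' \<in> Obj C;
        f \<in> Hom C \<rho> \<sigma>; g \<in> Hom C \<rho>' \<sigma>'\<rbrakk> \<Longrightarrow> f \<boxtimes> arr_scl C c g = arr_scl C c (f \<boxtimes> g)"
    and star_Hom: "\<lbrakk>\<rho> \<in> Obj C; \<sigma> \<in> Obj C; f \<in> Hom C \<rho> \<sigma>\<rbrakk> \<Longrightarrow> star C f \<in> Hom C \<sigma> \<rho>"
    and star_star: "\<lbrakk>\<rho> \<in> Obj C; \<sigma> \<in> Obj C; f \<in> Hom C \<rho> \<sigma>\<rbrakk> \<Longrightarrow> star C (star C f) = f"
    and star_add: "\<lbrakk>\<rho> \<in> Obj C; \<sigma> \<in> Obj C; f \<in> Hom C \<rho> \<sigma>; g \<in> Hom C \<rho> \<sigma>\<rbrakk>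
      \<Longrightarrow> star C (arr_add f g) = arr_add (star C f) (star C g)"
    and star_scl: "\<lbrakk>\<rho> \<in> Obj C; \<sigma> \<in> Obj C; f \<in> Hom C \<rho> \<sigma>\<rbrakk>
      \<Longrightarrow> star C (arr_scl C c f) = arr_scl C (cnj c) (star C f)"
    and star_cmp: "\<lbrakk>\<rho> \<in> Obj C; \<sigma> \<in> Obj C; \<delta> \<in> Obj C; f \<in> Hom C \<sigma> \<delta>; g \<in> Hom C \<rho> \<sigma>\<rbrakk>
      \<Longrightarrow> star C (f \<cdot> g) = star C g \<cdot> star C f"
    and star_tar: "\<lbrakk>\<rho> \<in> Obj C; \<sigma> \<in> Obj C; \<rho>' \<in> Obj C; \<sigma>' \<in> Obj C; f \<in> Hom C \<rho> \<sigma>; g \<in> Hom C \<rho>' \<sigma>'\<rbrakk>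
      \<Longrightarrow> star C (f \<boxtimes> g) = star C f \<boxtimes> star C g"
    and star_positive: "\<lbrakk>\<rho> \<in> Obj C; \<sigma> \<in> Obj C; f \<in> Hom C \<rho> \<sigma>; star C f \<cdot> f = arr_zero \<rho> \<rho>\<rbrakk>
      \<Longrightarrow> f = arr_zero \<rho> \<sigma>"

text \<open>
  \<open>Hom(\<rho>,\<rho>) = \<complex> id\<close> is read as one-dimensionality: zero objects, which exist as soon as
  the zero projection has a subobject, are not irreducible.
\<close>

definition irreducible_obj :: "('o, 'a::ab_group_add, 'm) tcat_scheme \<Rightarrow> 'o \<Rightarrow> bool" where
  "irreducible_obj C \<rho> \<longleftrightarrow> \<rho> \<in> Obj C \<and> idn C \<rho> \<noteq> arr_zero \<rho> \<rho> \<and>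
     Hom C \<rho> \<rho> = range (\<lambda>c. arr_scl C c (idn C \<rho>))"

definition isom :: "('o, 'a, 'm) tcat_scheme \<Rightarrow> 'o \<Rightarrow> 'o \<Rightarrow> bool" where
  "isom C \<rho> \<sigma> \<longleftrightarrow> \<rho> \<in> Obj C \<and> \<sigma> \<in> Obj C \<and>
     (\<exists>f \<in> Hom C \<rho> \<sigma>. \<exists>g \<in> Hom C \<sigma> \<rho>. g \<cdot>\<^bsub>C\<^esub> f = idn C \<rho> \<and> f \<cdot>\<^bsub>C\<^esub> g = idn C \<sigma>)"

definition isometry :: "('o, 'a, 'm) tcat_scheme \<Rightarrow> 'o \<Rightarrow> 'o \<Rightarrow> ('o, 'a) arrow \<Rightarrow> bool" where
  "isometry C \<rho> \<sigma> V \<longleftrightarrow> V \<in> Hom C \<rho> \<sigma> \<and> star C V \<cdot>\<^bsub>C\<^esub> V = idn C \<rho>"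

definition projection :: "('o, 'a, 'm) tcat_scheme \<Rightarrow> 'o \<Rightarrow> ('o, 'a) arrow \<Rightarrow> bool" where
  "projection C \<rho> E \<longleftrightarrow> E \<in> Hom C \<rho> \<rho> \<and> E \<cdot>\<^bsub>C\<^esub> E = E \<and> star C E = E"

definition conj_solution ::
  "('o, 'a, 'm) tcat_scheme \<Rightarrow> 'o \<Rightarrow> 'o \<Rightarrow> ('o, 'a) arrow \<Rightarrow> ('o, 'a) arrow \<Rightarrow> bool" where
  "conj_solution C \<rho> \<rho>b R Rb \<longleftrightarrow> \<rho> \<in> Obj C \<and> \<rho>b \<in> Obj C \<and>
     R \<in> Hom C (unt C) (\<rho>b \<odot>\<^bsub>C\<^esub> \<rho>) \<and> Rb \<in> Hom C (unt C) (\<rho> \<odot>\<^bsub>C\<^esub> \<rho>b) \<and>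
     (star C Rb \<boxtimes>\<^bsub>C\<^esub> idn C \<rho>) \<cdot>\<^bsub>C\<^esub> (idn C \<rho> \<boxtimes>\<^bsub>C\<^esub> R) = idn C \<rho> \<and>
     (star C R \<boxtimes>\<^bsub>C\<^esub> idn C \<rho>b) \<cdot>\<^bsub>C\<^esub> (idn C \<rho>b \<boxtimes>\<^bsub>C\<^esub> Rb) = idn C \<rho>b"

text \<open>The number \<open>d\<close> is the dimension of \<open>\<rho>\<close> if \<open>\<rho>\<close> is irreducible.\<close>

definition normalized_solution ::
  "('o, 'a, 'm) tcat_scheme \<Rightarrow> 'o \<Rightarrow> 'o \<Rightarrow> ('o, 'a) arrow \<Rightarrow> ('o, 'a) arrow \<Rightarrow> bool" where
  "normalized_solution C \<rho> \<rho>b R Rb \<longleftrightarrow> conj_solution C \<rho> \<rho>b R Rb \<and>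
     (\<exists>d. star C R \<cdot>\<^bsub>C\<^esub> R = arr_scl C d (idn C (unt C)) \<and>
          star C Rb \<cdot>\<^bsub>C\<^esub> Rb = arr_scl C d (idn C (unt C)))"

definition standard_solution ::
  "('o, 'a::ab_group_add, 'm) tcat_scheme \<Rightarrow> 'o \<Rightarrow> 'o \<Rightarrow> ('o, 'a) arrow \<Rightarrow> ('o, 'a) arrow \<Rightarrow> bool" where
  "standard_solution C \<rho> \<rho>b R Rb \<longleftrightarrow> \<rho> \<in> Obj C \<and> \<rho>b \<in> Obj C \<and>
     (\<exists>(n::nat) r rb Ri Rbi W Wb.
        (\<forall>i<n. irreducible_obj C (r i) \<and> irreducible_obj C (rb i) \<and>
           normalized_solution C (r i) (rb i) (Ri i) (Rbi i) \<and>
           isometry C (r i) \<rho> (W i) \<and> isometry C (rb i) \<rho>b (Wb i)) \<and>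
        arr_sum \<rho> \<rho> (\<lambda>i. W i \<cdot>\<^bsub>C\<^esub> star C (W i)) {..<n} = idn C \<rho> \<and>
        arr_sum \<rho>b \<rho>b (\<lambda>i. Wb i \<cdot>\<^bsub>C\<^esub> star C (Wb i)) {..<n} = idn C \<rho>b \<and>
        R = arr_sum (unt C) (\<rho>b \<odot>\<^bsub>C\<^esub> \<rho>) (\<lambda>i. (Wb i \<boxtimes>\<^bsub>C\<^esub> W i) \<cdot>\<^bsub>C\<^esub> Ri i) {..<n} \<and>
        Rb = arr_sum (unt C) (\<rho> \<odot>\<^bsub>C\<^esub> \<rho>b) (\<lambda>i. (W i \<boxtimes>\<^bsub>C\<^esub> Wb i) \<cdot>\<^bsub>C\<^esub> Rbi i) {..<n})"

locale TC_star = tensor_star_category C for C :: "('o, 'a::ab_group_add, 'm) tcat_scheme" (structure) +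
  assumes conjugates: "\<rho> \<in> Obj C \<Longrightarrow> \<exists>\<rho>b R Rb. conj_solution C \<rho> \<rho>b R Rb \<and>
        (irreducible_obj C \<rho> \<longrightarrow> normalized_solution C \<rho> \<rho>b R Rb)"
    and direct_sums: "\<lbrakk>\<rho> \<in> Obj C; \<sigma> \<in> Obj C\<rbrakk> \<Longrightarrow> \<exists>\<tau> \<in> Obj C. \<exists>V W. isometry C \<rho> \<tau> V \<and> isometry C \<sigma> \<tau> W \<and>
        arr_add (V \<cdot> star C V) (W \<cdot> star C W) = idn C \<tau>"
    and subobjects: "\<lbrakk>\<rho> \<in> Obj C; projection C \<rho> E\<rbrakk>
        \<Longrightarrow> \<exists>\<sigma> \<in> Obj C. \<exists>V. isometry C \<sigma> \<rho> V \<and> V \<cdot> star C V = E"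
    and Hom_finite_dim: "\<lbrakk>\<rho> \<in> Obj C; \<sigma> \<in> Obj C\<rbrakk>
        \<Longrightarrow> \<exists>B. finite B \<and> HomV C \<rho> \<sigma> = module.span (scl C) B"
    and unt_irreducible: "irreducible_obj C (unt C)"

locale BTC_star = TC_star C for C :: "('o, 'a::ab_group_add, 'm) tcat_scheme" (structure) +
  assumes brd_Hom: "\<lbrakk>\<rho> \<in> Obj C; \<sigma> \<in> Obj C\<rbrakk> \<Longrightarrow> brd C \<rho> \<sigma> \<in> Hom C (\<rho> \<odot> \<sigma>) (\<sigma> \<odot> \<rho>)"
    and brd_unitary: "\<lbrakk>\<rho> \<in> Obj C; \<sigma> \<in> Obj C\<rbrakk> \<Longrightarrow> star C (brd C \<rho> \<sigma>) \<cdot> brd C \<rho> \<sigma> = idn C (\<rho> \<odot> \<sigma>) \<and>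
        brd C \<rho> \<sigma> \<cdot> star C (brd C \<rho> \<sigma>) = idn C (\<sigma> \<odot> \<rho>)"
    and brd_natural: "\<lbrakk>\<rho> \<in> Obj C; \<sigma> \<in> Obj C; \<rho>' \<in> Obj C; \<sigma>' \<in> Obj C; f \<in> Hom C \<rho> \<rho>'; g \<in> Hom C \<sigma> \<sigma>'\<rbrakk>
        \<Longrightarrow> brd C \<rho>' \<sigma>' \<cdot> (f \<boxtimes> g) = (g \<boxtimes> f) \<cdot> brd C \<rho> \<sigma>"
    and brd_tob_right: "\<lbrakk>\<rho> \<in> Obj C; \<sigma> \<in> Obj C; \<tau> \<in> Obj C\<rbrakk>
        \<Longrightarrow> brd C \<rho> (\<sigma> \<odot> \<tau>) = (idn C \<sigma> \<boxtimes> brd C \<rho> \<tau>) \<cdot> (brd C \<rho> \<sigma> \<boxtimes> idn C \<tau>)"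
    and brd_tob_left: "\<lbrakk>\<rho> \<in> Obj C; \<sigma> \<in> Obj C; \<tau> \<in> Obj C\<rbrakk>
        \<Longrightarrow> brd C (\<rho> \<odot> \<sigma>) \<tau> = (brd C \<rho> \<tau> \<boxtimes> idn C \<sigma>) \<cdot> (idn C \<rho> \<boxtimes> brd C \<sigma> \<tau>)"

definition monodromy :: "('o, 'a, 'm) tcat_scheme \<Rightarrow> 'o \<Rightarrow> 'o \<Rightarrow> ('o, 'a) arrow" where
  "monodromy C \<rho> \<sigma> = brd C \<sigma> \<rho> \<cdot>\<^bsub>C\<^esub> brd C \<rho> \<sigma>"

definition degenerate_obj :: "('o, 'a, 'm) tcat_scheme \<Rightarrow> 'o \<Rightarrow> bool" where
  "degenerate_obj C \<rho> \<longleftrightarrow> \<rho> \<in> Obj C \<and> (\<forall>\<eta> \<in> Obj C. monodromy C \<rho> \<eta> = idn C (\<rho> \<odot>\<^bsub>C\<^esub> \<eta>))"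

text \<open>Full subcategories are given by their sets of objects.\<close>

definition degenerates :: "('o, 'a, 'm) tcat_scheme \<Rightarrow> 'o set" where
  "degenerates C = {\<rho>. degenerate_obj C \<rho>}"

definition degenerate_category :: "('o, 'a::ab_group_add, 'm) tcat_scheme \<Rightarrow> bool" where
  "degenerate_category C \<longleftrightarrow>
     (\<exists>\<rho>. irreducible_obj C \<rho> \<and> degenerate_obj C \<rho> \<and> \<not> isom C \<rho> (unt C))"

text \<open>
  The twist of \<open>\<rho>\<close> is \<open>twist_of C \<rho> \<rho>b R\<close> for any standard solution \<open>R\<close>; it does not depend on it.
\<close>

definition twist_of :: "('o, 'a, 'm) tcat_scheme \<Rightarrow> 'o \<Rightarrow> 'o \<Rightarrow> ('o, 'a) arrow \<Rightarrow> ('o, 'a) arrow" where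
  "twist_of C \<rho> \<rho>b R =
     (star C R \<boxtimes>\<^bsub>C\<^esub> idn C \<rho>) \<cdot>\<^bsub>C\<^esub> (idn C \<rho>b \<boxtimes>\<^bsub>C\<^esub> brd C \<rho> \<rho>) \<cdot>\<^bsub>C\<^esub> (R \<boxtimes>\<^bsub>C\<^esub> idn C \<rho>)"

definition even_subcat :: "('o, 'a::ab_group_add, 'm) tcat_scheme \<Rightarrow> 'o set \<Rightarrow> bool" where
  "even_subcat C S \<longleftrightarrow>
     (\<forall>\<rho> \<in> S. \<forall>\<rho>b R Rb. standard_solution C \<rho> \<rho>b R Rb \<longrightarrow> twist_of C \<rho> \<rho>b R = idn C \<rho>)"

definition rational :: "('o, 'a::ab_group_add, 'm) tcat_scheme \<Rightarrow> bool" where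
  "rational C \<longleftrightarrow> finite {{\<sigma>. isom C \<rho> \<sigma>} | \<rho>. irreducible_obj C \<rho>}"

definition irr_representatives :: "('o, 'a::ab_group_add, 'm) tcat_scheme \<Rightarrow> 'o set \<Rightarrow> 'o set \<Rightarrow> bool" where
  "irr_representatives C S I \<longleftrightarrow> I \<subseteq> S \<and> (\<forall>\<rho> \<in> I. irreducible_obj C \<rho>) \<and>
     (\<forall>\<rho> \<in> S. irreducible_obj C \<rho> \<longrightarrow> (\<exists>!\<sigma>. \<sigma> \<in> I \<and> isom C \<rho> \<sigma>))"

text \<open>The value is the same for all choices of the standard solutions.\<close>

definition Ymat :: "('o, 'a::ab_group_add, 'm) tcat_scheme \<Rightarrow> 'o \<Rightarrow> 'o \<Rightarrow> complex" where
  "Ymat C \<rho> \<sigma> = (THE y. \<exists>\<rho>b R Rb \<sigma>b Q Qb.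
     standard_solution C \<rho> \<rho>b R Rb \<and> standard_solution C \<sigma> \<sigma>b Q Qb \<and>
     arr_scl C y (idn C (unt C)) =
       (star C R \<boxtimes>\<^bsub>C\<^esub> star C Qb)
       \<cdot>\<^bsub>C\<^esub> (idn C \<rho>b \<boxtimes>\<^bsub>C\<^esub> monodromy C \<rho> \<sigma> \<boxtimes>\<^bsub>C\<^esub> idn C \<sigma>b)
       \<cdot>\<^bsub>C\<^esub> (R \<boxtimes>\<^bsub>C\<^esub> Qb))"

text \<open>
  The matrix indexed by isomorphism classes is written in terms of a set of representatives; its
  entries depend on the classes only.
\<close>

definition modular :: "('o, 'a::ab_group_add, 'm) tcat_scheme \<Rightarrow> bool" where
  "modular C \<longleftrightarrow> rational C \<and>
     (\<forall>I. irr_representatives C (Obj C) I \<longrightarrow>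
        (\<exists>Z. \<forall>\<rho> \<in> I. \<forall>\<sigma> \<in> I.
           (\<Sum>\<tau>\<in>I. Ymat C \<rho> \<tau> * Z \<tau> \<sigma>) = (if \<rho> = \<sigma> then 1 else 0) \<and>
           (\<Sum>\<tau>\<in>I. Z \<rho> \<tau> * Ymat C \<tau> \<sigma>) = (if \<rho> = \<sigma> then 1 else 0)))"


section \<open>Finite dimensional unitary representations of a compact group\<close>

definition compact_group :: "'g monoid \<Rightarrow> 'g topology \<Rightarrow> bool" where
  "compact_group G T \<longleftrightarrow> group G \<and> topspace T = carrier G \<and> compact_space T \<and> Hausdorff_space T \<and>
     continuous_map (prod_topology T T) T (\<lambda>(g, h). g \<otimes>\<^bsub>G\<^esub> h) \<and>
     continuous_map T T (\<lambda>g. inv\<^bsub>G\<^esub> g)"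

text \<open>Inner products are antilinear in the first variable.\<close>

record ('g, 'v) urep =
  rspace :: "'v set"
  rscl :: "complex \<Rightarrow> 'v \<Rightarrow> 'v"
  rip :: "'v \<Rightarrow> 'v \<Rightarrow> complex"
  ract :: "'g \<Rightarrow> 'v \<Rightarrow> 'v"

definition fd_hilbert :: "('g, 'v::ab_group_add) urep \<Rightarrow> bool" where
  "fd_hilbert U \<longleftrightarrow> vector_space (rscl U) \<and>
     (\<exists>B. finite B \<and> rspace U = module.span (rscl U) B) \<and>
     (\<forall>a \<in> rspace U. \<forall>b \<in> rspace U. \<forall>c \<in> rspace U. rip U a (b + c) = rip U a b + rip U a c) \<and>
     (\<forall>a \<in> rspace U. \<forall>b \<in> rspace U. \<forall>z. rip U a (rscl U z b) = z * rip U a b) \<and>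
     (\<forall>a \<in> rspace U. \<forall>b \<in> rspace U. rip U a b = cnj (rip U b a)) \<and>
     (\<forall>a \<in> rspace U. a \<noteq> 0 \<longrightarrow> Re (rip U a a) > 0)"

definition lin_on :: "('g, 'v::ab_group_add) urep \<Rightarrow> ('g, 'w::ab_group_add) urep \<Rightarrow> ('v \<Rightarrow> 'w) \<Rightarrow> bool" where
  "lin_on U U' t \<longleftrightarrow> (\<forall>a \<in> rspace U. t a \<in> rspace U') \<and>
     (\<forall>a \<in> rspace U. \<forall>b \<in> rspace U. t (a + b) = t a + t b) \<and>
     (\<forall>a \<in> rspace U. \<forall>z. t (rscl U z a) = rscl U' z (t a))"

text \<open>On a finite dimensional space, continuity is continuity of all matrix coefficients.\<close>

definition unitary_rep :: "'g monoid \<Rightarrow> 'g topology \<Rightarrow> ('g, 'v::ab_group_add) urep \<Rightarrow> bool" where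
  "unitary_rep G T U \<longleftrightarrow> fd_hilbert U \<and>
     (\<forall>g \<in> carrier G. lin_on U U (ract U g)) \<and>
     (\<forall>a \<in> rspace U. ract U \<one>\<^bsub>G\<^esub> a = a) \<and>
     (\<forall>g \<in> carrier G. \<forall>h \<in> carrier G. \<forall>a \<in> rspace U. ract U (g \<otimes>\<^bsub>G\<^esub> h) a = ract U g (ract U h a)) \<and>
     (\<forall>g \<in> carrier G. \<forall>a \<in> rspace U. \<forall>b \<in> rspace U. rip U (ract U g a) (ract U g b) = rip U a b) \<and>
     (\<forall>a \<in> rspace U. \<forall>b \<in> rspace U. continuous_map T euclidean (\<lambda>g. rip U a (ract U g b)))"

definition intertwiner ::
  "'g monoid \<Rightarrow> ('g, 'v::ab_group_add) urep \<Rightarrow> ('g, 'w::ab_group_add) urep \<Rightarrow> ('v \<Rightarrow> 'w) \<Rightarrow> bool" where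
  "intertwiner G U U' t \<longleftrightarrow> lin_on U U' t \<and>
     (\<forall>g \<in> carrier G. \<forall>a \<in> rspace U. t (ract U g a) = ract U' g (t a))"

definition isometric_on :: "('g, 'v::ab_group_add) urep \<Rightarrow> ('g, 'w::ab_group_add) urep \<Rightarrow> ('v \<Rightarrow> 'w) \<Rightarrow> bool" where
  "isometric_on U U' t \<longleftrightarrow> (\<forall>a \<in> rspace U. \<forall>b \<in> rspace U. rip U' (t a) (t b) = rip U a b)"

definition unitarily_equivalent ::
  "'g monoid \<Rightarrow> ('g, 'v::ab_group_add) urep \<Rightarrow> ('g, 'w::ab_group_add) urep \<Rightarrow> bool" where
  "unitarily_equivalent G U U' \<longleftrightarrow>
     (\<exists>t. intertwiner G U U' t \<and> isometric_on U U' t \<and> t ` rspace U = rspace U')"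

definition invariant_subspace :: "'g monoid \<Rightarrow> ('g, 'v::ab_group_add) urep \<Rightarrow> 'v set \<Rightarrow> bool" where
  "invariant_subspace G U W \<longleftrightarrow> W \<subseteq> rspace U \<and> module.subspace (rscl U) W \<and>
     (\<forall>g \<in> carrier G. ract U g ` W \<subseteq> W)"

definition irreducible_rep :: "'g monoid \<Rightarrow> ('g, 'v::ab_group_add) urep \<Rightarrow> bool" where
  "irreducible_rep G U \<longleftrightarrow> rspace U \<noteq> {0} \<and>
     (\<forall>W. invariant_subspace G U W \<longrightarrow> W = {0} \<or> W = rspace U)"

definition is_direct_sum ::
  "'g monoid \<Rightarrow> ('g, 'v::ab_group_add) urep \<Rightarrow> ('g, 'v) urep \<Rightarrow> ('g, 'v) urep \<Rightarrow> bool" where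
  "is_direct_sum G U U' D \<longleftrightarrow> (\<exists>t t'. intertwiner G U D t \<and> isometric_on U D t \<and>
     intertwiner G U' D t' \<and> isometric_on U' D t' \<and>
     (\<forall>a \<in> rspace U. \<forall>b \<in> rspace U'. rip D (t a) (t' b) = 0) \<and>
     rspace D = {t a + t' b | a b. a \<in> rspace U \<and> b \<in> rspace U'})"

definition std_rep :: "nat \<Rightarrow> ('g \<Rightarrow> (nat \<Rightarrow> complex) \<Rightarrow> nat \<Rightarrow> complex) \<Rightarrow> ('g, nat \<Rightarrow> complex) urep" where
  "std_rep n u = \<lparr>rspace = {x. \<forall>i\<ge>n. x i = 0}, rscl = (\<lambda>z x i. z * x i),
     rip = (\<lambda>x y. \<Sum>i<n. cnj (x i) * y i), ract = u\<rparr>"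


section \<open>The Doplicher--Roberts isomorphism\<close>

text \<open>
  The objects of the category of representations are the \<open>FObj \<rho>\<close> with \<open>\<rho> \<in> S\<close>, its arrows are all
  intertwiners. \<open>box \<rho> \<sigma>\<close> is the tensor product of vectors of \<open>FObj \<rho>\<close> and of \<open>FObj \<sigma>\<close>, with
  values in \<open>FObj (\<rho> \<odot> \<sigma>)\<close>.
\<close>

record ('o, 'a, 'g, 'v) dr_iso =
  grp :: "'g monoid"
  gtop :: "'g topology"
  FObj :: "'o \<Rightarrow> ('g, 'v) urep"
  FArr :: "('o, 'a) arrow \<Rightarrow> 'v \<Rightarrow> 'v"
  box :: "'o \<Rightarrow> 'o \<Rightarrow> 'v \<Rightarrow> 'v \<Rightarrow> 'v"
  vac :: "'v"

abbreviation hilb :: "('o, 'a, 'g, 'v) dr_iso \<Rightarrow> 'o \<Rightarrow> 'v set" where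
  "hilb F \<rho> \<equiv> rspace (FObj F \<rho>)"

abbreviation inner_of :: "('o, 'a, 'g, 'v) dr_iso \<Rightarrow> 'o \<Rightarrow> 'v \<Rightarrow> 'v \<Rightarrow> complex" where
  "inner_of F \<rho> \<equiv> rip (FObj F \<rho>)"

locale doplicher_roberts =
  fixes C :: "('o, 'a::ab_group_add, 'm) tcat_scheme" (structure)
    and S :: "'o set"
    and F :: "('o, 'a, 'g, 'v::ab_group_add) dr_iso"
  assumes compact: "compact_group (grp F) (gtop F)"
    and rep: "\<rho> \<in> S \<Longrightarrow> unitary_rep (grp F) (gtop F) (FObj F \<rho>)"
    and FObj_inj: "inj_on (FObj F) S"
    and FArr_intertwiner: "\<lbrakk>\<rho> \<in> S; \<sigma> \<in> S; f \<in> Hom C \<rho> \<sigma>\<rbrakk>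
        \<Longrightarrow> intertwiner (grp F) (FObj F \<rho>) (FObj F \<sigma>) (FArr F f)"
    and FArr_bij: "\<lbrakk>\<rho> \<in> S; \<sigma> \<in> S; intertwiner (grp F) (FObj F \<rho>) (FObj F \<sigma>) t\<rbrakk>
        \<Longrightarrow> \<exists>!f. f \<in> Hom C \<rho> \<sigma> \<and> (\<forall>a \<in> hilb F \<rho>. FArr F f a = t a)"
    and FArr_add: "\<lbrakk>\<rho> \<in> S; \<sigma> \<in> S; f \<in> Hom C \<rho> \<sigma>; g \<in> Hom C \<rho> \<sigma>; a \<in> hilb F \<rho>\<rbrakk>
        \<Longrightarrow> FArr F (arr_add f g) a = FArr F f a + FArr F g a"
    and FArr_scl: "\<lbrakk>\<rho> \<in> S; \<sigma> \<in> S; f \<in> Hom C \<rho> \<sigma>; a \<in> hilb F \<rho>\<rbrakk>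
        \<Longrightarrow> FArr F (arr_scl C z f) a = rscl (FObj F \<sigma>) z (FArr F f a)"
    and FArr_idn: "\<lbrakk>\<rho> \<in> S; a \<in> hilb F \<rho>\<rbrakk> \<Longrightarrow> FArr F (idn C \<rho>) a = a"
    and FArr_cmp: "\<lbrakk>\<rho> \<in> S; \<sigma> \<in> S; \<delta> \<in> S; f \<in> Hom C \<sigma> \<delta>; g \<in> Hom C \<rho> \<sigma>; a \<in> hilb F \<rho>\<rbrakk>
        \<Longrightarrow> FArr F (f \<cdot> g) a = FArr F f (FArr F g a)"
    and FArr_star: "\<lbrakk>\<rho> \<in> S; \<sigma> \<in> S; f \<in> Hom C \<rho> \<sigma>; a \<in> hilb F \<rho>; b \<in> hilb F \<sigma>\<rbrakk>
        \<Longrightarrow> inner_of F \<rho> a (FArr F (star C f) b) = inner_of F \<sigma> (FArr F f a) b"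
    and box_hilb: "\<lbrakk>\<rho> \<in> S; \<sigma> \<in> S\<rbrakk>
        \<Longrightarrow> hilb F (\<rho> \<odot> \<sigma>) =
              module.span (rscl (FObj F (\<rho> \<odot> \<sigma>))) {box F \<rho> \<sigma> a b | a b. a \<in> hilb F \<rho> \<and> b \<in> hilb F \<sigma>}"
    and box_add_left: "\<lbrakk>\<rho> \<in> S; \<sigma> \<in> S; a \<in> hilb F \<rho>; a' \<in> hilb F \<rho>; b \<in> hilb F \<sigma>\<rbrakk>
        \<Longrightarrow> box F \<rho> \<sigma> (a + a') b = box F \<rho> \<sigma> a b + box F \<rho> \<sigma> a' b"
    and box_add_right: "\<lbrakk>\<rho> \<in> S; \<sigma> \<in> S; a \<in> hilb F \<rho>; b \<in> hilb F \<sigma>; b' \<in> hilb F \<sigma>\<rbrakk>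
        \<Longrightarrow> box F \<rho> \<sigma> a (b + b') = box F \<rho> \<sigma> a b + box F \<rho> \<sigma> a b'"
    and box_scl_left: "\<lbrakk>\<rho> \<in> S; \<sigma> \<in> S; a \<in> hilb F \<rho>; b \<in> hilb F \<sigma>\<rbrakk>
        \<Longrightarrow> box F \<rho> \<sigma> (rscl (FObj F \<rho>) z a) b = rscl (FObj F (\<rho> \<odot> \<sigma>)) z (box F \<rho> \<sigma> a b)"
    and box_scl_right: "\<lbrakk>\<rho> \<in> S; \<sigma> \<in> S; a \<in> hilb F \<rho>; b \<in> hilb F \<sigma>\<rbrakk>
        \<Longrightarrow> box F \<rho> \<sigma> a (rscl (FObj F \<sigma>) z b) = rscl (FObj F (\<rho> \<odot> \<sigma>)) z (box F \<rho> \<sigma> a b)"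
    and box_inner: "\<lbrakk>\<rho> \<in> S; \<sigma> \<in> S; a \<in> hilb F \<rho>; a' \<in> hilb F \<rho>; b \<in> hilb F \<sigma>; b' \<in> hilb F \<sigma>\<rbrakk>
        \<Longrightarrow> inner_of F (\<rho> \<odot> \<sigma>) (box F \<rho> \<sigma> a b) (box F \<rho> \<sigma> a' b') =
              inner_of F \<rho> a a' * inner_of F \<sigma> b b'"
    and box_act: "\<lbrakk>\<rho> \<in> S; \<sigma> \<in> S; s \<in> carrier (grp F); a \<in> hilb F \<rho>; b \<in> hilb F \<sigma>\<rbrakk>
        \<Longrightarrow> ract (FObj F (\<rho> \<odot> \<sigma>)) s (box F \<rho> \<sigma> a b) =
              box F \<rho> \<sigma> (ract (FObj F \<rho>) s a) (ract (FObj F \<sigma>) s b)"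
    and box_assoc: "\<lbrakk>\<rho> \<in> S; \<sigma> \<in> S; \<tau> \<in> S; a \<in> hilb F \<rho>; b \<in> hilb F \<sigma>; c \<in> hilb F \<tau>\<rbrakk>
        \<Longrightarrow> box F (\<rho> \<odot> \<sigma>) \<tau> (box F \<rho> \<sigma> a b) c = box F \<rho> (\<sigma> \<odot> \<tau>) a (box F \<sigma> \<tau> b c)"
    and vac_hilb: "hilb F (unt C) = range (\<lambda>z. rscl (FObj F (unt C)) z (vac F))"
    and vac_unit: "inner_of F (unt C) (vac F) (vac F) = 1"
    and vac_act: "s \<in> carrier (grp F) \<Longrightarrow> ract (FObj F (unt C)) s (vac F) = vac F"
    and box_vac_left: "\<lbrakk>\<rho> \<in> S; a \<in> hilb F \<rho>\<rbrakk> \<Longrightarrow> box F (unt C) \<rho> (vac F) a = a"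
    and box_vac_right: "\<lbrakk>\<rho> \<in> S; a \<in> hilb F \<rho>\<rbrakk> \<Longrightarrow> box F \<rho> (unt C) a (vac F) = a"
    and FArr_tar: "\<lbrakk>\<rho> \<in> S; \<sigma> \<in> S; \<rho>' \<in> S; \<sigma>' \<in> S; f \<in> Hom C \<rho> \<sigma>; g \<in> Hom C \<rho>' \<sigma>';
          a \<in> hilb F \<rho>; b \<in> hilb F \<rho>'\<rbrakk>
        \<Longrightarrow> FArr F (f \<boxtimes> g) (box F \<rho> \<rho>' a b) = box F \<sigma> \<sigma>' (FArr F f a) (FArr F g b)"
    and FArr_brd: "\<lbrakk>\<rho> \<in> S; \<sigma> \<in> S; a \<in> hilb F \<rho>; b \<in> hilb F \<sigma>\<rbrakk>
        \<Longrightarrow> FArr F (brd C \<rho> \<sigma>) (box F \<rho> \<sigma> a b) = box F \<sigma> \<rho> b a"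
    and image_subreps: "\<lbrakk>\<rho> \<in> S; invariant_subspace (grp F) (FObj F \<rho>) W\<rbrakk>
        \<Longrightarrow> \<exists>\<sigma> \<in> S. unitarily_equivalent (grp F) (FObj F \<sigma>) (FObj F \<rho>\<lparr>rspace := W\<rparr>)"
    and image_direct_sums: "\<lbrakk>\<rho> \<in> S; \<sigma> \<in> S\<rbrakk> \<Longrightarrow> \<exists>\<tau> \<in> S. is_direct_sum (grp F) (FObj F \<rho>) (FObj F \<sigma>) (FObj F \<tau>)"
    and image_irreducibles: "\<lbrakk>unitary_rep (grp F) (gtop F) (std_rep n u); irreducible_rep (grp F) (std_rep n u)\<rbrakk>
        \<Longrightarrow> \<exists>\<rho> \<in> S. unitarily_equivalent (grp F) (FObj F \<rho>) (std_rep n u)"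


section \<open>The crossed product\<close>

text \<open>
  The index set of isomorphism classes of irreducible objects is replaced by a set \<open>reps\<close> of
  representatives, so that \<open>\<gamma>\<^sub>k\<close> is \<open>k\<close> itself and the class of the unit is \<open>unt C\<close>.
  \<open>fus k l m \<alpha>\<close> with \<open>\<alpha> < fmul k l m\<close> is the orthonormal basis of \<open>Hom(m, k \<odot> l)\<close>,
  \<open>bas k i\<close> with \<open>i < bdim k\<close> is an orthonormal basis of the Hilbert space of \<open>k\<close>.
\<close>

record ('o, 'a, 'v) cp_choices =
  reps :: "'o set"
  fmul :: "'o \<Rightarrow> 'o \<Rightarrow> 'o \<Rightarrow> nat"
  fus :: "'o \<Rightarrow> 'o \<Rightarrow> 'o \<Rightarrow> nat \<Rightarrow> ('o, 'a) arrow"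
  cjg :: "'o \<Rightarrow> 'o"
  cR :: "'o \<Rightarrow> ('o, 'a) arrow"
  cRb :: "'o \<Rightarrow> ('o, 'a) arrow"
  bdim :: "'o \<Rightarrow> nat"
  bas :: "'o \<Rightarrow> nat \<Rightarrow> 'v"

locale crossed_product_choices =
  fixes C :: "('o, 'a::ab_group_add, 'm) tcat_scheme" (structure)
    and S :: "'o set"
    and F :: "('o, 'a, 'g, 'v::ab_group_add) dr_iso"
    and X :: "('o, 'a, 'v) cp_choices"
  assumes reps: "irr_representatives C S (reps X)"
    and reps_unt: "unt C \<in> reps X"
    and fus_Hom: "\<lbrakk>k \<in> reps X; l \<in> reps X; m \<in> reps X; \<alpha> < fmul X k l m\<rbrakk>
        \<Longrightarrow> fus X k l m \<alpha> \<in> Hom C m (k \<odot> l)"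
    and fus_orthonormal: "\<lbrakk>k \<in> reps X; l \<in> reps X; m \<in> reps X; \<alpha> < fmul X k l m; \<beta> < fmul X k l m\<rbrakk>
        \<Longrightarrow> star C (fus X k l m \<alpha>) \<cdot> fus X k l m \<beta> = arr_scl C (if \<alpha> = \<beta> then 1 else 0) (idn C m)"
    and fus_span: "\<lbrakk>k \<in> reps X; l \<in> reps X; m \<in> reps X\<rbrakk>
        \<Longrightarrow> HomV C m (k \<odot> l) = module.span (scl C) ((\<lambda>\<alpha>. vect (fus X k l m \<alpha>)) ` {..<fmul X k l m})"
    and cjg_reps: "k \<in> reps X \<Longrightarrow> cjg X k \<in> reps X \<and> cjg X (cjg X k) = k"
    and cR_solution: "k \<in> reps X \<Longrightarrow> normalized_solution C k (cjg X k) (cR X k) (cRb X k)"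
    and cR_cjg: "\<lbrakk>k \<in> reps X; cjg X k \<noteq> k\<rbrakk> \<Longrightarrow> cR X (cjg X k) = cRb X k \<and> cRb X (cjg X k) = cR X k"
    and cR_selfconj: "\<lbrakk>k \<in> reps X; cjg X k = k\<rbrakk> \<Longrightarrow> cRb X k = cR X k \<or> cRb X k = arr_scl C (- 1) (cR X k)"
    and bas_hilb: "\<lbrakk>k \<in> reps X; i < bdim X k\<rbrakk> \<Longrightarrow> bas X k i \<in> hilb F k"
    and bas_orthonormal: "\<lbrakk>k \<in> reps X; i < bdim X k; j < bdim X k\<rbrakk>
        \<Longrightarrow> inner_of F k (bas X k i) (bas X k j) = (if i = j then 1 else 0)"
    and bas_span: "k \<in> reps X \<Longrightarrow> hilb F k = module.span (rscl (FObj F k)) (bas X k ` {..<bdim X k})"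

text \<open>
  The tensor product \<open>Hom(\<gamma>\<^sub>k \<rho>, \<sigma>) \<otimes> H\<^sub>k\<close> is modelled by coordinates: the element
  \<open>\<Sum>\<^sub>i T\<^sub>i \<otimes> bas k i\<close> is the family of the \<open>T\<^sub>i\<close>. An element of the direct sum over \<open>k\<close>
  is a finitely supported family \<open>x\<close>, where \<open>x k i\<close> is the vector of an arrow from \<open>\<gamma>\<^sub>k \<rho>\<close>
  to \<open>\<sigma>\<close>. \<open>elem_tensor C F X k T \<psi>\<close> is the elementary tensor \<open>T \<otimes> \<psi>\<close> in the summand \<open>k\<close>.
\<close>

type_synonym ('o, 'a) cpvec = "'o \<Rightarrow> nat \<Rightarrow> 'a"

definition cp_supp :: "('o, 'a::ab_group_add) cpvec \<Rightarrow> 'o set" where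
  "cp_supp x = {k. \<exists>i. x k i \<noteq> 0}"

definition elem_tensor :: "('o, 'a::ab_group_add, 'm) tcat_scheme \<Rightarrow> ('o, 'a, 'g, 'v) dr_iso \<Rightarrow>
    ('o, 'a, 'v) cp_choices \<Rightarrow> 'o \<Rightarrow> ('o, 'a) arrow \<Rightarrow> 'v \<Rightarrow> ('o, 'a) cpvec" where
  "elem_tensor C F X k T \<psi> = (\<lambda>k' i. if k' = k \<and> i < bdim X k
     then scl C (inner_of F k (bas X k i) \<psi>) (vect T) else 0)"

definition cp_HomV :: "('o, 'a::ab_group_add, 'm) tcat_scheme \<Rightarrow>
    ('o, 'a, 'v) cp_choices \<Rightarrow> 'o \<Rightarrow> 'o \<Rightarrow> ('o, 'a) cpvec set" where
  "cp_HomV C X \<rho> \<sigma> = {x. finite (cp_supp x) \<and>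
     (\<forall>k i. if k \<in> reps X \<and> i < bdim X k then x k i \<in> HomV C (k \<odot>\<^bsub>C\<^esub> \<rho>) \<sigma> else x k i = 0)}"

text \<open>
  \<open>(S \<otimes> \<psi>) \<circ> (T \<otimes> \<phi>)\<close> and \<open>(S \<otimes> \<psi>) \<times> (T \<otimes> \<phi>)\<close> on elementary tensors in the summands \<open>k\<close>
  and \<open>l\<close>. The adjoint of \<open>F(V)\<close> is \<open>F(V\<^sup>*)\<close>.
\<close>

definition elem_cmp :: "('o, 'a::ab_group_add, 'm) tcat_scheme \<Rightarrow> ('o, 'a, 'g, 'v) dr_iso \<Rightarrow>
    ('o, 'a, 'v) cp_choices \<Rightarrow> 'o \<Rightarrow> 'o \<Rightarrow> ('o, 'a) arrow \<Rightarrow> 'v \<Rightarrow> 'o \<Rightarrow> ('o, 'a) arrow \<Rightarrow> 'v \<Rightarrow>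
    ('o, 'a) cpvec" where
  "elem_cmp C F X \<rho> k S \<psi> l T \<phi> = (\<lambda>m. if m \<in> reps X then
     (\<Sum>\<alpha><fmul X k l m.
        elem_tensor C F X m
          (S \<cdot>\<^bsub>C\<^esub> (idn C k \<boxtimes>\<^bsub>C\<^esub> T) \<cdot>\<^bsub>C\<^esub> (fus X k l m \<alpha> \<boxtimes>\<^bsub>C\<^esub> idn C \<rho>))
          (FArr F (star C (fus X k l m \<alpha>)) (box F k l \<psi> \<phi>)) m)
     else 0)"

definition elem_tar :: "('o, 'a::ab_group_add, 'm) tcat_scheme \<Rightarrow> ('o, 'a, 'g, 'v) dr_iso \<Rightarrow>
    ('o, 'a, 'v) cp_choices \<Rightarrow> 'o \<Rightarrow> 'o \<Rightarrow> 'o \<Rightarrow> ('o, 'a) arrow \<Rightarrow> 'v \<Rightarrow> 'o \<Rightarrow> ('o, 'a) arrow \<Rightarrow> 'v \<Rightarrow>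
    ('o, 'a) cpvec" where
  "elem_tar C F X \<rho>1 \<rho>2 k S \<psi> l T \<phi> = (\<lambda>m. if m \<in> reps X then
     (\<Sum>\<alpha><fmul X k l m.
        elem_tensor C F X m
          ((S \<boxtimes>\<^bsub>C\<^esub> T) \<cdot>\<^bsub>C\<^esub> (idn C k \<boxtimes>\<^bsub>C\<^esub> brd C l \<rho>1 \<boxtimes>\<^bsub>C\<^esub> idn C \<rho>2)
            \<cdot>\<^bsub>C\<^esub> (fus X k l m \<alpha> \<boxtimes>\<^bsub>C\<^esub> idn C (\<rho>1 \<odot>\<^bsub>C\<^esub> \<rho>2)))
          (FArr F (star C (fus X k l m \<alpha>)) (box F k l \<psi> \<phi>)) m)
     else 0)"

definition cp_bar :: "('o, 'a::ab_group_add, 'm) tcat_scheme \<Rightarrow> ('o, 'a, 'g, 'v) dr_iso \<Rightarrow>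
    ('o, 'a, 'v) cp_choices \<Rightarrow> 'o \<Rightarrow> 'v \<Rightarrow> 'v" where
  "cp_bar C F X k \<psi> = (THE \<psi>b. \<psi>b \<in> hilb F (cjg X k) \<and>
     (\<forall>a \<in> hilb F (cjg X k). inner_of F (cjg X k) a \<psi>b =
        inner_of F (k \<odot>\<^bsub>C\<^esub> cjg X k) (box F k (cjg X k) \<psi> a) (FArr F (cRb X k) (vac F))))"

definition elem_star :: "('o, 'a::ab_group_add, 'm) tcat_scheme \<Rightarrow> ('o, 'a, 'g, 'v) dr_iso \<Rightarrow>
    ('o, 'a, 'v) cp_choices \<Rightarrow> 'o \<Rightarrow> 'o \<Rightarrow> ('o, 'a) arrow \<Rightarrow> 'v \<Rightarrow> ('o, 'a) cpvec" where
  "elem_star C F X \<rho> k S \<psi> = elem_tensor C F X (cjg X k)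
     ((star C (cR X k) \<boxtimes>\<^bsub>C\<^esub> idn C \<rho>) \<cdot>\<^bsub>C\<^esub> (idn C (cjg X k) \<boxtimes>\<^bsub>C\<^esub> star C S))
     (cp_bar C F X k \<psi>)"

text \<open>
  \<open>crossed0\<close> is \<open>C \<rtimes>\<^sub>0 S\<close>; the operations are the (anti-, bi-)additive extensions of those on
  elementary tensors.
\<close>

definition crossed0 :: "('o, 'a::ab_group_add, 'm) tcat_scheme \<Rightarrow> ('o, 'a, 'g, 'v) dr_iso \<Rightarrow>
    ('o, 'a, 'v) cp_choices \<Rightarrow> ('o, ('o, 'a) cpvec) tcat" where
  "crossed0 C F X = \<lparr>
     Obj = Obj C,
     HomV = cp_HomV C X,
     scl = (\<lambda>z x k i. scl C z (x k i)),
     idn = (\<lambda>\<rho>. Arrow \<rho> \<rho> (elem_tensor C F X (unt C) (idn C \<rho>) (vac F))),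
     cmp = (\<lambda>f g. Arrow (src g) (tgt f)
       (\<Sum>k\<in>cp_supp (vect f). \<Sum>i<bdim X k. \<Sum>l\<in>cp_supp (vect g). \<Sum>j<bdim X l.
          elem_cmp C F X (src g)
            k (Arrow (k \<odot>\<^bsub>C\<^esub> src f) (tgt f) (vect f k i)) (bas X k i)
            l (Arrow (l \<odot>\<^bsub>C\<^esub> src g) (tgt g) (vect g l j)) (bas X l j))),
     unt = unt C,
     tob = tob C,
     tar = (\<lambda>f g. Arrow (src f \<odot>\<^bsub>C\<^esub> src g) (tgt f \<odot>\<^bsub>C\<^esub> tgt g)
       (\<Sum>k\<in>cp_supp (vect f). \<Sum>i<bdim X k. \<Sum>l\<in>cp_supp (vect g). \<Sum>j<bdim X l.
          elem_tar C F X (src f) (src g)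
            k (Arrow (k \<odot>\<^bsub>C\<^esub> src f) (tgt f) (vect f k i)) (bas X k i)
            l (Arrow (l \<odot>\<^bsub>C\<^esub> src g) (tgt g) (vect g l j)) (bas X l j))),
     star = (\<lambda>f. Arrow (tgt f) (src f)
       (\<Sum>k\<in>cp_supp (vect f). \<Sum>i<bdim X k.
          elem_star C F X (src f) k (Arrow (k \<odot>\<^bsub>C\<^esub> src f) (tgt f) (vect f k i)) (bas X k i))),
     brd = (\<lambda>\<rho> \<sigma>. Arrow (\<rho> \<odot>\<^bsub>C\<^esub> \<sigma>) (\<sigma> \<odot>\<^bsub>C\<^esub> \<rho>) (elem_tensor C F X (unt C) (brd C \<rho> \<sigma>) (vac F)))\<rparr>"

text \<open>
  The closure of \<open>K\<close> under subobjects. An arrow from \<open>(\<rho>, E)\<close> to \<open>(\<sigma>, E')\<close> has the same vector as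
  the underlying arrow from \<open>\<rho>\<close> to \<open>\<sigma>\<close>.
\<close>

type_synonym ('o, 'a) sub_obj = "'o \<times> ('o, 'a) arrow"

definition under :: "(('o, 'a) sub_obj, 'a) arrow \<Rightarrow> ('o, 'a) arrow" where
  "under f = Arrow (fst (src f)) (fst (tgt f)) (vect f)"

definition sub_tob :: "('o, 'a) tcat \<Rightarrow> ('o, 'a) sub_obj \<Rightarrow> ('o, 'a) sub_obj \<Rightarrow> ('o, 'a) sub_obj" where
  "sub_tob K A B = (fst A \<odot>\<^bsub>K\<^esub> fst B, snd A \<boxtimes>\<^bsub>K\<^esub> snd B)"

definition subobject_closure :: "('o, 'a) tcat \<Rightarrow> (('o, 'a) sub_obj, 'a) tcat" where
  "subobject_closure K = \<lparr>
     Obj = {(\<rho>, E). \<rho> \<in> Obj K \<and> projection K \<rho> E},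
     HomV = (\<lambda>A B. {vect (snd B \<cdot>\<^bsub>K\<^esub> f \<cdot>\<^bsub>K\<^esub> snd A) | f. f \<in> Hom K (fst A) (fst B)}),
     scl = scl K,
     idn = (\<lambda>A. Arrow A A (vect (snd A))),
     cmp = (\<lambda>f g. Arrow (src g) (tgt f) (vect (under f \<cdot>\<^bsub>K\<^esub> under g))),
     unt = (unt K, idn K (unt K)),
     tob = sub_tob K,
     tar = (\<lambda>f g. Arrow (sub_tob K (src f) (src g)) (sub_tob K (tgt f) (tgt g))
              (vect (under f \<boxtimes>\<^bsub>K\<^esub> under g))),
     star = (\<lambda>f. Arrow (tgt f) (src f) (vect (star K (under f)))),
     brd = (\<lambda>A B. Arrow (sub_tob K A B) (sub_tob K B A)
              (vect ((snd B \<boxtimes>\<^bsub>K\<^esub> snd A) \<cdot>\<^bsub>K\<^esub> brd K (fst A) (fst B) \<cdot>\<^bsub>K\<^esub> (snd A \<boxtimes>\<^bsub>K\<^esub> snd B))))\<rparr>"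

definition crossed_product :: "('o, 'a::ab_group_add, 'm) tcat_scheme \<Rightarrow> ('o, 'a, 'g, 'v) dr_iso \<Rightarrow>
    ('o, 'a, 'v) cp_choices \<Rightarrow> (('o, ('o, 'a) cpvec) sub_obj, ('o, 'a) cpvec) tcat" where
  "crossed_product C F X = subobject_closure (crossed0 C F X)"

end

theory Submission
  imports Defs "HOL-Computational_Algebra.Fundamental_Theorem_Algebra"
begin

text \<open>
  The crossed product adjoins arrows from the unit to the degenerate objects until each of these becomes a
  multiple of the unit, and the point of the theorem is that nothing degenerate is left or created.

  \<^emph>\<open>Arrows as triples.\<close> The defining formulas of the crossed product decompose everything into the
  irreducible objects \<open>\<gamma>\<^sub>k\<close>. It is easier to admit any degenerate \<open>tau\<close>: a triple of \<open>tau\<close>, an arrow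
  \<open>T\<close> from \<open>tau rho\<close> to \<open>sigma\<close> and a vector \<open>psi\<close> of \<open>F(tau)\<close> defines an arrow from \<open>rho\<close> to
  \<open>sigma\<close>, and an arrow \<open>A\<close> between degenerate objects may be moved from the second entry to the third
  (\<open>ev_nat\<close>). Every arrow comes from a triple (\<open>K_rep\<close>), two parallel arrows can be given the same
  object and vector (\<open>pair\<close>), and the operations become
  \<open>(tau tau', S \<circ> (id \<times> T), psi \<otimes> phi)\<close> for the composition and similar formulas for the product and
  the adjoint (\<open>K_cmp\<close>, \<open>K_tar\<close>, \<open>K_star\<close>). The axioms are then identities between arrows of \<open>C\<close>
  and between vectors (\<open>tsc_K\<close>, \<open>pre_K\<close>). Among them only positivity needs the irreducible objects: the unit
  component of \<open>f\<^sup>* \<circ> f\<close> is a sum of terms \<open>Y\<^sup>* \<circ> Y\<close>, one for each component of \<open>f\<close>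
  (\<open>K_positive\<close>). Passing to subobjects costs one argument, the conjugate of a subobject
  (\<open>conj_subobject\<close>).

  \<^emph>\<open>Nondegeneracy.\<close> Let \<open>(rho, E)\<close> be irreducible and degenerate. Then the monodromy of \<open>rho\<close> with
  every object of \<open>C\<close> fixes \<open>E\<close>, hence all its components, which are arrows from \<open>\<gamma>\<^sub>k rho\<close> to
  \<open>rho\<close>. One of them has a nonzero component \<open>Z\<close> into an irreducible summand \<open>r\<close> of \<open>rho\<close>. The
  monodromy of \<open>r\<close> fixes \<open>Z\<close>, and \<open>Z \<circ> Z\<^sup>*\<close> is a nonzero scalar, so \<open>r\<close> is degenerate
  (\<open>degenerate_summand\<close>). The vectors of \<open>F(r)\<close> are arrows from the unit to \<open>r\<close>, and those of an
  orthonormal basis make \<open>r\<close> a multiple of the unit (\<open>arrow_to_unit\<close>). So there is a nonzero arrow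
  from \<open>(rho, E)\<close> to the unit, which is an isomorphism up to a scalar, since both are irreducible. In the
  same way every irreducible object of the crossed product is a summand of an irreducible object of \<open>C\<close>,
  which gives rationality.

  \<^emph>\<open>Modularity.\<close> In a rational category write \<open>Y\<^sub>i\<^sub>j = \<chi>\<^sub>i(j) d(j)\<close>, where \<open>\<chi>\<^sub>i(j)\<close> is the value
  of a loop of \<open>i\<close> around a strand of \<open>j\<close>. A product \<open>\<chi>\<^sub>i \<chi>\<^sub>k\<close> is a positive combination of the
  \<open>\<chi>\<^sub>m\<close> for the summands \<open>m\<close> of \<open>i k\<close> (\<open>chi_fusion\<close>), so the linear span of these functions is
  an algebra. A loop attains its maximal value only if the monodromy is trivial (\<open>maximal_loop\<close>);
  hence nondegeneracy separates the class of the unit from every other class, and by multiplying separating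
  functions the indicator function of the unit is obtained in the span. As the unit occurs in \<open>j\<close>
  times the conjugate of \<open>l\<close> just for isomorphic \<open>j\<close> and \<open>l\<close>, this yields an inverse of \<open>Y\<close>
  (\<open>nondegenerate_modular\<close>).
\<close>


section \<open>Calculus of arrows\<close>

context tensor_star_category
begin

sublocale V: vector_space "scl C" by (rule vs)

definition arr :: "('o, 'a) arrow \<Rightarrow> bool" where
  "arr f \<longleftrightarrow> src f \<in> Obj C \<and> tgt f \<in> Obj C \<and> vect f \<in> HomV C (src f) (tgt f)"

text \<open>
  The operations of \<open>C\<close> are only specified on arrows of \<open>C\<close> with matching ends. The variants below have the right source and
  target in all cases, so that the rules for \<open>src\<close> and \<open>tgt\<close> carry no hypotheses and the simplifier settles
  the side conditions of all other rules.
\<close>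

definition cp :: "('o, 'a) arrow \<Rightarrow> ('o, 'a) arrow \<Rightarrow> ('o, 'a) arrow" (infixr "oo" 60) where
  "f oo g = Arrow (src g) (tgt f) (vect (f \<cdot> g))"

definition tp :: "('o, 'a) arrow \<Rightarrow> ('o, 'a) arrow \<Rightarrow> ('o, 'a) arrow" (infixr "**" 70) where
  "f**g = Arrow (src f\<odot>src g) (tgt f\<odot>tgt g) (vect (f \<boxtimes> g))"

definition adj :: "('o, 'a) arrow \<Rightarrow> ('o, 'a) arrow" ("_\<star>" [1000] 999) where
  "f\<star> = Arrow (tgt f) (src f) (vect (star C f))"

definition idt :: "'o \<Rightarrow> ('o, 'a) arrow" where
  "idt rho = Arrow rho rho (vect (idn C rho))"

abbreviation asc :: "complex \<Rightarrow> ('o, 'a) arrow \<Rightarrow> ('o, 'a) arrow" (infixr "*>" 72) where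
  "z *> f \<equiv> arr_scl C z f"

abbreviation aad :: "('o, 'a) arrow \<Rightarrow> ('o, 'a) arrow \<Rightarrow> ('o, 'a) arrow" (infixl "\<boxplus>" 58) where
  "f \<boxplus> g \<equiv> arr_add f g"

abbreviation ob :: "'o \<Rightarrow> bool" where "ob rho \<equiv> rho \<in> Obj C"

definition homs :: "'o \<Rightarrow> 'o \<Rightarrow> ('o, 'a) arrow set" where
  "homs a b = {f. arr f \<and> src f = a \<and> tgt f = b}"

lemma arr_ob: "arr f \<Longrightarrow> src f \<in> Obj C" "arr f \<Longrightarrow> tgt f \<in> Obj C"
  by (auto simp: arr_def)

lemma homs_iff: "f \<in> homs a b \<longleftrightarrow> arr f \<and> src f = a \<and> tgt f = b \<and> ob a \<and> ob b"
  by (auto simp: homs_def arr_ob)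

lemma Hom_iff: "f \<in> Hom C a b \<longleftrightarrow> src f = a \<and> tgt f = b \<and> vect f \<in> HomV C a b"
  by (cases f) (auto simp: Hom_def)

lemma homs_Hom: "f \<in> homs a b \<longleftrightarrow> f \<in> Hom C a b \<and> ob a \<and> ob b"
  by (auto simp: homs_iff Hom_iff arr_def)

lemma homs_Arrow: "v \<in> HomV C a b \<Longrightarrow> ob a \<Longrightarrow> ob b \<Longrightarrow> Arrow a b v \<in> homs a b"
  by (simp add: homs_Hom Hom_iff)

lemma arr_Hom: "arr f \<longleftrightarrow> f \<in> Hom C (src f) (tgt f) \<and> ob (src f) \<and> ob (tgt f)"
  by (auto simp: Hom_iff arr_def)

lemma src_tgt [simp]:
  "src (f oo g) = src g" "tgt (f oo g) = tgt f"
  "src (f**g) = src f\<odot>src g" "tgt (f**g) = tgt f\<odot>tgt g"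
  "src (f\<star>) = tgt f" "tgt (f\<star>) = src f"
  "src (idt rho) = rho" "tgt (idt rho) = rho"
  "src (z *> f) = src f" "tgt (z *> f) = tgt f"
  "src (f \<boxplus> g) = src f" "tgt (f \<boxplus> g) = tgt f"
  "src (arr_zero rho sigma) = rho" "tgt (arr_zero rho sigma) = sigma"
  "src (arr_sum rho sigma F I) = rho" "tgt (arr_sum rho sigma F I) = sigma"
  by (auto simp: cp_def tp_def adj_def idt_def arr_scl_def arr_add_def arr_zero_def arr_sum_def)

lemma ob_simps [simp]: "ob rho \<Longrightarrow> ob sigma \<Longrightarrow> ob (rho\<odot>sigma)" "ob (unt C)"
  "\<lbrakk>ob rho; ob sigma; ob tau\<rbrakk> \<Longrightarrow> rho\<odot>sigma\<odot>tau = rho\<odot>(sigma\<odot>tau)"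
  "ob rho \<Longrightarrow> unt C\<odot>rho = rho" "ob rho \<Longrightarrow> rho\<odot>unt C = rho"
  by (auto simp: tob_Obj unt_Obj tob_assoc tob_unt_left tob_unt_right)

lemma cp_eq: "arr f \<Longrightarrow> arr g \<Longrightarrow> src f = tgt g \<Longrightarrow> f \<cdot> g = f oo g"
  using cmp_Hom[of "src g" "tgt g" "tgt f" f g]
  by (intro arrow.expand) (auto simp: arr_Hom Hom_iff cp_def)

lemma tp_eq: "arr f \<Longrightarrow> arr g \<Longrightarrow> f \<boxtimes> g = f**g"
  using tar_Hom[of "src f" "tgt f" "src g" "tgt g" f g]
  by (intro arrow.expand) (auto simp: arr_Hom Hom_iff tp_def)

lemma adj_eq: "arr f \<Longrightarrow> star C f = f\<star>"
  using star_Hom[of "src f" "tgt f" f]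
  by (intro arrow.expand) (auto simp: arr_Hom Hom_iff adj_def)

lemma idt_eq: "ob rho \<Longrightarrow> idn C rho = idt rho"
  using idn_Hom[of rho] by (intro arrow.expand) (auto simp: arr_Hom Hom_iff idt_def)

lemma arr_cp [simp]: "arr f \<Longrightarrow> arr g \<Longrightarrow> src f = tgt g \<Longrightarrow> arr (f oo g)"
  using cmp_Hom[of "src g" "tgt g" "tgt f" f g] by (auto simp: arr_Hom cp_eq)
lemma arr_tp [simp]: "arr f \<Longrightarrow> arr g \<Longrightarrow> arr (f**g)"
  using tar_Hom[of "src f" "tgt f" "src g" "tgt g" f g] by (auto simp: arr_Hom tp_eq)
lemma arr_adj [simp]: "arr f \<Longrightarrow> arr (f\<star>)"
  using star_Hom[of "src f" "tgt f" f] by (auto simp: arr_Hom adj_eq)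
lemma arr_idt [simp]: "ob rho \<Longrightarrow> arr (idt rho)"
  using idn_Hom[of rho] by (auto simp: arr_Hom idt_eq)

lemma HomV_sub: "ob rho \<Longrightarrow> ob sigma \<Longrightarrow> V.subspace (HomV C rho sigma)"
  by (rule Hom_subspace)

lemma arr_scl [simp]: "arr f \<Longrightarrow> arr (z *> f)"
  using HomV_sub[of "src f" "tgt f"] by (auto simp: arr_def arr_scl_def V.subspace_scale)
lemma arr_add [simp]: "arr f \<Longrightarrow> arr g \<Longrightarrow> src f = src g \<Longrightarrow> tgt f = tgt g \<Longrightarrow> arr (f \<boxplus> g)"
  using HomV_sub[of "src f" "tgt f"] by (auto simp: arr_def arr_add_def V.subspace_add)
lemma arr_zero [simp]: "ob rho \<Longrightarrow> ob sigma \<Longrightarrow> arr (arr_zero rho sigma)"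
  using HomV_sub[of rho sigma] by (auto simp: arr_def arr_zero_def V.subspace_0)
lemma arr_sum [simp]: "ob rho \<Longrightarrow> ob sigma \<Longrightarrow> (\<And>i. i \<in> I \<Longrightarrow> F i \<in> homs rho sigma) \<Longrightarrow> arr (arr_sum rho sigma F I)"
  using HomV_sub[of rho sigma] by (auto simp: arr_def arr_sum_def homs_iff intro!: V.subspace_sum)

declare arr_ob [simp]

lemma arr_HomI [simp]: "arr f \<Longrightarrow> src f = a \<Longrightarrow> tgt f = b \<Longrightarrow> f \<in> Hom C a b"
  by (auto simp: arr_Hom)

lemma homs_simps [simp]:
  "ob rho \<Longrightarrow> idt rho \<in> homs rho rho"
  "ob rho \<Longrightarrow> ob sigma \<Longrightarrow> arr_zero rho sigma \<in> homs rho sigma"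
  by (auto simp: homs_iff)

lemma homs_intros:
  "g \<in> homs a b \<Longrightarrow> f \<in> homs b c \<Longrightarrow> f oo g \<in> homs a c"
  "f \<in> homs a b \<Longrightarrow> f\<star> \<in> homs b a"
  "f \<in> homs a b \<Longrightarrow> g \<in> homs c d \<Longrightarrow> f**g \<in> homs (a\<odot>c) (b\<odot>d)"
  "f \<in> homs a b \<Longrightarrow> z *> f \<in> homs a b"
  "f \<in> homs a b \<Longrightarrow> g \<in> homs a b \<Longrightarrow> f \<boxplus> g \<in> homs a b"
  "ob rho \<Longrightarrow> ob sigma \<Longrightarrow> (\<And>i. i \<in> I \<Longrightarrow> F i \<in> homs rho sigma) \<Longrightarrow> arr_sum rho sigma F I \<in> homs rho sigma"
  by (auto simp: homs_iff)

lemma cp_assoc [simp]: "\<lbrakk>arr f; arr g; arr h; src f = tgt g; src g = tgt h\<rbrakk> \<Longrightarrow> (f oo g) oo h = f oo g oo h"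
  using cmp_assoc[of "src h" "tgt h" "tgt g" "tgt f" f g h] by (simp add: cp_eq)
lemma cp_idt_left [simp]: "arr f \<Longrightarrow> tgt f = rho \<Longrightarrow> idt rho oo f = f"
  using cmp_idn_left[of "src f" "tgt f" f] idt_eq[of "tgt f"] by (auto simp: cp_eq)
lemma cp_idt_right [simp]: "arr f \<Longrightarrow> src f = rho \<Longrightarrow> f oo idt rho = f"
  using cmp_idn_right[of "src f" "tgt f" f] idt_eq[of "src f"] by (auto simp: cp_eq)
lemma tp_assoc [simp]: "\<lbrakk>arr f; arr g; arr h\<rbrakk> \<Longrightarrow> (f**g)**h = f**g**h"
  using tar_assoc[of "src f" "tgt f" "src g" "tgt g" "src h" "tgt h" f g h] by (auto simp: tp_eq)
lemma tp_unt [simp]: "arr f \<Longrightarrow> idt (unt C)**f = f" "arr f \<Longrightarrow> f**idt (unt C) = f"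
  using tar_unt_left[of "src f" "tgt f" f] tar_unt_right[of "src f" "tgt f" f] idt_eq[of "unt C"]
  by (auto simp: tp_eq)
lemma tp_idt [simp]: "ob rho \<Longrightarrow> ob sigma \<Longrightarrow> idt rho**idt sigma = idt (rho\<odot>sigma)"
  using tar_idn[of rho sigma] by (auto simp: tp_eq idt_eq)
lemma tp_idt' [simp]: "ob rho \<Longrightarrow> ob sigma \<Longrightarrow> arr f \<Longrightarrow> idt rho**idt sigma**f = idt (rho\<odot>sigma)**f"
  using tp_assoc[of "idt rho" "idt sigma" f] by (simp del: tp_assoc)
lemma ichg: "\<lbrakk>arr f; arr g; arr f'; arr g'; src f = tgt g; src f' = tgt g'\<rbrakk>
    \<Longrightarrow> (f**f') oo (g**g') = (f oo g)**(f' oo g')"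
  using interchange[of "src g" "tgt g" "tgt f" "src g'" "tgt g'" "tgt f'" f g f' g']
  by (simp add: cp_eq tp_eq)

lemma adj_adj [simp]: "arr f \<Longrightarrow> (f\<star>)\<star> = f"
  using star_star[of "src f" "tgt f" f] adj_eq[of f] adj_eq[of "f\<star>"] by simp
lemma adj_cp [simp]: "\<lbrakk>arr f; arr g; src f = tgt g\<rbrakk> \<Longrightarrow> (f oo g)\<star> = g\<star> oo f\<star>"
  using star_cmp[of "src g" "tgt g" "tgt f" f g] adj_eq[of f] adj_eq[of g] adj_eq[of "f oo g"]
    cp_eq[of f g] cp_eq[of "g\<star>" "f\<star>"] by simp
lemma adj_tp [simp]: "\<lbrakk>arr f; arr g\<rbrakk> \<Longrightarrow> (f**g)\<star> = f\<star>**g\<star>"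
  using star_tar[of "src f" "tgt f" "src g" "tgt g" f g] adj_eq[of f] adj_eq[of g] adj_eq[of "f**g"]
    tp_eq[of f g] tp_eq[of "f\<star>" "g\<star>"] by simp
lemma adj_idt [simp]: assumes [simp]: "ob rho" shows "(idt rho)\<star> = idt rho"
proof -
  have "(idt rho)\<star> = idt rho oo (idt rho)\<star>" by simp
  also have "\<dots> = (((idt rho)\<star>)\<star> oo (idt rho)\<star>)" by (subst adj_adj) auto
  also have "\<dots> = (idt rho oo (idt rho)\<star>)\<star>" by (subst adj_cp) auto
  also have "\<dots> = idt rho" by simp
  finally show ?thesis .
qed

lemma pos: "\<lbrakk>arr f; f\<star> oo f = arr_zero rho rho; src f = rho; tgt f = sigma\<rbrakk> \<Longrightarrow> f = arr_zero rho sigma"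
  using star_positive[of rho sigma f] by (auto simp: cp_eq adj_eq)


lemma add_simps:
  "arr_zero (src f) (tgt f) \<boxplus> f = f" "f \<boxplus> arr_zero rho sigma = f"
  "1 *> f = f" "0 *> f = arr_zero (src f) (tgt f)" "z *> w *> f = (z * w) *> f"
  "z *> (f \<boxplus> g) = (z *> f) \<boxplus> (z *> g)"
  "z *> arr_zero rho sigma = arr_zero rho sigma"
  by (auto simp: arr_zero_def arr_add_def arr_scl_def arrow.expand V.scale_right_distrib)
declare add_simps(2-5)[simp] add_simps(7)[simp]

lemma add_scl: "(z + w) *> f = (z *> f) \<boxplus> (w *> f)"
  by (auto simp: arr_add_def arr_scl_def arrow.expand V.scale_left_distrib)

lemma add_ac: "(f \<boxplus> g) \<boxplus> h = f \<boxplus> (g \<boxplus> h)"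
  "src f = src g \<Longrightarrow> tgt f = tgt g \<Longrightarrow> f \<boxplus> g = g \<boxplus> f"
  by (auto simp: arr_add_def arrow.expand algebra_simps)

lemma cp_add: "\<lbrakk>arr f; arr f'; arr g; src f = src f'; tgt f = tgt f'; src f = tgt g\<rbrakk>
    \<Longrightarrow> (f \<boxplus> f') oo g = (f oo g) \<boxplus> (f' oo g)"
  "\<lbrakk>arr f; arr g; arr g'; src g = src g'; tgt g = tgt g'; src f = tgt g\<rbrakk>
    \<Longrightarrow> f oo (g \<boxplus> g') = (f oo g) \<boxplus> (f oo g')"
  using cmp_add_left[of "src g" "tgt g" "tgt f" f f' g] cmp_add_right[of "src g" "tgt g" "tgt f" f g g']
  by (metis (no_types, lifting) arr_Hom arr_add cp_eq src_tgt(11,12))+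

lemma tp_add: "\<lbrakk>arr f; arr f'; arr g; src f = src f'; tgt f = tgt f'\<rbrakk>
    \<Longrightarrow> (f \<boxplus> f')**g = (f**g) \<boxplus> (f'**g)"
  "\<lbrakk>arr f; arr g; arr g'; src g = src g'; tgt g = tgt g'\<rbrakk>
    \<Longrightarrow> f**(g \<boxplus> g') = (f**g) \<boxplus> (f**g')"
  using tar_add_left[of "src f" "tgt f" "src g" "tgt g" f f' g] tar_add_right[of "src f" "tgt f" "src g" "tgt g" f g g']
  by (metis (no_types, lifting) arr_Hom arr_add tp_eq)+

lemma adj_add: "\<lbrakk>arr f; arr g; src f = src g; tgt f = tgt g\<rbrakk> \<Longrightarrow> (f \<boxplus> g)\<star> = f\<star> \<boxplus> g\<star>"
  using star_add[of "src f" "tgt f" f g] by (metis (no_types, lifting) arr_Hom arr_add adj_eq)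

lemma cp_scl [simp]: "\<lbrakk>arr f; arr g; src f = tgt g\<rbrakk> \<Longrightarrow> (z *> f) oo g = z *> (f oo g)"
  "\<lbrakk>arr f; arr g; src f = tgt g\<rbrakk> \<Longrightarrow> f oo (z *> g) = z *> (f oo g)"
  using cmp_scl_left[of "src g" "tgt g" "tgt f" f g] cmp_scl_right[of "src g" "tgt g" "tgt f" f g]
  by (metis (no_types, lifting) arr_Hom arr_scl cp_eq src_tgt(9,10))+

lemma tp_scl [simp]: "\<lbrakk>arr f; arr g\<rbrakk> \<Longrightarrow> (z *> f)**g = z *> (f**g)"
  "\<lbrakk>arr f; arr g\<rbrakk> \<Longrightarrow> f**(z *> g) = z *> (f**g)"
  using tar_scl_left[of "src f" "tgt f" "src g" "tgt g" f g] tar_scl_right[of "src f" "tgt f" "src g" "tgt g" f g]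
  by (metis (no_types, lifting) arr_Hom arr_scl tp_eq)+

lemma adj_scl [simp]: "arr f \<Longrightarrow> (z *> f)\<star> = cnj z *> f\<star>"
  using star_scl[of "src f" "tgt f" f z] by (metis (no_types, lifting) arr_Hom arr_scl adj_eq)

lemma zero_simps [simp]:
  "arr f \<Longrightarrow> ob sigma \<Longrightarrow> tgt f = rho \<Longrightarrow> arr_zero rho sigma oo f = arr_zero (src f) sigma"
  "arr f \<Longrightarrow> ob sigma \<Longrightarrow> src f = rho \<Longrightarrow> f oo arr_zero sigma rho = arr_zero sigma (tgt f)"
  "arr f \<Longrightarrow> ob rho \<Longrightarrow> ob sigma \<Longrightarrow> arr_zero rho sigma**f = arr_zero (rho\<odot>src f) (sigma\<odot>tgt f)"
  "arr f \<Longrightarrow> ob rho \<Longrightarrow> ob sigma \<Longrightarrow> f**arr_zero rho sigma = arr_zero (src f\<odot>rho) (tgt f\<odot>sigma)"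
  "ob rho \<Longrightarrow> ob sigma \<Longrightarrow> (arr_zero rho sigma)\<star> = arr_zero sigma rho"
  using cp_scl(1)[of "arr_zero rho sigma" f 0] cp_scl(2)[of f "arr_zero sigma rho" 0]
    tp_scl(1)[of "arr_zero rho sigma" f 0] tp_scl(2)[of f "arr_zero rho sigma" 0] adj_scl[of "arr_zero rho sigma" 0]
  by auto

lemma arr_sum_insert: "finite I \<Longrightarrow> i \<notin> I \<Longrightarrow> src (F i) = rho \<Longrightarrow> tgt (F i) = sigma
    \<Longrightarrow> arr_sum rho sigma F (insert i I) = F i \<boxplus> arr_sum rho sigma F I"
  by (auto simp: arr_sum_def arr_add_def)

lemma arr_sum_empty [simp]: "arr_sum rho sigma F {} = arr_zero rho sigma"
  "infinite I \<Longrightarrow> arr_sum rho sigma F I = arr_zero rho sigma"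
  by (auto simp: arr_sum_def arr_zero_def)

lemma arr_sum_cong: "(\<And>i. i \<in> I \<Longrightarrow> F i = G i) \<Longrightarrow> arr_sum rho sigma F I = arr_sum rho sigma G I"
  by (auto simp: arr_sum_def intro!: sum.cong)

text \<open>
  Additivity of any construction on arrows extends to finite sums; the rules for sums below are instances.
\<close>

lemma arr_sum_additive:
  assumes "\<And>i. i \<in> I \<Longrightarrow> F i \<in> homs rho sigma" "ob rho" "ob sigma"
    and add: "\<And>f g. f \<in> homs rho sigma \<Longrightarrow> g \<in> homs rho sigma \<Longrightarrow> T (f \<boxplus> g) = T f \<boxplus> T g"
    and zero: "T (arr_zero rho sigma) = arr_zero rho' sigma'"
    and T: "\<And>f. f \<in> homs rho sigma \<Longrightarrow> src (T f) = rho' \<and> tgt (T f) = sigma'"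
  shows "T (arr_sum rho sigma F I) = arr_sum rho' sigma' (\<lambda>i. T (F i)) I"
  using assms(1)
proof (induction I rule: infinite_finite_induct)
  case (insert i I)
  have *: "F i \<in> homs rho sigma" "arr_sum rho sigma F I \<in> homs rho sigma" using insert.prems assms(2,3)
    by (auto intro!: homs_intros)
  have "arr_sum rho sigma F (insert i I) = F i \<boxplus> arr_sum rho sigma F I"
    using insert.hyps * by (subst arr_sum_insert) (auto simp: homs_iff)
  moreover have "arr_sum rho' sigma' (\<lambda>i. T (F i)) (insert i I) = T (F i) \<boxplus> arr_sum rho' sigma' (\<lambda>i. T (F i)) I"
    using insert.hyps * T by (subst arr_sum_insert) auto
  ultimately show ?case using add[OF *] insert by auto
qed (auto simp: zero)

lemma cp_sum:
  "\<lbrakk>\<And>i. i \<in> I \<Longrightarrow> F i \<in> homs sigma delta; ob delta; arr g; tgt g = sigma\<rbrakk>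
    \<Longrightarrow> arr_sum sigma delta F I oo g = arr_sum (src g) delta (\<lambda>i. F i oo g) I"
  "\<lbrakk>\<And>i. i \<in> I \<Longrightarrow> F i \<in> homs sigma delta; ob sigma; arr g; src g = delta\<rbrakk>
    \<Longrightarrow> g oo arr_sum sigma delta F I = arr_sum sigma (tgt g) (\<lambda>i. g oo F i) I"
  by (rule arr_sum_additive[where T = "\<lambda>f. f oo g"], auto simp: homs_iff cp_add)
     (rule arr_sum_additive[where T = "\<lambda>f. g oo f"], auto simp: homs_iff cp_add)

lemma tp_sum:
  "\<lbrakk>\<And>i. i \<in> I \<Longrightarrow> F i \<in> homs sigma delta; ob sigma; ob delta; arr g\<rbrakk>
    \<Longrightarrow> arr_sum sigma delta F I**g = arr_sum (sigma\<odot>src g) (delta\<odot>tgt g) (\<lambda>i. F i**g) I"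
  "\<lbrakk>\<And>i. i \<in> I \<Longrightarrow> F i \<in> homs sigma delta; ob sigma; ob delta; arr g\<rbrakk>
    \<Longrightarrow> g**arr_sum sigma delta F I = arr_sum (src g\<odot>sigma) (tgt g\<odot>delta) (\<lambda>i. g**F i) I"
  by (rule arr_sum_additive[where T = "\<lambda>f. f**g"], auto simp: homs_iff tp_add)
     (rule arr_sum_additive[where T = "\<lambda>f. g**f"], auto simp: homs_iff tp_add)

lemma adj_sum:
  "\<lbrakk>\<And>i. i \<in> I \<Longrightarrow> F i \<in> homs sigma delta; ob sigma; ob delta\<rbrakk>
    \<Longrightarrow> (arr_sum sigma delta F I)\<star> = arr_sum delta sigma (\<lambda>i. (F i)\<star>) I"
  by (rule arr_sum_additive[where T = "\<lambda>f. f\<star>"], auto simp: homs_iff adj_add)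

text \<open>
  Compositions are nested to the right, so an equation between \<open>f oo g\<close> and \<open>h\<close> has to be applied in front of
  a further factor as well.
\<close>

lemma cp_subst: "f oo g = h \<Longrightarrow> \<lbrakk>arr f; arr g; arr k; src f = tgt g; src g = tgt k\<rbrakk> \<Longrightarrow> f oo g oo k = h oo k"
  by (metis cp_assoc)

lemma slide: "\<lbrakk>arr f; arr g; src f = a; tgt f = b; src g = c; tgt g = d\<rbrakk> \<Longrightarrow> (f**idt d) oo (idt a**g) = f**g"
  "\<lbrakk>arr f; arr g; src f = a; tgt f = b; src g = c; tgt g = d\<rbrakk> \<Longrightarrow> (idt b**g) oo (f**idt c) = f**g"
  by (auto simp: ichg)

lemma tp_cp: "\<lbrakk>arr f; arr g; src f = tgt g; ob a\<rbrakk> \<Longrightarrow> idt a**(f oo g) = (idt a**f) oo (idt a**g)"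
  "\<lbrakk>arr f; arr g; src f = tgt g; ob a\<rbrakk> \<Longrightarrow> (f oo g)**idt a = (f**idt a) oo (g**idt a)"
  by (auto simp: ichg)

end


section \<open>Conjugates, positivity and braiding\<close>

text \<open>
  A braided tensor star-category with conjugates, direct sums and an irreducible unit, but without subobjects and
  without normalization of the conjugates. The crossed product is of this kind before its closure under subobjects.
\<close>

locale pre_BTC_star = tensor_star_category C for C :: "('o, 'a::ab_group_add, 'm) tcat_scheme" (structure) +
  assumes conj_ex: "rho \<in> Obj C \<Longrightarrow> \<exists>rhob R Rb. conj_solution C rho rhob R Rb"
    and dsum_ex: "\<lbrakk>rho \<in> Obj C; sigma \<in> Obj C\<rbrakk> \<Longrightarrow> \<exists>tau \<in> Obj C. \<exists>V W. isometry C rho tau V \<and> isometry C sigma tau W \<and>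
        arr_add (V \<cdot> star C V) (W \<cdot> star C W) = idn C tau"
    and fin_dim: "\<lbrakk>rho \<in> Obj C; sigma \<in> Obj C\<rbrakk> \<Longrightarrow> \<exists>B. finite B \<and> HomV C rho sigma = module.span (scl C) B"
    and unt_irr: "irreducible_obj C (unt C)"
    and br_Hom: "\<lbrakk>rho \<in> Obj C; sigma \<in> Obj C\<rbrakk> \<Longrightarrow> brd C rho sigma \<in> Hom C (rho\<odot>sigma) (sigma\<odot>rho)"
    and br_unitary: "\<lbrakk>rho \<in> Obj C; sigma \<in> Obj C\<rbrakk> \<Longrightarrow> star C (brd C rho sigma) \<cdot> brd C rho sigma = idn C (rho\<odot>sigma) \<and>
        brd C rho sigma \<cdot> star C (brd C rho sigma) = idn C (sigma\<odot>rho)"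
    and br_natural: "\<lbrakk>rho \<in> Obj C; sigma \<in> Obj C; rho' \<in> Obj C; sigma' \<in> Obj C; f \<in> Hom C rho rho'; g \<in> Hom C sigma sigma'\<rbrakk>
        \<Longrightarrow> brd C rho' sigma' \<cdot> (f \<boxtimes> g) = (g \<boxtimes> f) \<cdot> brd C rho sigma"
    and br_tob_right: "\<lbrakk>rho \<in> Obj C; sigma \<in> Obj C; tau \<in> Obj C\<rbrakk>
        \<Longrightarrow> brd C rho (sigma\<odot>tau) = (idn C sigma \<boxtimes> brd C rho tau) \<cdot> (brd C rho sigma \<boxtimes> idn C tau)"
    and br_tob_left: "\<lbrakk>rho \<in> Obj C; sigma \<in> Obj C; tau \<in> Obj C\<rbrakk>
        \<Longrightarrow> brd C (rho\<odot>sigma) tau = (brd C rho tau \<boxtimes> idn C sigma) \<cdot> (idn C rho \<boxtimes> brd C sigma tau)"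

sublocale BTC_star \<subseteq> pre_BTC_star
proof (unfold_locales, goal_cases)
  case (1 rho) then show ?case using conjugates by blast
next
  case (2 rho sigma) then show ?case by (rule direct_sums)
next
  case (3 rho sigma) then show ?case by (rule Hom_finite_dim)
next
  case 4 show ?case by (rule unt_irreducible)
next
  case (5 rho sigma) then show ?case by (rule brd_Hom)
next
  case (6 rho sigma) then show ?case by (rule brd_unitary)
next
  case 7 then show ?case by (rule brd_natural)
next
  case 8 then show ?case by (rule brd_tob_right)
next
  case 9 then show ?case by (rule brd_tob_left)
qed

context tensor_star_category
begin

text \<open>
  The conjugate equations for the operations with unconditional sources and targets.
\<close>

definition csol :: "'o \<Rightarrow> 'o \<Rightarrow> ('o, 'a) arrow \<Rightarrow> ('o, 'a) arrow \<Rightarrow> bool" where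
  "csol rho rhob R Rb \<longleftrightarrow> ob rho \<and> ob rhob \<and> R \<in> homs (unt C) (rhob\<odot>rho) \<and> Rb \<in> homs (unt C) (rho\<odot>rhob) \<and>
     (Rb\<star>**idt rho) oo (idt rho**R) = idt rho \<and> (R\<star>**idt rhob) oo (idt rhob**Rb) = idt rhob"

lemma csol_t: assumes "csol rho rhob R Rb"
  shows "arr R" "src R = unt C" "tgt R = rhob\<odot>rho" "arr Rb" "src Rb = unt C" "tgt Rb = rho\<odot>rhob" "ob rho" "ob rhob"
  using assms by (auto simp: csol_def homs_iff)

lemma csol_sym: "csol rho rhob R Rb \<Longrightarrow> csol rhob rho Rb R"
  by (auto simp: csol_def)

lemma csol_iff: "conj_solution C rho rhob R Rb \<longleftrightarrow> csol rho rhob R Rb"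
proof (cases "ob rho \<and> ob rhob \<and> R \<in> homs (unt C) (rhob\<odot>rho) \<and> Rb \<in> homs (unt C) (rho\<odot>rhob)")
  case True
  then show ?thesis by (auto simp: csol_def conj_solution_def cp_eq tp_eq adj_eq idt_eq homs_iff)
next
  case False
  then show ?thesis by (auto simp: csol_def conj_solution_def homs_Hom)
qed

lemma csol_zz: assumes "csol rho rhob R Rb"
  shows "(Rb\<star>**idt rho) oo (idt rho**R) = idt rho"
    "(R\<star>**idt rhob) oo (idt rhob**Rb) = idt rhob"
    "(idt rho**R\<star>) oo (Rb**idt rho) = idt rho"
    "(idt rhob**Rb\<star>) oo (R**idt rhob) = idt rhob"
proof -
  note [simp] = csol_t[OF assms]
  show 1: "(Rb\<star>**idt rho) oo (idt rho**R) = idt rho" "(R\<star>**idt rhob) oo (idt rhob**Rb) = idt rhob"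
    using assms by (auto simp: csol_def)
  show "(idt rho**R\<star>) oo (Rb**idt rho) = idt rho" "(idt rhob**Rb\<star>) oo (R**idt rhob) = idt rhob"
    using arg_cong[OF 1(1), of adj] arg_cong[OF 1(2), of adj] by simp_all
qed

lemma csol_zz_w: assumes c: "csol rho rhob R Rb" and [simp]: "ob a" "ob b"
  shows "(idt a**Rb\<star>**idt (rho\<odot>b)) oo (idt (a\<odot>rho)**R**idt b) = idt (a\<odot>(rho\<odot>b))"
    "(idt (a\<odot>rho)**R\<star>**idt b) oo (idt a**Rb**idt (rho\<odot>b)) = idt (a\<odot>(rho\<odot>b))"
proof -
  note [simp] = csol_t[OF c]
  show "(idt a**Rb\<star>**idt (rho\<odot>b)) oo (idt (a\<odot>rho)**R**idt b) = idt (a\<odot>(rho\<odot>b))"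
    using arg_cong[OF csol_zz(1)[OF c], of "\<lambda>x. idt a**x**idt b"] by (simp add: tp_cp)
  show "(idt (a\<odot>rho)**R\<star>**idt b) oo (idt a**Rb**idt (rho\<odot>b)) = idt (a\<odot>(rho\<odot>b))"
    using arg_cong[OF csol_zz(3)[OF c], of "\<lambda>x. idt a**x**idt b"] by (simp add: tp_cp)
qed

text \<open>
  Arrows on different strands may be interchanged. The strands \<open>x\<close>, \<open>y\<close> and \<open>z\<close> to the left, in between and to
  the right are the unit in most applications.
\<close>

lemma exch: assumes [simp]: "arr f" "arr g" "src f = a" "tgt f = a'" "src g = b" "tgt g = b'" "ob x" "ob y" "ob z"
  shows "(idt x**f**idt (y\<odot>(b'\<odot>z))) oo (idt (x\<odot>(a\<odot>y))**g**idt z)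
       = (idt (x\<odot>(a'\<odot>y))**g**idt z) oo (idt x**f**idt (y\<odot>(b\<odot>z)))"
proof -
  have [simp]: "ob a" "ob a'" "ob b" "ob b'" using arr_ob[of f] arr_ob[of g] by auto
  have "(idt x**f**idt (y\<odot>(b'\<odot>z))) oo (idt (x\<odot>(a\<odot>y))**g**idt z)
     = (idt x**f**(idt y**idt b'**idt z)) oo (idt x**idt a**idt y**g**idt z)" by simp
  also have "\<dots> = idt x**f**(idt y**g**idt z)"
    by (simp only: ichg cp_idt_left cp_idt_right src_tgt arr_idt arr_tp assms \<open>ob a\<close> \<open>ob a'\<close> \<open>ob b\<close> \<open>ob b'\<close>)
  also have "\<dots> = (idt x**idt a'**idt y**g**idt z) oo (idt x**f**(idt y**idt b**idt z))"
    by (simp only: ichg cp_idt_left cp_idt_right src_tgt arr_idt arr_tp assms \<open>ob a\<close> \<open>ob a'\<close> \<open>ob b\<close> \<open>ob b'\<close>)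
  finally show ?thesis by simp
qed

text \<open>
  The transpose turns \<open>f\<close> upside down. It depends on the chosen conjugates and is characterized by either of the
  two equations of the following lemma.
\<close>

definition tps :: "'o \<Rightarrow> ('o, 'a) arrow \<Rightarrow> ('o, 'a) arrow \<Rightarrow> ('o, 'a) arrow \<Rightarrow> 'o \<Rightarrow> ('o, 'a) arrow" where
  "tps sigmab Q f Rb rhob = (Q\<star>**idt rhob) oo (idt sigmab**f**idt rhob) oo (idt sigmab**Rb)"

lemma tps:
  assumes c: "csol rho rhob R Rb" and c': "csol sigma sigmab Q Qb" and f: "f \<in> homs rho sigma"
  defines "t \<equiv> tps sigmab Q f Rb rhob"
  shows "t \<in> homs sigmab rhob" "R\<star> oo (t**idt rho) = Q\<star> oo (idt sigmab**f)" "(idt sigma**t) oo Qb = (f**idt rhob) oo Rb"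
proof -
  note [simp] = csol_t[OF c] csol_t[OF c'] f[unfolded homs_iff]
  show "t \<in> homs sigmab rhob" by (simp add: t_def tps_def homs_iff)
  have e1: "R\<star> oo (Q\<star>**idt (rhob\<odot>rho)) = Q\<star> oo (idt (sigmab\<odot>sigma)**R\<star>)"
    using exch[of "Q\<star>" "R\<star>" _ _ _ _ "unt C" "unt C" "unt C", OF _ _ refl refl refl refl] by simp
  have e2: "(idt (sigmab\<odot>sigma)**R\<star>) oo (idt sigmab**f**idt (rhob\<odot>rho)) = (idt sigmab**f) oo (idt (sigmab\<odot>rho)**R\<star>)"
    using exch[of f "R\<star>" _ _ _ _ sigmab "unt C" "unt C", OF _ _ refl refl refl refl] by simp
  have e3: "(idt (sigmab\<odot>rho)**R\<star>) oo (idt sigmab**Rb**idt rho) = idt (sigmab\<odot>rho)"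
    using csol_zz_w(2)[OF c, of sigmab "unt C"] by simp
  show "R\<star> oo (t**idt rho) = Q\<star> oo (idt sigmab**f)"
    by (simp add: t_def tps_def tp_cp e1 cp_subst[OF e1] e2 cp_subst[OF e2] e3)
  have e1: "(idt (sigma\<odot>sigmab)**Rb) oo Qb = (Qb**idt (rho\<odot>rhob)) oo Rb"
    using exch[of Qb Rb _ _ _ _ "unt C" "unt C" "unt C", OF _ _ refl refl refl refl] by simp
  have e2: "(idt (sigma\<odot>sigmab)**f**idt rhob) oo (Qb**idt (rho\<odot>rhob)) = (Qb**idt (sigma\<odot>rhob)) oo (f**idt rhob)"
    using exch[of Qb f _ _ _ _ "unt C" "unt C" rhob, OF _ _ refl refl refl refl] by simp
  have e3: "(idt sigma**Q\<star>**idt rhob) oo (Qb**idt (sigma\<odot>rhob)) = idt (sigma\<odot>rhob)"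
    using csol_zz_w(2)[OF c', of "unt C" rhob] by simp
  show "(idt sigma**t) oo Qb = (f**idt rhob) oo Rb"
    by (simp add: t_def tps_def tp_cp e1 cp_subst[OF e2] cp_subst[OF e3])
qed

text \<open>
  An arrow can be recovered after one of its ends has been bent with a solution of the conjugate equations.
\<close>

lemma csol_inj:
  assumes c: "csol rho rhob R Rb"
  shows "\<lbrakk>arr f; arr g; src f = src g; tgt f = rhob; tgt g = rhob; R\<star> oo (f**idt rho) = R\<star> oo (g**idt rho)\<rbrakk> \<Longrightarrow> f = g"
    "\<lbrakk>arr f; arr g; tgt f = tgt g; src f = rho; src g = rho; (f**idt rhob) oo Rb = (g**idt rhob) oo Rb\<rbrakk> \<Longrightarrow> f = g"
    "\<lbrakk>arr f; arr g; tgt f = tgt g; src f = rho; src g = rho; (idt rhob**f) oo R = (idt rhob**g) oo R\<rbrakk> \<Longrightarrow> f = g"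
proof -
  note [simp] = csol_t[OF c]
  have *: "f = ((R\<star> oo (f**idt rho))**idt rhob) oo (idt (src f)**Rb)" if [simp]: "arr f" "tgt f = rhob" for f
  proof -
    have e: "(f**idt (rho\<odot>rhob)) oo (idt (src f)**Rb) = (idt rhob**Rb) oo f"
      using exch[of f Rb _ _ _ _ "unt C" "unt C" "unt C", OF _ _ refl refl refl refl] by simp
    show ?thesis by (simp add: tp_cp e cp_subst[OF csol_zz(2)[OF c]])
  qed
  show "f = g" if "arr f" "arr g" "src f = src g" "tgt f = rhob" "tgt g = rhob" "R\<star> oo (f**idt rho) = R\<star> oo (g**idt rho)" for f g
    using *[of f] *[of g] that by simp
  have *: "f = (idt (tgt f)**R\<star>) oo (((f**idt rhob) oo Rb)**idt rho)" if [simp]: "arr f" "src f = rho" for f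
  proof -
    have e: "(idt (tgt f)**R\<star>) oo (f**idt (rhob\<odot>rho)) = f oo (idt rho**R\<star>)"
      using exch[of f "R\<star>" _ _ _ _ "unt C" "unt C" "unt C", OF _ _ refl refl refl refl] by simp
    show ?thesis by (simp add: tp_cp cp_subst[OF e] csol_zz[OF c])
  qed
  show "f = g" if "arr f" "arr g" "tgt f = tgt g" "src f = rho" "src g = rho" "(f**idt rhob) oo Rb = (g**idt rhob) oo Rb" for f g
    using *[of f] *[of g] that by simp
  have *: "f = (Rb\<star>**idt (tgt f)) oo (idt rho**((idt rhob**f) oo R))" if [simp]: "arr f" "src f = rho" for f
  proof -
    have e: "(Rb\<star>**idt (tgt f)) oo (idt (rho\<odot>rhob)**f) = f oo (Rb\<star>**idt rho)"
      using exch[of "Rb\<star>" f _ _ _ _ "unt C" "unt C" "unt C", OF _ _ refl refl refl refl] by simp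
    show ?thesis by (simp add: tp_cp cp_subst[OF e] csol_zz[OF c])
  qed
  show "f = g" if "arr f" "arr g" "tgt f = tgt g" "src f = rho" "src g = rho" "(idt rhob**f) oo R = (idt rhob**g) oo R" for f g
    using *[of f] *[of g] that by simp
qed

lemma csol_product:
  assumes c: "csol rho rhob R Rb" and c': "csol sigma sigmab Q Qb"
  shows "csol (rho\<odot>sigma) (sigmab\<odot>rhob) ((idt sigmab**R**idt sigma) oo Q) ((idt rho**Qb**idt rhob) oo Rb)"
proof -
  note [simp] = csol_t[OF c] csol_t[OF c']
  have e1: "(idt rho**Qb\<star>**idt (rhob\<odot>(rho\<odot>sigma))) oo (idt (rho\<odot>(sigma\<odot>sigmab))**R**idt sigma)
      = (idt rho**R**idt sigma) oo (idt rho**Qb\<star>**idt sigma)"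
    using exch[of "Qb\<star>" R _ _ _ _ rho "unt C" sigma, OF _ _ refl refl refl refl] by simp
  have e2: "(idt rho**Qb\<star>**idt sigma) oo (idt (rho\<odot>sigma)**Q) = idt (rho\<odot>sigma)"
    using csol_zz_w(1)[OF c', of rho "unt C"] by simp
  have e3: "(Rb\<star>**idt (rho\<odot>sigma)) oo (idt rho**R**idt sigma) = idt (rho\<odot>sigma)"
    using csol_zz_w(1)[OF c, of "unt C" sigma] by simp
  have f1: "(idt sigmab**R\<star>**idt (sigma\<odot>(sigmab\<odot>rhob))) oo (idt (sigmab\<odot>(rhob\<odot>rho))**Qb**idt rhob)
      = (idt sigmab**Qb**idt rhob) oo (idt sigmab**R\<star>**idt rhob)"
    using exch[of "R\<star>" Qb _ _ _ _ sigmab "unt C" rhob, OF _ _ refl refl refl refl] by simp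
  have f2: "(idt sigmab**R\<star>**idt rhob) oo (idt (sigmab\<odot>rhob)**Rb) = idt (sigmab\<odot>rhob)"
    using csol_zz_w(1)[OF csol_sym[OF c], of sigmab "unt C"] by simp
  have f3: "(Q\<star>**idt (sigmab\<odot>rhob)) oo (idt sigmab**Qb**idt rhob) = idt (sigmab\<odot>rhob)"
    using csol_zz_w(1)[OF csol_sym[OF c'], of "unt C" rhob] by simp
  show ?thesis
    by (simp add: csol_def homs_iff tp_cp cp_subst[OF e1] e2 cp_subst[OF e2] e3 cp_subst[OF f1] f2 f3)
qed

text \<open>
  Frobenius reciprocity: bending the strand of \<open>k\<close> to the other end of an arrow and back again changes nothing, on
  either side of the arrow and in either order.
\<close>

lemma frobenius_left:
  assumes c: "csol k kb R Rb" and [simp]: "arr T" "src T = k\<odot>rho" "tgt T = sigma" "ob rho"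
  shows "(Rb\<star>**idt sigma) oo (idt k**((idt kb**T) oo (R**idt rho))) = T"
proof -
  note [simp] = csol_t[OF c]
  have [simp]: "ob sigma" using arr_ob(2)[of T] by simp
  have e: "(Rb\<star>**idt sigma) oo (idt (k\<odot>kb)**T) = T oo (Rb\<star>**idt (k\<odot>rho))"
    using exch[of "Rb\<star>" T _ _ _ _ "unt C" "unt C" "unt C", OF _ _ refl refl refl refl] by simp
  have f: "(Rb\<star>**idt (k\<odot>rho)) oo (idt k**R**idt rho) = idt (k\<odot>rho)"
    using csol_zz_w(1)[OF c, of "unt C" rho] by simp
  show ?thesis by (simp add: tp_cp cp_subst[OF e] f)
qed

lemma frobenius_left':
  assumes c: "csol k kb R Rb" and [simp]: "arr T" "src T = rho" "tgt T = kb\<odot>sigma" "ob sigma"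
  shows "(idt kb**((Rb\<star>**idt sigma) oo (idt k**T))) oo (R**idt rho) = T"
proof -
  note [simp] = csol_t[OF c]
  have [simp]: "ob rho" using arr_ob(1)[of T] by simp
  have e: "(idt (kb\<odot>k)**T) oo (R**idt rho) = (R**idt (kb\<odot>sigma)) oo T"
    using exch[of R T _ _ _ _ "unt C" "unt C" "unt C", OF _ _ refl refl refl refl] by simp
  have f: "(idt kb**Rb\<star>**idt sigma) oo (R**idt (kb\<odot>sigma)) = idt (kb\<odot>sigma)"
    using csol_zz_w(2)[OF csol_sym[OF c], of "unt C" sigma] by simp
  show ?thesis by (simp add: tp_cp e cp_subst[OF f])
qed

lemma frobenius_right:
  assumes c: "csol k kb R Rb" and [simp]: "arr T" "src T = rho\<odot>k" "tgt T = sigma" "ob rho"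
  shows "(idt sigma**R\<star>) oo (((T**idt kb) oo (idt rho**Rb))**idt k) = T"
proof -
  note [simp] = csol_t[OF c]
  have [simp]: "ob sigma" using arr_ob(2)[of T] by simp
  have e: "(idt sigma**R\<star>) oo (T**idt (kb\<odot>k)) = T oo (idt (rho\<odot>k)**R\<star>)"
    using exch[of T "R\<star>" _ _ _ _ "unt C" "unt C" "unt C", OF _ _ refl refl refl refl] by simp
  have f: "(idt (rho\<odot>k)**R\<star>) oo (idt rho**Rb**idt k) = idt (rho\<odot>k)"
    using csol_zz_w(2)[OF c, of rho "unt C"] by simp
  show ?thesis by (simp add: tp_cp cp_subst[OF e] f)
qed

lemma frobenius_right':
  assumes c: "csol k kb R Rb" and [simp]: "arr T" "src T = rho" "tgt T = sigma\<odot>kb" "ob sigma"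
  shows "(((idt sigma**R\<star>) oo (T**idt k))**idt kb) oo (idt rho**Rb) = T"
proof -
  note [simp] = csol_t[OF c]
  have [simp]: "ob rho" using arr_ob(1)[of T] by simp
  have e: "(T**idt (k\<odot>kb)) oo (idt rho**Rb) = (idt (sigma\<odot>kb)**Rb) oo T"
    using exch[of T Rb _ _ _ _ "unt C" "unt C" "unt C", OF _ _ refl refl refl refl] by simp
  have f: "(idt sigma**R\<star>**idt kb) oo (idt (sigma\<odot>kb)**Rb) = idt (sigma\<odot>kb)"
    using csol_zz_w(1)[OF csol_sym[OF c], of sigma "unt C"] by simp
  show ?thesis by (simp add: tp_cp e cp_subst[OF f])
qed

subsection \<open>Irreducible objects\<close>

abbreviation irr :: "'o \<Rightarrow> bool" where "irr r \<equiv> irreducible_obj C r"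

lemma vect_zero: "arr f \<Longrightarrow> vect f = 0 \<longleftrightarrow> f = arr_zero (src f) (tgt f)"
  by (cases f) (auto simp: arr_zero_def)
lemma vect_simps [simp]: "vect (arr_zero rho sigma) = 0" "vect (f \<boxplus> g) = vect f + vect g"
  "vect (z *> f) = scl C z (vect f)"
  by (auto simp: arr_zero_def arr_add_def arr_scl_def)

lemma irr_ob [simp]: "irr r \<Longrightarrow> ob r" unfolding irreducible_obj_def by blast
lemma irr_ne: "irr r \<Longrightarrow> vect (idt r) \<noteq> 0"
  using vect_zero[of "idt r"] idt_eq[of r] unfolding irreducible_obj_def by auto
lemma irr_ne' [simp]: "irr r \<Longrightarrow> arr_zero r r \<noteq> idt r" "irr r \<Longrightarrow> idt r \<noteq> arr_zero r r"
  using irr_ne[of r] vect_zero[of "idt r"] by (metis arrow.sel(3) arr_zero_def)+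
lemma irr_ex: "irr r \<Longrightarrow> X \<in> homs r r \<Longrightarrow> \<exists>c. X = c *> idt r"
  using idt_eq[of r] unfolding irreducible_obj_def by (auto simp: homs_Hom)
lemma irr_iff: "irr r \<longleftrightarrow> ob r \<and> vect (idt r) \<noteq> 0 \<and> (\<forall>X\<in>homs r r. \<exists>c. X = c *> idt r)"
proof
  assume a: "ob r \<and> vect (idt r) \<noteq> 0 \<and> (\<forall>X\<in>homs r r. \<exists>c. X = c *> idt r)"
  then have r: "ob r" by simp
  have 1: "Hom C r r = range (\<lambda>c. arr_scl C c (idn C r))"
  proof (intro equalityI subsetI)
    fix X assume "X \<in> Hom C r r"
    then have "X \<in> homs r r" using r by (simp add: homs_Hom)
    then obtain c where "X = c *> idt r" using a by blast
    then show "X \<in> range (\<lambda>c. arr_scl C c (idn C r))" using idt_eq[OF r] by auto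
  next
    fix X assume "X \<in> range (\<lambda>c. arr_scl C c (idn C r))"
    then obtain c where "X = c *> idt r" using idt_eq[OF r] by auto
    then show "X \<in> Hom C r r" using r by simp
  qed
  have 2: "idn C r \<noteq> arr_zero r r" using a idt_eq[OF r] vect_zero[of "idt r"] by auto
  show "irr r" unfolding irreducible_obj_def using 1 2 r by blast
qed (use irr_ne irr_ex in auto)

lemma scl_cancel: "arr f \<Longrightarrow> vect f \<noteq> 0 \<Longrightarrow> c *> f = d *> f \<longleftrightarrow> c = d"
  by (auto dest: arg_cong[of _ _ vect])
lemma scl_zero: "c *> f = arr_zero rho sigma \<Longrightarrow> vect f \<noteq> 0 \<Longrightarrow> c = 0"
  by (auto dest: arg_cong[of _ _ vect])

lemma pos': "arr f \<Longrightarrow> vect (f\<star> oo f) = 0 \<Longrightarrow> vect f = 0"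
  using pos[of f "src f" "tgt f"] vect_zero[of "f\<star> oo f"] vect_zero[of f] by auto

text \<open>
  Both scalars can be read off from \<open>f oo g oo f\<close>.
\<close>

lemma irr_arrow_scalar:
  assumes "irr r" "irr s" "f \<in> homs r s" "g \<in> homs s r" "g oo f = c *> idt r"
  shows "f oo g = c *> idt s"
proof (cases "vect f = 0")
  case True
  note [simp] = assms(3,4)[unfolded homs_iff]
  have f: "f = arr_zero r s" using True vect_zero[of f] by simp
  have "c *> idt r = arr_zero r r" using assms(5) by (simp add: f)
  then have "c = 0" using irr_ne[OF assms(1)] by (rule scl_zero)
  then show ?thesis by (simp add: f)
next
  case False
  note [simp] = assms(3,4)[unfolded homs_iff]
  obtain d where d: "f oo g = d *> idt s"
    using irr_ex[OF assms(2), of "f oo g"] by (auto simp: homs_iff)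
  have "c *> f = d *> f"
    using cp_assoc[of f g f] assms(5) d by simp
  then have "c = d" using False scl_cancel[of f] by simp
  with d show ?thesis by simp
qed

end

context pre_BTC_star
begin

text \<open>
  The orthogonality of the two ranges is automatic: composing the completeness relation with \<open>V\<close> shows that
  \<open>W oo W\<star> oo V\<close> vanishes.
\<close>

lemma dsum:
  assumes [simp]: "ob sigma" "ob sigma'"
  obtains tau V W where "ob tau" "V \<in> homs sigma tau" "W \<in> homs sigma' tau" "V\<star> oo V = idt sigma" "W\<star> oo W = idt sigma'"
    "W\<star> oo V = arr_zero sigma sigma'" "V\<star> oo W = arr_zero sigma' sigma" "(V oo V\<star>) \<boxplus> (W oo W\<star>) = idt tau"
proof -
  obtain tau V W where 1: "ob tau" "isometry C sigma tau V" "isometry C sigma' tau W"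
    "arr_add (V \<cdot> star C V) (W \<cdot> star C W) = idn C tau" using dsum_ex[OF assms] by blast
  have h: "V \<in> homs sigma tau" "W \<in> homs sigma' tau" using 1 by (auto simp: isometry_def homs_Hom)
  note [simp] = h[unfolded homs_iff]
  have i: "V\<star> oo V = idt sigma" "W\<star> oo W = idt sigma'" "(V oo V\<star>) \<boxplus> (W oo W\<star>) = idt tau"
    using 1 by (auto simp: isometry_def cp_eq adj_eq idt_eq)
  have "V \<boxplus> (W oo W\<star> oo V) = V"
    using arg_cong[OF i(3), of "\<lambda>x. x oo V"] by (simp add: cp_add i(1))
  then have "vect (W oo W\<star> oo V) = 0" by (auto dest: arg_cong[of _ _ vect])
  then have *: "W oo W\<star> oo V = arr_zero sigma tau" using vect_zero[of "W oo W\<star> oo V"] by simp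
  have a: "W\<star> oo V = arr_zero sigma sigma'"
    using arg_cong[OF *, of "\<lambda>x. W\<star> oo x"] cp_subst[OF i(2), of "W\<star> oo V"] by simp
  moreover have "V\<star> oo W = arr_zero sigma' sigma" using arg_cong[OF a, of adj] by simp
  ultimately show ?thesis using that h i 1 by blast
qed

text \<open>
  The sum is \<open>Z\<star> oo Z\<close> for the arrow \<open>Z\<close> with components \<open>X\<close> and \<open>Y\<close> into a direct sum, so positivity of
  sums follows from that of single arrows.
\<close>

lemma adj_sum_zero:
  assumes h: "X \<in> homs rho sigma" "Y \<in> homs rho sigma'" and z: "vect (X\<star> oo X) + vect (Y\<star> oo Y) = 0"
  shows "vect X = 0"
proof -
  note [simp] = h[unfolded homs_iff]
  obtain tau V W where d: "ob tau" "V \<in> homs sigma tau" "W \<in> homs sigma' tau" "V\<star> oo V = idt sigma" "W\<star> oo W = idt sigma'"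
    "W\<star> oo V = arr_zero sigma sigma'" "V\<star> oo W = arr_zero sigma' sigma" "(V oo V\<star>) \<boxplus> (W oo W\<star>) = idt tau"
    using dsum[of sigma sigma'] by (metis \<open>X \<in> homs rho sigma\<close> \<open>Y \<in> homs rho sigma'\<close> homs_iff)
  note [simp] = d(2,3)[unfolded homs_iff]
  define Z where "Z = (V oo X) \<boxplus> (W oo Y)"
  have [simp]: "arr Z" "src Z = rho" "tgt Z = tau" by (auto simp: Z_def)
  have r: "V\<star> oo Z = X" "W\<star> oo Z = Y"
    using d by (simp_all add: Z_def cp_add cp_subst[OF d(4)] cp_subst[OF d(5)] cp_subst[OF d(6)] cp_subst[OF d(7)] add_simps
        add_simps(1)[of Y, simplified])
  have "Z\<star> oo Z = (X\<star> oo V\<star> \<boxplus> Y\<star> oo W\<star>) oo Z" by (simp add: Z_def adj_add)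
  also have "\<dots> = (X\<star> oo X) \<boxplus> (Y\<star> oo Y)" by (simp add: cp_add r)
  finally have "vect (Z\<star> oo Z) = 0" using z by simp
  then have "vect Z = 0" using pos'[of Z] by simp
  then have "Z = arr_zero rho tau" using vect_zero[of Z] by simp
  then show ?thesis using r(1) by (metis \<open>V \<in> homs sigma tau\<close> arr_adj d(1) homs_iff src_tgt(5) vect_simps(1) zero_simps(2) h(1))
qed

text \<open>
  The scalar is real because \<open>V\<star> oo V\<close> is self-adjoint. If it were negative, adding a multiple of the identity of
  the form \<open>Y\<star> oo Y\<close> would give zero, against \<open>adj_sum_zero\<close>.
\<close>

lemma irr_pos:
  assumes r: "irr r" and h: "V \<in> homs r rho"
  obtains c where "V\<star> oo V = complex_of_real c *> idt r" "c \<ge> 0" "vect V \<noteq> 0 \<Longrightarrow> c > 0"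
proof -
  note [simp] = h[unfolded homs_iff]
  obtain c where c: "V\<star> oo V = c *> idt r" using irr_ex[OF r, of "V\<star> oo V"] by (auto simp: homs_iff)
  have "(V\<star> oo V)\<star> = V\<star> oo V" by simp
  then have "cnj c *> idt r = c *> idt r" using r by (simp add: c)
  then have "cnj c = c" using scl_cancel[of "idt r"] irr_ne[OF r] by simp
  then have re: "c = complex_of_real (Re c)" by (simp add: complex_eq_iff)
  have nz: "Re c \<noteq> 0" if "vect V \<noteq> 0" using pos'[of V] that c re by auto
  moreover have "Re c \<ge> 0"
  proof (rule ccontr)
    assume "\<not> Re c \<ge> 0"
    then have n: "Re c < 0" by simp
    define Y where "Y = complex_of_real (sqrt (- Re c)) *> idt r"
    have "complex_of_real (sqrt (- Re c)) * complex_of_real (sqrt (- Re c)) = - c"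
      using n re by (metis less_eq_real_def neg_0_le_iff_le of_real_minus of_real_mult real_sqrt_mult_self abs_of_nonneg)
    then have "Y\<star> oo Y = - c *> idt r" by (simp add: Y_def)
    then have "vect (V\<star> oo V) + vect (Y\<star> oo Y) = 0" using c by simp
    then have "vect V = 0" using adj_sum_zero[of V r rho Y r] h r by (simp add: Y_def homs_iff)
    then have "V = arr_zero r rho" using vect_zero[of V] by simp
    then have "c *> idt r = arr_zero r r" using c by simp
    then show False using scl_zero irr_ne[OF r] n by fastforce
  qed
  ultimately show ?thesis using that[of "Re c"] c re by force
qed

text \<open>
  Schur: by positivity a nonzero arrow between irreducible objects can be scaled to a unitary.
\<close>

lemma irr_unitary:
  assumes r: "irr r" "irr s" and h: "f \<in> homs r s" "vect f \<noteq> 0"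
  obtains u where "u \<in> homs r s" "u\<star> oo u = idt r" "u oo u\<star> = idt s"
proof -
  note [simp] = h(1)[unfolded homs_iff]
  obtain c where c: "f\<star> oo f = complex_of_real c *> idt r" "c > 0" using irr_pos[OF r(1) h(1)] h(2) by metis
  have c': "f oo f\<star> = complex_of_real c *> idt s"
    using irr_arrow_scalar[OF r h(1) _ c(1)] by (simp add: homs_iff)
  define u where "u = complex_of_real (1 / sqrt c) *> f"
  have s: "complex_of_real (1 / sqrt c) * (complex_of_real (1 / sqrt c) * complex_of_real c) = 1"
    using c(2) by (simp flip: of_real_mult of_real_divide)
  have "u\<star> oo u = idt r" "u oo u\<star> = idt s" using s c(1) c' by (simp_all add: u_def mult.assoc)
  then show ?thesis using that[of u] by (simp add: u_def homs_iff)
qed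

lemma isom_iff: "isom C rho sigma \<longleftrightarrow> (\<exists>f\<in>homs rho sigma. \<exists>g\<in>homs sigma rho. g oo f = idt rho \<and> f oo g = idt sigma)"
proof
  assume "isom C rho sigma"
  then obtain f g where o: "ob rho" "ob sigma" "f \<in> Hom C rho sigma" "g \<in> Hom C sigma rho" "g \<cdot> f = idn C rho" "f \<cdot> g = idn C sigma"
    by (auto simp: isom_def)
  then have "f \<in> homs rho sigma" "g \<in> homs sigma rho" by (auto simp: homs_Hom)
  then show "\<exists>f\<in>homs rho sigma. \<exists>g\<in>homs sigma rho. g oo f = idt rho \<and> f oo g = idt sigma"
    using o by (intro bexI[of _ f] bexI[of _ g]) (auto simp: cp_eq idt_eq homs_iff)
next
  assume "\<exists>f\<in>homs rho sigma. \<exists>g\<in>homs sigma rho. g oo f = idt rho \<and> f oo g = idt sigma"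
  then obtain f g where o: "f \<in> homs rho sigma" "g \<in> homs sigma rho" "g oo f = idt rho" "f oo g = idt sigma" by auto
  note [simp] = o(1,2)[unfolded homs_iff]
  show "isom C rho sigma" unfolding isom_def
    by (intro conjI bexI[of _ f] bexI[of _ g]) (use o in \<open>auto simp: cp_eq idt_eq\<close>)
qed

lemma isom_sym: "isom C rho sigma \<Longrightarrow> isom C sigma rho" by (auto simp: isom_def)
lemma isom_refl: "ob rho \<Longrightarrow> isom C rho rho" by (auto simp: isom_iff intro!: bexI[of _ "idt rho"])
lemma isom_trans: assumes "isom C rho sigma" "isom C sigma tau" shows "isom C rho tau"
proof -
  obtain f g where o: "f \<in> homs rho sigma" "g \<in> homs sigma rho" "g oo f = idt rho" "f oo g = idt sigma" using assms(1) by (auto simp: isom_iff)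
  obtain f' g' where o': "f' \<in> homs sigma tau" "g' \<in> homs tau sigma" "g' oo f' = idt sigma" "f' oo g' = idt tau" using assms(2) by (auto simp: isom_iff)
  note [simp] = o(1,2)[unfolded homs_iff] o'(1,2)[unfolded homs_iff]
  show ?thesis unfolding isom_iff
    by (intro bexI[of _ "f' oo f"] bexI[of _ "g oo g'"])
       (use o o' in \<open>auto simp: homs_iff cp_subst[OF o(4)] cp_subst[OF o'(3)]\<close>)
qed

lemma isom_of_arrow: "irr r \<Longrightarrow> irr s \<Longrightarrow> f \<in> homs r s \<Longrightarrow> vect f \<noteq> 0 \<Longrightarrow> isom C r s"
  by (erule (3) irr_unitary) (auto simp: isom_iff intro!: bexI homs_intros)

lemma isom_arrow: assumes "isom C r s" "irr r" obtains f where "f \<in> homs r s" "vect f \<noteq> 0"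
proof -
  obtain f g where o: "f \<in> homs r s" "g \<in> homs s r" "g oo f = idt r" using assms(1) by (auto simp: isom_iff)
  note [simp] = o(1,2)[unfolded homs_iff]
  have "vect f \<noteq> 0" using o(3) vect_zero[of f] irr_ne'[OF assms(2)] by auto
  then show ?thesis using that o by blast
qed

lemma isom_unitary: assumes "isom C r s" "irr r" "irr s"
  obtains u where "u \<in> homs r s" "u\<star> oo u = idt r" "u oo u\<star> = idt s"
  using assms by (metis isom_arrow irr_unitary)

lemma non_isom_zero: "irr r \<Longrightarrow> irr s \<Longrightarrow> \<not> isom C r s \<Longrightarrow> f \<in> homs r s \<Longrightarrow> f = arr_zero r s"
  using isom_of_arrow[of r s f] vect_zero[of f] by (auto simp: homs_iff)

lemma unt_scalar: "X \<in> homs (unt C) (unt C) \<Longrightarrow> \<exists>c. X = c *> idt (unt C)"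
  using irr_ex unt_irr by blast

text \<open>
  Transposition identifies the endomorphisms of \<open>rb\<close> with those of \<open>r\<close>.
\<close>

lemma irr_conj:
  assumes r: "irr r" and c: "csol r rb R Rb" shows "irr rb"
proof -
  note [simp] = csol_t[OF c]
  have "\<exists>z. X = z *> idt rb" if X: "X \<in> homs rb rb" for X
  proof -
    note [simp] = X[unfolded homs_iff]
    obtain z where z: "tps r Rb X R r = z *> idt r"
      using irr_ex[OF r] tps(1)[OF csol_sym[OF c] csol_sym[OF c] X] by auto
    have "(X**idt r) oo R = z *> R"
      using tps(3)[OF csol_sym[OF c] csol_sym[OF c] X] z by simp
    then have "X = z *> idt rb"
      using csol_inj(2)[OF csol_sym[OF c], of X "z *> idt rb"] by simp
    then show ?thesis by blast
  qed
  moreover have "vect (idt rb) \<noteq> 0"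
  proof
    assume "vect (idt rb) = 0"
    then have e: "idt rb = arr_zero rb rb" using vect_zero[of "idt rb"] by simp
    have "Rb = arr_zero (unt C) (r\<odot>rb)"
      using arg_cong[OF e, of "\<lambda>x. (idt r**x) oo Rb"] by simp
    then show False using csol_zz(1)[OF c] irr_ne'[OF r] by simp
  qed
  ultimately show ?thesis by (simp add: irr_iff)
qed

subsection \<open>Normalized solutions of the conjugate equations\<close>

definition nsol :: "'o \<Rightarrow> 'o \<Rightarrow> ('o, 'a) arrow \<Rightarrow> ('o, 'a) arrow \<Rightarrow> real \<Rightarrow> bool" where
  "nsol r rb R Rb d \<longleftrightarrow> irr r \<and> csol r rb R Rb \<and> R\<star> oo R = complex_of_real d *> idt (unt C) \<and>
     Rb\<star> oo Rb = complex_of_real d *> idt (unt C)"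

lemma csol_nz: assumes r: "irr r" and c: "csol r rb R Rb" shows "vect R \<noteq> 0" "vect Rb \<noteq> 0"
proof -
  note [simp] = csol_t[OF c]
  show "vect R \<noteq> 0" using csol_zz(1)[OF c] vect_zero[of R] irr_ne'[OF r] by auto
  show "vect Rb \<noteq> 0" using csol_zz(3)[OF c] vect_zero[of Rb] irr_ne'[OF r] by auto
qed

lemma nsol_pos: assumes "nsol r rb R Rb d" shows "d > 0"
proof -
  have c: "csol r rb R Rb" and r: "irr r" using assms by (auto simp: nsol_def)
  note [simp] = csol_t[OF c]
  obtain c where "R\<star> oo R = complex_of_real c *> idt (unt C)" "c > 0"
    using irr_pos[OF unt_irr, of R "rb\<odot>r"] csol_nz[OF r c] by (auto simp: homs_iff)
  then show ?thesis using assms scl_cancel[of "idt (unt C)"] irr_ne[OF unt_irr] by (auto simp: nsol_def)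
qed

lemma nsol_sym: "nsol r rb R Rb d \<Longrightarrow> nsol rb r Rb R d"
  by (auto simp: nsol_def intro: csol_sym irr_conj)

lemma nsol_iff: "irr r \<Longrightarrow> normalized_solution C r rb R Rb \<longleftrightarrow> (\<exists>d. nsol r rb R Rb d)"
proof
  assume r: "irr r" and "normalized_solution C r rb R Rb"
  then obtain d where c: "csol r rb R Rb" and d: "star C R \<cdot> R = d *> idn C (unt C)" "star C Rb \<cdot> Rb = d *> idn C (unt C)"
    by (auto simp: normalized_solution_def csol_iff)
  note [simp] = csol_t[OF c]
  have d: "R\<star> oo R = d *> idt (unt C)" "Rb\<star> oo Rb = d *> idt (unt C)" using d by (simp_all add: adj_eq cp_eq idt_eq)
  obtain e where "R\<star> oo R = complex_of_real e *> idt (unt C)"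
    using irr_pos[OF unt_irr, of R "rb\<odot>r"] csol_nz[OF r c] by (auto simp: homs_iff)
  then have "d = complex_of_real e" using d scl_cancel[of "idt (unt C)"] irr_ne[OF unt_irr] by auto
  then show "\<exists>d. nsol r rb R Rb d" using r c d by (auto simp: nsol_def)
next
  assume "\<exists>d. nsol r rb R Rb d"
  then obtain d where c: "csol r rb R Rb" and d: "R\<star> oo R = complex_of_real d *> idt (unt C)"
     "Rb\<star> oo Rb = complex_of_real d *> idt (unt C)" by (auto simp: nsol_def)
  note [simp] = csol_t[OF c]
  show "normalized_solution C r rb R Rb" unfolding normalized_solution_def csol_iff
    using c d by (auto intro!: exI[of _ "complex_of_real d"] simp: adj_eq cp_eq idt_eq)
qed

text \<open>
  Multiplying \<open>R\<close> by \<open>x\<close> and \<open>Rb\<close> by \<open>1/x\<close> preserves the conjugate equations; a fourth root makes the two norms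
  equal.
\<close>

lemma csol_normalize:
  assumes r: "irr r" and c: "csol r rb R Rb"
  obtains Q Qb d where "nsol r rb Q Qb d"
proof -
  note [simp] = csol_t[OF c]
  obtain a where a: "R\<star> oo R = complex_of_real a *> idt (unt C)" "a > 0"
    using irr_pos[OF unt_irr, of R "rb\<odot>r"] csol_nz[OF r c] by (auto simp: homs_iff)
  obtain b where b: "Rb\<star> oo Rb = complex_of_real b *> idt (unt C)" "b > 0"
    using irr_pos[OF unt_irr, of Rb "r\<odot>rb"] csol_nz[OF r c] by (auto simp: homs_iff)
  define x where "x = sqrt (sqrt (b / a))"
  have x: "x > 0" "x * x = sqrt (b / a)" using a b by (auto simp: x_def)
  have x2: "x * x * a = sqrt (a * b)" unfolding x(2) using a b
    by (simp add: real_sqrt_divide real_sqrt_mult field_simps)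
  have x3: "(1/x) * (1/x) * b = sqrt (a * b)"
  proof -
    have "sqrt (a * b) * (x * x) = b" unfolding x(2) using a b by (simp flip: real_sqrt_mult)
    then show ?thesis using x(1) by (simp add: field_simps)
  qed
  have "nsol r rb (complex_of_real x *> R) (complex_of_real (1 / x) *> Rb) (sqrt (a * b))"
    unfolding nsol_def
    using r c x(1) x2 x3 a b csol_zz[OF c]
    by (simp add: csol_def homs_iff mult.assoc flip: of_real_mult of_real_divide)
  then show ?thesis using that by blast
qed

lemma nsol_ex: "irr r \<Longrightarrow> \<exists>rb R Rb d. nsol r rb R Rb d"
  using conj_ex[of r] csol_normalize[of r] by (metis csol_iff irr_ob)

text \<open>
  Two normalized solutions differ by a unitary between the conjugates, namely the transpose of \<open>u\<star>\<close>: it is a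
  multiple of a unitary, and comparing the norms of \<open>Q\<close> and \<open>Qb\<close> with those of \<open>R\<close> and \<open>Rb\<close> shows that the
  factor is \<open>1\<close>.
\<close>

lemma nsol_unique:
  assumes n: "nsol r rb R Rb d" and n': "nsol s sb Q Qb e" and u: "u \<in> homs r s" "u\<star> oo u = idt r" "u oo u\<star> = idt s"
  obtains v where "v \<in> homs rb sb" "v\<star> oo v = idt rb" "v oo v\<star> = idt sb" "Q = (v**u) oo R" "Qb = (u**v) oo Rb" "d = e"
proof -
  have c: "csol r rb R Rb" and r: "irr r" and c': "csol s sb Q Qb" and s: "irr s" using n n' by (auto simp: nsol_def)
  note [simp] = csol_t[OF c] csol_t[OF c'] u(1)[unfolded homs_iff]
  have ud: "u\<star> \<in> homs s r" by (simp add: homs_iff)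
  define v where "v = tps rb R (u\<star>) Qb sb"
  have v: "v \<in> homs rb sb" "Q\<star> oo (v**idt s) = R\<star> oo (idt rb**u\<star>)" "(idt r**v) oo Rb = (u\<star>**idt sb) oo Qb"
    using tps[OF c' c ud] by (auto simp: v_def)
  note [simp] = v(1)[unfolded homs_iff]
  obtain z where z: "v\<star> oo v = complex_of_real z *> idt rb" "z \<ge> 0"
    using irr_pos[OF irr_conj[OF r c] v(1)] by blast
  have z': "v oo v\<star> = complex_of_real z *> idt sb"
    using irr_arrow_scalar[OF irr_conj[OF r c] irr_conj[OF s c'] v(1) _ z(1)] by (simp add: homs_iff)
  have Qb: "(u**v) oo Rb = Qb"
  proof -
    have "(u**v) oo Rb = (u**idt sb) oo (idt r**v) oo Rb"
      using slide(1)[of u v] cp_assoc[of "u**idt sb" "idt r**v" Rb] by simp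
    also have "\<dots> = ((u**idt sb) oo (u\<star>**idt sb)) oo Qb" by (simp add: v)
    also have "(u**idt sb) oo (u\<star>**idt sb) = idt (s\<odot>sb)" by (simp add: ichg u)
    finally show ?thesis by simp
  qed
  have q: "(v\<star>**u\<star>) oo Q = R"
  proof -
    have w: "(v\<star>**idt s) oo Q = (idt rb**u) oo R" using arg_cong[OF v(2), of adj] by simp
    have "(v\<star>**u\<star>) oo Q = (idt rb**u\<star>) oo (v\<star>**idt s) oo Q"
      using slide(2)[of "v\<star>" "u\<star>"] cp_assoc[of "idt rb**u\<star>" "v\<star>**idt s" Q] by simp
    also have "\<dots> = ((idt rb**u\<star>) oo (idt rb**u)) oo R" by (simp add: w)
    also have "(idt rb**u\<star>) oo (idt rb**u) = idt (rb\<odot>r)" by (simp add: ichg u)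
    finally show ?thesis by simp
  qed
  have nz: "vect (idt (unt C)) \<noteq> 0" using irr_ne unt_irr by blast
  have "Qb\<star> oo Qb = Rb\<star> oo ((u\<star>**v\<star>) oo (u**v)) oo Rb" by (simp add: Qb[symmetric])
  also have "(u\<star>**v\<star>) oo (u**v) = complex_of_real z *> idt (r\<odot>rb)" by (simp add: ichg u z)
  finally have "complex_of_real e *> idt (unt C) = complex_of_real (z * d) *> idt (unt C)"
    using n n' by (simp add: nsol_def)
  then have e: "e = z * d" using scl_cancel[OF _ nz] by (simp flip: of_real_mult)
  have "R\<star> oo R = Q\<star> oo ((v**u) oo (v\<star>**u\<star>)) oo Q" by (simp add: q[symmetric])
  also have "(v**u) oo (v\<star>**u\<star>) = complex_of_real z *> idt (sb\<odot>s)" by (simp add: ichg u z')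
  finally have "complex_of_real d *> idt (unt C) = complex_of_real (z * e) *> idt (unt C)"
    using n n' by (simp add: nsol_def)
  then have d: "d = z * e" using scl_cancel[OF _ nz] by (simp flip: of_real_mult)
  have "z * z = 1" using d e nsol_pos[OF n] by (metis mult.assoc mult_cancel_right1 less_irrefl)
  then have z1: "z = 1" using z(2) by (metis abs_of_nonneg abs_mult_self_eq power2_eq_square real_sqrt_abs real_sqrt_one)
  have v1: "v\<star> oo v = idt rb" "v oo v\<star> = idt sb" using z z' z1 by auto
  have "(v**u) oo R = ((v**u) oo (v\<star>**u\<star>)) oo Q" by (simp add: q[symmetric])
  also have "(v**u) oo (v\<star>**u\<star>) = idt (sb\<odot>s)" by (simp add: ichg u v1)
  finally have "Q = (v**u) oo R" by simp
  then show ?thesis using that v(1) v1 Qb e z1 by simp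
qed

subsection \<open>The braiding\<close>

definition br :: "'o \<Rightarrow> 'o \<Rightarrow> ('o, 'a) arrow" where
  "br rho sigma = Arrow (rho\<odot>sigma) (sigma\<odot>rho) (vect (brd C rho sigma))"

lemma br_src_tgt [simp]: "src (br rho sigma) = rho\<odot>sigma" "tgt (br rho sigma) = sigma\<odot>rho" by (auto simp: br_def)
lemma br_eq: "ob rho \<Longrightarrow> ob sigma \<Longrightarrow> brd C rho sigma = br rho sigma"
  using br_Hom[of rho sigma] by (intro arrow.expand) (auto simp: Hom_iff br_def)
lemma arr_br [simp]: "ob rho \<Longrightarrow> ob sigma \<Longrightarrow> arr (br rho sigma)"
  using br_Hom[of rho sigma] by (simp add: br_eq arr_Hom)
lemma br_adj [simp]: "ob rho \<Longrightarrow> ob sigma \<Longrightarrow> (br rho sigma)\<star> oo br rho sigma = idt (rho\<odot>sigma)"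
  "ob rho \<Longrightarrow> ob sigma \<Longrightarrow> br rho sigma oo (br rho sigma)\<star> = idt (sigma\<odot>rho)"
  using br_unitary[of rho sigma] by (simp_all add: br_eq cp_eq adj_eq idt_eq)
lemma br_nat: "\<lbrakk>arr f; arr g; tgt f = a; tgt g = b\<rbrakk> \<Longrightarrow> br a b oo (f**g) = (g**f) oo br (src f) (src g)"
  using br_natural[of "src f" "src g" "tgt f" "tgt g" f g] by (auto simp: br_eq cp_eq tp_eq)
lemma br_right: "\<lbrakk>ob rho; ob sigma; ob tau\<rbrakk> \<Longrightarrow> br rho (sigma\<odot>tau) = (idt sigma**br rho tau) oo (br rho sigma**idt tau)"
  using br_tob_right[of rho sigma tau] by (simp add: br_eq cp_eq tp_eq idt_eq)
lemma br_left: "\<lbrakk>ob rho; ob sigma; ob tau\<rbrakk> \<Longrightarrow> br (rho\<odot>sigma) tau = (br rho tau**idt sigma) oo (idt rho**br sigma tau)"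
  using br_tob_left[of rho sigma tau] by (simp add: br_eq cp_eq tp_eq idt_eq)

lemma br_unt [simp]: assumes [simp]: "ob rho" shows "br (unt C) rho = idt rho" "br rho (unt C) = idt rho"
proof -
  have "br (unt C) rho = br (unt C) rho oo br (unt C) rho" using br_left[of "unt C" "unt C" rho] by simp
  then have "(br (unt C) rho)\<star> oo br (unt C) rho = (br (unt C) rho)\<star> oo br (unt C) rho oo br (unt C) rho" by simp
  then show "br (unt C) rho = idt rho" using cp_subst[OF br_adj(1)[of "unt C" rho], of "br (unt C) rho"] by simp
  have "br rho (unt C) = br rho (unt C) oo br rho (unt C)" using br_right[of rho "unt C" "unt C"] by simp
  then have "(br rho (unt C))\<star> oo br rho (unt C) = (br rho (unt C))\<star> oo br rho (unt C) oo br rho (unt C)" by simp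
  then show "br rho (unt C) = idt rho" using cp_subst[OF br_adj(1)[of rho "unt C"], of "br rho (unt C)"] by simp
qed

text \<open>
  A strand of \<open>rho\<close> can be pulled through the arc \<open>R\<star>\<close>, by naturality of the braiding. This expresses the
  braiding with a conjugate by the inverse of the braiding with \<open>tau\<close>.
\<close>

lemma br_conj:
  assumes c: "csol tau taub R Rb" and [simp]: "ob rho"
  shows "(idt rho**R\<star>) oo (br taub rho**idt tau) = (R\<star>**idt rho) oo (idt taub**(br tau rho)\<star>)"
    "(idt rho**R\<star>) oo ((br rho taub)\<star>**idt tau) = (R\<star>**idt rho) oo (idt taub**br rho tau)"
proof -
  note [simp] = csol_t[OF c]
  have "(idt rho**R\<star>) oo br (taub\<odot>tau) rho = R\<star>**idt rho"
    using br_nat[of "R\<star>" "idt rho" "unt C" rho] by simp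
  then have 1: "(idt rho**R\<star>) oo (br taub rho**idt tau) oo (idt taub**br tau rho) = R\<star>**idt rho"
    by (simp add: br_left)
  have "(idt taub**br tau rho) oo (idt taub**(br tau rho)\<star>) = idt (taub\<odot>(rho\<odot>tau))" by (simp add: ichg)
  then show "(idt rho**R\<star>) oo (br taub rho**idt tau) = (R\<star>**idt rho) oo (idt taub**(br tau rho)\<star>)"
    using arg_cong[OF 1, of "\<lambda>x. x oo (idt taub**(br tau rho)\<star>)"] by simp
  have "(R\<star>**idt rho) oo br rho (taub\<odot>tau) = idt rho**R\<star>"
    using br_nat[of "idt rho" "R\<star>" rho "unt C"] by simp
  then have 1: "(R\<star>**idt rho) oo (idt taub**br rho tau) oo (br rho taub**idt tau) = idt rho**R\<star>"
    by (simp add: br_right)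
  have "(br rho taub**idt tau) oo ((br rho taub)\<star>**idt tau) = idt (taub\<odot>(rho\<odot>tau))" by (simp add: ichg)
  then show "(idt rho**R\<star>) oo ((br rho taub)\<star>**idt tau) = (R\<star>**idt rho) oo (idt taub**br rho tau)"
    using arg_cong[OF 1, of "\<lambda>x. x oo ((br rho taub)\<star>**idt tau)"] by simp
qed

subsection \<open>Degenerate objects\<close>

abbreviation "D \<equiv> degenerates C"

lemma D_iff: "rho \<in> D \<longleftrightarrow> ob rho \<and> (\<forall>eta. ob eta \<longrightarrow> br eta rho oo br rho eta = idt (rho\<odot>eta))"
  by (auto simp: degenerates_def degenerate_obj_def monodromy_def br_eq cp_eq idt_eq)

lemma D_ob [simp]: "rho \<in> D \<Longrightarrow> ob rho" by (simp add: D_iff)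

lemma D_br: assumes "rho \<in> D" "ob eta"
  shows "br eta rho oo br rho eta = idt (rho\<odot>eta)" "br eta rho = (br rho eta)\<star>" "br rho eta oo br eta rho = idt (eta\<odot>rho)"
proof -
  note [simp] = assms D_ob[OF assms(1)]
  show 1: "br eta rho oo br rho eta = idt (rho\<odot>eta)" using assms D_iff by blast
  show 2: "br eta rho = (br rho eta)\<star>" using cp_subst[OF 1, of "(br rho eta)\<star>"] by simp
  show "br rho eta oo br eta rho = idt (eta\<odot>rho)" by (simp add: 2)
qed

lemma D_I: assumes [simp]: "ob rho" and "\<And>eta. ob eta \<Longrightarrow> br eta rho = (br rho eta)\<star>" shows "rho \<in> D"
  unfolding D_iff using assms by auto

lemma D_unt [simp]: "unt C \<in> D" by (rule D_I) auto

lemma D_tob [simp]: assumes "rho \<in> D" "sigma \<in> D" shows "rho\<odot>sigma \<in> D"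
proof (rule D_I)
  note [simp] = D_ob[OF assms(1)] D_ob[OF assms(2)]
  show "ob (rho\<odot>sigma)" by simp
  fix eta assume [simp]: "ob eta"
  have 1: "br (rho\<odot>sigma) eta = (br rho eta**idt sigma) oo (idt rho**br sigma eta)"
    by (rule br_left) simp_all
  have 2: "br eta (rho\<odot>sigma) = (idt rho**br eta sigma) oo (br eta rho**idt sigma)"
    by (rule br_right) simp_all
  have 3: "br eta rho = (br rho eta)\<star>" "br eta sigma = (br sigma eta)\<star>"
    using D_br(2)[OF assms(1)] D_br(2)[OF assms(2)] by simp_all
  show "br eta (rho\<odot>sigma) = (br (rho\<odot>sigma) eta)\<star>"
    unfolding 1 2 3 by simp
qed

lemma D_conj: assumes "rho \<in> D" and c: "csol rho rhob R Rb" shows "rhob \<in> D"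
proof (rule D_I)
  note [simp] = csol_t[OF c]
  show "ob rhob" by simp
  fix eta assume [simp]: "ob eta"
  have z: "f = ((idt eta**R\<star>**idt rhob) oo (f**idt (rho\<odot>rhob))) oo (idt (rhob\<odot>eta)**Rb)"
    if [simp]: "arr f" "src f = rhob\<odot>eta" "tgt f = eta\<odot>rhob" for f
  proof -
    have e: "(f**idt (rho\<odot>rhob)) oo (idt (rhob\<odot>eta)**Rb) = (idt (eta\<odot>rhob)**Rb) oo f"
      using exch[of f Rb _ _ _ _ "unt C" "unt C" "unt C", OF _ _ refl refl refl refl] by simp
    have e2: "(idt eta**R\<star>**idt rhob) oo (idt (eta\<odot>rhob)**Rb) = idt (eta\<odot>rhob)"
      using csol_zz_w(1)[OF csol_sym[OF c], of eta "unt C"] by simp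
    show ?thesis by (simp add: e cp_subst[OF e2])
  qed
  have eq: "(idt eta**R\<star>) oo (br rhob eta**idt rho) = (idt eta**R\<star>) oo ((br eta rhob)\<star>**idt rho)"
    using br_conj[OF c, of eta] D_br(2)[OF assms(1), of eta] by simp
  have eq': "(idt eta**R\<star>**idt rhob) oo (br rhob eta**idt (rho\<odot>rhob))
      = (idt eta**R\<star>**idt rhob) oo ((br eta rhob)\<star>**idt (rho\<odot>rhob))"
    using arg_cong[OF eq, of "\<lambda>x. x**idt rhob"] by (simp add: tp_cp)
  have "br rhob eta = ((idt eta**R\<star>**idt rhob) oo (br rhob eta**idt (rho\<odot>rhob))) oo (idt (rhob\<odot>eta)**Rb)" by (rule z) simp_all
  also have "\<dots> = ((idt eta**R\<star>**idt rhob) oo ((br eta rhob)\<star>**idt (rho\<odot>rhob))) oo (idt (rhob\<odot>eta)**Rb)" by (simp only: eq')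
  also have "\<dots> = (br eta rhob)\<star>" by (rule z[symmetric]) simp_all
  finally have "br rhob eta = (br eta rhob)\<star>" .
  then show "br eta rhob = (br rhob eta)\<star>" by simp
qed

text \<open>
  The monodromy is natural. This gives the closure of the degenerate objects under subobjects and direct sums.
\<close>

lemma mon_nat: assumes [simp]: "arr f" "src f = sigma" "tgt f = rho" "ob eta"
  shows "(br eta rho oo br rho eta) oo (f**idt eta) = (f**idt eta) oo br eta sigma oo br sigma eta"
proof -
  have [simp]: "ob sigma" "ob rho" using arr_ob[of f] by auto
  have 1: "br rho eta oo (f**idt eta) = (idt eta**f) oo br sigma eta" using br_nat[of f "idt eta" rho eta] by simp
  have 2: "br eta rho oo (idt eta**f) = (f**idt eta) oo br eta sigma" using br_nat[of "idt eta" f eta rho] by simp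
  show ?thesis by (simp add: 1 cp_subst[OF 2])
qed

lemma D_sub: assumes "rho \<in> D" and V: "V \<in> homs sigma rho" "V\<star> oo V = idt sigma" shows "sigma \<in> D"
proof -
  note [simp] = D_ob[OF assms(1)] V(1)[unfolded homs_iff]
  have "br eta sigma oo br sigma eta = idt (sigma\<odot>eta)" if [simp]: "ob eta" for eta
  proof -
    have "(V**idt eta) oo br eta sigma oo br sigma eta = V**idt eta"
      using mon_nat[of V sigma rho eta] D_br(1)[OF assms(1), of eta] by simp
    then have "(V\<star>**idt eta) oo (V**idt eta) oo br eta sigma oo br sigma eta = (V\<star>**idt eta) oo (V**idt eta)" by simp
    moreover have e: "(V\<star>**idt eta) oo (V**idt eta) = idt (sigma\<odot>eta)" by (simp add: ichg V)
    ultimately show ?thesis by (simp add: cp_subst[OF e])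
  qed
  then show ?thesis unfolding D_iff by auto
qed

lemma D_dsum: assumes "sigma \<in> D" "sigma' \<in> D" "V \<in> homs sigma tau" "W \<in> homs sigma' tau" "(V oo V\<star>) \<boxplus> (W oo W\<star>) = idt tau"
  shows "tau \<in> D"
proof -
  note [simp] = D_ob[OF assms(1)] assms(3,4)[unfolded homs_iff]
  have "br eta tau oo br tau eta = idt (tau\<odot>eta)" if [simp]: "ob eta" for eta
  proof -
    have V: "(br eta tau oo br tau eta) oo (V**idt eta) = V**idt eta"
      using mon_nat[of V sigma tau eta] D_br(1)[OF assms(1), of eta] by simp
    have W: "(br eta tau oo br tau eta) oo (W**idt eta) = W**idt eta"
      using mon_nat[of W sigma' tau eta] D_br(1)[OF assms(2), of eta] by simp
    have d: "idt (tau\<odot>eta) = ((V**idt eta) oo (V\<star>**idt eta)) \<boxplus> ((W**idt eta) oo (W\<star>**idt eta))"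
      using arg_cong[OF assms(5), of "\<lambda>x. x**idt eta"] by (simp add: tp_add tp_cp)
    have "br eta tau oo br tau eta = (br eta tau oo br tau eta) oo idt (tau\<odot>eta)" by simp
    also have "\<dots> = (((br eta tau oo br tau eta) oo (V**idt eta)) oo (V\<star>**idt eta)) \<boxplus>
        (((br eta tau oo br tau eta) oo (W**idt eta)) oo (W\<star>**idt eta))"
      unfolding d by (simp add: cp_add)
    also have "\<dots> = idt (tau\<odot>eta)" unfolding V W d by simp
    finally show ?thesis .
  qed
  then show ?thesis unfolding D_iff by auto
qed

end


section \<open>Decomposition into irreducible objects\<close>

lemma (in vector_space) dim_less_subspace:
  assumes "subspace S" "S \<subset> T" "finite B" "T \<subseteq> span B"
  shows "dim S < dim T"
proof -
  obtain A where A: "A \<subseteq> S" "independent A" "S \<subseteq> span A" "card A = dim S" using basis_exists by blast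
  obtain A' where A': "A' \<subseteq> T" "independent A'" "T \<subseteq> span A'" "card A' = dim T" using basis_exists by blast
  have fin: "finite A'" using independent_span_bound[OF assms(3) A'(2)] A'(1) assms(4) by blast
  obtain x where x: "x \<in> T" "x \<notin> S" using assms(2) by blast
  have sA: "span A \<subseteq> S" using A(1) assms(1) by (rule span_minimal)
  have "independent (insert x A)" using independent_insertI[of x A] A(2) x sA by blast
  moreover have "insert x A \<subseteq> span A'" using A(1) A'(3) x assms(2) by blast
  ultimately have "finite (insert x A) \<and> card (insert x A) \<le> card A'"
    by (rule independent_span_bound[OF fin])
  moreover have "x \<notin> A" using x A(1) by blast
  ultimately show ?thesis using A(4) A'(4) by auto
qed

text \<open>The map \<open>f\<close> may be linear or antilinear, which is why \<open>phi\<close> is an arbitrary bijection of the scalars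
  that fixes zero.\<close>

lemma (in vector_space) dim_semilinear_bij:
  assumes S: "subspace S" "S \<subseteq> span B0" "finite B0" and T: "subspace T"
    and add: "\<And>x y. x \<in> S \<Longrightarrow> y \<in> S \<Longrightarrow> f (x + y) = f x + f y"
    and scl: "\<And>c x. x \<in> S \<Longrightarrow> f (scale c x) = scale (phi c) (f x)"
    and phi: "\<And>c. phi (psi c) = c" "phi 0 = 0"
    and bij: "inj_on f S" "f ` S = T"
  shows "dim T = dim S"
proof -
  obtain A where A: "A \<subseteq> S" "independent A" "S \<subseteq> span A" "card A = dim S" using basis_exists by blast
  have fin: "finite A" using independent_span_bound[OF S(3) A(2)] A(1) S(2) by blast
  have f0: "f 0 = 0" using add[of 0 0] subspace_0[OF S(1)] by simp
  have inS: "(\<Sum>a\<in>A'. scale (u a) a) \<in> S" if "A' \<subseteq> A" for u A'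
    using that A(1) by (intro subspace_sum[OF S(1)] subspace_scale[OF S(1)]) auto
  have sum: "f (\<Sum>a\<in>A'. scale (u a) a) = (\<Sum>a\<in>A'. scale (phi (u a)) (f a))" if "A' \<subseteq> A" for u A'
  proof -
    have "finite A'" using that fin by (rule finite_subset)
    then show ?thesis using that
    proof (induction A')
      case (insert a A')
      have "f (scale (u a) a + (\<Sum>a\<in>A'. scale (u a) a)) = f (scale (u a) a) + f (\<Sum>a\<in>A'. scale (u a) a)"
        using insert.prems A(1) inS[of A'] by (intro add) (auto intro!: subspace_scale[OF S(1)])
      then show ?case using insert A(1) scl by auto
    qed (simp add: f0)
  qed
  have "independent (f ` A)"
    unfolding dependent_finite[OF finite_imageI[OF fin]]
  proof safe
    fix u a assume a: "a \<in> A" "u (f a) \<noteq> 0" and z: "(\<Sum>v\<in>f ` A. scale (u v) v) = 0"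
    have "(\<Sum>v\<in>f ` A. scale (u v) v) = (\<Sum>a\<in>A. scale (u (f a)) (f a))"
      using bij(1) A(1) by (intro sum.reindex_cong[of f]) (auto intro: inj_on_subset)
    then have "f (\<Sum>a\<in>A. scale (psi (u (f a))) a) = f 0" using z f0 by (simp add: sum phi)
    then have "(\<Sum>a\<in>A. scale (psi (u (f a))) a) = 0"
      using bij(1) inS[of A] subspace_0[OF S(1)] by (auto simp: inj_on_def)
    then have "psi (u (f a)) = 0" using A(2) a(1) unfolding dependent_finite[OF fin] by auto
    then show False using phi a(2) by metis
  qed
  moreover have "span (f ` A) = span T"
  proof
    show "span (f ` A) \<subseteq> span T" using A(1) bij(2) by (intro span_mono) auto
    have "T \<subseteq> span (f ` A)"
    proof
      fix t assume "t \<in> T"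
      then obtain s where s: "s \<in> S" "t = f s" using bij by auto
      then have "s \<in> span A" using A(3) by blast
      then obtain u where "s = (\<Sum>a\<in>A. scale (u a) a)" using span_finite[OF fin] by auto
      then have "t = (\<Sum>a\<in>A. scale (phi (u a)) (f a))" using s sum[of A u] by simp
      then show "t \<in> span (f ` A)" by (simp only:) (intro span_sum span_scale span_base imageI)
    qed
    then show "span T \<subseteq> span (f ` A)" by (simp add: span_minimal)
  qed
  ultimately have "dim T = card (f ` A)" by (intro dim_eq_card) auto
  also have "\<dots> = card A" using bij(1) A(1) by (intro card_image) (auto intro: inj_on_subset)
  finally show ?thesis using A(4) by simp
qed

context pre_BTC_star
begin

definition proj :: "'o \<Rightarrow> ('o, 'a) arrow \<Rightarrow> bool" where
  "proj rho E \<longleftrightarrow> E \<in> homs rho rho \<and> E oo E = E \<and> E\<star> = E"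

lemma proj_iff: assumes [simp]: "ob rho" shows "projection C rho E \<longleftrightarrow> proj rho E"
proof (cases "E \<in> homs rho rho")
  case True
  note [simp] = True[unfolded homs_iff]
  show ?thesis using True by (simp add: projection_def proj_def cp_eq adj_eq)
next
  case False
  then show ?thesis by (auto simp: projection_def proj_def homs_Hom)
qed

text \<open>
  The value of a polynomial at \<open>A\<close>, where the projection \<open>E\<close> takes the place of the identity.
\<close>

definition evp :: "'o \<Rightarrow> ('o, 'a) arrow \<Rightarrow> ('o, 'a) arrow \<Rightarrow> complex poly \<Rightarrow> ('o, 'a) arrow" where
  "evp rho E A p = fold_coeffs (\<lambda>a r. (a *> E) \<boxplus> (A oo r)) p (arr_zero rho rho)"

lemma evp_rules:
  assumes E: "E \<in> homs rho rho" and A: "A \<in> homs rho rho"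
  shows "evp rho E A 0 = arr_zero rho rho" "evp rho E A (pCons a p) = (a *> E) \<boxplus> (A oo evp rho E A p)"
    "evp rho E A p \<in> homs rho rho"
    "evp rho E A (p + q) = evp rho E A p \<boxplus> evp rho E A q"
    "evp rho E A (smult c p) = c *> evp rho E A p"
proof -
  note [simp] = E[unfolded homs_iff] A[unfolded homs_iff]
  show Z: "evp rho E A 0 = arr_zero rho rho" by (simp add: evp_def)
  have P: "evp rho E A (pCons a p) = (a *> E) \<boxplus> (A oo evp rho E A p)" for a p
    by (cases "p = 0 \<and> a = 0") (auto simp: evp_def add_simps)
  then show "evp rho E A (pCons a p) = (a *> E) \<boxplus> (A oo evp rho E A p)" .
  have H: "evp rho E A p \<in> homs rho rho" for p
    by (induction p) (auto simp: Z P homs_iff)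
  then show "evp rho E A p \<in> homs rho rho" .
  note [simp] = H[unfolded homs_iff]
  show "evp rho E A (p + q) = evp rho E A p \<boxplus> evp rho E A q"
  proof (induction p q rule: poly_induct2)
    case 0 show ?case by (simp add: Z add_simps)
  next
    case (pCons a p b q)
    show ?case by (auto simp: P pCons cp_add intro!: arrow.expand simp: V.scale_left_distrib)
  qed
  show "evp rho E A (smult c p) = c *> evp rho E A p"
    by (induction p) (auto simp: Z P add_simps)
qed

text \<open>
  Otherwise the polynomials of all degrees would embed into a finite dimensional space.
\<close>

lemma evp_annihilated:
  assumes E: "E \<in> homs rho rho" and A: "A \<in> homs rho rho"
  shows "\<exists>p. p \<noteq> 0 \<and> vect (evp rho E A p) = 0"
proof (rule ccontr)
  assume *: "\<not> ?thesis"
  let ?ev = "\<lambda>p. vect (evp rho E A p)"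
  note r = evp_rules[OF E A]
  have [simp]: "ob rho" using E by (simp add: homs_iff)
  obtain B where B: "finite B" "HomV C rho rho = V.span B" using fin_dim[of rho rho] by auto
  define m where "m i = monom (1::complex) i" for i
  have nz: "p = 0" if "?ev p = 0" for p using * that by blast
  have sub: "?ev (p - q) = ?ev p - ?ev q" for p q
    using r(4)[of "p - q" q] by simp
  have inj: "inj (\<lambda>i. ?ev (m i))"
  proof (rule injI)
    fix i j assume "?ev (m i) = ?ev (m j)"
    then have "m i - m j = 0" by (intro nz) (simp add: sub)
    then have "coeff (m i) i = coeff (m j) i" by simp
    then show "i = j" by (auto simp: m_def split: if_splits)
  qed
  define T where "T = (\<lambda>i. ?ev (m i)) ` {..card B}"
  have fin: "finite T" by (simp add: T_def)
  have sum: "?ev (\<Sum>i\<in>I. smult (c i) (m i)) = (\<Sum>i\<in>I. scl C (c i) (?ev (m i)))" for c I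
    by (induction I rule: infinite_finite_induct) (auto simp: r)
  have "V.independent T" unfolding V.dependent_finite[OF fin]
  proof safe
    fix u v assume v: "v \<in> T" "u v \<noteq> 0" and s: "(\<Sum>v\<in>T. scl C (u v) v) = 0"
    have "(\<Sum>v\<in>T. scl C (u v) v) = (\<Sum>i\<le>card B. scl C (u (?ev (m i))) (?ev (m i)))"
      unfolding T_def using inj by (intro sum.reindex_cong[of "\<lambda>i. ?ev (m i)"]) (auto intro: inj_on_subset)
    then have "(\<Sum>i\<le>card B. smult (u (?ev (m i))) (m i)) = 0" using s by (intro nz) (simp add: sum)
    moreover obtain i where i: "i \<le> card B" "v = ?ev (m i)" using v by (auto simp: T_def)
    moreover have "coeff (\<Sum>i\<le>card B. smult (u (?ev (m i))) (m i)) i = u (?ev (m i))"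
      using i by (simp add: coeff_sum m_def if_distrib[of "\<lambda>x. _ * x"] sum.delta cong: if_cong)
    ultimately show False using v by simp
  qed
  moreover have "T \<subseteq> V.span B" using r(3) B(2) by (auto simp: T_def homs_Hom Hom_iff)
  ultimately have "card T \<le> card B" using V.independent_span_bound[OF B(1)] by blast
  moreover have "card T = Suc (card B)" unfolding T_def using inj by (subst card_image) (auto intro: inj_on_subset)
  ultimately show False by simp
qed

text \<open>A self-adjoint element of the corner of \<open>E\<close> that is not scalar has a nontrivial spectral projection: it is
  proportional to the value of the minimal polynomial with one linear factor removed.\<close>

lemma spectral_projection:
  assumes E: "proj rho E" "vect E \<noteq> 0" and A: "A \<in> homs rho rho" "A\<star> = A" "E oo A = A" "A oo E = A"
    and ns: "\<And>c. A \<noteq> c *> E"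
  obtains P where "proj rho P" "vect P \<noteq> 0" "P \<noteq> E" "E oo P = P" "P oo E = P"
proof -
  have Eh: "E \<in> homs rho rho" and Ep: "E oo E = E" "E\<star> = E" using E by (auto simp: proj_def)
  note [simp] = Eh[unfolded homs_iff] A(1)[unfolded homs_iff]
  let ?ev = "evp rho E A"
  note r = evp_rules[OF Eh A(1)]
  note [simp] = r(3)[unfolded homs_iff]
  have "\<exists>p. (p \<noteq> 0 \<and> vect (?ev p) = 0) \<and> (\<forall>q. (q \<noteq> 0 \<and> vect (?ev q) = 0) \<longrightarrow> degree p \<le> degree q)"
    using evp_annihilated[OF Eh A(1)] ex_has_least_nat[of "\<lambda>p. p \<noteq> 0 \<and> vect (?ev p) = 0" _ degree] by blast
  then obtain p where p: "p \<noteq> 0" "vect (?ev p) = 0" "\<And>q. q \<noteq> 0 \<Longrightarrow> vect (?ev q) = 0 \<Longrightarrow> degree p \<le> degree q" by blast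
  have "degree p \<noteq> 0"
  proof
    assume "degree p = 0"
    then obtain a where a: "p = [:a:]" by (metis degree_eq_zeroE)
    then show False using p E(2) by (simp add: r V.scale_eq_0_iff)
  qed
  then obtain z where "poly p z = 0" using fundamental_theorem_of_algebra[of p] constant_degree[of p] by auto
  then obtain q where q: "p = [:- z, 1:] * q" by (auto simp: poly_eq_0_iff_dvd)
  then have "q \<noteq> 0" using p(1) by auto
  then have dq: "degree p = Suc (degree q)" unfolding q by (subst degree_mult_eq) auto
  define B where "B = ?ev q"
  have Bh: "B \<in> homs rho rho" by (simp add: B_def r)
  note [simp] = Bh[unfolded homs_iff]
  have Bnz: "vect B \<noteq> 0" using p(3)[OF \<open>q \<noteq> 0\<close>] dq by (auto simp: B_def)
  have pq: "p = smult (- z) q + pCons 0 q" unfolding q by simp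
  have "?ev p = (- z *> B) \<boxplus> ((0 *> E) \<boxplus> (A oo B))" unfolding pq r(4) r(5) r(2) B_def ..
  then have "vect (A oo B) = vect (z *> B)" using p(2) by (simp add: add_eq_0_iff)
  then have AB: "A oo B = z *> B" by (intro arrow.expand) auto
  have EB: "E oo B = B" "B oo E = B"
  proof -
    have "E oo ?ev p = ?ev p \<and> ?ev p oo E = ?ev p" for p
    proof (induction p)
      case (pCons a p)
      then show ?case by (simp add: r cp_add Ep A cp_subst[OF A(3)])
    qed (simp add: r)
    then show "E oo B = B" "B oo E = B" by (auto simp: B_def)
  qed
  have "\<exists>c. (?ev p)\<star> oo B = c *> B" for p
  proof (induction p)
    case 0 show ?case by (auto simp: r intro!: exI[of _ 0])
  next
    case (pCons a p)
    then obtain c where c: "(?ev p)\<star> oo B = c *> B" by blast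
    have "(?ev (pCons a p))\<star> oo B = (cnj a + z * c) *> B"
      by (simp add: r adj_add Ep A cp_add EB AB c add_scl)
    then show ?case by blast
  qed
  then obtain c where c: "B\<star> oo B = c *> B" unfolding B_def by blast
  have c0: "c \<noteq> 0" using pos'[of B] Bnz c by auto
  have "(B\<star> oo B)\<star> = B\<star> oo B" by simp
  then have "cnj c *> B\<star> = c *> B" by (simp add: c)
  then have "(1 / cnj c) *> cnj c *> B\<star> = (1 / cnj c) *> c *> B" by simp
  then have Bd: "B\<star> = (c / cnj c) *> B" using c0 by simp
  have "(c / cnj c) *> (B oo B) = c *> B" using c Bd by simp
  then have "(cnj c / c) *> (c / cnj c) *> (B oo B) = (cnj c / c) *> c *> B" by simp
  then have BB: "B oo B = cnj c *> B" using c0 by simp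
  \<comment> \<open>Here \<open>B\<star>\<close> and \<open>B oo B\<close> are multiples of \<open>B\<close>, and the scalar turns \<open>B\<close> into a projection.\<close>
  define P where "P = (1 / cnj c) *> B"
  have "proj rho P" unfolding proj_def using c0 by (simp add: P_def homs_iff BB Bd)
  moreover have "vect P \<noteq> 0" using c0 Bnz by (simp add: P_def V.scale_eq_0_iff)
  moreover have "P \<noteq> E"
  proof
    assume "P = E"
    then have "A = A oo P" using A(4) by simp
    also have "\<dots> = z *> P" by (simp add: P_def AB mult.commute)
    finally show False using ns[of z] \<open>P = E\<close> by simp
  qed
  moreover have "E oo P = P" "P oo E = P" by (simp_all add: P_def EB)
  ultimately show ?thesis using that by blast
qed

text \<open>
  If \<open>X\<close> is not a scalar multiple of \<open>E\<close>, then its real part or its imaginary part is not either.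
\<close>

lemma corner_projection:
  assumes E: "proj rho E" "vect E \<noteq> 0" and X: "X \<in> homs rho rho" "E oo X = X" "X oo E = X"
    and ns: "\<And>c. X \<noteq> c *> E"
  obtains P where "proj rho P" "vect P \<noteq> 0" "P \<noteq> E" "E oo P = P" "P oo E = P"
proof -
  have Eh: "E \<in> homs rho rho" and Ep: "E oo E = E" "E\<star> = E" using E by (auto simp: proj_def)
  note [simp] = Eh[unfolded homs_iff] X(1)[unfolded homs_iff]
  have X': "E oo X\<star> = X\<star>" "X\<star> oo E = X\<star>"
    using arg_cong[OF X(3), of adj] arg_cong[OF X(2), of adj] by (simp_all add: Ep)
  define A where "A = X \<boxplus> X\<star>"
  define B where "B = (\<i> *> X) \<boxplus> (- \<i> *> X\<star>)"
  have A: "A \<in> homs rho rho" "A\<star> = A" "E oo A = A" "A oo E = A"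
    by (auto simp: A_def homs_iff adj_add add_ac(2) cp_add X X')
  have B: "B \<in> homs rho rho" "B\<star> = B" "E oo B = B" "B oo E = B"
    by (auto simp: B_def homs_iff adj_add add_ac(2) cp_add X X')
  have "(\<forall>c. A \<noteq> c *> E) \<or> (\<forall>c. B \<noteq> c *> E)"
  proof (rule ccontr)
    assume "\<not> ?thesis"
    then obtain c d where cd: "A = c *> E" "B = d *> E" by blast
    have "X = (1/2) *> (A \<boxplus> (- \<i> *> B))"
    proof (rule arrow.expand, intro conjI)
      have "vect (A \<boxplus> (- \<i> *> B)) = vect X + vect X"
        unfolding A_def B_def by (simp add: V.scale_right_distrib V.scale_right_diff_distrib)
      then have "vect ((1/2) *> (A \<boxplus> (- \<i> *> B))) = scl C (1/2) (vect X + vect X)" by simp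
      also have "\<dots> = scl C (1/2 + 1/2) (vect X)" by (simp only: V.scale_right_distrib V.scale_left_distrib)
      finally show "vect X = vect ((1/2) *> (A \<boxplus> (- \<i> *> B)))" by simp
    qed (auto simp: A_def)
    also have "\<dots> = ((1/2) * (c - \<i> * d)) *> E"
      unfolding cd by (intro arrow.expand) (auto simp: V.scale_right_diff_distrib V.scale_left_diff_distrib diff_divide_distrib)
    finally show False using ns by blast
  qed
  then show ?thesis
    using spectral_projection[OF E A] spectral_projection[OF E B] that by metis
qed

text \<open>
  A decomposition of the range of the projection \<open>E\<close> into irreducible objects. It is stated for projections
  because the induction in \<open>decE_ex\<close> runs through the projections of a fixed object.
\<close>

definition decE :: "'o \<Rightarrow> ('o, 'a) arrow \<Rightarrow> nat \<Rightarrow> (nat \<Rightarrow> 'o) \<Rightarrow> (nat \<Rightarrow> ('o, 'a) arrow) \<Rightarrow> bool" where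
  "decE rho E n r W \<longleftrightarrow> (\<forall>i<n. irr (r i) \<and> W i \<in> homs (r i) rho \<and> (W i)\<star> oo W i = idt (r i)) \<and>
     arr_sum rho rho (\<lambda>i. W i oo (W i)\<star>) {..<n} = E"

abbreviation decomp where "decomp rho \<equiv> decE rho (idt rho)"

lemma arr_sum_append:
  fixes n m :: nat
  shows "arr_sum rho sigma (\<lambda>i. if i < n then F i else G (i - n)) {..<n + m} = arr_sum rho sigma F {..<n} \<boxplus> arr_sum rho sigma G {..<m}"
proof -
  have "(\<Sum>i<n + m. vect (if i < n then F i else G (i - n))) = (\<Sum>i<n. vect (F i)) + (\<Sum>i<m. vect (G i))"
  proof (induction m)
    case 0 show ?case by (auto intro!: sum.cong)
  qed (simp add: add.assoc)
  then show ?thesis by (simp add: arr_sum_def arr_add_def)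
qed

lemma decE_append:
  assumes "decE rho E n r W" "decE rho E' m s V" "ob rho"
  shows "\<exists>r W. decE rho (E \<boxplus> E') (n + m) r W"
proof -
  let ?W = "\<lambda>i. if i < n then W i else V (i - n)"
  have "arr_sum rho rho (\<lambda>i. ?W i oo (?W i)\<star>) {..<n + m}
      = arr_sum rho rho (\<lambda>i. if i < n then W i oo (W i)\<star> else (\<lambda>i. V i oo (V i)\<star>) (i - n)) {..<n + m}"
    by (rule arr_sum_cong) auto
  also have "\<dots> = E \<boxplus> E'"
    using arr_sum_append[of rho rho n "\<lambda>i. W i oo (W i)\<star>" "\<lambda>i. V i oo (V i)\<star>" m] assms by (simp add: decE_def)
  finally have "arr_sum rho rho (\<lambda>i. ?W i oo (?W i)\<star>) {..<n + m} = E \<boxplus> E'" .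
  then have "decE rho (E \<boxplus> E') (n + m) (\<lambda>i. if i < n then r i else s (i - n)) ?W"
    using assms unfolding decE_def by auto
  then show ?thesis by blast
qed

definition corner :: "'o \<Rightarrow> ('o, 'a) arrow \<Rightarrow> 'a set" where
  "corner rho E = vect ` {X \<in> homs rho rho. E oo X = X \<and> X oo E = X}"

lemma corner_subspace: assumes E: "E \<in> homs rho rho" shows "V.subspace (corner rho E)"
proof (rule V.subspaceI)
  note [simp] = E[unfolded homs_iff]
  show "0 \<in> corner rho E" unfolding corner_def
    by (rule image_eqI[of _ _ "arr_zero rho rho"]) (auto simp: homs_iff)
  fix x y assume "x \<in> corner rho E" "y \<in> corner rho E"
  then obtain X Y where "x = vect X" "y = vect Y" "X \<in> homs rho rho" "Y \<in> homs rho rho"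
    "E oo X = X" "X oo E = X" "E oo Y = Y" "Y oo E = Y" by (auto simp: corner_def)
  then show "x + y \<in> corner rho E" unfolding corner_def
    by (intro image_eqI[of _ _ "X \<boxplus> Y"]) (auto simp: homs_iff cp_add)
next
  note [simp] = E[unfolded homs_iff]
  fix c x assume "x \<in> corner rho E"
  then obtain X where "x = vect X" "X \<in> homs rho rho" "E oo X = X" "X oo E = X" by (auto simp: corner_def)
  then show "scl C c x \<in> corner rho E" unfolding corner_def
    by (intro image_eqI[of _ _ "c *> X"]) (auto simp: homs_iff)
qed

text \<open>
  The projection \<open>E\<close> belongs to its own corner but not to that of \<open>P\<close>.
\<close>

lemma corner_dim_less:
  assumes E: "proj rho E" and P: "proj rho P" "P \<noteq> E" "E oo P = P" "P oo E = P"
  shows "V.dim (corner rho P) < V.dim (corner rho E)"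
proof -
  have h: "E \<in> homs rho rho" "P \<in> homs rho rho" "E oo E = E" "P oo P = P" using E P by (auto simp: proj_def)
  note [simp] = h(1,2)[unfolded homs_iff]
  obtain B where B: "finite B" "HomV C rho rho = V.span B" using fin_dim[of rho rho] by auto
  have "corner rho P \<subseteq> corner rho E"
  proof
    fix x assume "x \<in> corner rho P"
    then obtain X where X: "x = vect X" "X \<in> homs rho rho" "P oo X = X" "X oo P = X" by (auto simp: corner_def)
    note [simp] = X(2)[unfolded homs_iff]
    have "E oo X = X" using cp_subst[OF P(3), of X] X(3) by simp
    moreover have "X oo E = X" using P(4) X(4) cp_assoc[of X P E] by simp
    ultimately show "x \<in> corner rho E" using X by (auto simp: corner_def)
  qed
  moreover have "vect E \<in> corner rho E" using h by (auto simp: corner_def)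
  moreover have "vect E \<notin> corner rho P"
  proof
    assume "vect E \<in> corner rho P"
    then obtain X where "vect E = vect X" "X \<in> homs rho rho" "P oo X = X" by (auto simp: corner_def)
    then have "P oo E = E" by (metis \<open>E \<in> homs rho rho\<close> arrow.expand homs_iff)
    then show False using P(2,4) by simp
  qed
  moreover have "corner rho E \<subseteq> V.span B" using B(2) by (auto simp: corner_def homs_Hom Hom_iff)
  ultimately show ?thesis using V.dim_less_subspace[OF corner_subspace[OF h(2)] _ B(1)] by blast
qed

end

context BTC_star
begin

lemma subobj:
  assumes "proj rho E"
  obtains sigma V where "V \<in> homs sigma rho" "V\<star> oo V = idt sigma" "V oo V\<star> = E"
proof -
  have r: "ob rho" using assms by (auto simp: proj_def homs_iff)
  then obtain sigma V where V: "ob sigma" "isometry C sigma rho V" "V \<cdot> star C V = E"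
    using subobjects[of rho E] assms by (auto simp: proj_iff)
  then have h: "V \<in> homs sigma rho" using r by (simp add: homs_Hom isometry_def)
  note [simp] = h[unfolded homs_iff]
  show ?thesis using that[of V sigma] h V by (simp add: isometry_def cp_eq adj_eq idt_eq)
qed

text \<open>
  By induction on the dimension of the corner of \<open>E\<close>. If the corner consists of scalars, a subobject with range
  \<open>E\<close> is irreducible. Otherwise \<open>E\<close> is the sum of two projections with smaller corners.
\<close>

lemma decE_ex: "proj rho E \<Longrightarrow> \<exists>n r W. decE rho E n r W"
proof (induction "V.dim (corner rho E)" arbitrary: E rule: less_induct)
  case less
  have h: "E \<in> homs rho rho" "E oo E = E" "E\<star> = E" using less.prems by (auto simp: proj_def)
  note [simp] = h(1)[unfolded homs_iff]
  show ?case
  proof (cases "vect E = 0")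
    case True
    then have "E = arr_zero rho rho" using vect_zero[of E] by simp
    then have "decE rho E 0 (\<lambda>_. rho) (\<lambda>_. E)" by (simp add: decE_def)
    then show ?thesis by blast
  next
    case nz: False
    show ?thesis
    proof (cases "\<forall>X \<in> homs rho rho. E oo X = X \<and> X oo E = X \<longrightarrow> (\<exists>c. X = c *> E)")
      case True
      obtain sigma V where V: "V \<in> homs sigma rho" "V\<star> oo V = idt sigma" "V oo V\<star> = E" using subobj[OF less.prems] .
      note [simp] = V(1)[unfolded homs_iff]
      have EV: "E oo V = V" "V\<star> oo E = V\<star>" unfolding V(3)[symmetric] by (simp_all add: V(2) cp_subst[OF V(2)])
      have "irr sigma" unfolding irr_iff
      proof (intro conjI ballI)
        show "vect (idt sigma) \<noteq> 0"
        proof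
          assume "vect (idt sigma) = 0"
          then have e: "idt sigma = arr_zero sigma sigma" using vect_zero[of "idt sigma"] by simp
          have "V oo idt sigma = V oo arr_zero sigma sigma" by (simp only: e)
          then have "V = arr_zero sigma rho" by simp
          then have "E = arr_zero rho rho" using V(3) by simp
          then show False using nz by (metis vect_simps(1))
        qed
        fix X assume X: "X \<in> homs sigma sigma"
        note [simp] = X[unfolded homs_iff]
        have "\<exists>c. V oo X oo V\<star> = c *> E"
          by (rule True[rule_format]) (auto simp: homs_iff cp_subst[OF EV(1)] EV)
        then obtain c where c: "V oo X oo V\<star> = c *> E" by blast
        have "X = V\<star> oo (V oo X oo V\<star>) oo V" by (simp add: V(2) cp_subst[OF V(2)])
        also have "\<dots> = c *> idt sigma" unfolding c by (simp add: EV V(2))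
        finally show "\<exists>c. X = c *> idt sigma" by blast
      qed simp
      then have "decE rho E 1 (\<lambda>_. sigma) (\<lambda>_. V)" using V
        by (simp add: decE_def) (simp add: arr_sum_def, metis arrow.collapse \<open>E \<in> homs rho rho\<close> homs_iff)
      then show ?thesis by blast
    next
      case False
      then obtain X where "X \<in> homs rho rho" "E oo X = X" "X oo E = X" "\<And>c. X \<noteq> c *> E" by blast
      then obtain P where P: "proj rho P" "vect P \<noteq> 0" "P \<noteq> E" "E oo P = P" "P oo E = P"
        using corner_projection[OF less.prems nz] by metis
      have Ph: "P \<in> homs rho rho" "P oo P = P" "P\<star> = P" using P(1) by (auto simp: proj_def)
      note [simp] = Ph(1)[unfolded homs_iff]
      define Q where "Q = E \<boxplus> (- 1 *> P)"
      have Q: "Q \<in> homs rho rho" by (simp add: Q_def homs_iff)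
      have "vect (Q oo Q) = vect Q"
        unfolding Q_def by (simp add: cp_add P Ph h)
      then have "Q oo Q = Q" by (intro arrow.expand) (simp add: Q_def)
      then have pQ: "proj rho Q" using Q by (simp add: proj_def) (simp add: Q_def adj_add h Ph)
      have Q': "Q \<noteq> E" using P(2) by (auto simp: Q_def dest!: arg_cong[of _ _ vect])
      have Q'': "E oo Q = Q" "Q oo E = Q" by (simp_all add: Q_def cp_add h P)
      obtain n r W where 1: "decE rho P n r W"
        using less.hyps[OF corner_dim_less[OF less.prems P(1,3,4,5)] P(1)] by blast
      obtain m s V where 2: "decE rho Q m s V"
        using less.hyps[OF corner_dim_less[OF less.prems pQ Q' Q''] pQ] by blast
      have "P \<boxplus> Q = E" by (intro arrow.expand) (auto simp: Q_def)
      then show ?thesis using decE_append[OF 1 2] by auto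
    qed
  qed
qed

lemma decomp_ex: "ob rho \<Longrightarrow> \<exists>n r W. decomp rho n r W"
  by (rule decE_ex) (simp add: proj_def)

end

context pre_BTC_star
begin

lemma decompD: assumes "decomp rho n r W" "i < n"
  shows "irr (r i)" "W i \<in> homs (r i) rho" "(W i)\<star> oo W i = idt (r i)"
  using assms by (auto simp: decE_def)

lemma decomp_sum_left:
  assumes d: "decomp rho n r W" and f: "f \<in> homs sigma rho"
  shows "f = arr_sum sigma rho (\<lambda>i. W i oo (W i)\<star> oo f) {..<n}"
proof -
  note [simp] = f[unfolded homs_iff] decompD(2)[OF d, unfolded homs_iff]
  have "f = arr_sum rho rho (\<lambda>i. W i oo (W i)\<star>) {..<n} oo f" using d by (simp add: decE_def)
  also have "\<dots> = arr_sum sigma rho (\<lambda>i. (W i oo (W i)\<star>) oo f) {..<n}"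
    by (subst cp_sum(1)) (auto simp: homs_iff)
  also have "\<dots> = arr_sum sigma rho (\<lambda>i. W i oo (W i)\<star> oo f) {..<n}"
    by (rule arr_sum_cong) auto
  finally show ?thesis .
qed

lemma vect_arr_sum [simp]: "vect (arr_sum rho sigma F I) = (\<Sum>i\<in>I. vect (F i))"
  by (simp add: arr_sum_def)

text \<open>
  Isometries whose range projections add up to the identity have orthogonal ranges: sandwiching the identity
  between \<open>W j\<star>\<close> and \<open>W j\<close> leaves a sum of positive terms that vanishes.
\<close>

lemma decomp_orth:
  assumes d: "decomp rho n r W" and ij: "i < n" "j < n" "i \<noteq> j"
  shows "(W i)\<star> oo W j = arr_zero (r j) (r i)"
proof -
  note [simp] = decompD(2)[OF d, unfolded homs_iff]
  have rj: "irr (r j)" using decompD[OF d ij(2)] by simp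
  have "\<exists>c\<ge>0. ((W i)\<star> oo W j)\<star> oo (W i)\<star> oo W j = complex_of_real c *> idt (r j)" if "i < n" for i
    using irr_pos[OF rj, of "(W i)\<star> oo W j" "r i"] that ij by (metis arr_adj arr_cp decompD(2)[OF d] homs_intros(1,2))
  then obtain c where c: "\<And>i. i < n \<Longrightarrow> c i \<ge> 0"
    "\<And>i. i < n \<Longrightarrow> ((W i)\<star> oo W j)\<star> oo (W i)\<star> oo W j = complex_of_real (c i) *> idt (r j)" by metis
  have "vect (idt (r j)) = vect ((W j)\<star> oo W j)" using decompD[OF d ij(2)] by simp
  also have "\<dots> = vect ((W j)\<star> oo arr_sum (r j) rho (\<lambda>i. W i oo (W i)\<star> oo W j) {..<n})"
    using decomp_sum_left[OF d decompD(2)[OF d ij(2)]] by simp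
  also have "\<dots> = (\<Sum>i<n. vect (((W i)\<star> oo W j)\<star> oo (W i)\<star> oo W j))"
    using ij by (subst cp_sum(2)) (auto simp: homs_iff)
  also have "\<dots> = (\<Sum>i<n. scl C (complex_of_real (c i)) (vect (idt (r j))))"
    by (rule sum.cong) (simp_all add: c)
  finally have "scl C 1 (vect (idt (r j))) = scl C (complex_of_real (\<Sum>i<n. c i)) (vect (idt (r j)))"
    by (simp add: V.scale_sum_left)
  then have s1: "(\<Sum>i<n. c i) = 1" using irr_ne[OF rj] by (simp only: V.scale_cancel_right) (metis of_real_1 of_real_eq_iff)
  have "complex_of_real (c j) *> idt (r j) = 1 *> idt (r j)" using c(2)[OF ij(2)] decompD[OF d ij(2)] rj by simp
  then have cj: "c j = 1" using scl_cancel[of "idt (r j)"] irr_ne[OF rj] rj by (metis arr_idt irr_ob of_real_1 of_real_eq_iff)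
  have "c i + c j \<le> (\<Sum>i<n. c i)"
    using sum_mono2[of "{..<n}" "{i,j}" c] ij c(1) by auto
  then have "c i = 0" using c(1)[OF ij(1)] cj s1 by simp
  then have "vect (((W i)\<star> oo W j)\<star> oo (W i)\<star> oo W j) = 0" using c(2)[OF ij(1)] rj by simp
  then have "vect ((W i)\<star> oo W j) = 0" using ij pos'[of "(W i)\<star> oo W j"] by simp
  then show ?thesis using vect_zero[of "(W i)\<star> oo W j"] ij by simp
qed

text \<open>Orthonormal bases of \<open>Hom(m, tau)\<close> for irreducible \<open>m\<close>.\<close>

definition onb :: "'o \<Rightarrow> 'o \<Rightarrow> 'i set \<Rightarrow> ('i \<Rightarrow> ('o, 'a) arrow) \<Rightarrow> bool" where
  "onb m tau J V \<longleftrightarrow> finite J \<and> irr m \<and> ob tau \<and> (\<forall>i\<in>J. V i \<in> homs m tau) \<and>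
     (\<forall>i\<in>J. \<forall>j\<in>J. (V i)\<star> oo V j = (if i = j then 1 else 0) *> idt m) \<and>
     (\<forall>X\<in>homs m tau. vect X \<in> V.span ((\<lambda>i. vect (V i)) ` J))"

lemma onb_coeff:
  assumes b: "onb m tau J V" and X: "X \<in> homs m tau"
  obtains c where "X = arr_sum m tau (\<lambda>i. c i *> V i) J" "\<And>i. i \<in> J \<Longrightarrow> (V i)\<star> oo X = c i *> idt m"
proof -
  have h: "finite J" "irr m" "\<And>i. i \<in> J \<Longrightarrow> V i \<in> homs m tau"
    "\<And>i j. i \<in> J \<Longrightarrow> j \<in> J \<Longrightarrow> (V i)\<star> oo V j = (if i = j then 1 else 0) *> idt m"
    "vect X \<in> V.span ((\<lambda>i. vect (V i)) ` J)" using b X by (auto simp: onb_def)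
  note [simp] = h(2) X[unfolded homs_iff] h(3)[unfolded homs_iff]
  have "\<exists>c. vect X = (\<Sum>i\<in>J. scl C (c i) (vect (V i)))"
    using h(5)
  proof (induction rule: V.span_induct_alt)
    case base show ?case by (auto intro!: exI[of _ "\<lambda>_. 0"])
  next
    case (step a x y)
    then obtain j c where "j \<in> J" "x = vect (V j)" "y = (\<Sum>i\<in>J. scl C (c i) (vect (V i)))" by auto
    then have "scl C a x + y = (\<Sum>i\<in>J. scl C ((if i = j then a else 0) + c i) (vect (V i)))"
      using h(1) by (simp add: V.scale_left_distrib sum.distrib if_distrib[of "\<lambda>z. scl C z _"] sum.delta cong: if_cong)
    then show ?case by (rule exI[of _ "\<lambda>i. (if i = j then a else 0) + c i"])
  qed
  then obtain c where c: "vect X = (\<Sum>i\<in>J. scl C (c i) (vect (V i)))" by blast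
  then have X: "X = arr_sum m tau (\<lambda>i. c i *> V i) J" by (intro arrow.expand) auto
  have "(V j)\<star> oo X = c j *> idt m" if j: "j \<in> J" for j
  proof (rule arrow.expand, intro conjI)
    have "vect ((V j)\<star> oo X) = (\<Sum>i\<in>J. vect ((V j)\<star> oo (c i *> V i)))"
      unfolding X using j by (subst cp_sum(2)) (auto simp: homs_iff)
    also have "\<dots> = (\<Sum>i\<in>J. if i = j then vect (c i *> idt m) else 0)"
      using j by (intro sum.cong) (auto simp: h(4))
    finally show "vect ((V j)\<star> oo X) = vect (c j *> idt m)" using j h(1) by simp
  qed (use j in auto)
  then show ?thesis using that X by blast
qed

text \<open>
  The summands isomorphic to \<open>m\<close> provide an orthonormal basis, as the others admit no arrows from \<open>m\<close>.
\<close>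

lemma decomp_onb:
  assumes d: "decomp tau n r W" and m: "irr m" and t: "ob tau"
    and u: "\<And>i. i < n \<Longrightarrow> isom C m (r i) \<Longrightarrow> u i \<in> homs m (r i) \<and> (u i)\<star> oo u i = idt m \<and> u i oo (u i)\<star> = idt (r i)"
  shows "onb m tau {i. i < n \<and> isom C m (r i)} (\<lambda>i. W i oo u i)"
proof -
  let ?J = "{i. i < n \<and> isom C m (r i)}"
  note [simp] = m t decompD(2)[OF d, unfolded homs_iff]
  have [simp]: "u i \<in> homs m (r i)" "arr (u i)" "src (u i) = m" "tgt (u i) = r i" "ob (r i)"
     "(u i)\<star> oo u i = idt m" "u i oo (u i)\<star> = idt (r i)" if "i \<in> ?J" for i
    using u[of i] that by (auto simp: homs_iff)
  have "(W i oo u i)\<star> oo (W j oo u j) = (if i = j then 1 else 0) *> idt m" if i: "i \<in> ?J" "j \<in> ?J" for i j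
  proof (cases "i = j")
    case True
    have "(W i oo u i)\<star> oo (W i oo u i) = (u i)\<star> oo ((W i)\<star> oo W i) oo u i" using i by simp
    then show ?thesis using True i decompD(3)[OF d, of i] by simp
  next
    case False
    have "(W i oo u i)\<star> oo (W j oo u j) = (u i)\<star> oo ((W i)\<star> oo W j) oo u j" using i by simp
    then show ?thesis using False i decomp_orth[OF d, of i j] by simp
  qed
  moreover have "vect X \<in> V.span ((\<lambda>i. vect (W i oo u i)) ` ?J)" if X: "X \<in> homs m tau" for X
  proof -
    note [simp] = X[unfolded homs_iff]
    have "vect X = (\<Sum>i<n. vect (W i oo (W i)\<star> oo X))"
      using arg_cong[OF decomp_sum_left[OF d X], of vect] by simp
    also have "\<dots> \<in> V.span ((\<lambda>i. vect (W i oo u i)) ` ?J)"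
    proof (rule V.span_sum)
      fix i assume i: "i \<in> {..<n}"
      have hx: "(W i)\<star> oo X \<in> homs m (r i)" using i decompD(1)[OF d, of i] by (simp add: homs_iff)
      show "vect (W i oo (W i)\<star> oo X) \<in> V.span ((\<lambda>i. vect (W i oo u i)) ` ?J)"
      proof (cases "i \<in> ?J")
        case True
        obtain c where c: "(u i)\<star> oo (W i)\<star> oo X = c *> idt m"
          using irr_ex[OF m, of "(u i)\<star> oo (W i)\<star> oo X"] True by (auto simp: homs_iff)
        have "u i oo (u i)\<star> oo (W i)\<star> oo X = (W i)\<star> oo X"
          using cp_subst[of "u i" "(u i)\<star>" "idt (r i)" "(W i)\<star> oo X"] True by simp
        then have "W i oo (W i)\<star> oo X = W i oo (u i oo ((u i)\<star> oo (W i)\<star> oo X))" by simp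
        also have "\<dots> = c *> (W i oo u i)" using True by (simp add: c)
        finally show ?thesis using True by (simp only: vect_simps) (intro V.span_scale V.span_base imageI)
      next
        case False
        then have "(W i)\<star> oo X = arr_zero m (r i)"
          using non_isom_zero[OF m decompD(1)[OF d] _ hx] i by auto
        then show ?thesis using i hx by (simp add: V.span_zero homs_iff)
      qed
    qed
    finally show ?thesis .
  qed
  ultimately show ?thesis unfolding onb_def by (auto simp: homs_iff)
qed

lemma decomp_reps:
  assumes d: "decomp tau n r W" and s: "\<And>i. i < n \<Longrightarrow> irr (s i) \<and> isom C (s i) (r i)"
  obtains V where "decomp tau n s V"
proof -
  note [simp] = decompD(2)[OF d, unfolded homs_iff]
  have "\<exists>u. u \<in> homs (s i) (r i) \<and> u\<star> oo u = idt (s i) \<and> u oo u\<star> = idt (r i)" if "i < n" for i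
    using isom_unitary[of "s i" "r i"] s[OF that] decompD(1)[OF d that] by metis
  then obtain u where u: "\<And>i. i < n \<Longrightarrow> u i \<in> homs (s i) (r i)" "\<And>i. i < n \<Longrightarrow> (u i)\<star> oo u i = idt (s i)"
    "\<And>i. i < n \<Longrightarrow> u i oo (u i)\<star> = idt (r i)" by metis
  note [simp] = u(1)[unfolded homs_iff]
  have 1: "(W i oo u i)\<star> oo (W i oo u i) = idt (s i)" if "i < n" for i
    using that u(2)[OF that] cp_subst[OF decompD(3)[OF d that], of "u i"] by simp
  have 2: "(W i oo u i) oo (W i oo u i)\<star> = W i oo (W i)\<star>" if "i < n" for i
    using that cp_subst[OF u(3)[OF that], of "(W i)\<star>"] by simp
  have "arr_sum tau tau (\<lambda>i. (W i oo u i) oo (W i oo u i)\<star>) {..<n} = arr_sum tau tau (\<lambda>i. W i oo (W i)\<star>) {..<n}"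
    by (rule arr_sum_cong) (rule 2, simp)
  then have "decomp tau n s (\<lambda>i. W i oo u i)"
    using d 1 s unfolding decE_def by (auto simp: homs_iff)
  then show ?thesis using that by blast
qed

end



section \<open>Nondegenerate rational categories are modular\<close>

context BTC_star
begin

lemma irr_scl_eq: "irr r \<Longrightarrow> c *> idt r = d *> idt r \<Longrightarrow> c = d"
  using scl_cancel[OF arr_idt irr_ne] by simp

lemma decomp_component:
  assumes d: "decomp rho n r W" and f: "f \<in> homs sigma rho" "vect f \<noteq> 0"
  obtains i where "i < n" "vect ((W i)\<star> oo f) \<noteq> 0"
proof -
  have "\<exists>i<n. vect ((W i)\<star> oo f) \<noteq> 0"
  proof (rule ccontr)
    assume h: "\<not> ?thesis"
    have "vect f = (\<Sum>i<n. vect (W i oo (W i)\<star> oo f))"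
      using arg_cong[OF decomp_sum_left[OF d f(1)], of vect] by (simp only: vect_arr_sum)
    also have "\<dots> = 0"
    proof (rule sum.neutral, rule ballI)
      fix i assume i: "i \<in> {..<n}"
      note [simp] = f(1)[unfolded homs_iff] decompD(2)[OF d, of i, unfolded homs_iff]
      have "vect ((W i)\<star> oo f) = 0" using h i by blast
      then have "(W i)\<star> oo f = arr_zero sigma (r i)" using vect_zero[of "(W i)\<star> oo f"] i by simp
      then show "vect (W i oo (W i)\<star> oo f) = 0" using i by simp
    qed
    finally show False using f(2) by simp
  qed
  then show ?thesis using that by blast
qed

lemma irr_isom_summand:
  assumes a: "irr A" and f: "f \<in> homs A rho" "vect f \<noteq> 0" and d: "decomp rho n r W"
  obtains i where "i < n" "isom C A (r i)"
proof -
  obtain i where i: "i < n" "vect ((W i)\<star> oo f) \<noteq> 0" by (rule decomp_component[OF d f])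
  have "isom C A (r i)"
    by (rule isom_of_arrow[OF a decompD(1)[OF d i(1)] homs_intros(1)[OF f(1) homs_intros(2)[OF decompD(2)[OF d i(1)]]] i(2)])
  then show ?thesis using that i by blast
qed

lemma nsol_transport:
  assumes n: "nsol r rb R Rb d" and u: "u \<in> homs r s" "u\<star> oo u = idt r" "u oo u\<star> = idt s"
    and v: "v \<in> homs rb sb" "v\<star> oo v = idt rb" "v oo v\<star> = idt sb" and s: "irr s"
  shows "nsol s sb ((v**u) oo R) ((u**v) oo Rb) d"
proof -
  have c: "csol r rb R Rb" and R: "R\<star> oo R = complex_of_real d *> idt (unt C)" "Rb\<star> oo Rb = complex_of_real d *> idt (unt C)"
    using n by (auto simp: nsol_def)
  have zz: "((Rb\<star> oo (u\<star>**v\<star>))**idt s) oo (idt s**((v**u) oo R)) = idt s"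
    if c: "csol r rb R Rb" and u: "u \<in> homs r s" "u\<star> oo u = idt r" "u oo u\<star> = idt s"
    and v: "v \<in> homs rb sb" "v\<star> oo v = idt rb" "v oo v\<star> = idt sb" for r rb R Rb u s v sb
  proof -
    note [simp] = csol_t[OF c] u(1)[unfolded homs_iff] v(1)[unfolded homs_iff]
    have 1: "(u\<star>**v\<star>**idt s) oo (idt s**v**u) = (idt (r\<odot>rb)**u) oo (u\<star>**idt (rb\<odot>r))"
    proof -
      have "(u\<star>**v\<star>**idt s) oo (idt s**v**u) = u\<star>**idt rb**u" by (simp add: ichg v)
      also have "\<dots> = (idt r**idt rb**u) oo (u\<star>**idt rb**idt r)" by (simp add: ichg del: tp_idt tp_idt')
      finally show ?thesis by simp
    qed
    have 2: "(Rb\<star>**idt s) oo (idt (r\<odot>rb)**u) = u oo (Rb\<star>**idt r)"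
      using exch[of "Rb\<star>" u _ _ _ _ "unt C" "unt C" "unt C", OF _ _ refl refl refl refl] by simp
    have 3: "(u\<star>**idt (rb\<odot>r)) oo (idt s**R) = (idt r**R) oo u\<star>"
      using exch[of "u\<star>" R _ _ _ _ "unt C" "unt C" "unt C", OF _ _ refl refl refl refl] by simp
    show ?thesis
      by (simp add: tp_cp cp_subst[OF 1] 3 cp_subst[OF 2] cp_subst[OF csol_zz(1)[OF c]] u)
  qed
  note [simp] = csol_t[OF c] u(1)[unfolded homs_iff] v(1)[unfolded homs_iff]
  have e1: "(v\<star>**u\<star>) oo (v**u) = idt (rb\<odot>r)" "(u\<star>**v\<star>) oo (u**v) = idt (r\<odot>rb)" by (simp_all add: ichg u v)
  show ?thesis unfolding nsol_def csol_def
    using s zz[OF c u v] zz[OF csol_sym[OF c] v u] R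
    by (simp add: homs_iff cp_subst[OF e1(1)] cp_subst[OF e1(2)])
qed

text \<open>
  An irreducible object has no decomposition into more than one summand, because each \<open>W i oo (W i)\<star>\<close> would be the
  identity. So its standard solutions are the transports of normalized ones along unitaries.
\<close>

lemma standard_irr:
  assumes r: "irr rho"
  shows "standard_solution C rho rhob R Rb \<longleftrightarrow> (\<exists>d. nsol rho rhob R Rb d)"
proof
  assume "standard_solution C rho rhob R Rb"
  then obtain n r rb Ri Rbi W Wb where o: "ob rho" "ob rhob"
    and i: "\<And>i. i < (n::nat) \<Longrightarrow> irr (r i) \<and> irr (rb i) \<and> normalized_solution C (r i) (rb i) (Ri i) (Rbi i) \<and>
           isometry C (r i) rho (W i) \<and> isometry C (rb i) rhob (Wb i)"
    and s: "arr_sum rho rho (\<lambda>i. W i \<cdot> star C (W i)) {..<n} = idn C rho"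
      "arr_sum rhob rhob (\<lambda>i. Wb i \<cdot> star C (Wb i)) {..<n} = idn C rhob"
    and R: "R = arr_sum (unt C) (rhob\<odot>rho) (\<lambda>i. (Wb i \<boxtimes> W i) \<cdot> Ri i) {..<n}"
      "Rb = arr_sum (unt C) (rho\<odot>rhob) (\<lambda>i. (W i \<boxtimes> Wb i) \<cdot> Rbi i) {..<n}"
    unfolding standard_solution_def by blast
  have W: "W i \<in> homs (r i) rho" "Wb i \<in> homs (rb i) rhob" if "i < n" for i
    using i[OF that] o by (auto simp: isometry_def homs_Hom)
  note [simp] = o W[unfolded homs_iff]
  have iso: "(W i)\<star> oo W i = idt (r i)" "(Wb i)\<star> oo Wb i = idt (rb i)" if "i < n" for i
    using i[OF that] that by (auto simp: isometry_def cp_eq adj_eq idt_eq)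
  have one: "W i oo (W i)\<star> = idt rho" if "i < n" for i
    using irr_arrow_scalar[of "r i" rho "W i" "(W i)\<star>" 1] i[OF that] iso[OF that] r that by (simp add: homs_iff)
  have "vect (idt rho) = (\<Sum>i<n. vect (W i \<cdot> star C (W i)))" using arg_cong[OF s(1), of vect] by (simp add: idt_eq)
  also have "\<dots> = (\<Sum>i<n. scl C 1 (vect (idt rho)))"
    by (intro sum.cong refl) (simp add: cp_eq adj_eq one)
  finally have "scl C 1 (vect (idt rho)) = scl C (of_nat n) (vect (idt rho))"
    by (simp only: V.scale_sum_left[symmetric]) (simp add: V.scale_one)
  then have "(1::complex) = of_nat n" using irr_ne[OF r] by (simp only: V.scale_cancel_right) simp
  then have n: "n = 1" by (metis of_nat_1 of_nat_eq_iff)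
  obtain d where d: "nsol (r 0) (rb 0) (Ri 0) (Rbi 0) d" using nsol_iff i[of 0] n by auto
  have c: "csol (r 0) (rb 0) (Ri 0) (Rbi 0)" using d by (simp add: nsol_def)
  note [simp] = csol_t[OF c]
  have [simp]: "arr (W 0)" "src (W 0) = r 0" "tgt (W 0) = rho" "arr (Wb 0)" "src (Wb 0) = rb 0" "tgt (Wb 0) = rhob"
    using W[of 0] n by (auto simp: homs_iff)
  have sing: "arr_sum a b F {..<(1::nat)} = F 0" if "src (F 0) = a" "tgt (F 0) = b" for F :: "nat \<Rightarrow> ('o, 'a) arrow" and a b
    using that by (intro arrow.expand) auto
  have "Wb 0 oo (Wb 0)\<star> = idt rhob"
    using s(2) unfolding n by (subst (asm) sing) (auto simp: cp_eq adj_eq idt_eq)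
  then have "nsol rho rhob ((Wb 0**W 0) oo Ri 0) ((W 0**Wb 0) oo Rbi 0) d"
    using W[of 0] iso[of 0] one[of 0] n by (intro nsol_transport[OF d]) (auto simp: r)
  moreover have "R = (Wb 0**W 0) oo Ri 0" "Rb = (W 0**Wb 0) oo Rbi 0"
    unfolding R n by (subst sing; simp add: cp_eq tp_eq)+
  ultimately show "\<exists>d. nsol rho rhob R Rb d" by blast
next
  assume "\<exists>d. nsol rho rhob R Rb d"
  then obtain d where d: "nsol rho rhob R Rb d" by blast
  then have c: "csol rho rhob R Rb" by (simp add: nsol_def)
  note [simp] = csol_t[OF c]
  have rb: "irr rhob" by (rule irr_conj[OF r c])
  have sing: "arr_sum a b F {..<(1::nat)} = F 0" if "src (F 0) = a" "tgt (F 0) = b" for F :: "nat \<Rightarrow> ('o, 'a) arrow" and a b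
    using that by (intro arrow.expand) auto
  have iso: "isometry C a a (idt a)" if "ob a" for a
    using that by (simp add: isometry_def adj_eq cp_eq idt_eq)
  show "standard_solution C rho rhob R Rb" unfolding standard_solution_def
  proof (intro conjI exI allI impI)
    show "irr ((\<lambda>_. rho) i)" "irr ((\<lambda>_. rhob) i)" for i :: nat using r rb by auto
    show "normalized_solution C ((\<lambda>_. rho) i) ((\<lambda>_. rhob) i) ((\<lambda>_. R) i) ((\<lambda>_. Rb) i)" for i :: nat
      using d nsol_iff[OF r] by auto
    show "isometry C ((\<lambda>_. rho) i) rho ((\<lambda>_. idt rho) i)" "isometry C ((\<lambda>_. rhob) i) rhob ((\<lambda>_. idt rhob) i)" for i :: nat
      using iso by auto
    show "arr_sum rho rho (\<lambda>i. (\<lambda>_. idt rho) i \<cdot> star C ((\<lambda>_. idt rho) i)) {..<1::nat} = idn C rho"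
      by (subst sing) (simp_all add: adj_eq cp_eq idt_eq)
    show "arr_sum rhob rhob (\<lambda>i. (\<lambda>_. idt rhob) i \<cdot> star C ((\<lambda>_. idt rhob) i)) {..<1::nat} = idn C rhob"
      by (subst sing) (simp_all add: adj_eq cp_eq idt_eq)
    show "R = arr_sum (unt C) (rhob\<odot>rho) (\<lambda>i. ((\<lambda>_. idt rhob) i \<boxtimes> (\<lambda>_. idt rho) i) \<cdot> (\<lambda>_. R) i) {..<1::nat}"
      by (subst sing) (simp_all add: tp_eq cp_eq idt_eq)
    show "Rb = arr_sum (unt C) (rho\<odot>rhob) (\<lambda>i. ((\<lambda>_. idt rho) i \<boxtimes> (\<lambda>_. idt rhob) i) \<cdot> (\<lambda>_. Rb) i) {..<1::nat}"
      by (subst sing) (simp_all add: tp_eq cp_eq idt_eq)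
  qed simp_all
qed

definition mon :: "'o \<Rightarrow> 'o \<Rightarrow> ('o, 'a) arrow" where
  "mon rho sigma = br sigma rho oo br rho sigma"

lemma mon_t [simp]: "src (mon rho sigma) = rho\<odot>sigma" "tgt (mon rho sigma) = rho\<odot>sigma" "ob rho \<Longrightarrow> ob sigma \<Longrightarrow> arr (mon rho sigma)"
  by (simp_all add: mon_def)

text \<open>
  By naturality the monodromy with any object is determined by that with its irreducible summands.
\<close>

lemma all_mon_degenerate:
  assumes [simp]: "ob rho" and m: "\<And>eta. irr eta \<Longrightarrow> mon rho eta = idt (rho\<odot>eta)"
  shows "degenerate_obj C rho"
proof -
  have "br eta rho oo br rho eta = idt (rho\<odot>eta)" if [simp]: "ob eta" for eta
  proof -
    obtain n r W where d: "decomp eta n r W" using decomp_ex[of eta] by auto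
    note [simp] = decompD(1)[OF d] decompD(2)[OF d, unfolded homs_iff]
    have s: "idt (rho\<odot>eta) = arr_sum (rho\<odot>eta) (rho\<odot>eta) (\<lambda>i. idt rho**(W i oo (W i)\<star>)) {..<n}"
    proof -
      have "idt (rho\<odot>eta) = idt rho**arr_sum eta eta (\<lambda>i. W i oo (W i)\<star>) {..<n}" using d by (simp add: decE_def)
      then show ?thesis by (subst (asm) tp_sum(2)) (auto simp: homs_iff)
    qed
    have e: "mon rho eta oo (idt rho**(W i oo (W i)\<star>)) = idt rho**(W i oo (W i)\<star>)" if i: "i < n" for i
    proof -
      have 1: "br rho eta oo (idt rho**W i) = (W i**idt rho) oo br rho (r i)" using br_nat[of "idt rho" "W i" rho eta] i by simp
      have 2: "br eta rho oo (W i**idt rho) = (idt rho**W i) oo br (r i) rho" using br_nat[of "W i" "idt rho" eta rho] i by simp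
      have "mon rho eta oo (idt rho**W i) = (idt rho**W i) oo mon rho (r i)"
        using i by (simp add: mon_def 1 cp_subst[OF 2])
      also have "\<dots> = idt rho**W i" using i m[of "r i"] by simp
      finally have 3: "mon rho eta oo (idt rho**W i) = idt rho**W i" .
      show ?thesis using i by (simp add: tp_cp cp_subst[OF 3])
    qed
    have "mon rho eta = mon rho eta oo arr_sum (rho\<odot>eta) (rho\<odot>eta) (\<lambda>i. idt rho**(W i oo (W i)\<star>)) {..<n}" by (simp flip: s)
    also have "\<dots> = arr_sum (rho\<odot>eta) (rho\<odot>eta) (\<lambda>i. mon rho eta oo (idt rho**(W i oo (W i)\<star>))) {..<n}"
      by (subst cp_sum(2)) (auto simp: homs_iff)
    also have "\<dots> = idt (rho\<odot>eta)" unfolding s by (rule arr_sum_cong) (simp only: lessThan_iff e)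
    finally show ?thesis by (simp add: mon_def)
  qed
  then have "rho \<in> D" unfolding D_iff by auto
  then show ?thesis by (simp add: degenerates_def)
qed

text \<open>
  The strand of \<open>i\<close> is pulled through the loop. A loop on its right then becomes a loop on its left, with
  inverse crossings and therefore the adjoint.
\<close>

lemma right_loop:
  assumes c: "csol j jb Q Qb" and [simp]: "ob i"
  shows "(idt i**Qb\<star>) oo (mon i j**idt jb) oo (idt i**Qb) = ((Qb\<star>**idt i) oo (idt j**mon jb i) oo (Qb**idt i))\<star>"
proof -
  note [simp] = csol_t[OF c]
  have bl: "br (j\<odot>jb) i = (br j i**idt jb) oo (idt j**br jb i)" by (rule br_left) simp_all
  have e1: "idt i**Qb = (br j i**idt jb) oo (idt j**br jb i) oo (Qb**idt i)"
    using br_nat[of Qb "idt i" "j\<odot>jb" i] by (simp add: bl)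
  have "(idt i**Qb)\<star> = ((br j i**idt jb) oo (idt j**br jb i) oo (Qb**idt i))\<star>" unfolding e1 ..
  then have e1': "idt i**Qb\<star> = (Qb\<star>**idt i) oo (idt j**(br jb i)\<star>) oo ((br j i)\<star>**idt jb)" by simp
  have "(br j i)\<star> oo mon i j oo br j i = mon j i" using cp_subst[OF br_adj(1)[of j i], of "br i j oo br j i"] by (simp add: mon_def)
  from arg_cong[OF this, of "\<lambda>x. x**idt jb"]
  have e2: "((br j i)\<star>**idt jb) oo (mon i j**idt jb) oo (br j i**idt jb) = mon j i**idt jb" by (simp add: tp_cp)
  have br2: "br i (j\<odot>jb) = (idt j**br i jb) oo (br i j**idt jb)" by (rule br_right) simp_all
  have "br i (j\<odot>jb) oo br (j\<odot>jb) i oo (Qb**idt i) = Qb**idt i" using mon_nat[of Qb "unt C" "j\<odot>jb" i] by simp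
  then have "(idt j**br i jb) oo (mon j i**idt jb) oo (idt j**br jb i) oo (Qb**idt i) = Qb**idt i"
    unfolding bl br2 by (simp add: mon_def tp_cp)
  then have "(idt j**(br i jb)\<star>) oo (idt j**br i jb) oo (mon j i**idt jb) oo (idt j**br jb i) oo (Qb**idt i) = (idt j**(br i jb)\<star>) oo (Qb**idt i)" by simp
  moreover have "(idt j**(br i jb)\<star>) oo (idt j**br i jb) = idt (j\<odot>(i\<odot>jb))" by (simp add: ichg)
  note cp_subst[OF this, of "(mon j i**idt jb) oo (idt j**br jb i) oo (Qb**idt i)"]
  ultimately have e3: "(mon j i**idt jb) oo (idt j**br jb i) oo (Qb**idt i) = (idt j**(br i jb)\<star>) oo (Qb**idt i)" by simp
  have e2': "((br j i)\<star>**idt jb) oo (mon i j**idt jb) oo (br j i**idt jb) oo X = (mon j i**idt jb) oo X" if "arr X" "tgt X = j\<odot>(i\<odot>jb)" for X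
    using arg_cong[OF e2, of "\<lambda>f. f oo X"] that by simp
  show ?thesis unfolding e1 e1' by (simp add: e2' e3) (simp add: mon_def tp_cp)
qed

text \<open>
  The value of a loop of \<open>i\<close> around a strand of \<open>j\<close>. The choice of the normalized solution is irrelevant
  because two of them differ by a unitary.
\<close>

definition chi :: "'o \<Rightarrow> 'o \<Rightarrow> complex" where
  "chi i j = (THE c. \<exists>ib R Rb d. nsol i ib R Rb d \<and> (R\<star>**idt j) oo (idt ib**mon i j) oo (R**idt j) = c *> idt j)"

lemma chi:
  assumes n: "nsol i ib R Rb d" and j: "irr j"
  shows "(R\<star>**idt j) oo (idt ib**mon i j) oo (R**idt j) = chi i j *> idt j"
proof -
  have c: "csol i ib R Rb" using n by (simp add: nsol_def)
  note [simp] = csol_t[OF c] j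
  obtain x where x: "(R\<star>**idt j) oo (idt ib**mon i j) oo (R**idt j) = x *> idt j"
    using irr_ex[OF j, of "(R\<star>**idt j) oo (idt ib**mon i j) oo (R**idt j)"] by (auto simp: homs_iff)
  have "chi i j = x" unfolding chi_def
  proof (rule the_equality)
    show "\<exists>ib R Rb d. nsol i ib R Rb d \<and> (R\<star>**idt j) oo (idt ib**mon i j) oo (R**idt j) = x *> idt j" using n x by blast
    fix y assume "\<exists>ib R Rb d. nsol i ib R Rb d \<and> (R\<star>**idt j) oo (idt ib**mon i j) oo (R**idt j) = y *> idt j"
    then obtain sb Q Qb e where m: "nsol i sb Q Qb e" and y: "(Q\<star>**idt j) oo (idt sb**mon i j) oo (Q**idt j) = y *> idt j" by blast
    obtain v where v: "v \<in> homs ib sb" "v\<star> oo v = idt ib" "Q = (v**idt i) oo R"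
      by (rule nsol_unique[OF n m, of "idt i"]) simp_all
    note [simp] = v(1)[unfolded homs_iff]
    have 0: "(v\<star>**idt (i\<odot>j)) oo (idt sb**mon i j) oo (v**idt (i\<odot>j)) = idt ib**mon i j" by (simp add: ichg v(2))
    have 1: "(v\<star>**idt (i\<odot>j)) oo (idt sb**mon i j) oo (v**idt (i\<odot>j)) oo Z = (idt ib**mon i j) oo Z" if "arr Z" "tgt Z = ib\<odot>(i\<odot>j)" for Z
      using arg_cong[OF 0, of "\<lambda>f. f oo Z"] that by simp
    have "(Q\<star>**idt j) oo (idt sb**mon i j) oo (Q**idt j) = x *> idt j" unfolding v(3) by (simp add: tp_cp 1 x)
    then have "y *> idt j = x *> idt j" using y by simp
    then show "y = x" by (rule irr_scl_eq[OF j])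
  qed
  then show ?thesis using x by simp
qed

lemma chi_degenerate:
  assumes n: "nsol i ib R Rb d" and j: "irr j" "j \<in> D"
  shows "chi i j = complex_of_real d"
proof -
  have c: "csol i ib R Rb" and R: "R\<star> oo R = complex_of_real d *> idt (unt C)" using n by (auto simp: nsol_def)
  note [simp] = csol_t[OF c] j(1)
  have "mon i j = idt (i\<odot>j)" using D_br(3)[OF j(2), of i] by (simp add: mon_def)
  then have "chi i j *> idt j = complex_of_real d *> idt j" using chi[OF n j(1)] R by (simp add: ichg)
  then show ?thesis by (rule irr_scl_eq[OF j(1)])
qed

text \<open>
  The number \<open>Y\<close> consists of two linked loops. Evaluating the left one first gives \<open>chi i j\<close> times the dimension of
  \<open>j\<close>, and evaluating the right one first, with \<open>right_loop\<close>, gives the other side of the reciprocity.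
\<close>

lemma Y_values:
  assumes n: "nsol i ib R Rb d" "nsol j jb Q Qb e"
  shows "(R\<star>**Qb\<star>) oo (idt ib**mon i j**idt jb) oo (R**Qb) = (chi i j * complex_of_real e) *> idt (unt C)"
    "chi i j * complex_of_real e = cnj (chi jb i) * complex_of_real d"
    "(idt i**Qb\<star>) oo (mon i j**idt jb) oo (idt i**Qb) = cnj (chi jb i) *> idt i"
proof -
  have c: "csol i ib R Rb" "csol j jb Q Qb" "irr i" "irr j" "R\<star> oo R = complex_of_real d *> idt (unt C)" "Qb\<star> oo Qb = complex_of_real e *> idt (unt C)"
    using n by (auto simp: nsol_def)
  note [simp] = csol_t[OF c(1)] csol_t[OF c(2)]
  let ?Y = "(R\<star>**Qb\<star>) oo (idt ib**mon i j**idt jb) oo (R**Qb)"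
  have s: "R**Qb = (R**idt (j\<odot>jb)) oo Qb" "R\<star>**Qb\<star> = Qb\<star> oo (R\<star>**idt (j\<odot>jb))"
    "R**Qb = (idt (ib\<odot>i)**Qb) oo R" "R\<star>**Qb\<star> = R\<star> oo (idt (ib\<odot>i)**Qb\<star>)"
    using slide[of R Qb, OF _ _ refl refl refl refl] slide[of "R\<star>" "Qb\<star>", OF _ _ refl refl refl refl] by simp_all
  have "((R\<star>**idt j) oo (idt ib**mon i j) oo (R**idt j))**idt jb = chi i j *> idt (j\<odot>jb)" unfolding chi[OF n(1) c(4)] by simp
  then have 1: "(R\<star>**idt (j\<odot>jb)) oo (idt ib**mon i j**idt jb) oo (R**idt (j\<odot>jb)) = chi i j *> idt (j\<odot>jb)" by (simp add: tp_cp)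
  have "?Y = Qb\<star> oo ((R\<star>**idt (j\<odot>jb)) oo (idt ib**mon i j**idt jb) oo (R**idt (j\<odot>jb))) oo Qb"
    unfolding s(1,2) by simp
  then show v: "?Y = (chi i j * complex_of_real e) *> idt (unt C)" unfolding 1 using c(6) by simp
  show r: "(idt i**Qb\<star>) oo (mon i j**idt jb) oo (idt i**Qb) = cnj (chi jb i) *> idt i"
    unfolding right_loop[OF c(2) irr_ob[OF c(3)]] chi[OF nsol_sym[OF n(2)] c(3)] using c(3) by simp
  have 2: "(idt (ib\<odot>i)**Qb\<star>) oo (idt ib**mon i j**idt jb) oo (idt (ib\<odot>i)**Qb) = cnj (chi jb i) *> idt (ib\<odot>i)"
    using arg_cong[OF r, of "\<lambda>f. idt ib**f"] by (simp add: tp_cp)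
  have "?Y = R\<star> oo ((idt (ib\<odot>i)**Qb\<star>) oo (idt ib**mon i j**idt jb) oo (idt (ib\<odot>i)**Qb)) oo R"
    unfolding s(3,4) by simp
  then have "?Y = (cnj (chi jb i) * complex_of_real d) *> idt (unt C)" unfolding 2 using c(5) by simp
  then show "chi i j * complex_of_real e = cnj (chi jb i) * complex_of_real d" using v irr_scl_eq[OF unt_irr] by metis
qed

lemma Ymat_chi: assumes i: "irr i" and n: "nsol j jb Q Qb e" shows "Ymat C i j = chi i j * complex_of_real e"
proof -
  have j: "irr j" using n by (simp add: nsol_def)
  have val: "(star C R \<boxtimes> star C Qb') \<cdot> (idn C ib \<boxtimes> monodromy C i j \<boxtimes> idn C jb') \<cdot> (R \<boxtimes> Qb') = (chi i j * complex_of_real e) *> idt (unt C)"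
    if m: "nsol i ib R Rb d" "nsol j jb' Q' Qb' e'" for ib R Rb d jb' Q' Qb' e'
  proof -
    have c: "csol i ib R Rb" "csol j jb' Q' Qb'" using m by (auto simp: nsol_def)
    note [simp] = csol_t[OF c(1)] csol_t[OF c(2)]
    have ee: "e' = e" by (rule nsol_unique[OF n m(2), of "idt j"]) simp_all
    have "monodromy C i j = mon i j" by (simp add: monodromy_def mon_def br_eq cp_eq)
    then show ?thesis using Y_values(1)[OF m] ee by (simp add: adj_eq idt_eq tp_eq cp_eq)
  qed
  obtain ib R Rb d where m: "nsol i ib R Rb d" using nsol_ex[OF i] by blast
  show ?thesis unfolding Ymat_def standard_irr[OF i] standard_irr[OF j]
  proof (rule the_equality)
    have "(chi i j * complex_of_real e) *> idn C (unt C) =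
       (star C R \<boxtimes> star C Qb) \<cdot> (idn C ib \<boxtimes> monodromy C i j \<boxtimes> idn C jb) \<cdot> (R \<boxtimes> Qb)"
      using val[OF m n] by (simp add: idt_eq)
    then show "\<exists>rhob R Rb sigmab Q Qb. (\<exists>d. nsol i rhob R Rb d) \<and> (\<exists>d. nsol j sigmab Q Qb d) \<and>
     (chi i j * complex_of_real e) *> idn C (unt C) =
       (star C R \<boxtimes> star C Qb) \<cdot> (idn C rhob \<boxtimes> monodromy C i j \<boxtimes> idn C sigmab) \<cdot> (R \<boxtimes> Qb)"
      using m n by blast
    fix y assume "\<exists>rhob R Rb sigmab Q Qb. (\<exists>d. nsol i rhob R Rb d) \<and> (\<exists>d. nsol j sigmab Q Qb d) \<and>
     y *> idn C (unt C) = (star C R \<boxtimes> star C Qb) \<cdot> (idn C rhob \<boxtimes> monodromy C i j \<boxtimes> idn C sigmab) \<cdot> (R \<boxtimes> Qb)"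
    then have "y *> idt (unt C) = (chi i j * complex_of_real e) *> idt (unt C)" using val by (metis idt_eq unt_Obj)
    then show "y = chi i j * complex_of_real e" by (rule irr_scl_eq[OF unt_irr])
  qed
qed

text \<open>
  Hence the rows of \<open>Y\<close> are characters of an algebra with positive structure constants. The
  product solution of the conjugate equations need not be standard, so these constants may differ from
  the multiplicities, but they do not depend on \<open>j\<close>.
\<close>

lemma chi_fusion:
  assumes i: "irr i" and k: "irr k" and dec: "decomp (i\<odot>k) n r W"
  shows "\<exists>c. (\<forall>a<n. c a > (0::real)) \<and> (\<forall>j. irr j \<longrightarrow> chi i j * chi k j = (\<Sum>a<n. complex_of_real (c a) * chi (r a) j))"
proof -
  obtain ib Ri Rbi di kb Rk Rbk dk where n: "nsol i ib Ri Rbi di" "nsol k kb Rk Rbk dk" using nsol_ex[OF i] nsol_ex[OF k] by blast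
  have c: "csol i ib Ri Rbi" "csol k kb Rk Rbk" using n by (auto simp: nsol_def)
  note [simp] = csol_t[OF c(1)] csol_t[OF c(2)]
  let ?rho = "i\<odot>k" and ?rhob = "kb\<odot>ib"
  define R where "R = (idt kb**Ri**idt k) oo Rk"
  have cR: "csol ?rho ?rhob R ((idt i**Rbk**idt ib) oo Rbi)" unfolding R_def by (rule csol_product[OF c])
  have R: "arr R" "src R = unt C" "tgt R = ?rhob\<odot>?rho" by (simp_all add: R_def)
  note [simp] = R
  \<comment> \<open>The adjoint of the transpose of \<open>W a\<close> embeds the conjugate of \<open>r a\<close>; the square of its norm is the structure constant.\<close>
  have ra: "\<exists>c>0. \<exists>mb Q Qb e s. nsol (r a) mb Q Qb e \<and> s \<in> homs mb ?rhob \<and> s\<star> oo s = complex_of_real c *> idt mb \<and>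
     (s**idt (r a)) oo Q = (idt ?rhob**(W a)\<star>) oo R" if a: "a < n" for a
  proof -
    note W = decompD[OF dec a]
    note [simp] = W(2)[unfolded homs_iff]
    obtain mb Q Qb e where m: "nsol (r a) mb Q Qb e" using nsol_ex[OF W(1)] by blast
    have cm: "csol (r a) mb Q Qb" using m by (simp add: nsol_def)
    note [simp] = csol_t[OF cm]
    define t where "t = tps ?rhob R (W a) Qb mb"
    note t = tps[OF cm cR W(2), folded t_def]
    note [simp] = t(1)[unfolded homs_iff]
    have "(Q\<star> oo (t**idt (r a)))\<star> = (R\<star> oo (idt ?rhob**W a))\<star>" unfolding t(2) ..
    then have s: "(t\<star>**idt (r a)) oo Q = (idt ?rhob**(W a)\<star>) oo R" by simp
    have th: "t\<star> \<in> homs mb ?rhob" by (simp add: homs_iff)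
    have "vect (t\<star>) \<noteq> 0"
    proof
      assume "vect (t\<star>) = 0"
      then have z: "t\<star> = arr_zero mb ?rhob" using vect_zero[of "t\<star>"] by simp
      have "(idt ?rhob**(W a)\<star>) oo R = (arr_zero mb ?rhob**idt (r a)) oo Q" using s unfolding z by (rule sym)
      then have "(W a)\<star> = arr_zero ?rho (r a)" by - (rule csol_inj(3)[OF cR], simp_all)
      then show False using W(3) irr_ne'[OF W(1)] W(1) by simp
    qed
    then obtain x where x: "t oo t\<star> = complex_of_real x *> idt mb" "x > 0" using irr_pos[OF irr_conj[OF W(1) cm] th] by auto
    then show ?thesis using m th s by (intro exI[of _ x] conjI exI[of _ mb] exI[of _ Q] exI[of _ Qb] exI[of _ e] exI[of _ "t\<star>"]) simp_all
  qed
  then obtain x where x: "\<And>a. a < n \<Longrightarrow> x a > 0 \<and> (\<exists>mb Q Qb e s. nsol (r a) mb Q Qb e \<and> s \<in> homs mb ?rhob \<and> s\<star> oo s = complex_of_real (x a) *> idt mb \<and>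
     (s**idt (r a)) oo Q = (idt ?rhob**(W a)\<star>) oo R)" by metis
  have "chi i j * chi k j = (\<Sum>a<n. complex_of_real (x a) * chi (r a) j)" if j: "irr j" for j
  proof -
    note [simp] = j
    note yi = chi[OF n(1) j] and yk = chi[OF n(2) j]
    define G where "G = (R\<star>**idt j) oo (idt ?rhob**mon ?rho j) oo (R**idt j)"
    have G: "G = (chi i j * chi k j) *> idt j"
    proof -
      \<comment> \<open>The loop of the product consists of two nested loops; the inner one, of \<open>i\<close>, is evaluated first.\<close>
      have m: "mon ?rho j = (idt i**br j k) oo (mon i j**idt k) oo (idt i**br k j)"
        using br_left[of i k j] br_right[of j i k] by (simp add: mon_def tp_cp)
      have 1: "(idt kb**Ri\<star>**idt (k\<odot>j)) oo (idt (kb\<odot>(ib\<odot>i))**br j k) = (idt kb**br j k) oo (idt kb**Ri\<star>**idt (j\<odot>k))"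
        using exch[of "Ri\<star>" "br j k" _ _ _ _ kb "unt C" "unt C", OF _ _ refl refl refl refl] by simp
      have 2: "(idt (kb\<odot>(ib\<odot>i))**br k j) oo (idt kb**Ri**idt (k\<odot>j)) = (idt kb**Ri**idt (j\<odot>k)) oo (idt kb**br k j)"
        using exch[of Ri "br k j" _ _ _ _ kb "unt C" "unt C", OF _ _ refl refl refl refl] by simp
      have 3: "(idt kb**Ri\<star>**idt (j\<odot>k)) oo (idt (kb\<odot>ib)**mon i j**idt k) oo (idt kb**Ri**idt (j\<odot>k)) = chi i j *> idt (kb\<odot>(j\<odot>k))"
        using arg_cong[OF yi, of "\<lambda>x. idt kb**x**idt k"] by (simp add: tp_cp)
      have 4: "(idt kb**Ri\<star>**idt (j\<odot>k)) oo (idt (kb\<odot>ib)**mon i j**idt k) oo (idt kb**Ri**idt (j\<odot>k)) oo Z = chi i j *> Z"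
        if "arr Z" "tgt Z = kb\<odot>(j\<odot>k)" for Z using arg_cong[OF 3, of "\<lambda>f. f oo Z"] that by simp
      have "G = (Rk\<star>**idt j) oo (idt kb**Ri\<star>**idt (k\<odot>j)) oo (idt (kb\<odot>(ib\<odot>i))**br j k) oo
         (idt (kb\<odot>ib)**mon i j**idt k) oo (idt (kb\<odot>(ib\<odot>i))**br k j) oo (idt kb**Ri**idt (k\<odot>j)) oo (Rk**idt j)"
        unfolding G_def m R_def by (simp add: tp_cp)
      also have "\<dots> = chi i j *> ((Rk\<star>**idt j) oo (idt kb**mon k j) oo (Rk**idt j))"
        by (simp add: cp_subst[OF 1] cp_subst[OF 2] 4) (simp add: mon_def tp_cp)
      also have "\<dots> = (chi i j * chi k j) *> idt j" unfolding yk by simp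
      finally show ?thesis .
    qed
    have part: "(R\<star>**idt j) oo (idt ?rhob**(mon ?rho j oo ((W a oo (W a)\<star>)**idt j))) oo (R**idt j) = (complex_of_real (x a) * chi (r a) j) *> idt j" if a: "a < n" for a
    proof -
      note W = decompD[OF dec a]
      note [simp] = W(2)[unfolded homs_iff]
      obtain mb Q Qb e s where q: "nsol (r a) mb Q Qb e" "s \<in> homs mb ?rhob" "s\<star> oo s = complex_of_real (x a) *> idt mb"
        "(s**idt (r a)) oo Q = (idt ?rhob**(W a)\<star>) oo R" using x[OF a] by blast
      have cm: "csol (r a) mb Q Qb" using q(1) by (simp add: nsol_def)
      note [simp] = csol_t[OF cm] q(2)[unfolded homs_iff]
      have m: "mon ?rho j oo (W a**idt j) = (W a**idt j) oo mon (r a) j" unfolding mon_def using mon_nat[of "W a" "r a" ?rho j] by simp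
      have 1: "(idt ?rhob**(W a)\<star>**idt j) oo (R**idt j) = (s**idt (r a\<odot>j)) oo (Q**idt j)"
        using arg_cong[OF q(4), of "\<lambda>f. f**idt j"] by (simp add: tp_cp)
      have "((s**idt (r a)) oo Q)\<star> = ((idt ?rhob**(W a)\<star>) oo R)\<star>" unfolding q(4) ..
      then have "Q\<star> oo (s\<star>**idt (r a)) = R\<star> oo (idt ?rhob**W a)" by simp
      from arg_cong[OF this, of "\<lambda>f. f**idt j"]
      have 2: "(R\<star>**idt j) oo (idt ?rhob**W a**idt j) = (Q\<star>**idt j) oo (s\<star>**idt (r a\<odot>j))" by (simp add: tp_cp)
      have "(s\<star>**idt (r a\<odot>j)) oo (idt ?rhob**mon (r a) j) oo (s**idt (r a\<odot>j)) = complex_of_real (x a) *> (idt mb**mon (r a) j)" by (simp add: ichg q(3))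
      from arg_cong[OF this, of "\<lambda>f. f oo (Q**idt j)"]
      have 3: "(s\<star>**idt (r a\<odot>j)) oo (idt ?rhob**mon (r a) j) oo (s**idt (r a\<odot>j)) oo (Q**idt j) = complex_of_real (x a) *> ((idt mb**mon (r a) j) oo (Q**idt j))" by simp
      have "mon ?rho j oo ((W a oo (W a)\<star>)**idt j) = (W a**idt j) oo mon (r a) j oo ((W a)\<star>**idt j)" by (simp add: tp_cp cp_subst[OF m])
      then show ?thesis using chi[OF q(1) j] by (simp add: tp_cp 1 cp_subst[OF 2] 3)
    qed
    have Wh: "W a oo (W a)\<star> \<in> homs ?rho ?rho" if "a \<in> {..<n}" for a using decompD(2)[OF dec, of a] that by (simp add: homs_iff)
    have "G = (R\<star>**idt j) oo (idt ?rhob**(mon ?rho j oo (arr_sum ?rho ?rho (\<lambda>a. W a oo (W a)\<star>) {..<n}**idt j))) oo (R**idt j)"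
      using dec by (simp add: G_def decE_def)
    also have "\<dots> = arr_sum j j (\<lambda>a. (R\<star>**idt j) oo (idt ?rhob**(mon ?rho j oo ((W a oo (W a)\<star>)**idt j))) oo (R**idt j)) {..<n}"
      by (rule arr_sum_additive[where T = "\<lambda>f. (R\<star>**idt j) oo (idt ?rhob**(mon ?rho j oo (f**idt j))) oo (R**idt j)", OF Wh]) (auto simp: homs_iff tp_add cp_add)
    also have "\<dots> = arr_sum j j (\<lambda>a. (complex_of_real (x a) * chi (r a) j) *> idt j) {..<n}"
      by (rule arr_sum_cong) (simp only: lessThan_iff part)
    finally have "vect ((chi i j * chi k j) *> idt j) = vect (arr_sum j j (\<lambda>a. (complex_of_real (x a) * chi (r a) j) *> idt j) {..<n})" unfolding G by (rule arg_cong)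
    then have "scl C (chi i j * chi k j) (vect (idt j)) = scl C (\<Sum>a<n. complex_of_real (x a) * chi (r a) j) (vect (idt j))"
      by (simp only: vect_arr_sum V.scale_sum_left arr_scl_def arrow.sel)
    then show ?thesis using irr_ne[OF j] by simp
  qed
  then show ?thesis using x by blast
qed

text \<open>
  The loop is the inner product of \<open>idt i**Qb\<close> with its image under the monodromy, which has the same norm. So
  this is the case of equality in the Cauchy-Schwarz inequality.
\<close>

lemma maximal_loop:
  assumes i: "irr i" and n: "nsol j jb Q Qb e" and m: "cnj (chi jb i) = complex_of_real e"
  shows "mon i j = idt (i\<odot>j)"
proof -
  obtain ib R Rb d where ni: "nsol i ib R Rb d" using nsol_ex[OF i] by blast
  have c: "csol j jb Q Qb" and Q: "Qb\<star> oo Qb = complex_of_real e *> idt (unt C)" using n by (auto simp: nsol_def)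
  note [simp] = csol_t[OF c] i
  let ?Q = "idt i**Qb"
  define X where "X = (mon i j**idt jb) oo ?Q"
  have [simp]: "arr X" "src X = i" "tgt X = i\<odot>(j\<odot>jb)" by (simp_all add: X_def)
  have u: "(mon i j)\<star> oo mon i j = idt (i\<odot>j)" using cp_subst[OF br_adj(1)[of j i], of "br i j"] by (simp add: mon_def)
  have QQ: "?Q\<star> oo ?Q = complex_of_real e *> idt i" by (simp add: ichg Q)
  have QX: "?Q\<star> oo X = complex_of_real e *> idt i" using Y_values(3)[OF ni n] m by (simp add: X_def)
  then have "(?Q\<star> oo X)\<star> = complex_of_real e *> idt i" by simp
  then have XQ: "X\<star> oo ?Q = complex_of_real e *> idt i" by simp
  have "((mon i j)\<star>**idt jb) oo (mon i j**idt jb) = idt (i\<odot>(j\<odot>jb))" by (simp add: ichg u)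
  from cp_subst[OF this, of ?Q] have XX: "X\<star> oo X = complex_of_real e *> idt i" using QQ by (simp add: X_def)
  define Y where "Y = ?Q"
  have [simp]: "arr Y" "src Y = i" "tgt Y = i\<odot>(j\<odot>jb)" by (simp_all add: Y_def)
  have "vect ((X \<boxplus> (- 1 *> Y))\<star> oo (X \<boxplus> (- 1 *> Y))) = 0"
    using QQ QX XQ XX unfolding Y_def[symmetric] by (simp add: adj_add cp_add)
  then have "vect (X \<boxplus> (- 1 *> Y)) = 0" by - (rule pos', simp_all)
  then have "X = Y" by (intro arrow.expand) simp
  then have "X = ?Q" by (simp only: Y_def)
  then show ?thesis
    using frobenius_right[OF c, of "mon i j" i "i\<odot>j"] frobenius_right[OF c, of "idt (i\<odot>j)" i "i\<odot>j"] by (simp add: X_def)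
qed

text \<open>
  Nondegeneracy separates the class \<open>u\<close> of the unit from all others, and interpolation gives a combination of
  the functions \<open>cnj (chi i m)\<close> of \<open>m\<close> that is the indicator function of \<open>u\<close>. By reciprocity this is a system of
  weights \<open>w\<close> for which the sum of \<open>w i * chi m i\<close> over \<open>i\<close> vanishes unless \<open>m = u\<close>. Applied to the
  products \<open>chi j * chi (b l)\<close>, where \<open>b l\<close> represents the conjugate of \<open>l\<close>, the fusion rule leaves only the
  coefficient of \<open>u\<close>, which is nonzero just for \<open>j = l\<close>. That is the inverse of \<open>Y\<close>.
\<close>

theorem nondegenerate_modular:
  assumes rat: "rational C" and nd: "\<not> degenerate_category C"
  shows "modular C"
  unfolding modular_def
proof (intro conjI allI impI)
  show "rational C" by (rule rat)
  fix I assume I: "irr_representatives C (Obj C) I"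
  have Iirr [simp]: "irr i" if "i \<in> I" for i using I that by (auto simp: irr_representatives_def)
  have Iob [simp]: "ob i" if "i \<in> I" for i using Iirr[OF that] by simp
  have Iex: "\<exists>s. s \<in> I \<and> isom C s r" if "irr r" for r
    using I that isom_sym irr_ob[OF that] unfolding irr_representatives_def by blast
  have Iuniq: "i = j" if "i \<in> I" "j \<in> I" "isom C i j" for i j
    using I that Iirr[OF that(1)] isom_refl[of i] Iob[OF that(1)] unfolding irr_representatives_def by blast
  have fin: "finite I"
  proof (rule finite_imageD)
    show "finite ((\<lambda>rho. {sigma. isom C rho sigma}) ` I)"
      by (rule finite_subset[OF _ rat[unfolded rational_def]]) auto
    show "inj_on (\<lambda>rho. {sigma. isom C rho sigma}) I"
    proof (rule inj_onI)
      fix i j assume ij: "i \<in> I" "j \<in> I" "{sigma. isom C i sigma} = {sigma. isom C j sigma}"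
      then have "isom C i j" using isom_refl[of j] Iob by blast
      then show "i = j" using Iuniq ij by blast
    qed
  qed
  obtain u where u: "u \<in> I" "isom C u (unt C)" using Iex[OF unt_irr] by blast
  obtain v where v: "v \<in> homs u (unt C)" "v\<star> oo v = idt u" "v oo v\<star> = idt (unt C)"
    using isom_unitary[OF u(2) _ unt_irr] u(1) Iirr by blast
  have uD: "u \<in> D" by (rule D_sub[OF D_unt v(1,2)])
  have fusion: "\<exists>N. (\<forall>j. irr j \<longrightarrow> chi i j * chi k j = (\<Sum>m\<in>I. N m * chi m j)) \<and> (N u \<noteq> 0 \<longleftrightarrow> (\<exists>f\<in>homs (unt C) (i\<odot>k). vect f \<noteq> 0))"
    if ik: "irr i" "irr k" for i k
  proof -
    have o: "ob (i\<odot>k)" using ik by simp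
    obtain n r W where d: "decomp (i\<odot>k) n r W" using decomp_ex[OF o] by blast
    have "\<exists>s. \<forall>a<n. s a \<in> I \<and> isom C (s a) (r a)" using Iex decompD(1)[OF d] by (intro choice allI) meson
    then obtain s where s: "\<And>a. a < n \<Longrightarrow> s a \<in> I \<and> isom C (s a) (r a)" by blast
    then obtain V where V: "decomp (i\<odot>k) n s V" using decomp_reps[OF d, of s] Iirr by metis
    obtain c where c: "\<And>a. a < n \<Longrightarrow> c a > (0::real)" "\<And>j. irr j \<Longrightarrow> chi i j * chi k j = (\<Sum>a<n. complex_of_real (c a) * chi (s a) j)"
      using chi_fusion[OF ik V] by blast
    define N where "N m = complex_of_real (\<Sum>a | a \<in> {..<n} \<and> s a = m. c a)" for m
    have "chi i j * chi k j = (\<Sum>m\<in>I. N m * chi m j)" if j: "irr j" for j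
    proof -
      have "(\<Sum>a<n. complex_of_real (c a) * chi (s a) j) = (\<Sum>m\<in>I. \<Sum>a | a \<in> {..<n} \<and> s a = m. complex_of_real (c a) * chi (s a) j)"
        using s fin by (intro sum.group[symmetric]) auto
      also have "\<dots> = (\<Sum>m\<in>I. N m * chi m j)"
        by (intro sum.cong[OF refl]) (auto simp: N_def sum_distrib_right)
      finally show ?thesis using c(2)[OF j] by simp
    qed
    moreover have "N u \<noteq> 0 \<longleftrightarrow> (\<exists>f\<in>homs (unt C) (i\<odot>k). vect f \<noteq> 0)"
    proof
      assume "N u \<noteq> 0"
      then have "{a. a \<in> {..<n} \<and> s a = u} \<noteq> {}" unfolding N_def by (intro notI) (simp only: sum.empty of_real_0 simp_thms)
      then obtain a where a: "a < n" "s a = u" by auto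
      note W = decompD[OF V a(1), unfolded a(2)]
      note [simp] = v(1)[unfolded homs_iff] W(2)[unfolded homs_iff]
      have "(V a oo v\<star>)\<star> oo (V a oo v\<star>) = idt (unt C)" by (simp add: cp_subst[OF W(3)] v(3))
      moreover have "(arr_zero (unt C) (i\<odot>k))\<star> oo arr_zero (unt C) (i\<odot>k) = arr_zero (unt C) (unt C)" using ik by simp
      ultimately have "V a oo v\<star> \<noteq> arr_zero (unt C) (i\<odot>k)" using irr_ne'[OF unt_irr] by metis
      then have "vect (V a oo v\<star>) \<noteq> 0" using vect_zero[of "V a oo v\<star>"] by simp
      moreover have "V a oo v\<star> \<in> homs (unt C) (i\<odot>k)" by (simp add: homs_iff)
      ultimately show "\<exists>f\<in>homs (unt C) (i\<odot>k). vect f \<noteq> 0" by blast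
    next
      assume "\<exists>f\<in>homs (unt C) (i\<odot>k). vect f \<noteq> 0"
      then obtain f where f: "f \<in> homs (unt C) (i\<odot>k)" "vect f \<noteq> 0" by blast
      obtain a where a: "a < n" "isom C (unt C) (s a)" by (rule irr_isom_summand[OF unt_irr f V])
      have "u = s a" using Iuniq[OF u(1)] s[OF a(1)] isom_trans[OF u(2) a(2)] by blast
      then have "a \<in> {a. a \<in> {..<n} \<and> s a = u}" using a by simp
      then have "(\<Sum>a | a \<in> {..<n} \<and> s a = u. c a) > 0" using c(1) by (intro sum_pos) auto
      then show "N u \<noteq> 0" unfolding N_def of_real_eq_0_iff by linarith
    qed
    ultimately show ?thesis by blast
  qed
  have "\<exists>kb. kb \<in> I \<and> (\<exists>R Rb d. nsol k kb R Rb d)" if k: "k \<in> I" for k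
  proof -
    obtain k' R Rb d where n: "nsol k k' R Rb d" using nsol_ex[of k] k by auto
    have k': "irr k'" using nsol_sym[OF n] by (simp add: nsol_def)
    obtain kb where kb: "kb \<in> I" "isom C kb k'" using Iex[OF k'] by blast
    obtain v where v: "v \<in> homs k' kb" "v\<star> oo v = idt k'" "v oo v\<star> = idt kb"
      using isom_unitary[OF isom_sym[OF kb(2)] k'] kb(1) Iirr by blast
    have "nsol k kb ((v**idt k) oo R) ((idt k**v) oo Rb) d"
      by (rule nsol_transport[OF n _ _ _ v]) (use k in \<open>auto simp: homs_iff\<close>)
    then show ?thesis using kb by blast
  qed
  then obtain b R Rb dm where b: "\<And>k. k \<in> I \<Longrightarrow> b k \<in> I" "\<And>k. k \<in> I \<Longrightarrow> nsol k (b k) (R k) (Rb k) (dm k)" by metis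
  have dpos: "dm k > 0" if "k \<in> I" for k using nsol_pos[OF b(2)[OF that]] .
  have "inj_on b I"
  proof (rule inj_onI)
    fix i j assume ij: "i \<in> I" "j \<in> I" "b i = b j"
    obtain w where w: "w \<in> homs i j" "w\<star> oo w = idt i" "w oo w\<star> = idt j"
      using nsol_unique[OF nsol_sym[OF b(2)[OF ij(1)]] nsol_sym[OF b(2)[OF ij(2)]], of "idt (b i)"] ij b(1) by force
    have "isom C i j" unfolding isom_iff using w homs_intros(2)[OF w(1)] by blast
    then show "i = j" by (rule Iuniq[OF ij(1,2)])
  qed
  then have bij: "bij_betw b I I" using endo_inj_surj[OF fin] b(1) by (auto simp: bij_betw_def)
  \<comment> \<open>The linear span of the conjugate characters as functions on the classes; by the fusion rule it is an algebra.\<close>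
  define G where "G = {f. \<exists>a. \<forall>m\<in>I. f m = (\<Sum>i\<in>I. a i * cnj (chi i m))}"
  have chi_unt: "chi (unt C) j = 1" if j: "irr j" for j
  proof -
    have "nsol (unt C) (unt C) (idt (unt C)) (idt (unt C)) 1" using unt_irr by (simp add: nsol_def csol_def homs_iff)
    from chi[OF this j] show ?thesis using irr_scl_eq[OF j, of 1 "chi (unt C) j"] j by (simp add: mon_def)
  qed
  have GI: "f \<in> G" if "\<And>m. m \<in> I \<Longrightarrow> f m = (\<Sum>i\<in>I. a i * cnj (chi i m))" for f a
    using that unfolding G_def by blast
  have G_chi: "(\<lambda>m. cnj (chi k m)) \<in> G" if k: "irr k" for k
  proof -
    obtain N where N: "\<And>j. irr j \<Longrightarrow> chi (unt C) j * chi k j = (\<Sum>m\<in>I. N m * chi m j)" using fusion[OF unt_irr k] by blast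
    then have "chi k m = (\<Sum>i\<in>I. N i * chi i m)" if "m \<in> I" for m using chi_unt that by force
    then show ?thesis by (intro GI[of _ "\<lambda>i. cnj (N i)"]) simp
  qed
  have G_lin: "(\<lambda>m. \<Sum>x\<in>A. z x * f x m) \<in> G" if f: "\<And>x. x \<in> A \<Longrightarrow> f x \<in> G" for A :: "'x set" and f z
  proof -
    have "\<forall>x\<in>A. \<exists>a. \<forall>m\<in>I. f x m = (\<Sum>i\<in>I. a i * cnj (chi i m))" using f by (simp add: G_def)
    from bchoice[OF this] obtain a where a: "\<And>x m. x \<in> A \<Longrightarrow> m \<in> I \<Longrightarrow> f x m = (\<Sum>i\<in>I. a x i * cnj (chi i m))" by blast
    have "(\<Sum>x\<in>A. z x * f x m) = (\<Sum>i\<in>I. (\<Sum>x\<in>A. z x * a x i) * cnj (chi i m))" if "m \<in> I" for m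
      using that by (simp add: a sum_distrib_left sum_distrib_right mult.assoc) (rule sum.swap)
    then show ?thesis by (rule GI)
  qed
  have G_mult: "(\<lambda>m. f m * g m) \<in> G" if fg: "f \<in> G" "g \<in> G" for f g
  proof -
    obtain a where a: "\<And>m. m \<in> I \<Longrightarrow> f m = (\<Sum>i\<in>I. a i * cnj (chi i m))" using fg(1) by (auto simp: G_def)
    obtain a' where a': "\<And>m. m \<in> I \<Longrightarrow> g m = (\<Sum>i\<in>I. a' i * cnj (chi i m))" using fg(2) by (auto simp: G_def)
    have pr: "(\<lambda>m. cnj (chi i m) * cnj (chi k m)) \<in> G" if ik: "i \<in> I" "k \<in> I" for i k
    proof -
      obtain N where "\<And>j. irr j \<Longrightarrow> chi i j * chi k j = (\<Sum>m\<in>I. N m * chi m j)" using fusion[OF Iirr[OF ik(1)] Iirr[OF ik(2)]] by blast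
      then show ?thesis by (intro GI[of _ "\<lambda>i. cnj (N i)"]) (simp flip: complex_cnj_mult cnj_sum)
    qed
    have "(\<lambda>m. \<Sum>p\<in>I \<times> I. (a (fst p) * a' (snd p)) * (cnj (chi (fst p) m) * cnj (chi (snd p) m))) \<in> G" by (rule G_lin) (auto intro: pr)
    moreover have "f m * g m = (\<Sum>p\<in>I \<times> I. (a (fst p) * a' (snd p)) * (cnj (chi (fst p) m) * cnj (chi (snd p) m)))" if "m \<in> I" for m
      unfolding a[OF that] a'[OF that] sum_product sum.cartesian_product by (rule sum.cong) (auto simp: algebra_simps)
    ultimately show ?thesis by (simp add: G_def)
  qed
  have one: "(\<lambda>_. 1) \<in> G" using G_chi[OF unt_irr] chi_unt by (simp add: G_def)
  have sep: "\<exists>h\<in>G. h u = 1 \<and> h m = 0" if m: "m \<in> I" "m \<noteq> u" for m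
  proof -
    have "\<not> isom C m (unt C)" using m Iuniq[OF m(1) u(1)] isom_trans[OF _ isom_sym[OF u(2)]] by blast
    then have "\<not> degenerate_obj C m" using nd m(1) Iirr unfolding degenerate_category_def by blast
    then obtain s where s: "irr s" "mon m s \<noteq> idt (m\<odot>s)" using all_mon_degenerate[of m] m(1) by auto
    obtain sb Q Qb e where n: "nsol s sb Q Qb e" using nsol_ex[OF s(1)] by blast
    have sb: "irr sb" using nsol_sym[OF n] by (simp add: nsol_def)
    define x where "x = cnj (chi sb m)"
    \<comment> \<open>The loop of \<open>sb\<close> has the value \<open>e\<close> at \<open>u\<close> and a different one at \<open>m\<close>; an affine function of it separates them.\<close>
    have x: "x \<noteq> complex_of_real e" using maximal_loop[OF Iirr[OF m(1)] n] s(2) by (auto simp: x_def)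
    have e: "chi sb u = complex_of_real e" by (rule chi_degenerate[OF nsol_sym[OF n] Iirr[OF u(1)] uD])
    let ?z = "\<lambda>t. (if t then 1 else - x) / (complex_of_real e - x)"
    have "(\<lambda>k. \<Sum>t\<in>UNIV. ?z t * (if t then cnj (chi sb k) else 1)) \<in> G"
      using G_chi[OF sb] one by (intro G_lin[of UNIV "\<lambda>t k. if t then cnj (chi sb k) else 1" ?z]) (rename_tac t, case_tac t, simp_all)
    moreover have "?z True * cnj (chi sb u) + ?z False = 1" using x by (simp add: e diff_divide_distrib[symmetric])
    ultimately show ?thesis using x by (intro bexI) (auto simp: UNIV_bool x_def add.commute)
  qed
  have "\<exists>h\<in>G. h u = 1 \<and> (\<forall>m\<in>A. h m = 0)" if "finite A" "A \<subseteq> I - {u}" for A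
    using that
  proof (induction A)
    case empty
    show ?case using one by (intro bexI[OF _ one]) simp
  next
    case (insert m A)
    obtain g where g: "g \<in> G" "g u = 1" "\<forall>m\<in>A. g m = 0" using insert by auto
    obtain h where h: "h \<in> G" "h u = 1" "h m = 0" using sep[of m] insert by auto
    show ?case using g h by (intro bexI[OF _ G_mult[OF g(1) h(1)]]) simp
  qed
  from this[of "I - {u}"] obtain a where a: "\<And>m. m \<in> I \<Longrightarrow> (\<Sum>i\<in>I. a i * cnj (chi i m)) = (if m = u then 1 else 0)"
    using fin u(1) unfolding G_def by fastforce
  have ref: "chi i j * complex_of_real (dm j) = cnj (chi (b j) i) * complex_of_real (dm i)" if "i \<in> I" "j \<in> I" for i j
    by (rule Y_values(2)[OF b(2)[OF that(1)] b(2)[OF that(2)]])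
  define w where "w i = a (b i) * complex_of_real (dm i)" for i
  have w: "(\<Sum>i\<in>I. w i * chi m i) = (if m = u then complex_of_real (dm u) else 0)" if m: "m \<in> I" for m
  proof -
    have "(\<Sum>i\<in>I. w i * chi m i) = (\<Sum>i\<in>I. a (b i) * cnj (chi (b i) m)) * complex_of_real (dm m)"
      unfolding sum_distrib_right by (rule sum.cong[OF refl]) (use ref[OF m] in \<open>simp add: w_def mult_ac\<close>)
    also have "(\<Sum>i\<in>I. a (b i) * cnj (chi (b i) m)) = (\<Sum>i\<in>I. a i * cnj (chi i m))" by (rule sum.reindex_bij_betw[OF bij])
    finally show ?thesis using a[OF m] by simp
  qed
  have hom: "(\<exists>f\<in>homs (unt C) (j\<odot>b l). vect f \<noteq> 0) \<longleftrightarrow> j = l" if jl: "j \<in> I" "l \<in> I" for j l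
  proof
    have c: "csol l (b l) (R l) (Rb l)" using b(2)[OF jl(2)] by (simp add: nsol_def)
    note [simp] = csol_t[OF c] Iob[OF jl(1)]
    show "\<exists>f\<in>homs (unt C) (j\<odot>b l). vect f \<noteq> 0" if "j = l"
      using that csol_nz(2)[OF Iirr[OF jl(2)] c] by (intro bexI[of _ "Rb l"]) (simp_all add: homs_iff)
    assume "\<exists>f\<in>homs (unt C) (j\<odot>b l). vect f \<noteq> 0"
    then obtain f where f: "f \<in> homs (unt C) (j\<odot>b l)" "vect f \<noteq> 0" by blast
    note [simp] = f(1)[unfolded homs_iff]
    let ?f = "(idt j**(R l)\<star>) oo (f**idt l)"
    have "(?f**idt (b l)) oo Rb l = f" using frobenius_right'[OF c, of f "unt C" j] by simp
    then have "vect ?f \<noteq> 0" using f(2) vect_zero[of ?f] by auto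
    then have "isom C l j" by (intro isom_of_arrow[of _ _ ?f]) (use jl in \<open>auto simp: homs_iff\<close>)
    then show "j = l" using Iuniq jl by blast
  qed
  have S: "(\<Sum>tau\<in>I. w tau * (chi j tau * chi (b l) tau)) \<noteq> 0 \<longleftrightarrow> j = l" if jl: "j \<in> I" "l \<in> I" for j l
  proof -
    obtain N where N: "\<And>tau. irr tau \<Longrightarrow> chi j tau * chi (b l) tau = (\<Sum>m\<in>I. N m * chi m tau)" "N u \<noteq> 0 \<longleftrightarrow> j = l"
      using fusion[of j "b l"] b(1)[OF jl(2)] jl(1) unfolding hom[OF jl] by auto
    have "(\<Sum>tau\<in>I. w tau * (chi j tau * chi (b l) tau)) = (\<Sum>tau\<in>I. \<Sum>m\<in>I. N m * (w tau * chi m tau))"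
      by (rule sum.cong[OF refl]) (simp add: N(1) sum_distrib_left mult_ac)
    also have "\<dots> = (\<Sum>m\<in>I. N m * (\<Sum>tau\<in>I. w tau * chi m tau))" by (subst sum.swap) (simp add: sum_distrib_left)
    also have "\<dots> = (\<Sum>m\<in>I. if m = u then N u * complex_of_real (dm u) else 0)" by (rule sum.cong[OF refl]) (simp add: w)
    also have "\<dots> = N u * complex_of_real (dm u)" using fin u(1) by simp
    finally show ?thesis using N(2) dpos[OF u(1)] by auto
  qed
  define E where "E l = (\<Sum>tau\<in>I. w tau * (chi l tau * chi (b l) tau))" for l
  have E: "E l \<noteq> 0" if "l \<in> I" for l using S[OF that that] by (simp add: E_def)
  have A: "(\<Sum>tau\<in>I. w tau * (chi j tau * chi (b l) tau)) = (if j = l then E l else 0)" if "j \<in> I" "l \<in> I" for j l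
    using S[OF that] by (cases "j = l") (simp_all only: E_def if_True if_False simp_thms)
  define Z where "Z tau l = w tau * chi (b l) tau / (complex_of_real (dm tau) * E l)" for tau l
  \<comment> \<open>The complex conjugate of the relation for \<open>Z\<close>, rewritten by reciprocity, shows that \<open>Z'\<close> is a left inverse.\<close>
  define Z' where "Z' j tau = cnj (w tau * chi j tau) / (complex_of_real (dm tau) * cnj (E j))" for j tau
  have Y: "Ymat C i j = chi i j * complex_of_real (dm j)" if "i \<in> I" "j \<in> I" for i j
    by (rule Ymat_chi[OF Iirr[OF that(1)] b(2)[OF that(2)]])
  have YZ: "(\<Sum>tau\<in>I. Ymat C j tau * Z tau l) = (if j = l then 1 else 0)" if jl: "j \<in> I" "l \<in> I" for j l
  proof -
    have "(\<Sum>tau\<in>I. Ymat C j tau * Z tau l) = (\<Sum>tau\<in>I. w tau * (chi j tau * chi (b l) tau)) / E l"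
      unfolding sum_divide_distrib by (rule sum.cong[OF refl]) (use jl dpos E in \<open>simp add: Y Z_def less_imp_neq[symmetric]\<close>)
    then show ?thesis using A[OF jl] E[OF jl(2)] by simp
  qed
  have ZY: "(\<Sum>tau\<in>I. Z' j tau * Ymat C tau l) = (if j = l then 1 else 0)" if jl: "j \<in> I" "l \<in> I" for j l
  proof -
    have "(\<Sum>tau\<in>I. Z' j tau * Ymat C tau l) = (\<Sum>tau\<in>I. cnj (w tau * (chi j tau * chi (b l) tau)) / cnj (E j))"
      by (rule sum.cong[OF refl]) (use jl dpos in \<open>simp add: Y ref Z'_def less_imp_neq[symmetric]\<close>)
    also have "\<dots> = cnj (\<Sum>tau\<in>I. w tau * (chi j tau * chi (b l) tau)) / cnj (E j)" by (simp add: sum_divide_distrib)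
    finally show ?thesis unfolding A[OF jl] using E[OF jl(1)] by (cases "j = l") simp_all
  qed
  have ZZ: "Z' j l = Z j l" if jl: "j \<in> I" "l \<in> I" for j l
  proof -
    have "Z' j l = (\<Sum>\<mu>\<in>I. if \<mu> = l then Z' j \<mu> else 0)" using fin jl by simp
    also have "\<dots> = (\<Sum>\<mu>\<in>I. Z' j \<mu> * (\<Sum>tau\<in>I. Ymat C \<mu> tau * Z tau l))"
      by (rule sum.cong[OF refl]) (use YZ jl in auto)
    also have "\<dots> = (\<Sum>tau\<in>I. (\<Sum>\<mu>\<in>I. Z' j \<mu> * Ymat C \<mu> tau) * Z tau l)"
      unfolding sum_distrib_left sum_distrib_right by (subst sum.swap) (simp add: mult.assoc)
    also have "\<dots> = (\<Sum>tau\<in>I. if tau = j then Z tau l else 0)"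
      by (rule sum.cong[OF refl]) (use ZY jl in auto)
    finally show ?thesis using fin jl by simp
  qed
  show "\<exists>Z. \<forall>rho\<in>I. \<forall>sigma\<in>I. (\<Sum>tau\<in>I. Ymat C rho tau * Z tau sigma) = (if rho = sigma then 1 else 0) \<and>
           (\<Sum>tau\<in>I. Z rho tau * Ymat C tau sigma) = (if rho = sigma then 1 else 0)"
    using YZ ZY by (intro exI[of _ Z]) (simp flip: ZZ cong: sum.cong)
qed

end


section \<open>Closure under subobjects\<close>

context pre_BTC_star
begin

text \<open>
  Multiplication by this arrow is injective by positivity, hence surjective on the finite dimensional space
  \<open>Hom(rho, rho)\<close>.
\<close>

lemma inverse_one_plus_positive:
  assumes Y: "Y \<in> homs rho rho"
  obtains W where "W \<in> homs rho rho" "(idt rho \<boxplus> (Y oo Y\<star>)) oo W = idt rho"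
proof -
  note [simp] = Y[unfolded homs_iff]
  define Z where "Z = idt rho \<boxplus> (Y oo Y\<star>)"
  have Z: "Z \<in> homs rho rho" by (simp add: Z_def homs_iff)
  note [simp] = Z[unfolded homs_iff]
  let ?S = "HomV C rho rho"
  have S: "V.subspace ?S" by (rule HomV_sub) simp_all
  define f where "f v = vect (Z oo Arrow rho rho v)" for v
  have A: "Arrow rho rho v \<in> homs rho rho" "arr (Arrow rho rho v)" if "v \<in> ?S" for v
    using homs_Arrow[OF that] by (auto simp: homs_iff)
  have add: "f (x + y) = f x + f y" if "x \<in> ?S" "y \<in> ?S" for x y
  proof -
    have "Arrow rho rho (x + y) = Arrow rho rho x \<boxplus> Arrow rho rho y" by (simp add: arr_add_def)
    then show ?thesis using A that by (simp add: f_def cp_add)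
  qed
  have scl: "f (scl C c x) = scl C c (f x)" if "x \<in> ?S" for c x
  proof -
    have "Arrow rho rho (scl C c x) = c *> Arrow rho rho x" by (simp add: arr_scl_def)
    then show ?thesis using A that by (simp add: f_def)
  qed
  have fS: "f ` ?S \<subseteq> ?S"
  proof
    fix w assume "w \<in> f ` ?S"
    then obtain v where v: "v \<in> ?S" "w = f v" by auto
    have "Z oo Arrow rho rho v \<in> homs rho rho" using A[OF v(1)] by (simp add: homs_iff)
    then show "w \<in> ?S" by (simp add: v(2) f_def homs_Hom Hom_iff)
  qed
  have ker: "v = 0" if v: "v \<in> ?S" "f v = 0" for v
  proof -
    define X where "X = Arrow rho rho v"
    have X: "X \<in> homs rho rho" using A[OF v(1)] by (simp add: X_def)
    note [simp] = X[unfolded homs_iff]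
    have "Z oo X = arr_zero rho rho" using v(2) vect_zero[of "Z oo X"] by (simp add: f_def flip: X_def)
    then have "X\<star> oo (Z oo X) = arr_zero rho rho" by simp
    then have "vect (X\<star> oo (Z oo X)) = 0" by (metis vect_simps(1))
    moreover have "vect (X\<star> oo (Z oo X)) = vect (X\<star> oo X) + vect ((Y\<star> oo X)\<star> oo (Y\<star> oo X))"
      by (simp add: Z_def cp_add)
    ultimately have "vect X = 0"
      by (intro adj_sum_zero[OF X, of "Y\<star> oo X" rho]) (simp_all add: homs_iff)
    then show ?thesis by (simp add: X_def)
  qed
  have inj: "inj_on f ?S"
  proof (rule inj_onI)
    fix x y assume xy: "x \<in> ?S" "y \<in> ?S" "f x = f y"
    have "f (x - y) = 0" using add[of "x - y" y] V.subspace_diff[OF S xy(1,2)] xy by simp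
    then show "x = y" using ker[OF V.subspace_diff[OF S xy(1,2)]] by simp
  qed
  obtain B where B: "finite B" "?S = V.span B" using fin_dim[of rho rho] by auto
  have sub: "V.subspace (f ` ?S)"
  proof (rule V.subspaceI)
    show "0 \<in> f ` ?S" using scl[OF V.subspace_0[OF S], of 0] V.subspace_0[OF S] by force
    fix x y assume "x \<in> f ` ?S" "y \<in> f ` ?S"
    then show "x + y \<in> f ` ?S" using add V.subspace_add[OF S] by (auto simp flip: add)
  next
    fix c x assume "x \<in> f ` ?S"
    then show "scl C c x \<in> f ` ?S" using scl V.subspace_scale[OF S] by (auto simp flip: scl)
  qed
  have "V.dim (f ` ?S) = V.dim ?S"
    by (rule V.dim_semilinear_bij[where f = f and phi = "\<lambda>c. c" and psi = "\<lambda>c. c"])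
       (use S B sub add scl inj in auto)
  then have "f ` ?S = ?S"
    using V.dim_less_subspace[OF sub _ B(1), of ?S] fS B(2) by fastforce
  moreover have "vect (idt rho) \<in> ?S" using homs_simps(1)[of rho] by (simp add: homs_Hom Hom_iff del: homs_simps)
  ultimately obtain w where w: "w \<in> ?S" "f w = vect (idt rho)" by (metis imageE)
  have "Z oo Arrow rho rho w = idt rho" using w by (intro arrow.expand) (simp add: f_def)
  then show ?thesis using that[of "Arrow rho rho w"] A[OF w(1)] by (simp add: Z_def)
qed

text \<open>
  The orthogonal projection with the same range as an idempotent \<open>N\<close> is \<open>N N\<^sup>* Z\<^sup>-\<^sup>1\<close> with
  \<open>Z = 1 + (N - N\<^sup>*)(N - N\<^sup>*)\<^sup>*\<close>, which commutes with \<open>N\<close> and \<open>N\<^sup>*\<close>.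
\<close>

lemma range_projection:
  assumes N: "N \<in> homs rho rho" "N oo N = N"
  obtains Q where "proj rho Q" "Q oo N = N" "N oo Q = Q"
proof -
  note [simp] = N(1)[unfolded homs_iff]
  define Y where "Y = N \<boxplus> (- 1 *> N\<star>)"
  have Y: "Y \<in> homs rho rho" by (simp add: Y_def homs_iff)
  note [simp] = Y[unfolded homs_iff]
  define Z where "Z = idt rho \<boxplus> (Y oo Y\<star>)"
  obtain W where W: "W \<in> homs rho rho" "Z oo W = idt rho" unfolding Z_def by (rule inverse_one_plus_positive[OF Y])
  have Z: "Z \<in> homs rho rho" "Z\<star> = Z" by (simp_all add: Z_def homs_iff adj_add)
  note [simp] = W(1)[unfolded homs_iff] Z(1)[unfolded homs_iff]
  have NN: "N\<star> oo N\<star> = N\<star>" using arg_cong[OF N(2), of adj] by simp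
  have Ze: "Z = idt rho \<boxplus> ((N oo N\<star>) \<boxplus> (- 1 *> N) \<boxplus> (- 1 *> N\<star>) \<boxplus> (N\<star> oo N))"
    by (intro arrow.expand) (simp add: Z_def Y_def adj_add cp_add N NN)
  have ZN: "Z oo N = N oo N\<star> oo N" "N oo Z = N oo N\<star> oo N"
    by (rule arrow.expand, simp add: Ze cp_add N NN cp_subst[OF N(2)])+
  have ZNd: "Z oo N\<star> = N\<star> oo Z"
    using arg_cong[OF ZN(1), of adj] arg_cong[OF ZN(2), of adj] by (simp add: Z(2))
  have "W\<star> oo Z = idt rho" using arg_cong[OF W(2), of adj] by (simp add: Z(2))
  then have "W\<star> = W" using cp_assoc[of "W\<star>" Z W] W(2) by simp
  then have WZ: "W oo Z = idt rho" using \<open>W\<star> oo Z = idt rho\<close> by simp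
  have comm: "W oo X = X oo W" if X: "X \<in> homs rho rho" and ZX: "Z oo X = X oo Z" for X
  proof -
    note [simp] = X[unfolded homs_iff]
    have "W oo X = W oo (X oo Z) oo W" by (simp add: W)
    also have "\<dots> = (W oo Z) oo X oo W" by (simp only: ZX[symmetric]) simp
    also have "\<dots> = X oo W" by (simp add: WZ)
    finally show ?thesis .
  qed
  have WN: "W oo N = N oo W" by (rule comm) (simp_all add: N(1) ZN)
  have WNd: "W oo N\<star> = N\<star> oo W" by (rule comm) (simp_all add: homs_iff ZNd)
  define Q where "Q = N oo N\<star> oo W"
  have Q: "Q \<in> homs rho rho" by (simp add: Q_def homs_iff)
  note [simp] = Q[unfolded homs_iff]
  have "Q\<star> = W oo N oo N\<star>" by (simp add: Q_def \<open>W\<star> = W\<close>)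
  also have "\<dots> = Q" by (simp add: Q_def cp_subst[OF WN] WNd)
  finally have Qa: "Q\<star> = Q" .
  have QN: "Q oo N = N"
  proof -
    have "Q oo N = (N oo N\<star> oo N) oo W" by (simp add: Q_def WN)
    also have "\<dots> = (N oo Z) oo W" by (simp only: ZN)
    finally show ?thesis by (simp add: W)
  qed
  have NQ: "N oo Q = Q" by (simp add: Q_def cp_subst[OF N(2)])
  have "Q oo Q = (Q oo N) oo N\<star> oo W" by (simp add: Q_def)
  also have "\<dots> = Q" unfolding QN by (simp add: Q_def)
  finally have "proj rho Q" using Q Qa by (simp add: proj_def)
  then show ?thesis using that QN NQ by blast
qed

text \<open>
  The conjugate of a subobject should be the range of the transpose of \<open>E\<close>. This transpose is idempotent but need
  not be self-adjoint, unless \<open>R\<close> and \<open>Rb\<close> are standard, so it is replaced by the projection with the same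
  range.
\<close>

lemma conj_subobject:
  assumes E: "proj rho E"
  obtains rhob Q R Rb where "proj rhob Q" "R \<in> homs (unt C) (rhob\<odot>rho)" "Rb \<in> homs (unt C) (rho\<odot>rhob)"
    "(Q**E) oo R = R" "(E**Q) oo Rb = Rb"
    "(Rb\<star>**E) oo (E**R) = E" "(R\<star>**Q) oo (Q**Rb) = Q"
proof -
  have Eh: "E \<in> homs rho rho" "E oo E = E" "E\<star> = E" using E by (auto simp: proj_def)
  note [simp] = Eh(1)[unfolded homs_iff]
  obtain rhob R Rb where c: "csol rho rhob R Rb" using conj_ex[of rho] csol_iff by auto
  note [simp] = csol_t[OF c]
  define P where "P = tps rhob R E Rb rhob"
  note P = tps[OF c c Eh(1), folded P_def]
  note [simp] = P(1)[unfolded homs_iff]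
  have PP: "P oo P = P"
  proof (rule csol_inj(1)[OF c])
    have "R\<star> oo ((P oo P)**idt rho) = (R\<star> oo (P**idt rho)) oo (P**idt rho)" by (simp add: tp_cp)
    also have "\<dots> = R\<star> oo ((idt rhob**E) oo (P**idt rho))" by (simp add: P)
    also have "(idt rhob**E) oo (P**idt rho) = (P**idt rho) oo (idt rhob**E)" by (simp add: ichg)
    also have "R\<star> oo \<dots> = (R\<star> oo (P**idt rho)) oo (idt rhob**E)" by simp
    also have "\<dots> = R\<star> oo ((idt rhob**E) oo (idt rhob**E))" by (simp add: P)
    also have "(idt rhob**E) oo (idt rhob**E) = idt rhob**E" by (simp add: ichg Eh)
    finally show "R\<star> oo ((P oo P)**idt rho) = R\<star> oo (P**idt rho)" by (simp add: P)
  qed simp_all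
  have "P\<star> oo P\<star> = P\<star>" using arg_cong[OF PP, of adj] by simp
  then obtain Q where Q: "proj rhob Q" "Q oo P\<star> = P\<star>" "P\<star> oo Q = Q"
    using range_projection[of "P\<star>" rhob] by (auto simp: homs_iff)
  have Qh: "Q \<in> homs rhob rhob" "Q oo Q = Q" "Q\<star> = Q" using Q(1) by (auto simp: proj_def)
  note [simp] = Qh(1)[unfolded homs_iff]
  have QP: "Q oo P = Q" using arg_cong[OF Q(3), of adj] Qh by simp
  have PR: "(P\<star>**idt rho) oo R = (idt rhob**E) oo R" using arg_cong[OF P(2), of adj] by (simp add: Eh)
  have R1: "(Q**E) oo R = (idt rhob**E) oo R"
  proof -
    have "(Q**E) oo R = (Q**idt rho) oo (idt rhob**E) oo R" using cp_subst[of "Q**idt rho" "idt rhob**E" "Q**E" R] by (simp add: ichg)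
    also have "\<dots> = ((Q**idt rho) oo (P\<star>**idt rho)) oo R" by (simp add: PR)
    also have "(Q**idt rho) oo (P\<star>**idt rho) = P\<star>**idt rho" by (simp add: ichg Q)
    finally show ?thesis by (simp add: PR)
  qed
  have Rb1: "(E**Q) oo Rb = (idt rho**Q) oo Rb"
  proof -
    have "(E**Q) oo Rb = (idt rho**Q) oo (E**idt rhob) oo Rb" using cp_subst[of "idt rho**Q" "E**idt rhob" "E**Q" Rb] by (simp add: ichg)
    also have "\<dots> = ((idt rho**Q) oo (idt rho**P)) oo Rb" by (simp add: P)
    also have "(idt rho**Q) oo (idt rho**P) = idt rho**Q" by (simp add: ichg QP)
    finally show ?thesis .
  qed
  define R' where "R' = (Q**E) oo R"
  define Rb' where "Rb' = (E**Q) oo Rb"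
  have qe: "(Q**E) oo (Q**E) = Q**E" "(E**Q) oo (E**Q) = E**Q" by (simp_all add: ichg Qh Eh)
  have z1: "(Rb'\<star>**E) oo (E**R') = E"
  proof -
    have "(Rb'\<star>**E) oo (E**R') = ((Rb\<star>**idt rho) oo (E**Q**E)) oo ((E**Q**E) oo (idt rho**R))"
    proof -
      have "Rb'\<star>**E = (Rb\<star>**idt rho) oo (E**Q**E)"
        using ichg[of "Rb\<star>" "E**Q" "idt rho" E] by (simp add: Rb'_def Qh Eh)
      moreover have "E**R' = (E**Q**E) oo (idt rho**R)"
        using ichg[of E "idt rho" "Q**E" R] by (simp add: R'_def)
      ultimately show ?thesis by simp
    qed
    also have "\<dots> = (Rb\<star>**idt rho) oo ((E**Q**E) oo (E**Q**E)) oo (idt rho**R)" by simp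
    also have "(E**Q**E) oo (E**Q**E) = E**(Q**E)" by (simp add: ichg Qh Eh)
    also have "(E**(Q**E)) oo (idt rho**R) = E**((idt rhob**E) oo R)" by (simp add: ichg R1)
    also have "\<dots> = (E**idt rhob**E) oo (idt rho**R)" by (simp add: ichg)
    also have "E**idt rhob**E = (idt (rho\<odot>rhob)**E) oo (E**idt (rhob\<odot>rho))"
    proof -
      have "E**idt rhob**E = (idt rho**idt rhob**E) oo (E**idt rhob**idt rho)" by (simp add: ichg del: tp_idt tp_idt')
      then show ?thesis by simp
    qed
    also have "(Rb\<star>**idt rho) oo ((idt (rho\<odot>rhob)**E) oo (E**idt (rhob\<odot>rho))) oo (idt rho**R) =
        ((Rb\<star>**idt rho) oo (idt (rho\<odot>rhob)**E)) oo ((E**idt (rhob\<odot>rho)) oo (idt rho**R))" by simp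
    also have "(Rb\<star>**idt rho) oo (idt (rho\<odot>rhob)**E) = E oo (Rb\<star>**idt rho)"
      using exch[of "Rb\<star>" E _ _ _ _ "unt C" "unt C" "unt C", OF _ _ refl refl refl refl] by simp
    also have "(E**idt (rhob\<odot>rho)) oo (idt rho**R) = (idt rho**R) oo E"
      using exch[of E R _ _ _ _ "unt C" "unt C" "unt C", OF _ _ refl refl refl refl] by simp
    also have "(E oo (Rb\<star>**idt rho)) oo ((idt rho**R) oo E) = E"
      by (simp add: cp_subst[OF csol_zz(1)[OF c]] Eh)
    finally show ?thesis .
  qed
  have z2: "(R'\<star>**Q) oo (Q**Rb') = Q"
  proof -
    have "(R'\<star>**Q) oo (Q**Rb') = ((R\<star>**idt rhob) oo (Q**E**Q)) oo ((Q**E**Q) oo (idt rhob**Rb))"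
    proof -
      have "R'\<star>**Q = (R\<star>**idt rhob) oo (Q**E**Q)"
        using ichg[of "R\<star>" "Q**E" "idt rhob" Q] by (simp add: R'_def Qh Eh)
      moreover have "Q**Rb' = (Q**E**Q) oo (idt rhob**Rb)"
        using ichg[of Q "idt rhob" "E**Q" Rb] by (simp add: Rb'_def)
      ultimately show ?thesis by simp
    qed
    also have "\<dots> = (R\<star>**idt rhob) oo ((Q**E**Q) oo (Q**E**Q)) oo (idt rhob**Rb)" by simp
    also have "(Q**E**Q) oo (Q**E**Q) = Q**(E**Q)" by (simp add: ichg Qh Eh)
    also have "(Q**(E**Q)) oo (idt rhob**Rb) = Q**((idt rho**Q) oo Rb)" by (simp add: ichg Rb1)
    also have "\<dots> = (Q**idt rho**Q) oo (idt rhob**Rb)" by (simp add: ichg)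
    also have "Q**idt rho**Q = (idt (rhob\<odot>rho)**Q) oo (Q**idt (rho\<odot>rhob))"
    proof -
      have "Q**idt rho**Q = (idt rhob**idt rho**Q) oo (Q**idt rho**idt rhob)" by (simp add: ichg del: tp_idt tp_idt')
      then show ?thesis by simp
    qed
    also have "(R\<star>**idt rhob) oo ((idt (rhob\<odot>rho)**Q) oo (Q**idt (rho\<odot>rhob))) oo (idt rhob**Rb) =
        ((R\<star>**idt rhob) oo (idt (rhob\<odot>rho)**Q)) oo ((Q**idt (rho\<odot>rhob)) oo (idt rhob**Rb))" by simp
    also have "(R\<star>**idt rhob) oo (idt (rhob\<odot>rho)**Q) = Q oo (R\<star>**idt rhob)"
      using exch[of "R\<star>" Q _ _ _ _ "unt C" "unt C" "unt C", OF _ _ refl refl refl refl] by simp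
    also have "(Q**idt (rho\<odot>rhob)) oo (idt rhob**Rb) = (idt rhob**Rb) oo Q"
      using exch[of Q Rb _ _ _ _ "unt C" "unt C" "unt C", OF _ _ refl refl refl refl] by simp
    also have "(Q oo (R\<star>**idt rhob)) oo ((idt rhob**Rb) oo Q) = Q"
      by (simp add: cp_subst[OF csol_zz(2)[OF c]] Qh)
    finally show ?thesis .
  qed
  show ?thesis
    by (rule that[OF Q(1), of R' Rb', OF _ _ _ _ z1 z2])
       (simp_all add: R'_def Rb'_def homs_iff cp_subst[OF qe(1)] cp_subst[OF qe(2)])
qed

end

text \<open>
  The records of a \<open>pre_BTC\<close> have no further fields, as required by \<open>subobject_closure\<close>.
\<close>

locale pre_BTC = pre_BTC_star C for C :: "('o, 'a::ab_group_add) tcat" (structure)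
begin

definition Sc where "Sc = subobject_closure C"

lemma Sc_simps:
  "Obj Sc = {(rho, E). rho \<in> Obj C \<and> projection C rho E}"
  "HomV Sc = (\<lambda>A B. {vect (snd B \<cdot> f \<cdot> snd A) | f. f \<in> Hom C (fst A) (fst B)})"
  "scl Sc = scl C" "idn Sc A = Arrow A A (vect (snd A))"
  "cmp Sc f g = Arrow (src g) (tgt f) (vect (under f \<cdot> under g))"
  "unt Sc = (unt C, idn C (unt C))" "tob Sc = sub_tob C"
  "tar Sc f g = Arrow (sub_tob C (src f) (src g)) (sub_tob C (tgt f) (tgt g)) (vect (under f \<boxtimes> under g))"
  "star Sc f = Arrow (tgt f) (src f) (vect (star C (under f)))"
  "brd Sc A B = Arrow (sub_tob C A B) (sub_tob C B A)
     (vect ((snd B \<boxtimes> snd A) \<cdot> brd C (fst A) (fst B) \<cdot> (snd A \<boxtimes> snd B)))"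
  by (simp_all add: Sc_def subobject_closure_def)

definition so :: "('o, 'a) sub_obj \<Rightarrow> bool" where
  "so A \<longleftrightarrow> ob (fst A) \<and> proj (fst A) (snd A)"

lemma so_Obj: "A \<in> Obj Sc \<longleftrightarrow> so A"
  by (cases A) (auto simp: Sc_simps so_def proj_iff)

lemma soD: assumes "so A"
  shows "ob (fst A)" "arr (snd A)" "src (snd A) = fst A" "tgt (snd A) = fst A" "snd A oo snd A = snd A" "(snd A)\<star> = snd A"
  using assms by (auto simp: so_def proj_def homs_iff)

lemma so_sub: "so A \<Longrightarrow> arr f \<Longrightarrow> tgt f = fst A \<Longrightarrow> snd A oo snd A oo f = snd A oo f"
  using cp_subst[OF soD(5), of A f] soD[of A] by simp

lemma under_simps [simp]: "src (under f) = fst (src f)" "tgt (under f) = fst (tgt f)" "vect (under f) = vect f"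
  by (simp_all add: under_def)

lemma under_ops [simp]:
  "under (cmp Sc f g) = under f oo under g" "under (star Sc f) = (under f)\<star>"
  "under (tar Sc f g) = under f**under g"
  "under (arr_add f g) = under f \<boxplus> under g" "under (arr_scl Sc c f) = c *> under f"
  "under (arr_zero A B) = arr_zero (fst A) (fst B)" "so A \<Longrightarrow> under (idn Sc A) = snd A"
  by (auto simp: under_def Sc_simps cp_def adj_def tp_def sub_tob_def arr_add_def arr_scl_def arr_zero_def
      intro!: arrow.expand dest: soD(3,4))

lemma Sc_src_tgt [simp]:
  "src (cmp Sc f g) = src g" "tgt (cmp Sc f g) = tgt f" "src (star Sc f) = tgt f" "tgt (star Sc f) = src f"
  "src (tar Sc f g) = sub_tob C (src f) (src g)" "tgt (tar Sc f g) = sub_tob C (tgt f) (tgt g)"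
  "src (idn Sc A) = A" "tgt (idn Sc A) = A" "src (brd Sc A B) = sub_tob C A B" "tgt (brd Sc A B) = sub_tob C B A"
  "src (arr_scl Sc c f) = src f" "tgt (arr_scl Sc c f) = tgt f" "src (arr_add f g) = src f" "tgt (arr_add f g) = tgt f"
  "src (arr_zero A B) = A" "tgt (arr_zero A B) = B"
  by (simp_all add: Sc_simps arr_scl_def arr_add_def arr_zero_def)

lemma sub_tob_simps: assumes "so A" "so B"
  shows "snd (sub_tob C A B) = snd A**snd B" "so (sub_tob C A B)"
proof -
  note [simp] = soD[OF assms(1)] soD[OF assms(2)]
  show 1: "snd (sub_tob C A B) = snd A**snd B" by (simp add: sub_tob_def tp_eq)
  show "so (sub_tob C A B)" unfolding so_def proj_def 1 by (simp add: sub_tob_def homs_iff ichg)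
qed

lemma fst_sub_tob [simp]: "fst (sub_tob C A B) = fst A\<odot>fst B" by (simp add: sub_tob_def)

lemma under_brd: assumes "so A" "so B"
  shows "under (brd Sc A B) = (snd B**snd A) oo br (fst A) (fst B)" "under (brd Sc A B) = br (fst A) (fst B) oo (snd A**snd B)"
proof -
  note [simp] = soD[OF assms(1)] soD[OF assms(2)]
  have "under (brd Sc A B) = (snd B**snd A) oo br (fst A) (fst B) oo (snd A**snd B)"
    by (intro arrow.expand) (simp add: Sc_simps br_eq tp_eq cp_eq under_def)
  moreover have n: "br (fst A) (fst B) oo (snd A**snd B) = (snd B**snd A) oo br (fst A) (fst B)"
    using br_nat[of "snd A" "snd B" "fst A" "fst B"] by simp
  moreover have e: "(snd B**snd A) oo (snd B**snd A) = snd B**snd A" by (simp add: ichg)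
  ultimately show "under (brd Sc A B) = (snd B**snd A) oo br (fst A) (fst B)" "under (brd Sc A B) = br (fst A) (fst B) oo (snd A**snd B)"
    using cp_subst[OF e, of "br (fst A) (fst B)"] by simp_all
qed

text \<open>
  The elements of \<open>E' \<circ> Hom \<circ> E\<close> are the arrows fixed by composition with \<open>E'\<close> and \<open>E\<close>, a condition that is
  easily checked for the results of the operations.
\<close>

definition uh :: "('o, 'a) sub_obj \<Rightarrow> ('o, 'a) sub_obj \<Rightarrow> (('o, 'a) sub_obj, 'a) arrow \<Rightarrow> bool" where
  "uh A B f \<longleftrightarrow> src f = A \<and> tgt f = B \<and> arr (under f) \<and> snd B oo under f = under f \<and> under f oo snd A = under f"

lemma uh_Hom: assumes "so A" "so B" shows "f \<in> Hom Sc A B \<longleftrightarrow> uh A B f"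
proof -
  note [simp] = soD[OF assms(1)] soD[OF assms(2)]
  have "f \<in> Hom Sc A B \<longleftrightarrow> src f = A \<and> tgt f = B \<and> (\<exists>g. vect f = vect (snd B \<cdot> g \<cdot> snd A) \<and> g \<in> Hom C (fst A) (fst B))"
    by (cases f) (auto simp: Hom_def[of Sc] Sc_simps)
  also have "\<dots> \<longleftrightarrow> uh A B f"
  proof
    assume h: "src f = A \<and> tgt f = B \<and> (\<exists>g. vect f = vect (snd B \<cdot> g \<cdot> snd A) \<and> g \<in> Hom C (fst A) (fst B))"
    then obtain g where g: "vect f = vect (snd B \<cdot> g \<cdot> snd A)" "g \<in> homs (fst A) (fst B)" by (auto simp: homs_Hom)
    note [simp] = g(2)[unfolded homs_iff]
    have u: "under f = snd B oo g oo snd A" using h g by (intro arrow.expand) (simp add: cp_eq)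
    show "uh A B f" unfolding uh_def u using h assms by (simp add: so_sub)
  next
    assume h: "uh A B f"
    then have u: "arr (under f)" "snd B oo under f = under f" "under f oo snd A = under f" "src f = A" "tgt f = B" by (auto simp: uh_def)
    have "snd B \<cdot> under f \<cdot> snd A = under f" using u by (simp add: cp_eq)
    then show "src f = A \<and> tgt f = B \<and> (\<exists>g. vect f = vect (snd B \<cdot> g \<cdot> snd A) \<and> g \<in> Hom C (fst A) (fst B))"
      using u by (intro conjI exI[of _ "under f"]) auto
  qed
  finally show ?thesis .
qed

text \<open>
  With this rule all axioms for the closure become equations between arrows of \<open>C\<close>.
\<close>

lemma ueq: "src f = src g \<Longrightarrow> tgt f = tgt g \<Longrightarrow> under f = under g \<Longrightarrow> f = g"
  by (metis arrow.expand under_simps(3))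

lemma HomV_Sc: assumes "so A" "so B"
  shows "v \<in> HomV Sc A B \<longleftrightarrow> uh A B (Arrow A B v)"
  using uh_Hom[OF assms, of "Arrow A B v"] by (auto simp: Hom_def)

lemma HomV_Sc_subspace: assumes "so A" "so B" shows "V.subspace (HomV Sc A B)"
proof (rule V.subspaceI)
  note [simp] = soD[OF assms(1)] soD[OF assms(2)]
  have z: "under (Arrow A B 0) = arr_zero (fst A) (fst B)" by (simp add: under_def arr_zero_def)
  show "0 \<in> HomV Sc A B" by (simp add: HomV_Sc assms uh_def z)
  fix x y assume "x \<in> HomV Sc A B" "y \<in> HomV Sc A B"
  moreover have "under (Arrow A B (x + y)) = under (Arrow A B x) \<boxplus> under (Arrow A B y)" by (simp add: under_def arr_add_def)
  ultimately show "x + y \<in> HomV Sc A B" by (simp add: HomV_Sc assms uh_def cp_add)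
next
  note [simp] = soD[OF assms(1)] soD[OF assms(2)]
  fix c x assume "x \<in> HomV Sc A B"
  moreover have "under (Arrow A B (scl C c x)) = c *> under (Arrow A B x)" by (simp add: under_def arr_scl_def)
  ultimately show "scl C c x \<in> HomV Sc A B" by (simp add: HomV_Sc assms uh_def)
qed

lemma uhD: "uh A B f \<Longrightarrow> src f = A" "uh A B f \<Longrightarrow> tgt f = B" "uh A B f \<Longrightarrow> arr (under f)"
  "uh A B f \<Longrightarrow> snd B oo under f = under f" "uh A B f \<Longrightarrow> under f oo snd A = under f"
  by (auto simp: uh_def)

lemma so_unt: "so (unt Sc)" "snd (unt Sc) = idt (unt C)" "fst (unt Sc) = unt C"
  by (auto simp: so_def proj_def Sc_simps homs_iff idt_eq)

lemma uh_cmp: assumes o: "so A" "so B" "so J" and f: "uh B J f" and g: "uh A B g" shows "uh A J (cmp Sc f g)"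
proof -
  note [simp] = soD[OF o(1)] soD[OF o(2)] soD[OF o(3)] uhD[OF f] uhD[OF g]
  show ?thesis by (simp add: uh_def cp_subst[OF uhD(4)[OF f]])
qed

lemma uh_tar: assumes o: "so A" "so B" "so A'" "so B'" and f: "uh A B f" and g: "uh A' B' g"
  shows "uh (sub_tob C A A') (sub_tob C B B') (tar Sc f g)"
proof -
  note [simp] = soD[OF o(1)] soD[OF o(2)] soD[OF o(3)] soD[OF o(4)] uhD[OF f] uhD[OF g]
  show ?thesis using o by (simp add: uh_def sub_tob_simps ichg)
qed

lemma uh_star: assumes o: "so A" "so B" and f: "uh A B f" shows "uh B A (star Sc f)"
proof -
  have "snd A oo (under f)\<star> = (under f)\<star>"
    using arg_cong[OF uhD(5)[OF f], of adj] soD[OF o(1)] uhD(1-3)[OF f] by simp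
  moreover have "(under f)\<star> oo snd B = (under f)\<star>"
    using arg_cong[OF uhD(4)[OF f], of adj] soD[OF o(2)] uhD(1-3)[OF f] by simp
  ultimately show ?thesis using uhD(1-3)[OF f] by (simp add: uh_def)
qed

lemma sub_tob_assoc: "so A \<Longrightarrow> so B \<Longrightarrow> so J \<Longrightarrow> sub_tob C (sub_tob C A B) J = sub_tob C A (sub_tob C B J)"
  using sub_tob_simps[of A B] sub_tob_simps[of B J] sub_tob_simps[of "sub_tob C A B" J] sub_tob_simps[of A "sub_tob C B J"]
    soD[of A] soD[of B] soD[of J]
  by (intro prod_eqI) simp_all

lemma sub_tob_unt: "so A \<Longrightarrow> sub_tob C (unt Sc) A = A" "so A \<Longrightarrow> sub_tob C A (unt Sc) = A"
  using sub_tob_simps[OF so_unt(1), of A] sub_tob_simps[OF _ so_unt(1), of A] soD[of A] by (auto intro!: prod_eqI simp: so_unt)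

lemma tsc_Sc: "tensor_star_category Sc"
proof (unfold_locales, unfold so_Obj, goal_cases)
  case 1 show ?case using vs unfolding Sc_simps vector_space_def by blast
next
  case 2 show ?case using vs unfolding Sc_simps vector_space_def by blast
next
  case 3 show ?case using vs unfolding Sc_simps vector_space_def by blast
next
  case 4 show ?case using vs unfolding Sc_simps vector_space_def by blast
next
  case (5 A B) then show ?case using HomV_Sc_subspace[of A B] by (simp only: Sc_simps(3))
next
  case (6 A) then show ?case using soD[of A] by (simp add: uh_Hom uh_def)
next
  case (7 A B J f g) then show ?case using uh_cmp by (simp add: uh_Hom)
next
  case (8 A B f) then show ?case by (intro ueq) (simp_all add: uh_Hom uh_def)
next
  case (9 A B f) then show ?case by (intro ueq) (simp_all add: uh_Hom uh_def)
next
  case (10 A B J G f g h) then show ?case by (intro ueq) (auto simp add: uh_Hom uh_def)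
next
  case (11 A B J f f' g) then show ?case by (intro ueq) (auto simp add: uh_Hom uh_def cp_add)
next
  case (12 A B J f g g') then show ?case by (intro ueq) (auto simp add: uh_Hom uh_def cp_add)
next
  case (13 A B J f g c) then show ?case by (intro ueq) (auto simp add: uh_Hom uh_def)
next
  case (14 A B J f g c) then show ?case by (intro ueq) (auto simp add: uh_Hom uh_def)
next
  case 15 show ?case by (rule so_unt)
next
  case (16 A B) then show ?case by (simp add: Sc_simps sub_tob_simps)
next
  case (17 A B J) then show ?case by (simp add: Sc_simps sub_tob_assoc)
next
  case (18 A) then show ?case using sub_tob_unt by (simp only: Sc_simps(7))
next
  case (19 A) then show ?case using sub_tob_unt by (simp only: Sc_simps(7))
next
  case (20 A B A' B' f g)
  then show ?case using uh_tar[of A B A' B' f g] sub_tob_simps[of A A'] sub_tob_simps[of B B'] by (simp add: Sc_simps(7) uh_Hom)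
next
  case (21 A B A' B' A'' B'' f g h)
  then have u: "uh A B f" "uh A' B' g" "uh A'' B'' h" by (auto simp: uh_Hom)
  show ?case by (rule ueq) (use 21(1-6) in \<open>simp_all add: uhD[OF u(1)] uhD[OF u(2)] uhD[OF u(3)] sub_tob_assoc\<close>)
next
  case (22 A B f)
  then have u: "uh A B f" by (auto simp: uh_Hom)
  show ?case by (rule ueq) (use 22(1-2) in \<open>simp_all add: uhD[OF u] sub_tob_unt so_unt\<close>)
next
  case (23 A B f)
  then have u: "uh A B f" by (auto simp: uh_Hom)
  show ?case by (rule ueq) (use 23(1-2) in \<open>simp_all add: uhD[OF u] sub_tob_unt so_unt\<close>)
next
  case (24 A B) then show ?case by (intro ueq) (simp_all add: Sc_simps(7) sub_tob_simps)
next
  case (25 A B J A' B' J' f g f' g')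
  then have u: "uh B J f" "uh A B g" "uh B' J' f'" "uh A' B' g'" by (auto simp: uh_Hom)
  show ?case by (rule ueq) (simp_all add: uhD[OF u(1)] uhD[OF u(2)] uhD[OF u(3)] uhD[OF u(4)] ichg)
next
  case (26 A B A' B' f f' g) then show ?case by (intro ueq) (auto simp add: uh_Hom uh_def tp_add)
next
  case (27 A B A' B' f g g') then show ?case by (intro ueq) (auto simp add: uh_Hom uh_def tp_add)
next
  case (28 A B A' B' f g c) then show ?case by (intro ueq) (auto simp add: uh_Hom uh_def)
next
  case (29 A B A' B' f g c) then show ?case by (intro ueq) (auto simp add: uh_Hom uh_def)
next
  case (30 A B f) then show ?case using uh_star by (simp add: uh_Hom)
next
  case (31 A B f) then show ?case by (intro ueq) (auto simp add: uh_Hom uh_def)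
next
  case (32 A B f g) then show ?case by (intro ueq) (auto simp add: uh_Hom uh_def adj_add)
next
  case (33 A B f c) then show ?case by (intro ueq) (auto simp add: uh_Hom uh_def)
next
  case (34 A B J f g) then show ?case by (intro ueq) (auto simp add: uh_Hom uh_def)
next
  case (35 A B A' B' f g) then show ?case by (intro ueq) (auto simp add: uh_Hom uh_def)
next
  case (36 A B f)
  then have u: "uh A B f" by (auto simp: uh_Hom)
  have "under (cmp Sc (star Sc f) f) = arr_zero (fst A) (fst A)" using 36(4) by simp
  then have "under f = arr_zero (fst A) (fst B)" using pos[of "under f" "fst A" "fst B"] by (simp add: uhD[OF u])
  then show ?case by (intro ueq) (simp_all add: uhD[OF u])
qed

lemma pre_Sc: "pre_BTC_star Sc"
proof -
  interpret T: tensor_star_category Sc by (rule tsc_Sc)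
  have oneH: "uh (unt Sc) (unt Sc) (idn Sc (unt Sc))" using so_unt by (simp add: uh_def)
  show ?thesis
  proof (unfold_locales, unfold so_Obj, goal_cases)
    case (1 A)
    note [simp] = soD[OF 1]
    obtain rhob Q R Rb where c: "proj rhob Q" "R \<in> homs (unt C) (rhob\<odot>fst A)" "Rb \<in> homs (unt C) (fst A\<odot>rhob)"
      "(Q**snd A) oo R = R" "(snd A**Q) oo Rb = Rb"
      "(Rb\<star>**snd A) oo (snd A**R) = snd A" "(R\<star>**Q) oo (Q**Rb) = Q"
      using conj_subobject[of "fst A" "snd A"] 1 unfolding so_def by metis
    define B where "B = (rhob, Q)"
    have B: "so B" "fst B = rhob" "snd B = Q" using c(1) by (auto simp: B_def so_def proj_def homs_iff)
    note [simp] = soD[OF B(1)] B(2,3) c(2,3)[unfolded homs_iff]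
    define r where "r = Arrow (unt Sc) (sub_tob C B A) (vect R)"
    define rb where "rb = Arrow (unt Sc) (sub_tob C A B) (vect Rb)"
    have st [simp]: "src r = unt Sc" "tgt r = sub_tob C B A" "src rb = unt Sc" "tgt rb = sub_tob C A B" by (simp_all add: r_def rb_def)
    have un [simp]: "under r = R" "under rb = Rb" by (auto intro!: arrow.expand simp: so_unt) (simp_all add: r_def rb_def)
    have h: "uh (unt Sc) (sub_tob C B A) r" "uh (unt Sc) (sub_tob C A B) rb"
      using 1 B c(4,5) by (simp_all add: uh_def sub_tob_simps so_unt)
    have "conj_solution Sc A B r rb" unfolding conj_solution_def so_Obj
    proof (intro conjI)
      show "r \<in> Hom Sc (unt Sc) (tob Sc B A)" "rb \<in> Hom Sc (unt Sc) (tob Sc A B)"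
        using h 1 B sub_tob_simps so_unt by (simp_all add: Sc_simps(7) uh_Hom)
      show "cmp Sc (tar Sc (star Sc rb) (idn Sc A)) (tar Sc (idn Sc A) r) = idn Sc A"
        by (rule ueq) (use 1 B c in \<open>simp_all add: sub_tob_unt\<close>)
      show "cmp Sc (tar Sc (star Sc r) (idn Sc B)) (tar Sc (idn Sc B) rb) = idn Sc B"
        by (rule ueq) (use 1 B c in \<open>simp_all add: sub_tob_unt\<close>)
    qed (use 1 B in simp_all)
    then show ?case by blast
  next
    case (2 A B)
    note [simp] = soD[OF 2(1)] soD[OF 2(2)]
    obtain tau V W where d: "ob tau" "V \<in> homs (fst A) tau" "W \<in> homs (fst B) tau" "V\<star> oo V = idt (fst A)" "W\<star> oo W = idt (fst B)"
      "W\<star> oo V = arr_zero (fst A) (fst B)" "V\<star> oo W = arr_zero (fst B) (fst A)" "(V oo V\<star>) \<boxplus> (W oo W\<star>) = idt tau"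
      by (rule dsum[of "fst A" "fst B"]) simp_all
    note [simp] = d(1) d(2,3)[unfolded homs_iff]
    \<comment> \<open>The direct sum of two subobjects is a subobject of the direct sum.\<close>
    define E where "E = (V oo snd A oo V\<star>) \<boxplus> (W oo snd B oo W\<star>)"
    have E: "E \<in> homs tau tau" by (simp add: E_def homs_iff)
    note [simp] = E[unfolded homs_iff]
    have EV: "E oo V = V oo snd A" "E oo W = W oo snd B"
      by (auto intro!: arrow.expand simp: E_def cp_add d)
    have VE: "E oo V oo X = V oo snd A oo X" if "arr X" "tgt X = fst A" for X
      using that cp_subst[OF EV(1), of X] by simp
    have WE: "E oo W oo X = W oo snd B oo X" if "arr X" "tgt X = fst B" for X
      using that cp_subst[OF EV(2), of X] by simp
    have "E oo E = (E oo V oo snd A oo V\<star>) \<boxplus> (E oo W oo snd B oo W\<star>)"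
      by (subst (2) E_def) (simp add: cp_add)
    also have "\<dots> = E" using 2 by (simp add: VE WE so_sub) (simp add: E_def)
    finally have EE: "E oo E = E" .
    have Ed: "E\<star> = E" by (simp add: E_def adj_add)
    define J where "J = (tau, E)"
    have J: "so J" "fst J = tau" "snd J = E" using E EE Ed by (auto simp: J_def so_def proj_def)
    note [simp] = soD[OF J(1)] J(2,3)
    define v where "v = Arrow A J (vect (V oo snd A))"
    define w where "w = Arrow B J (vect (W oo snd B))"
    have st [simp]: "src v = A" "tgt v = J" "src w = B" "tgt w = J" by (simp_all add: v_def w_def)
    have un [simp]: "under v = V oo snd A" "under w = W oo snd B"
      by (auto intro!: arrow.expand) (simp_all add: v_def w_def)
    have h: "uh A J v" "uh B J w" using 2 by (auto simp: uh_def VE WE so_sub)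
    have "isometry Sc A J v" unfolding isometry_def
    proof
      show "v \<in> Hom Sc A J" using h 2 J uh_Hom by blast
      show "cmp Sc (star Sc v) v = idn Sc A" by (rule ueq) (use 2 in \<open>simp_all add: cp_subst[OF d(4)]\<close>)
    qed
    moreover have "isometry Sc B J w" unfolding isometry_def
    proof
      show "w \<in> Hom Sc B J" using h 2 J uh_Hom by blast
      show "cmp Sc (star Sc w) w = idn Sc B" by (rule ueq) (use 2 in \<open>simp_all add: cp_subst[OF d(5)]\<close>)
    qed
    moreover have "arr_add (cmp Sc v (star Sc v)) (cmp Sc w (star Sc w)) = idn Sc J"
      by (rule ueq) (use 2 J(1) in \<open>simp_all add: so_sub\<close>, simp add: E_def)
    ultimately show ?case using J(1) by (intro bexI[of _ J] exI conjI) (auto simp: so_Obj)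
  next
    case (3 A B)
    note [simp] = soD[OF 3(1)] soD[OF 3(2)]
    obtain B0 where B0: "finite B0" "HomV C (fst A) (fst B) = V.span B0" using fin_dim[of "fst A" "fst B"] by auto
    have s: "V.subspace (HomV Sc A B)" by (rule HomV_Sc_subspace[OF 3])
    have sub: "HomV Sc A B \<subseteq> V.span B0"
    proof
      fix v assume "v \<in> HomV Sc A B"
      then have "under (Arrow A B v) \<in> homs (fst A) (fst B)" using 3 by (simp add: HomV_Sc uh_def homs_iff)
      then show "v \<in> V.span B0" using B0(2) by (simp add: homs_Hom Hom_iff)
    qed
    obtain B1 where B1: "B1 \<subseteq> HomV Sc A B" "V.independent B1" "HomV Sc A B \<subseteq> V.span B1" using V.basis_exists[of "HomV Sc A B"] by metis
    have "B1 \<subseteq> V.span B0" by (rule subset_trans[OF B1(1) sub])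
    then have "finite B1" using V.independent_span_bound[OF B0(1) B1(2)] by simp
    moreover have "HomV Sc A B = V.span B1" by (rule equalityI[OF B1(3) V.span_minimal[OF B1(1) s]])
    ultimately show ?case unfolding Sc_simps(3) by blast
  next
    case 4
    have "idn Sc (unt Sc) \<noteq> arr_zero (unt Sc) (unt Sc)"
    proof
      assume "idn Sc (unt Sc) = arr_zero (unt Sc) (unt Sc)"
      then have "under (idn Sc (unt Sc)) = under (arr_zero (unt Sc) (unt Sc))" by (rule arg_cong)
      then show False using so_unt irr_ne'[OF unt_irr] by simp
    qed
    moreover have "Hom Sc (unt Sc) (unt Sc) = range (\<lambda>c. arr_scl Sc c (idn Sc (unt Sc)))"
    proof (intro equalityI subsetI)
      fix f assume "f \<in> Hom Sc (unt Sc) (unt Sc)"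
      then have u: "uh (unt Sc) (unt Sc) f" using so_unt uh_Hom by blast
      then have "under f \<in> homs (unt C) (unt C)" by (simp add: homs_iff uh_def so_unt)
      then obtain c where "under f = c *> idt (unt C)" using unt_scalar by blast
      then have "f = arr_scl Sc c (idn Sc (unt Sc))" by (intro ueq) (simp_all add: uhD[OF u] so_unt)
      then show "f \<in> range (\<lambda>c. arr_scl Sc c (idn Sc (unt Sc)))" by blast
    next
      fix f assume "f \<in> range (\<lambda>c. arr_scl Sc c (idn Sc (unt Sc)))"
      then obtain c where f: "f = arr_scl Sc c (idn Sc (unt Sc))" by blast
      have "uh (unt Sc) (unt Sc) f" using so_unt by (simp add: f uh_def)
      then show "f \<in> Hom Sc (unt Sc) (unt Sc)" using so_unt uh_Hom by blast
    qed
    ultimately show ?case unfolding irreducible_obj_def so_Obj using so_unt by blast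
  next
    case (5 A B)
    note [simp] = soD[OF 5(1)] soD[OF 5(2)]
    have e: "(snd B**snd A) oo (snd B**snd A) = snd B**snd A" "(snd A**snd B) oo (snd A**snd B) = snd A**snd B"
      by (simp_all add: ichg)
    have "(snd B**snd A) oo under (brd Sc A B) = under (brd Sc A B)"
      using cp_subst[OF e(1), of "br (fst A) (fst B)"] by (simp add: under_brd(1)[OF 5])
    moreover have "under (brd Sc A B) oo (snd A**snd B) = under (brd Sc A B)"
      by (simp add: under_brd(2)[OF 5] e(2))
    moreover have "arr (under (brd Sc A B))" by (simp add: under_brd(1)[OF 5])
    ultimately have "uh (sub_tob C A B) (sub_tob C B A) (brd Sc A B)"
      using 5 by (simp add: uh_def sub_tob_simps)
    then show ?case using 5 sub_tob_simps by (simp add: Sc_simps(7) uh_Hom)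
  next
    case (6 A B)
    note [simp] = soD[OF 6(1)] soD[OF 6(2)]
    have e: "(snd B**snd A) oo (snd B**snd A) = snd B**snd A" "(snd A**snd B) oo (snd A**snd B) = snd A**snd B"
      by (simp_all add: ichg)
    let ?b = "br (fst A) (fst B)"
    have n: "?b oo (snd A**snd B) = (snd B**snd A) oo ?b" using under_brd[OF 6] by simp
    have "under (cmp Sc (star Sc (brd Sc A B)) (brd Sc A B)) = snd A**snd B"
      by (simp only: under_ops, simp add: under_brd(2)[OF 6] cp_subst[OF br_adj(1)] e)
    moreover have "under (cmp Sc (brd Sc A B) (star Sc (brd Sc A B))) = snd B**snd A"
      by (simp only: under_ops, simp add: under_brd(1)[OF 6] cp_subst[OF br_adj(2)] e)
    ultimately show ?case
      using 6 sub_tob_simps[of A B] sub_tob_simps[of B A] by (intro conjI ueq) (simp_all add: Sc_simps(7))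
  next
    case (7 A B A' B' f g)
    then have u: "uh A A' f" "uh B B' g" by (auto simp: uh_Hom)
    note [simp] = soD[OF 7(1)] soD[OF 7(2)] soD[OF 7(3)] soD[OF 7(4)] uhD[OF u(1)] uhD[OF u(2)]
    have "under (cmp Sc (brd Sc A' B') (tar Sc f g)) = br (fst A') (fst B') oo (under f**under g)"
      by (simp only: under_ops under_brd(2)[OF 7(3,4)]) (simp add: ichg)
    also have "\<dots> = (under g**under f) oo br (fst A) (fst B)" by (subst br_nat) simp_all
    also have "\<dots> = under (cmp Sc (tar Sc g f) (brd Sc A B))"
    proof -
      have "(under g**under f) oo (snd B**snd A) = under g**under f" by (simp add: ichg)
      from cp_subst[OF this, of "br (fst A) (fst B)"] show ?thesis by (simp only: under_ops under_brd(1)[OF 7(1,2)]) simp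
    qed
    finally show ?case by (intro ueq) simp_all
  next
    case (8 A B J)
    note [simp] = soD[OF 8(1)] soD[OF 8(2)] soD[OF 8(3)]
    have u1: "under (brd Sc A (sub_tob C B J)) = br (fst A) (fst B\<odot>fst J) oo (snd A**snd B**snd J)"
      using under_brd(2)[of A "sub_tob C B J"] 8 sub_tob_simps[of B J] by simp
    have "(snd B**(br (fst A) (fst J) oo (snd A**snd J))) oo ((br (fst A) (fst B) oo (snd A**snd B))**snd J)
      = br (fst A) (fst B\<odot>fst J) oo (snd A**snd B**snd J)"
    proof -
      have 1: "snd B**(br (fst A) (fst J) oo (snd A**snd J)) = (idt (fst B)**br (fst A) (fst J)) oo (snd B**snd A**snd J)"
        by (simp add: ichg)
      have 2: "(br (fst A) (fst B) oo (snd A**snd B))**snd J = (br (fst A) (fst B)**idt (fst J)) oo (snd A**snd B**snd J)"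
        using ichg[of "br (fst A) (fst B)" "snd A**snd B" "idt (fst J)" "snd J"] by simp
      have 3: "(snd B**snd A**snd J) oo (br (fst A) (fst B)**idt (fst J)) = (br (fst A) (fst B)**idt (fst J)) oo (snd A**snd B**snd J)"
      proof -
        have "(snd B**snd A**snd J) oo (br (fst A) (fst B)**idt (fst J)) = ((snd B**snd A) oo br (fst A) (fst B))**snd J"
          using ichg[of "snd B**snd A" "br (fst A) (fst B)" "snd J" "idt (fst J)"] by simp
        also have "(snd B**snd A) oo br (fst A) (fst B) = br (fst A) (fst B) oo (snd A**snd B)" by (subst br_nat) simp_all
        finally show ?thesis using 2 by simp
      qed
      have 4: "(snd A**snd B**snd J) oo (snd A**snd B**snd J) = snd A**snd B**snd J" by (simp add: ichg)
      show ?thesis unfolding 1 2 by (simp add: br_right cp_subst[OF 3] 4)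
    qed
    then show ?case
      using 8 sub_tob_simps[of B J] by (intro ueq) (simp_all add: Sc_simps(7) sub_tob_assoc u1 under_brd(2))
  next
    case (9 A B J)
    note [simp] = soD[OF 9(1)] soD[OF 9(2)] soD[OF 9(3)]
    have u1: "under (brd Sc (sub_tob C A B) J) = br (fst A\<odot>fst B) (fst J) oo (snd A**snd B**snd J)"
      using under_brd(2)[of "sub_tob C A B" J] 9 sub_tob_simps[of A B] by simp
    have "((br (fst A) (fst J) oo (snd A**snd J))**snd B) oo (snd A**(br (fst B) (fst J) oo (snd B**snd J)))
      = br (fst A\<odot>fst B) (fst J) oo (snd A**snd B**snd J)"
    proof -
      have 1: "snd A**(br (fst B) (fst J) oo (snd B**snd J)) = (idt (fst A)**br (fst B) (fst J)) oo (snd A**snd B**snd J)"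
        by (simp add: ichg)
      have 2: "(br (fst A) (fst J) oo (snd A**snd J))**snd B = (br (fst A) (fst J)**idt (fst B)) oo (snd A**snd J**snd B)"
        using ichg[of "br (fst A) (fst J)" "snd A**snd J" "idt (fst B)" "snd B"] by simp
      have 3: "(snd A**snd J**snd B) oo (idt (fst A)**br (fst B) (fst J)) = (idt (fst A)**br (fst B) (fst J)) oo (snd A**snd B**snd J)"
      proof -
        have "(snd J**snd B) oo br (fst B) (fst J) = br (fst B) (fst J) oo (snd B**snd J)" by (subst br_nat) simp_all
        then show ?thesis by (simp add: ichg)
      qed
      have 4: "(snd A**snd B**snd J) oo (snd A**snd B**snd J) = snd A**snd B**snd J" by (simp add: ichg)
      show ?thesis unfolding 1 2 by (simp add: br_left cp_subst[OF 3] 4)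
    qed
    then show ?case
      using 9 sub_tob_simps[of A B] by (intro ueq) (simp_all add: Sc_simps(7) sub_tob_assoc u1 under_brd(2))
  qed
qed

theorem subobject_closure_BTC: "BTC_star Sc"
proof -
  interpret P: pre_BTC_star Sc by (rule pre_Sc)
  show ?thesis
  proof (unfold_locales, goal_cases)
    case (1 A)
    then obtain B R Rb where c: "conj_solution Sc A B R Rb" using P.conj_ex by blast
    show ?case
    proof (cases "irreducible_obj Sc A")
      case True
      obtain Q Qb d where "P.nsol A B Q Qb d" using P.csol_normalize[OF True] c P.csol_iff by blast
      then show ?thesis using P.nsol_iff[OF True] P.csol_iff P.nsol_def by blast
    next
      case False
      then show ?thesis using c by blast
    qed
  next
    case 2 then show ?case by (rule P.dsum_ex)
  next
    case (3 A E)
    then have A: "so A" by (simp add: so_Obj)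
    note [simp] = soD[OF A]
    have E: "uh A A E" "cmp Sc E E = E" "star Sc E = E" using 3(2) uh_Hom[OF A A] by (auto simp: projection_def)
    note [simp] = uhD[OF E(1)]
    have uE: "under E oo under E = under E" "(under E)\<star> = under E"
      using arg_cong[OF E(2), of under] arg_cong[OF E(3), of under] by simp_all
    \<comment> \<open>A projection of \<open>(rho, E)\<close> is a projection of \<open>rho\<close> below \<open>E\<close>, and as such an object.\<close>
    define B where "B = (fst A, under E)"
    have B: "so B" "fst B = fst A" "snd B = under E" using uE by (auto simp: B_def so_def proj_def homs_iff)
    note [simp] = soD[OF B(1)] B(2,3)
    define v where "v = Arrow B A (vect E)"
    have st [simp]: "src v = B" "tgt v = A" by (simp_all add: v_def)
    have un [simp]: "under v = under E" by (auto intro!: arrow.expand) (simp add: v_def)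
    have "uh B A v" using uE by (simp add: uh_def)
    then have "v \<in> Hom Sc B A" using uh_Hom A B by blast
    moreover have "cmp Sc (star Sc v) v = idn Sc B" by (rule ueq) (use B(1) uE in simp_all)
    moreover have "cmp Sc v (star Sc v) = E" by (rule ueq) (use uE in simp_all)
    ultimately show ?case using B(1) by (intro bexI[of _ B] exI[of _ v]) (auto simp: isometry_def so_Obj)
  next
    case 4 then show ?case by (rule P.fin_dim)
  next
    case 5 show ?case by (rule P.unt_irr)
  next
    case 6 then show ?case by (rule P.br_Hom)
  next
    case 7 then show ?case by (rule P.br_unitary)
  next
    case 8 then show ?case by (rule P.br_natural)
  next
    case 9 then show ?case by (rule P.br_tob_right)
  next
    case 10 then show ?case by (rule P.br_tob_left)
  qed
qed

end


section \<open>Arrows of the crossed product as triples\<close>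

locale crossed = BTC_star C + doplicher_roberts C "degenerates C" F + crossed_product_choices C "degenerates C" F X
  for C :: "('o, 'a::ab_group_add) tcat" (structure)
    and F :: "('o, 'a, 'g, 'v::ab_group_add) dr_iso"
    and X :: "('o, 'a, 'v) cp_choices"
begin

abbreviation HH :: "'o \<Rightarrow> 'v set" where "HH tau \<equiv> hilb F tau"
abbreviation ip :: "'o \<Rightarrow> 'v \<Rightarrow> 'v \<Rightarrow> complex" where "ip tau \<equiv> inner_of F tau"
abbreviation rs :: "'o \<Rightarrow> complex \<Rightarrow> 'v \<Rightarrow> 'v" where "rs tau \<equiv> rscl (FObj F tau)"
abbreviation bx :: "'o \<Rightarrow> 'o \<Rightarrow> 'v \<Rightarrow> 'v \<Rightarrow> 'v" where "bx \<equiv> box F"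
abbreviation fa :: "('o, 'a) arrow \<Rightarrow> 'v \<Rightarrow> 'v" where "fa \<equiv> FArr F"
abbreviation Om :: 'v where "Om \<equiv> vac F"

subsection \<open>The Hilbert spaces\<close>

lemma H_fd: "tau \<in> D \<Longrightarrow> fd_hilbert (FObj F tau)"
  using rep[of tau] by (auto simp: unitary_rep_def)

lemma H_vs: "tau \<in> D \<Longrightarrow> vector_space (rs tau)"
  using H_fd[of tau] by (auto simp: fd_hilbert_def)

lemma H_sub: assumes "tau \<in> D" shows "module.subspace (rs tau) (HH tau)"
proof -
  interpret U: vector_space "rs tau" by (rule H_vs[OF assms])
  obtain B where "HH tau = U.span B" using H_fd[OF assms] unfolding fd_hilbert_def by blast
  then show ?thesis by (simp add: U.subspace_span)
qed

lemma H_closed: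
  assumes "tau \<in> D"
  shows "0 \<in> HH tau" "a \<in> HH tau \<Longrightarrow> b \<in> HH tau \<Longrightarrow> a + b \<in> HH tau" "a \<in> HH tau \<Longrightarrow> rs tau z a \<in> HH tau"
    "a \<in> HH tau \<Longrightarrow> b \<in> HH tau \<Longrightarrow> a - b \<in> HH tau" "(\<And>i. i \<in> I \<Longrightarrow> f i \<in> HH tau) \<Longrightarrow> sum f I \<in> HH tau"
    "rs tau 1 a = a" "rs tau 0 a = 0" "rs tau z 0 = 0" "rs tau (- 1) a = - a"
proof -
  interpret U: vector_space "rs tau" by (rule H_vs[OF assms])
  note s = H_sub[OF assms]
  show "0 \<in> HH tau" "a \<in> HH tau \<Longrightarrow> b \<in> HH tau \<Longrightarrow> a + b \<in> HH tau" "a \<in> HH tau \<Longrightarrow> rs tau z a \<in> HH tau"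
    "a \<in> HH tau \<Longrightarrow> b \<in> HH tau \<Longrightarrow> a - b \<in> HH tau" "(\<And>i. i \<in> I \<Longrightarrow> f i \<in> HH tau) \<Longrightarrow> sum f I \<in> HH tau"
    using s by (auto simp: U.subspace_0 U.subspace_add U.subspace_scale U.subspace_diff intro: U.subspace_sum)
  show "rs tau 1 a = a" "rs tau 0 a = 0" "rs tau z 0 = 0" "rs tau (- 1) a = - a" by simp_all
qed

lemma ip_rules:
  assumes "tau \<in> D"
  shows "a \<in> HH tau \<Longrightarrow> b \<in> HH tau \<Longrightarrow> c \<in> HH tau \<Longrightarrow> ip tau a (b + c) = ip tau a b + ip tau a c"
    "a \<in> HH tau \<Longrightarrow> b \<in> HH tau \<Longrightarrow> ip tau a (rs tau z b) = z * ip tau a b"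
    "a \<in> HH tau \<Longrightarrow> b \<in> HH tau \<Longrightarrow> ip tau b a = cnj (ip tau a b)"
    "a \<in> HH tau \<Longrightarrow> b \<in> HH tau \<Longrightarrow> c \<in> HH tau \<Longrightarrow> ip tau (a + b) c = ip tau a c + ip tau b c"
    "a \<in> HH tau \<Longrightarrow> b \<in> HH tau \<Longrightarrow> ip tau (rs tau z a) b = cnj z * ip tau a b"
    "a \<in> HH tau \<Longrightarrow> ip tau a 0 = 0" "a \<in> HH tau \<Longrightarrow> ip tau 0 a = 0"
    "a \<in> HH tau \<Longrightarrow> ip tau a a = 0 \<Longrightarrow> a = 0"
proof -
  note h = H_fd[OF assms, unfolded fd_hilbert_def] and cl = H_closed[OF assms]
  have A: "a \<in> HH tau \<Longrightarrow> b \<in> HH tau \<Longrightarrow> c \<in> HH tau \<Longrightarrow> ip tau a (b + c) = ip tau a b + ip tau a c" for a b c using h by blast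
  have S: "a \<in> HH tau \<Longrightarrow> b \<in> HH tau \<Longrightarrow> ip tau a (rs tau z b) = z * ip tau a b" for a b z using h by blast
  have J: "a \<in> HH tau \<Longrightarrow> b \<in> HH tau \<Longrightarrow> ip tau b a = cnj (ip tau a b)" for a b using h by blast
  show "a \<in> HH tau \<Longrightarrow> b \<in> HH tau \<Longrightarrow> c \<in> HH tau \<Longrightarrow> ip tau a (b + c) = ip tau a b + ip tau a c" by (rule A)
  show "a \<in> HH tau \<Longrightarrow> b \<in> HH tau \<Longrightarrow> ip tau a (rs tau z b) = z * ip tau a b" by (rule S)
  show "a \<in> HH tau \<Longrightarrow> b \<in> HH tau \<Longrightarrow> ip tau b a = cnj (ip tau a b)" by (rule J)
  show "a \<in> HH tau \<Longrightarrow> b \<in> HH tau \<Longrightarrow> c \<in> HH tau \<Longrightarrow> ip tau (a + b) c = ip tau a c + ip tau b c"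
    using J[of c "a + b"] J[of c a] J[of c b] A[of c a b] cl(2) by simp
  show "a \<in> HH tau \<Longrightarrow> b \<in> HH tau \<Longrightarrow> ip tau (rs tau z a) b = cnj z * ip tau a b"
    using J[of b "rs tau z a"] J[of b a] S[of b a z] cl(3) by simp
  show z: "a \<in> HH tau \<Longrightarrow> ip tau a 0 = 0" using S[of a a 0] cl(7) by simp
  show "a \<in> HH tau \<Longrightarrow> ip tau 0 a = 0" using J[of a 0] S[of a a 0] cl(7) cl(1) by simp
  show "a \<in> HH tau \<Longrightarrow> ip tau a a = 0 \<Longrightarrow> a = 0" using h by (metis less_irrefl zero_complex.sel(1))
qed

lemma ip_sum:
  assumes t: "tau \<in> D" and a: "a \<in> HH tau" and f: "\<And>i. i \<in> I \<Longrightarrow> f i \<in> HH tau"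
  shows "ip tau a (sum f I) = (\<Sum>i\<in>I. ip tau a (f i))" "ip tau (sum f I) a = (\<Sum>i\<in>I. ip tau (f i) a)"
  using f by (induction I rule: infinite_finite_induct) (simp_all add: ip_rules(1,4,6,7)[OF t] a H_closed(1,5)[OF t])

lemma ip_eqI:
  assumes t: "tau \<in> D" and uv: "u \<in> HH tau" "v \<in> HH tau" and e: "\<And>a. a \<in> HH tau \<Longrightarrow> ip tau a u = ip tau a v"
  shows "u = v"
proof -
  have d: "u - v \<in> HH tau" using H_closed[OF t] uv by simp
  have "ip tau (u - v) u = ip tau (u - v) (u - v) + ip tau (u - v) v"
    using ip_rules(1)[OF t d d uv(2)] by simp
  then have "ip tau (u - v) (u - v) = 0" using e[OF d] by simp
  then show ?thesis using ip_rules(8)[OF t d] by simp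
qed

lemma box_mem: assumes t: "rho \<in> D" "sigma \<in> D" and "a \<in> HH rho" "b \<in> HH sigma" shows "bx rho sigma a b \<in> HH (rho\<odot>sigma)"
proof -
  interpret U: vector_space "rs (rho\<odot>sigma)" using t by (intro H_vs) simp
  show ?thesis unfolding box_hilb[OF t] using assms by (auto intro!: U.span_base)
qed

text \<open>
  Product vectors span the Hilbert space of a product.
\<close>

lemma box_ext:
  assumes t: "rho \<in> D" "sigma \<in> D" and uv: "u \<in> HH (rho\<odot>sigma)" "v \<in> HH (rho\<odot>sigma)"
    and e: "\<And>a b. a \<in> HH rho \<Longrightarrow> b \<in> HH sigma \<Longrightarrow> ip (rho\<odot>sigma) (bx rho sigma a b) u = ip (rho\<odot>sigma) (bx rho sigma a b) v"
  shows "u = v"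
proof (rule ip_eqI[of "rho\<odot>sigma"])
  show t': "rho\<odot>sigma \<in> D" using t by simp
  interpret U: vector_space "rs (rho\<odot>sigma)" by (rule H_vs[OF t'])
  fix w assume "w \<in> HH (rho\<odot>sigma)"
  then have "w \<in> U.span {bx rho sigma a b | a b. a \<in> HH rho \<and> b \<in> HH sigma}" using box_hilb[OF t] by simp
  then have "w \<in> HH (rho\<odot>sigma) \<and> ip (rho\<odot>sigma) w u = ip (rho\<odot>sigma) w v"
  proof (induction rule: U.span_induct_alt)
    case base show ?case using ip_rules(7)[OF t'] H_closed(1)[OF t'] uv by simp
  next
    case (step c x y)
    then obtain a b where "x = bx rho sigma a b" "a \<in> HH rho" "b \<in> HH sigma" by auto
    then have x: "x \<in> HH (rho\<odot>sigma)" "ip (rho\<odot>sigma) x u = ip (rho\<odot>sigma) x v" using box_mem[OF t] e by auto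
    then show ?case using step.IH uv ip_rules(4,5)[OF t'] H_closed(2,3)[OF t'] by simp
  qed
  then show "ip (rho\<odot>sigma) w u = ip (rho\<odot>sigma) w v" by simp
qed (use uv in simp_all)

lemma fa_rules:
  assumes t: "rho \<in> D" "sigma \<in> D" and f: "f \<in> homs rho sigma"
  shows "a \<in> HH rho \<Longrightarrow> fa f a \<in> HH sigma"
    "a \<in> HH rho \<Longrightarrow> b \<in> HH rho \<Longrightarrow> fa f (a + b) = fa f a + fa f b"
    "a \<in> HH rho \<Longrightarrow> fa f (rs rho z a) = rs sigma z (fa f a)"
    "g \<in> homs rho sigma \<Longrightarrow> a \<in> HH rho \<Longrightarrow> fa (f \<boxplus> g) a = fa f a + fa g a"
    "a \<in> HH rho \<Longrightarrow> fa (z *> f) a = rs sigma z (fa f a)"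
    "a \<in> HH rho \<Longrightarrow> b \<in> HH sigma \<Longrightarrow> ip rho a (fa (f\<star>) b) = ip sigma (fa f a) b"
    "a \<in> HH rho \<Longrightarrow> b \<in> HH sigma \<Longrightarrow> ip rho (fa (f\<star>) b) a = ip sigma b (fa f a)"
proof -
  have h: "f \<in> Hom C rho sigma" using f by (simp add: homs_Hom)
  note l = FArr_intertwiner[OF t h, unfolded intertwiner_def lin_on_def]
  show 1: "a \<in> HH rho \<Longrightarrow> fa f a \<in> HH sigma" for a using l by blast
  show "a \<in> HH rho \<Longrightarrow> b \<in> HH rho \<Longrightarrow> fa f (a + b) = fa f a + fa f b" using l by blast
  show "a \<in> HH rho \<Longrightarrow> fa f (rs rho z a) = rs sigma z (fa f a)" using l by blast
  show "g \<in> homs rho sigma \<Longrightarrow> a \<in> HH rho \<Longrightarrow> fa (f \<boxplus> g) a = fa f a + fa g a"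
    using FArr_add[OF t h] by (simp add: homs_Hom)
  show "a \<in> HH rho \<Longrightarrow> fa (z *> f) a = rs sigma z (fa f a)" using FArr_scl[OF t h] by simp
  have s: "star C f = f\<star>" using f by (simp add: homs_iff adj_eq)
  show A: "a \<in> HH rho \<Longrightarrow> b \<in> HH sigma \<Longrightarrow> ip rho a (fa (f\<star>) b) = ip sigma (fa f a) b" for a b
    using FArr_star[OF t h] s by simp
  assume ab: "a \<in> HH rho" "b \<in> HH sigma"
  have "f\<star> \<in> Hom C sigma rho" using f by (simp add: homs_iff)
  then have "fa (f\<star>) b \<in> HH rho" using FArr_intertwiner[OF t(2,1), unfolded intertwiner_def lin_on_def] ab by blast
  then show "ip rho (fa (f\<star>) b) a = ip sigma b (fa f a)"
    using A[OF ab] ip_rules(3)[OF t(1) ab(1), of "fa (f\<star>) b"] ip_rules(3)[OF t(2) 1[OF ab(1)] ab(2)] by simp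
qed

lemma fa_cp: assumes "rho \<in> D" "sigma \<in> D" "delta \<in> D" "f \<in> homs sigma delta" "g \<in> homs rho sigma" "a \<in> HH rho"
  shows "fa (f oo g) a = fa f (fa g a)"
proof -
  have "f \<cdot> g = f oo g" using assms by (intro cp_eq) (auto simp: homs_iff)
  then show ?thesis using FArr_cmp[OF assms(1-3), of f g a] assms by (simp add: homs_Hom)
qed

lemma fa_idt [simp]: "rho \<in> D \<Longrightarrow> a \<in> HH rho \<Longrightarrow> fa (idt rho) a = a"
  using FArr_idn[of rho a] by (simp add: idt_eq)

lemma fa_tp: assumes t: "rho \<in> D" "sigma \<in> D" "rho' \<in> D" "sigma' \<in> D" and f: "f \<in> homs rho sigma" "g \<in> homs rho' sigma'" and a: "a \<in> HH rho" "b \<in> HH rho'"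
  shows "fa (f**g) (bx rho rho' a b) = bx sigma sigma' (fa f a) (fa g b)"
proof -
  have "f \<boxtimes> g = f**g" using f by (intro tp_eq) (auto simp: homs_iff)
  then show ?thesis using FArr_tar[OF t, of f g a b] f a by (simp add: homs_Hom)
qed

lemma fa_br: "rho \<in> D \<Longrightarrow> sigma \<in> D \<Longrightarrow> a \<in> HH rho \<Longrightarrow> b \<in> HH sigma \<Longrightarrow> fa (br rho sigma) (bx rho sigma a b) = bx sigma rho b a"
  using FArr_brd[of rho sigma a b] by (simp add: br_eq)

lemma Om_mem [simp]: "Om \<in> HH (unt C)"
proof -
  have "rs (unt C) 1 Om \<in> HH (unt C)" unfolding vac_hilb by blast
  then show ?thesis using H_closed(6)[OF D_unt] by simp
qed

lemma fa_sum:
  assumes t: "rho \<in> D" "sigma \<in> D" and f: "f \<in> homs rho sigma" and a: "\<And>i. i \<in> I \<Longrightarrow> a i \<in> HH rho"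
  shows "fa f (sum a I) = (\<Sum>i\<in>I. fa f (a i))"
proof -
  have z: "fa f 0 = 0" using fa_rules(3)[OF t f H_closed(1)[OF t(1)], of 0] H_closed(7)[OF t(1)] H_closed(7)[OF t(2)] by simp
  show ?thesis using a
    by (induction I rule: infinite_finite_induct) (auto simp: z fa_rules(2)[OF t f] H_closed[OF t(1)])
qed

lemma fa_zero: assumes t: "rho \<in> D" "sigma \<in> D" and a: "a \<in> HH rho" shows "fa (arr_zero rho sigma) a = 0"
  using fa_rules(5)[OF t homs_simps(2), of a 0] H_closed(7)[OF t(2)] t a by simp

lemma fa_arr_sum:
  assumes t: "rho \<in> D" "sigma \<in> D" and f: "\<And>i. i \<in> I \<Longrightarrow> f i \<in> homs rho sigma" and a: "a \<in> HH rho"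
  shows "fa (arr_sum rho sigma f I) a = (\<Sum>i\<in>I. fa (f i) a)"
  using f
proof (induction I rule: infinite_finite_induct)
  case (insert i I)
  have "arr_sum rho sigma f (insert i I) = f i \<boxplus> arr_sum rho sigma f I"
    using insert by (intro arr_sum_insert) (auto simp: homs_iff)
  moreover have "arr_sum rho sigma f I \<in> homs rho sigma" using insert.prems t by (intro homs_intros) auto
  ultimately show ?case using insert fa_rules(4)[OF t, of "f i" "arr_sum rho sigma f I" a] a by simp
qed (simp_all add: fa_zero[OF t a])

subsection \<open>Contraction of a tensor with a vector\<close>

text \<open>
  The contraction of the first tensor factor with \<open>psi\<close>. On product vectors it is given by \<open>ctr_simple\<close>. As the
  latter are not linearly independent, it is defined by its inner products instead.
\<close>

definition ctr :: "'o \<Rightarrow> 'o \<Rightarrow> 'v \<Rightarrow> 'v \<Rightarrow> 'v" where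
  "ctr rho sigma psi u = (THE b. b \<in> HH sigma \<and> (\<forall>a\<in>HH sigma. ip sigma a b = ip (rho\<odot>sigma) (bx rho sigma psi a) u))"

lemma ctr_unique:
  assumes t: "rho \<in> D" "sigma \<in> D" and b: "b \<in> HH sigma" "\<And>a. a \<in> HH sigma \<Longrightarrow> ip sigma a b = ip (rho\<odot>sigma) (bx rho sigma psi a) u"
  shows "ctr rho sigma psi u = b"
  unfolding ctr_def
proof (rule the_equality)
  fix b' assume b': "b' \<in> HH sigma \<and> (\<forall>a\<in>HH sigma. ip sigma a b' = ip (rho\<odot>sigma) (bx rho sigma psi a) u)"
  show "b' = b" by (rule ip_eqI[OF t(2)]) (use b b' in auto)
qed (use b in auto)

lemma ctr_simple:
  assumes t: "rho \<in> D" "sigma \<in> D" and m: "psi \<in> HH rho" "x \<in> HH rho" "y \<in> HH sigma"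
  shows "ctr rho sigma psi (bx rho sigma x y) = rs sigma (ip rho psi x) y"
  by (rule ctr_unique[OF t]) (use m H_closed(3)[OF t(2)] ip_rules(2)[OF t(2)] box_inner[OF t] in simp_all)

text \<open>
  Existence is clear for product vectors and extends to their span.
\<close>

lemma ctr:
  assumes t: "rho \<in> D" "sigma \<in> D" and m: "psi \<in> HH rho" "u \<in> HH (rho\<odot>sigma)"
  shows "ctr rho sigma psi u \<in> HH sigma" "a \<in> HH sigma \<Longrightarrow> ip sigma a (ctr rho sigma psi u) = ip (rho\<odot>sigma) (bx rho sigma psi a) u"
proof -
  have t': "rho\<odot>sigma \<in> D" using t by simp
  interpret U: vector_space "rs (rho\<odot>sigma)" by (rule H_vs[OF t'])
  have "u \<in> U.span {bx rho sigma a b | a b. a \<in> HH rho \<and> b \<in> HH sigma}" using box_hilb[OF t] m by simp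
  then have "u \<in> HH (rho\<odot>sigma) \<and> (\<exists>b. b \<in> HH sigma \<and> (\<forall>a\<in>HH sigma. ip sigma a b = ip (rho\<odot>sigma) (bx rho sigma psi a) u))"
  proof (induction rule: U.span_induct_alt)
    case base
    show ?case using H_closed(1)[OF t(2)] H_closed(1)[OF t'] box_mem[OF t m(1)] ip_rules(6)[OF t'] ip_rules(6)[OF t(2)]
      by (auto intro!: exI[of _ 0])
  next
    case (step c x y)
    then obtain p q where x: "x = bx rho sigma p q" "p \<in> HH rho" "q \<in> HH sigma" by auto
    obtain b where b: "b \<in> HH sigma" "\<And>a. a \<in> HH sigma \<Longrightarrow> ip sigma a b = ip (rho\<odot>sigma) (bx rho sigma psi a) y" using step by blast
    have x': "x \<in> HH (rho\<odot>sigma)" using x box_mem[OF t] by simp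
    have "ip sigma a (rs sigma (c * ip rho psi p) q + b) = ip (rho\<odot>sigma) (bx rho sigma psi a) (rs (rho\<odot>sigma) c x + y)" if a: "a \<in> HH sigma" for a
      using a x x' b step.IH box_mem[OF t m(1) a] H_closed[OF t'] H_closed[OF t(2)] ip_rules(1,2)[OF t'] ip_rules(1,2)[OF t(2)]
        box_inner[OF t m(1) x(2) a x(3)] by simp
    then show ?case using x x' b step.IH H_closed(2,3)[OF t(2)] H_closed(2,3)[OF t']
      by (intro conjI exI[of _ "rs sigma (c * ip rho psi p) q + b"]) auto
  qed
  then obtain b where b: "b \<in> HH sigma" "\<And>a. a \<in> HH sigma \<Longrightarrow> ip sigma a b = ip (rho\<odot>sigma) (bx rho sigma psi a) u" by blast
  have "ctr rho sigma psi u = b" by (rule ctr_unique[OF t b])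
  then show "ctr rho sigma psi u \<in> HH sigma" "a \<in> HH sigma \<Longrightarrow> ip sigma a (ctr rho sigma psi u) = ip (rho\<odot>sigma) (bx rho sigma psi a) u" using b by auto
qed

lemma ctr_add:
  assumes t: "rho \<in> D" "sigma \<in> D" and m: "psi \<in> HH rho" "phi \<in> HH rho" "u \<in> HH (rho\<odot>sigma)"
  shows "ctr rho sigma (psi + phi) u = ctr rho sigma psi u + ctr rho sigma phi u"
  by (rule ctr_unique[OF t])
     (use m ctr[OF t] box_add_left[OF t] box_mem[OF t] H_closed[OF t(2)] ip_rules(1)[OF t(2)] ip_rules(4)[of "rho\<odot>sigma"] t in simp_all)

lemma ctr_fa:
  assumes t: "rho \<in> D" "sigma \<in> D" "sigma' \<in> D" and m: "psi \<in> HH rho" "u \<in> HH (rho\<odot>sigma)" and f: "f \<in> homs sigma sigma'"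
  shows "ctr rho sigma' psi (fa (idt rho**f) u) = fa f (ctr rho sigma psi u)"
proof (rule ctr_unique[OF t(1,3)])
  note [simp] = f[unfolded homs_iff]
  have c: "ctr rho sigma psi u \<in> HH sigma" by (rule ctr[OF t(1,2) m])
  show "fa f (ctr rho sigma psi u) \<in> HH sigma'" by (rule fa_rules(1)[OF t(2,3) f c])
  fix a assume a: "a \<in> HH sigma'"
  have fd: "f\<star> \<in> homs sigma' sigma" and F: "idt rho**f \<in> homs (rho\<odot>sigma) (rho\<odot>sigma')" using t by (simp_all add: homs_iff)
  have "ip sigma' a (fa f (ctr rho sigma psi u)) = ip sigma (fa (f\<star>) a) (ctr rho sigma psi u)" using fa_rules(7)[OF t(2,3) f c a] by simp
  also have "\<dots> = ip (rho\<odot>sigma) (bx rho sigma psi (fa (f\<star>) a)) u"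
    by (rule ctr(2)[OF t(1,2) m fa_rules(1)[OF t(3,2) fd a]])
  also have "bx rho sigma psi (fa (f\<star>) a) = fa ((idt rho**f)\<star>) (bx rho sigma' psi a)"
    using fa_tp[OF t(1,1,3,2) _ fd m(1) a, of "idt rho"] t m by simp
  also have "ip (rho\<odot>sigma) \<dots> u = ip (rho\<odot>sigma') (bx rho sigma' psi a) (fa (idt rho**f) u)"
    using fa_rules(7)[OF _ _ F m(2) box_mem[OF t(1,3) m(1) a]] t by simp
  finally show "ip sigma' a (fa f (ctr rho sigma psi u)) = ip (rho\<odot>sigma') (bx rho sigma' psi a) (fa (idt rho**f) u)" .
qed

lemma ctr_fa_left:
  assumes t: "rho \<in> D" "rho' \<in> D" "sigma \<in> D" and m: "psi \<in> HH rho" "u \<in> HH (rho'\<odot>sigma)" and g: "g \<in> homs rho rho'"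
  shows "ctr rho sigma psi (fa (g\<star>**idt sigma) u) = ctr rho' sigma (fa g psi) u"
proof (rule ctr_unique[OF t(1,3)])
  note [simp] = g[unfolded homs_iff]
  have gm: "fa g psi \<in> HH rho'" by (rule fa_rules(1)[OF t(1,2) g m(1)])
  show "ctr rho' sigma (fa g psi) u \<in> HH sigma" by (rule ctr[OF t(2,3) gm m(2)])
  fix a assume a: "a \<in> HH sigma"
  have F: "g**idt sigma \<in> homs (rho\<odot>sigma) (rho'\<odot>sigma)" using t by (simp add: homs_iff)
  have "ip sigma a (ctr rho' sigma (fa g psi) u) = ip (rho'\<odot>sigma) (bx rho' sigma (fa g psi) a) u" by (rule ctr(2)[OF t(2,3) gm m(2) a])
  also have "bx rho' sigma (fa g psi) a = fa (g**idt sigma) (bx rho sigma psi a)" using fa_tp[OF t(1,2,3,3) g _ m(1) a, of "idt sigma"] t a by simp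
  also have "ip (rho'\<odot>sigma) \<dots> u = ip (rho\<odot>sigma) (bx rho sigma psi a) (fa ((g**idt sigma)\<star>) u)"
    using fa_rules(6)[OF _ _ F box_mem[OF t(1,3) m(1) a] m(2)] t by simp
  finally show "ip sigma a (ctr rho' sigma (fa g psi) u) = ip (rho\<odot>sigma) (bx rho sigma psi a) (fa (g\<star>**idt sigma) u)" using t by simp
qed

lemma ctr_box:
  assumes t: "rho \<in> D" "sigma \<in> D" "delta \<in> D" and m: "psi \<in> HH rho" "u \<in> HH (rho\<odot>sigma)" "y \<in> HH delta"
  shows "ctr rho (sigma\<odot>delta) psi (bx (rho\<odot>sigma) delta u y) = bx sigma delta (ctr rho sigma psi u) y"
proof -
  have t': "sigma\<odot>delta \<in> D" "rho\<odot>sigma \<in> D" using t by simp_all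
  have [simp]: "ob rho" "ob sigma" "ob delta" using t by simp_all
  have U: "bx (rho\<odot>sigma) delta u y \<in> HH (rho\<odot>(sigma\<odot>delta))" using box_mem[OF t'(2) t(3) m(2,3)] by simp
  have c: "ctr rho sigma psi u \<in> HH sigma" by (rule ctr[OF t(1,2) m(1,2)])
  show ?thesis
  proof (rule box_ext[OF t(2,3)])
    show "ctr rho (sigma\<odot>delta) psi (bx (rho\<odot>sigma) delta u y) \<in> HH (sigma\<odot>delta)" by (rule ctr[OF t(1) t'(1) m(1) U])
    show "bx sigma delta (ctr rho sigma psi u) y \<in> HH (sigma\<odot>delta)" by (rule box_mem[OF t(2,3) c m(3)])
    fix a b assume ab: "a \<in> HH sigma" "b \<in> HH delta"
    have "ip (sigma\<odot>delta) (bx sigma delta a b) (ctr rho (sigma\<odot>delta) psi (bx (rho\<odot>sigma) delta u y)) =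
      ip (rho\<odot>(sigma\<odot>delta)) (bx rho (sigma\<odot>delta) psi (bx sigma delta a b)) (bx (rho\<odot>sigma) delta u y)"
      by (rule ctr(2)[OF t(1) t'(1) m(1) U box_mem[OF t(2,3) ab]])
    also have "\<dots> = ip (rho\<odot>sigma\<odot>delta) (bx (rho\<odot>sigma) delta (bx rho sigma psi a) b) (bx (rho\<odot>sigma) delta u y)"
      using box_assoc[OF t m(1) ab] by simp
    also have "\<dots> = ip (rho\<odot>sigma) (bx rho sigma psi a) u * ip delta b y"
      by (rule box_inner[OF t'(2) t(3) box_mem[OF t(1,2) m(1) ab(1)] m(2) ab(2) m(3)])
    also have "ip (rho\<odot>sigma) (bx rho sigma psi a) u = ip sigma a (ctr rho sigma psi u)" using ctr(2)[OF t(1,2) m(1,2) ab(1)] by simp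
    also have "\<dots> * ip delta b y = ip (sigma\<odot>delta) (bx sigma delta a b) (bx sigma delta (ctr rho sigma psi u) y)"
      using box_inner[OF t(2,3) ab(1) c ab(2) m(3)] by simp
    finally show "ip (sigma\<odot>delta) (bx sigma delta a b) (ctr rho (sigma\<odot>delta) psi (bx (rho\<odot>sigma) delta u y)) =
       ip (sigma\<odot>delta) (bx sigma delta a b) (bx sigma delta (ctr rho sigma psi u) y)" .
  qed
qed

lemma ctr_ctr:
  assumes t: "rho \<in> D" "sigma \<in> D" "delta \<in> D" and m: "psi \<in> HH rho" "phi \<in> HH sigma" "u \<in> HH (rho\<odot>(sigma\<odot>delta))"
  shows "ctr (rho\<odot>sigma) delta (bx rho sigma psi phi) u = ctr sigma delta phi (ctr rho (sigma\<odot>delta) psi u)"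
proof -
  have t': "sigma\<odot>delta \<in> D" "rho\<odot>sigma \<in> D" using t by simp_all
  have [simp]: "ob rho" "ob sigma" "ob delta" using t by simp_all
  have c: "ctr rho (sigma\<odot>delta) psi u \<in> HH (sigma\<odot>delta)" by (rule ctr[OF t(1) t'(1) m(1,3)])
  show ?thesis
  proof (rule ctr_unique[OF t'(2) t(3)])
    show "ctr sigma delta phi (ctr rho (sigma\<odot>delta) psi u) \<in> HH delta" by (rule ctr[OF t(2,3) m(2) c])
    fix a assume a: "a \<in> HH delta"
    show "ip delta a (ctr sigma delta phi (ctr rho (sigma\<odot>delta) psi u)) = ip (rho\<odot>sigma\<odot>delta) (bx (rho\<odot>sigma) delta (bx rho sigma psi phi) a) u"
      using ctr(2)[OF t(2,3) m(2) c a] ctr(2)[OF t(1) t'(1) m(1,3) box_mem[OF t(2,3) m(2) a]] box_assoc[OF t m(1,2) a] by simp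
  qed
qed

text \<open>
  The conjugate vector in the definition of the adjoint, here for an arbitrary degenerate object and an arbitrary
  solution of the conjugate equations.
\<close>

definition bar :: "'o \<Rightarrow> 'o \<Rightarrow> ('o, 'a) arrow \<Rightarrow> 'v \<Rightarrow> 'v" where
  "bar tau taub Rb psi = ctr tau taub psi (fa Rb Om)"

lemma bar_mem: assumes "tau \<in> D" and c: "csol tau taub R Rb" and "psi \<in> HH tau"
  shows "bar tau taub Rb psi \<in> HH taub" "fa Rb Om \<in> HH (tau\<odot>taub)"
proof -
  have tb: "taub \<in> D" by (rule D_conj[OF assms(1) c])
  have "Rb \<in> homs (unt C) (tau\<odot>taub)" using c by (simp add: csol_def)
  then show 1: "fa Rb Om \<in> HH (tau\<odot>taub)" using fa_rules(1)[OF D_unt _ _ Om_mem] assms tb by simp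
  show "bar tau taub Rb psi \<in> HH taub" unfolding bar_def by (rule ctr[OF assms(1) tb assms(3) 1])
qed

text \<open>
  One of the two conjugate equations in terms of vectors.
\<close>

lemma bar_inner:
  assumes t: "tau \<in> D" and c: "csol tau taub R Rb" and m: "psi \<in> HH tau" "b \<in> HH tau"
  shows "ip (taub\<odot>tau) (fa R Om) (bx taub tau (bar tau taub Rb psi) b) = ip tau psi b"
proof -
  note [simp] = csol_t[OF c]
  have tb: "taub \<in> D" by (rule D_conj[OF t c])
  have Rm: "fa R Om \<in> HH (taub\<odot>tau)" "fa Rb Om \<in> HH (tau\<odot>taub)" using bar_mem(2)[OF tb csol_sym[OF c]] bar_mem(2)[OF t c] m bar_mem(1)[OF t c m(1)] by auto
  have R: "R \<in> homs (unt C) (taub\<odot>tau)" "Rb \<in> homs (unt C) (tau\<odot>taub)" by (simp_all add: homs_iff)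
  have t3: "tau\<odot>(taub\<odot>tau) \<in> D" "taub\<odot>tau \<in> D" "tau\<odot>taub \<in> D" using t tb by simp_all
  have f1: "idt tau**R \<in> homs tau (tau\<odot>(taub\<odot>tau))" "Rb**idt tau \<in> homs tau (tau\<odot>(taub\<odot>tau))" by (simp_all add: homs_iff)
  have e1: "fa (idt tau**R) psi = bx tau (taub\<odot>tau) psi (fa R Om)"
    using fa_tp[OF t t D_unt t3(2) _ R(1) m(1) Om_mem, of "idt tau"] box_vac_right[OF t m(1)] t m by simp
  have e2: "fa (Rb**idt tau) b = bx (tau\<odot>taub) tau (fa Rb Om) b"
    using fa_tp[OF D_unt t3(3) t t R(2) _ Om_mem m(2), of "idt tau"] box_vac_left[OF t m(2)] t m by simp
  have B: "bx (tau\<odot>taub) tau (fa Rb Om) b \<in> HH (tau\<odot>(taub\<odot>tau))" using box_mem[OF t3(3) t Rm(2) m(2)] by simp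
  have "ip tau psi b = ip tau (fa ((Rb\<star>**idt tau) oo (idt tau**R)) psi) b" using csol_zz(1)[OF c] t m by simp
  also have "fa ((Rb\<star>**idt tau) oo (idt tau**R)) psi = fa ((Rb**idt tau)\<star>) (fa (idt tau**R) psi)"
    using fa_cp[OF t t3(1) t _ f1(1) m(1), of "(Rb**idt tau)\<star>"] by (simp add: homs_iff)
  also have "ip tau \<dots> b = ip (tau\<odot>(taub\<odot>tau)) (fa (idt tau**R) psi) (fa (Rb**idt tau) b)"
    by (rule fa_rules(7)[OF t t3(1) f1(2) m(2) fa_rules(1)[OF t t3(1) f1(1) m(1)]])
  also have "\<dots> = ip (taub\<odot>tau) (fa R Om) (ctr tau (taub\<odot>tau) psi (bx (tau\<odot>taub) tau (fa Rb Om) b))"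
    unfolding e1 e2 using ctr(2)[OF t t3(2) m(1) B Rm(1)] by simp
  also have "ctr tau (taub\<odot>tau) psi (bx (tau\<odot>taub) tau (fa Rb Om) b) = bx taub tau (bar tau taub Rb psi) b"
    unfolding bar_def by (rule ctr_box[OF t tb t m(1) Rm(2) m(2)])
  finally show ?thesis by simp
qed

lemma bar_bar:
  assumes t: "tau \<in> D" and c: "csol tau taub R Rb" and m: "psi \<in> HH tau"
  shows "bar taub tau R (bar tau taub Rb psi) = psi"
proof -
  have tb: "taub \<in> D" by (rule D_conj[OF t c])
  have b: "bar tau taub Rb psi \<in> HH taub" by (rule bar_mem[OF t c m])
  have Rm: "fa R Om \<in> HH (taub\<odot>tau)" using bar_mem(2)[OF tb csol_sym[OF c] b] .
  have t': "taub\<odot>tau \<in> D" using t tb by simp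
  show ?thesis unfolding bar_def[of taub]
  proof (rule ctr_unique[OF tb t m])
    fix a assume a: "a \<in> HH tau"
    show "ip tau a psi = ip (taub\<odot>tau) (bx taub tau (bar tau taub Rb psi) a) (fa R Om)"
      using bar_inner[OF t c m a] ip_rules(3)[OF t m a] ip_rules(3)[OF t' Rm box_mem[OF tb t b a]] by simp
  qed
qed

lemma bar_add:
  assumes t: "tau \<in> D" and c: "csol tau taub R Rb" and m: "psi \<in> HH tau" "phi \<in> HH tau"
  shows "bar tau taub Rb (psi + phi) = bar tau taub Rb psi + bar tau taub Rb phi"
  unfolding bar_def using ctr_add[OF t D_conj[OF t c] m bar_mem(2)[OF t c m(1)]] .

lemma bar_product:
  assumes t: "tau \<in> D" "tau' \<in> D" and c: "csol tau taub R Rb" and c': "csol tau' taub' R' Rb'" and m: "psi \<in> HH tau" "phi \<in> HH tau'"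
  shows "bar (tau\<odot>tau') (taub'\<odot>taub) ((idt tau**Rb'**idt taub) oo Rb) (bx tau tau' psi phi)
    = bx taub' taub (bar tau' taub' Rb' phi) (bar tau taub Rb psi)"
proof -
  note [simp] = csol_t[OF c] csol_t[OF c']
  have tb: "taub \<in> D" "taub' \<in> D" using D_conj[OF t(1) c] D_conj[OF t(2) c'] by auto
  have t4: "taub'\<odot>taub \<in> D" "tau\<odot>taub \<in> D" "tau'\<odot>(taub'\<odot>taub) \<in> D" "tau\<odot>(tau'\<odot>(taub'\<odot>taub)) \<in> D" "tau'\<odot>taub' \<in> D" using t tb by simp_all
  have Rm: "fa Rb Om \<in> HH (tau\<odot>taub)" "fa Rb' Om \<in> HH (tau'\<odot>taub')" using bar_mem(2)[OF t(1) c m(1)] bar_mem(2)[OF t(2) c' m(2)] by auto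
  have bm: "bar tau taub Rb psi \<in> HH taub" by (rule bar_mem[OF t(1) c m(1)])
  have R': "Rb'**idt taub \<in> homs taub (tau'\<odot>(taub'\<odot>taub))" "idt tau**Rb'**idt taub \<in> homs (tau\<odot>taub) (tau\<odot>(tau'\<odot>(taub'\<odot>taub)))"
    "Rb \<in> homs (unt C) (tau\<odot>taub)" "Rb' \<in> homs (unt C) (tau'\<odot>taub')"
    by (simp_all add: homs_iff)
  have 1: "fa ((idt tau**Rb'**idt taub) oo Rb) Om = fa (idt tau**(Rb'**idt taub)) (fa Rb Om)"
    by (rule fa_cp[OF D_unt t4(2,4) R'(2,3) Om_mem])
  have u: "fa (idt tau**(Rb'**idt taub)) (fa Rb Om) \<in> HH (tau\<odot>(tau'\<odot>(taub'\<odot>taub)))"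
    by (rule fa_rules(1)[OF t4(2,4) R'(2) Rm(1)])
  have 2: "ctr tau (tau'\<odot>(taub'\<odot>taub)) psi (fa (idt tau**(Rb'**idt taub)) (fa Rb Om)) = fa (Rb'**idt taub) (bar tau taub Rb psi)"
    unfolding bar_def by (rule ctr_fa[OF t(1) tb(1) t4(3) m(1) Rm(1) R'(1)])
  also have "\<dots> = bx (tau'\<odot>taub') taub (fa Rb' Om) (bar tau taub Rb psi)"
    using fa_tp[OF D_unt t4(5) tb(1,1) R'(4) _ Om_mem bm, of "idt taub"] box_vac_left[OF tb(1) bm] tb bm by simp
  finally have 3: "ctr tau (tau'\<odot>(taub'\<odot>taub)) psi (fa (idt tau**(Rb'**idt taub)) (fa Rb Om)) = bx (tau'\<odot>taub') taub (fa Rb' Om) (bar tau taub Rb psi)" .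
  show ?thesis
    unfolding bar_def[of "tau\<odot>tau'"] 1 ctr_ctr[OF t t4(1) m u] 3
    using ctr_box[OF t(2) tb(2,1) m(2) Rm(2) bm] by (simp add: bar_def)
qed

text \<open>
  Conjugation is natural with respect to transposes. Hence the adjoint of an arrow will not depend on the triple
  that represents it.
\<close>

lemma bar_fa:
  assumes t: "tau \<in> D" "k \<in> D" and c: "csol tau taub R Rb" and c': "csol k kb Q Qb" and g: "g \<in> homs k tau" and b: "b \<in> HH k"
  defines "s \<equiv> tps kb Q (g\<star>) Rb taub"
  shows "fa s (bar k kb Qb b) = bar tau taub Rb (fa g b)"
proof -
  note [simp] = csol_t[OF c] csol_t[OF c'] g[unfolded homs_iff]
  have gd: "g\<star> \<in> homs tau k" by (simp add: homs_iff)
  note s = tps[OF c c' gd, folded s_def]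
  note [simp] = s(1)[unfolded homs_iff]
  have tb: "taub \<in> D" "kb \<in> D" using D_conj[OF t(1) c] D_conj[OF t(2) c'] by auto
  have Rm: "fa Qb Om \<in> HH (k\<odot>kb)" "fa Rb Om \<in> HH (tau\<odot>taub)" using bar_mem(2)[OF t(2) c' b] bar_mem(2)[OF t(1) c fa_rules(1)[OF t(2,1) g b]] by auto
  have "fa s (bar k kb Qb b) = ctr k taub b (fa (idt k**s) (fa Qb Om))"
    unfolding bar_def using ctr_fa[OF t(2) tb(2,1) b Rm(1) s(1)] by simp
  also have "fa (idt k**s) (fa Qb Om) = fa ((idt k**s) oo Qb) Om"
    using t tb by (intro fa_cp[symmetric, where sigma = "k\<odot>kb" and delta = "k\<odot>taub" and rho = "unt C"]) (simp_all add: homs_iff)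
  also have "\<dots> = fa (g\<star>**idt taub) (fa Rb Om)"
    unfolding s(3) using t tb by (intro fa_cp[where sigma = "tau\<odot>taub" and delta = "k\<odot>taub" and rho = "unt C"]) (simp_all add: homs_iff)
  also have "ctr k taub b \<dots> = bar tau taub Rb (fa g b)"
    unfolding bar_def by (rule ctr_fa_left[OF t(2,1) tb(1) b Rm(2) g])
  finally show ?thesis .
qed

subsection \<open>Coordinates\<close>

lemma repsD [simp]: "m \<in> reps X \<Longrightarrow> m \<in> D" "m \<in> reps X \<Longrightarrow> irr m"
  using reps by (auto simp: irr_representatives_def)

lemma reps_ex: "irr r \<Longrightarrow> r \<in> D \<Longrightarrow> \<exists>s. s \<in> reps X \<and> isom C s r"
  using reps isom_sym unfolding irr_representatives_def by blast

lemma reps_unique: "k \<in> reps X \<Longrightarrow> l \<in> reps X \<Longrightarrow> isom C k l \<Longrightarrow> k = l"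
  using reps isom_refl[of k] unfolding irr_representatives_def by (metis repsD D_ob subsetD)

lemma reps_zero: "k \<in> reps X \<Longrightarrow> l \<in> reps X \<Longrightarrow> k \<noteq> l \<Longrightarrow> f \<in> homs k l \<Longrightarrow> f = arr_zero k l"
  using non_isom_zero[of k l f] reps_unique by auto

lemma D_decomp: assumes t: "tau \<in> D"
  obtains n r W where "decomp tau n r W" "\<And>i. i < n \<Longrightarrow> r i \<in> reps X"
proof -
  obtain n r W where d: "decomp tau n r W" using decomp_ex[of tau] t by auto
  have "\<exists>s. s \<in> reps X \<and> isom C s (r i)" if "i < n" for i
    using reps_ex[OF decompD(1)[OF d that] D_sub[OF t decompD(2,3)[OF d that]]] .
  then obtain s where s: "\<And>i. i < n \<Longrightarrow> s i \<in> reps X \<and> isom C (s i) (r i)" by metis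
  then obtain V where "decomp tau n s V" using decomp_reps[OF d, of s] repsD by metis
  then show ?thesis using that s by blast
qed

text \<open>
  The map that sends \<open>V\<close> in \<open>Hom(m, tau)\<close> to the vector \<open>F(V) a\<close> has an adjoint, and \<open>crd m tau a\<close> is this adjoint.
  For the vectors \<open>a\<close> of an orthonormal basis these are the coordinates of the isotypical component of type \<open>m\<close>.
\<close>

definition crd :: "'o \<Rightarrow> 'o \<Rightarrow> 'v \<Rightarrow> 'v \<Rightarrow> ('o, 'a) arrow" where
  "crd m tau a psi = (THE g. g \<in> homs m tau \<and> (\<forall>V\<in>homs m tau. V\<star> oo g = ip tau (fa V a) psi *> idt m))"

lemma crd_unique:
  assumes g: "g \<in> homs m tau" "\<And>V. V \<in> homs m tau \<Longrightarrow> V\<star> oo g = ip tau (fa V a) psi *> idt m"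
  shows "crd m tau a psi = g"
  unfolding crd_def
proof (rule the_equality)
  fix h assume h: "h \<in> homs m tau \<and> (\<forall>V\<in>homs m tau. V\<star> oo h = ip tau (fa V a) psi *> idt m)"
  note [simp] = g(1)[unfolded homs_iff] h[THEN conjunct1, unfolded homs_iff]
  define V where "V = h \<boxplus> (- 1 *> g)"
  have V: "V \<in> homs m tau" by (simp add: V_def homs_iff)
  note [simp] = V[unfolded homs_iff]
  have "vect (V\<star> oo V) = vect (V\<star> oo h) - vect (V\<star> oo g)" by (subst (2) V_def) (simp add: cp_add)
  also have "\<dots> = 0" using g(2)[OF V] h V by simp
  finally have z: "vect (V\<star> oo V) = 0" .
  have "vect V = 0" by (rule pos'[OF _ z]) simp
  then show "h = g" by (intro arrow.expand) (simp add: V_def)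
qed (use g in auto)

lemma crd_onb_rule:
  assumes o: "onb m tau J V" and t: "m \<in> D" "tau \<in> D" and a: "a \<in> HH m" "psi \<in> HH tau"
  defines "g \<equiv> arr_sum m tau (\<lambda>i. ip tau (fa (V i) a) psi *> V i) J"
  shows "g \<in> homs m tau" "\<And>W. W \<in> homs m tau \<Longrightarrow> W\<star> oo g = ip tau (fa W a) psi *> idt m"
proof -
  have h: "finite J" "irr m" "\<And>i. i \<in> J \<Longrightarrow> V i \<in> homs m tau"
    "\<And>i j. i \<in> J \<Longrightarrow> j \<in> J \<Longrightarrow> (V i)\<star> oo V j = (if i = j then 1 else 0) *> idt m" using o by (auto simp: onb_def)
  note [simp] = h(2) h(3)[unfolded homs_iff] D_ob[OF t(1)] D_ob[OF t(2)]
  let ?c = "\<lambda>i. ip tau (fa (V i) a) psi"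
  let ?g = "arr_sum m tau (\<lambda>i. ?c i *> V i) J"
  have gg: "g = ?g" by (simp add: g_def)
  have g: "?g \<in> homs m tau" by (intro homs_intros) (auto simp: homs_iff)
  then show "g \<in> homs m tau" by (simp add: gg)
  note [simp] = g[unfolded homs_iff]
  have 1: "(V j)\<star> oo ?g = ?c j *> idt m" if j: "j \<in> J" for j
  proof (rule arrow.expand, intro conjI)
    have "vect ((V j)\<star> oo ?g) = (\<Sum>i\<in>J. vect ((V j)\<star> oo (?c i *> V i)))"
      using j by (subst cp_sum(2)) (auto simp: homs_iff)
    also have "\<dots> = (\<Sum>i\<in>J. if i = j then vect (?c i *> idt m) else 0)"
      using j by (intro sum.cong) (auto simp: h(4))
    finally show "vect ((V j)\<star> oo ?g) = vect (?c j *> idt m)" using j h(1) by simp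
  qed (use j in auto)
  fix W assume W: "W \<in> homs m tau"
  note [simp] = W[unfolded homs_iff]
  obtain c where c: "W = arr_sum m tau (\<lambda>i. c i *> V i) J" using onb_coeff[OF o W] by blast
  have Vc: "c i *> V i \<in> homs m tau" if "i \<in> J" for i using that by (simp add: homs_iff)
  show "W\<star> oo g = ip tau (fa W a) psi *> idt m" unfolding gg
  proof (rule arrow.expand, intro conjI)
    have "W\<star> = arr_sum tau m (\<lambda>i. (c i *> V i)\<star>) J" unfolding c by (rule adj_sum) (auto simp: homs_iff)
    then have "W\<star> oo ?g = arr_sum m m (\<lambda>i. (c i *> V i)\<star> oo ?g) J"
      using cp_sum(1)[of J "\<lambda>i. (c i *> V i)\<star>" tau m ?g] by (simp add: homs_iff)
    then have "vect (W\<star> oo ?g) = (\<Sum>i\<in>J. vect ((c i *> V i)\<star> oo ?g))" by simp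
    also have "\<dots> = (\<Sum>i\<in>J. scl C (cnj (c i) * ?c i) (vect (idt m)))"
      by (rule sum.cong[OF refl]) (simp add: 1)
    also have "\<dots> = scl C (\<Sum>i\<in>J. cnj (c i) * ?c i) (vect (idt m))" by (simp add: V.scale_sum_left)
    also have "(\<Sum>i\<in>J. cnj (c i) * ?c i) = (\<Sum>i\<in>J. ip tau (fa (c i *> V i) a) psi)"
      by (rule sum.cong[OF refl]) (use fa_rules(5)[OF t h(3)] fa_rules(1)[OF t h(3)] ip_rules(5)[OF t(2)] a in simp)
    also have "\<dots> = ip tau (\<Sum>i\<in>J. fa (c i *> V i) a) psi"
      using fa_rules(1)[OF t Vc a(1)] by (intro ip_sum(2)[OF t(2) a(2), symmetric]) auto
    also have "(\<Sum>i\<in>J. fa (c i *> V i) a) = fa W a" unfolding c by (rule fa_arr_sum[OF t Vc a(1), symmetric])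
    finally show "vect (W\<star> oo ?g) = vect (ip tau (fa W a) psi *> idt m)" by simp
  qed simp_all
qed

lemma crd_onb:
  assumes o: "onb m tau J V" and t: "m \<in> D" "tau \<in> D" and a: "a \<in> HH m" "psi \<in> HH tau"
  shows "crd m tau a psi = arr_sum m tau (\<lambda>i. ip tau (fa (V i) a) psi *> V i) J"
  by (rule crd_unique) (use crd_onb_rule[OF o t a] in auto)

lemma reps_onb: assumes m: "m \<in> reps X" and t: "tau \<in> D" and d: "decomp tau n r W" and r: "\<And>i. i < n \<Longrightarrow> r i \<in> reps X"
  shows "onb m tau {i. i < n \<and> r i = m} W"
proof -
  have e: "{i. i < n \<and> isom C m (r i)} = {i. i < n \<and> r i = m}"
    using reps_unique[OF m r] isom_refl[of m] m by auto
  have u: "idt m \<in> homs m (r i) \<and> (idt m)\<star> oo idt m = idt m \<and> idt m oo (idt m)\<star> = idt (r i)" if "i < n" "isom C m (r i)" for i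
    using reps_unique[OF m r[OF that(1)] that(2)] m by (auto simp: homs_iff)
  have "onb m tau {i. i < n \<and> isom C m (r i)} (\<lambda>i. W i oo idt m)"
    by (rule decomp_onb[OF d repsD(2)[OF m] D_ob[OF t] u])
  then show ?thesis unfolding e using decompD(2)[OF d] by (auto simp: onb_def homs_iff)
qed

lemma crd:
  assumes m: "m \<in> reps X" and t: "tau \<in> D" and a: "a \<in> HH m" "psi \<in> HH tau"
  shows "crd m tau a psi \<in> homs m tau" "V \<in> homs m tau \<Longrightarrow> V\<star> oo crd m tau a psi = ip tau (fa V a) psi *> idt m"
proof -
  obtain n r W where d: "decomp tau n r W" "\<And>i. i < n \<Longrightarrow> r i \<in> reps X" using D_decomp[OF t] by blast
  note o = crd_onb_rule[OF reps_onb[OF m t d] repsD(1)[OF m] t a] and c = crd_onb[OF reps_onb[OF m t d] repsD(1)[OF m] t a]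
  show "crd m tau a psi \<in> homs m tau" using o(1) c by simp
  show "V \<in> homs m tau \<Longrightarrow> V\<star> oo crd m tau a psi = ip tau (fa V a) psi *> idt m" using o(2)[of V] c by simp
qed

end


section \<open>Operations of the crossed product on triples\<close>

lemma additive_sum:
  fixes P :: "'b::ab_group_add \<Rightarrow> 'c::ab_group_add"
  assumes A: "0 \<in> A" "\<And>a b. a \<in> A \<Longrightarrow> b \<in> A \<Longrightarrow> a + b \<in> A" and P: "\<And>a b. a \<in> A \<Longrightarrow> b \<in> A \<Longrightarrow> P (a + b) = P a + P b"
    and f: "\<And>i. i \<in> I \<Longrightarrow> f i \<in> A"
  shows "P (sum f I) = (\<Sum>i\<in>I. P (f i))" "sum f I \<in> A"
proof -
  have "P 0 = 0" using P[OF A(1) A(1)] by simp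
  then have "P (sum f I) = (\<Sum>i\<in>I. P (f i)) \<and> sum f I \<in> A" using f
    by (induction I rule: infinite_finite_induct) (simp_all add: A P)
  then show "P (sum f I) = (\<Sum>i\<in>I. P (f i))" "sum f I \<in> A" by auto
qed

context crossed
begin

lemma bas_mem [simp]: "m \<in> reps X \<Longrightarrow> i < bdim X m \<Longrightarrow> bas X m i \<in> HH m"
  by (rule bas_hilb)

lemma bas_expand: assumes k: "k \<in> reps X" and x: "x \<in> HH k"
  shows "(\<Sum>i<bdim X k. rs k (ip k (bas X k i) x) (bas X k i)) = x"
proof (rule ip_eqI[OF repsD(1)[OF k] _ x])
  note t = repsD(1)[OF k]
  interpret U: vector_space "rs k" by (rule H_vs[OF t])
  have m: "rs k (ip k (bas X k i) x) (bas X k i) \<in> HH k" if "i \<in> {..<bdim X k}" for i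
    using that k H_closed(3)[OF t] by simp
  let ?y = "\<Sum>i<bdim X k. rs k (ip k (bas X k i) x) (bas X k i)"
  show y: "?y \<in> HH k" by (rule H_closed(5)[OF t m])
  have b: "ip k (bas X k j) ?y = ip k (bas X k j) x" if j: "j < bdim X k" for j
  proof -
    have "ip k (bas X k j) ?y = (\<Sum>i<bdim X k. ip k (bas X k j) (rs k (ip k (bas X k i) x) (bas X k i)))"
      using j k m by (intro ip_sum(1)[OF t]) auto
    also have "\<dots> = (\<Sum>i<bdim X k. if i = j then ip k (bas X k j) x else 0)"
      using j k by (intro sum.cong[OF refl]) (auto simp: ip_rules(2)[OF t] bas_orthonormal)
    finally show ?thesis using j by simp
  qed
  fix v assume "v \<in> HH k"
  then have "v \<in> U.span (bas X k ` {..<bdim X k})" using bas_span[OF k] by simp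
  then have "v \<in> HH k \<and> ip k v ?y = ip k v x"
  proof (induction rule: U.span_induct_alt)
    case base show ?case unfolding ip_rules(7)[OF t y] ip_rules(7)[OF t x] using H_closed(1)[OF t] by simp
  next
    case (step c a v)
    then obtain j where j: "a = bas X k j" "j < bdim X k" by auto
    then have a: "a \<in> HH k" using k by simp
    have "ip k (rs k c a + v) z = cnj c * ip k a z + ip k v z" if "z \<in> HH k" for z
      using that a step.IH ip_rules(4,5)[OF t] H_closed(3)[OF t] by simp
    then show ?case using b[OF j(2)] j(1) a step.IH x y H_closed(2,3)[OF t] by simp
  qed
  then show "ip k v ?y = ip k v x" by simp
qed

lemma crd_arr [simp]:
  assumes "m \<in> reps X" "tau \<in> D" "a \<in> HH m" "psi \<in> HH tau"
  shows "arr (crd m tau a psi)" "src (crd m tau a psi) = m" "tgt (crd m tau a psi) = tau"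
  using crd(1)[OF assms] by (auto simp: homs_iff)

lemma crd_nat:
  assumes m: "m \<in> reps X" and t: "tau \<in> D" "tau' \<in> D" and A: "A \<in> homs tau tau'" and a: "a \<in> HH m" "psi \<in> HH tau"
  shows "A oo crd m tau a psi = crd m tau' a (fa A psi)"
proof (rule crd_unique[symmetric])
  note [simp] = A[unfolded homs_iff]
  show "A oo crd m tau a psi \<in> homs m tau'" using crd(1)[OF m t(1) a] A by (intro homs_intros)
  fix V assume V: "V \<in> homs m tau'"
  note [simp] = V[unfolded homs_iff]
  have Va: "fa V a \<in> HH tau'" by (rule fa_rules(1)[OF repsD(1)[OF m] t(2) V a(1)])
  have AV: "A\<star> oo V \<in> homs m tau" using V A by (intro homs_intros)
  have "V\<star> oo A oo crd m tau a psi = (A\<star> oo V)\<star> oo crd m tau a psi" using m t a by simp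
  also have "\<dots> = ip tau (fa (A\<star> oo V) a) psi *> idt m" by (rule crd(2)[OF m t(1) a AV])
  also have "fa (A\<star> oo V) a = fa (A\<star>) (fa V a)" using m t V A a by (intro fa_cp[where sigma = tau']) (auto intro: homs_intros)
  also have "ip tau \<dots> psi = ip tau' (fa V a) (fa A psi)" by (rule fa_rules(7)[OF t A a(2) Va])
  finally show "V\<star> oo A oo crd m tau a psi = ip tau' (fa V a) (fa A psi) *> idt m" .
qed

lemma crd_add:
  assumes m: "m \<in> reps X" and t: "tau \<in> D" and a: "a \<in> HH m" "psi \<in> HH tau" "phi \<in> HH tau"
  shows "crd m tau a (psi + phi) = crd m tau a psi \<boxplus> crd m tau a phi"
proof (rule crd_unique)
  show "crd m tau a psi \<boxplus> crd m tau a phi \<in> homs m tau" using crd(1)[OF m t a(1)] a by (intro homs_intros) auto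
  fix V assume V: "V \<in> homs m tau"
  have Va: "fa V a \<in> HH tau" by (rule fa_rules(1)[OF repsD(1)[OF m] t V a(1)])
  have "V\<star> oo (crd m tau a psi \<boxplus> crd m tau a phi) = (V\<star> oo crd m tau a psi) \<boxplus> (V\<star> oo crd m tau a phi)"
    using V m t a by (intro cp_add) (auto simp: homs_iff)
  then show "V\<star> oo (crd m tau a psi \<boxplus> crd m tau a phi) = ip tau (fa V a) (psi + phi) *> idt m"
    using crd(2)[OF m t a(1) _ V] a ip_rules(1)[OF t Va a(2,3)] by (simp add: add_scl)
qed

lemma crd_irr:
  assumes k: "k \<in> reps X" and m: "m \<in> reps X" and a: "a \<in> HH m" "psi \<in> HH k"
  shows "crd m k a psi = (if m = k then ip k a psi *> idt k else arr_zero m k)"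
proof (cases "m = k")
  case True
  note t = repsD(1)[OF k]
  have "crd k k a psi = ip k a psi *> idt k"
  proof (rule crd_unique)
    show "ip k a psi *> idt k \<in> homs k k" using k by (simp add: homs_iff)
    fix V assume V: "V \<in> homs k k"
    obtain c where c: "V = c *> idt k" using irr_ex[OF repsD(2)[OF k] V] by blast
    have "fa V a = rs k c a" unfolding c using fa_rules(5)[OF t t homs_simps(1)] a k True t by simp
    then show "V\<star> oo (ip k a psi *> idt k) = ip k (fa V a) psi *> idt k"
      using ip_rules(5)[OF t] a k True by (simp add: c mult.commute)
  qed
  then show ?thesis using True by simp
next
  case False
  have "crd m k a psi = arr_zero m k" by (rule reps_zero[OF m k False crd(1)[OF m repsD(1)[OF k] a]])
  then show ?thesis using False by simp
qed

text \<open>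
  A vector is the sum of its isotypical components, and each of these is recovered from its coordinates.
\<close>

lemma crd_complete:
  assumes t: "tau \<in> D" and d: "decomp tau n r W" and r: "\<And>i. i < n \<Longrightarrow> r i \<in> reps X" and p: "psi \<in> HH tau"
  shows "(\<Sum>k\<in>r ` {..<n}. \<Sum>i<bdim X k. fa (crd k tau (bas X k i) psi) (bas X k i)) = psi"
proof -
  let ?p = "\<lambda>j. fa (W j oo (W j)\<star>) psi"
  have in1: "(\<Sum>i<bdim X k. fa (crd k tau (bas X k i) psi) (bas X k i)) = (\<Sum>j | j < n \<and> r j = k. ?p j)" if k: "k \<in> reps X" for k
  proof -
    note kD = repsD(1)[OF k]
    let ?J = "{j. j < n \<and> r j = k}"
    have W: "W j \<in> homs k tau" "fa ((W j)\<star>) psi \<in> HH k" "?p j = fa (W j) (fa ((W j)\<star>) psi)" if "j \<in> ?J" for j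
    proof -
      show W: "W j \<in> homs k tau" using that decompD(2)[OF d] by auto
      show "fa ((W j)\<star>) psi \<in> HH k" by (rule fa_rules(1)[OF t kD homs_intros(2)[OF W] p])
      show "?p j = fa (W j) (fa ((W j)\<star>) psi)" by (rule fa_cp[OF t kD t W homs_intros(2)[OF W] p])
    qed
    have "fa (crd k tau (bas X k i) psi) (bas X k i) = (\<Sum>j\<in>?J. fa (W j) (rs k (ip k (bas X k i) (fa ((W j)\<star>) psi)) (bas X k i)))"
      if i: "i < bdim X k" for i
    proof -
      note b = bas_mem[OF k i]
      have c: "crd k tau (bas X k i) psi = arr_sum k tau (\<lambda>j. ip tau (fa (W j) (bas X k i)) psi *> W j) ?J"
        by (rule crd_onb[OF reps_onb[OF k t d r] kD t b p])
      have "fa (crd k tau (bas X k i) psi) (bas X k i) = (\<Sum>j\<in>?J. fa (ip tau (fa (W j) (bas X k i)) psi *> W j) (bas X k i))"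
        unfolding c by (rule fa_arr_sum[OF kD t _ b]) (auto intro!: homs_intros W(1))
      also have "\<dots> = (\<Sum>j\<in>?J. fa (W j) (rs k (ip k (bas X k i) (fa ((W j)\<star>) psi)) (bas X k i)))"
      proof (rule sum.cong[OF refl])
        fix j assume j: "j \<in> ?J"
        show "fa (ip tau (fa (W j) (bas X k i)) psi *> W j) (bas X k i) = fa (W j) (rs k (ip k (bas X k i) (fa ((W j)\<star>) psi)) (bas X k i))"
          using fa_rules(5)[OF kD t W(1)[OF j] b] fa_rules(3)[OF kD t W(1)[OF j] b] fa_rules(6)[OF kD t W(1)[OF j] b p] by simp
      qed
      finally show ?thesis .
    qed
    then have "(\<Sum>i<bdim X k. fa (crd k tau (bas X k i) psi) (bas X k i)) =
        (\<Sum>i<bdim X k. \<Sum>j\<in>?J. fa (W j) (rs k (ip k (bas X k i) (fa ((W j)\<star>) psi)) (bas X k i)))" by simp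
    also have "\<dots> = (\<Sum>j\<in>?J. \<Sum>i<bdim X k. fa (W j) (rs k (ip k (bas X k i) (fa ((W j)\<star>) psi)) (bas X k i)))"
      by (rule sum.swap)
    also have "\<dots> = (\<Sum>j\<in>?J. ?p j)"
    proof (rule sum.cong[OF refl])
      fix j assume j: "j \<in> ?J"
      have "(\<Sum>i<bdim X k. fa (W j) (rs k (ip k (bas X k i) (fa ((W j)\<star>) psi)) (bas X k i)))
        = fa (W j) (\<Sum>i<bdim X k. rs k (ip k (bas X k i) (fa ((W j)\<star>) psi)) (bas X k i))"
        using k by (intro fa_sum[OF kD t W(1)[OF j], symmetric]) (simp add: H_closed(3)[OF kD])
      then show "(\<Sum>i<bdim X k. fa (W j) (rs k (ip k (bas X k i) (fa ((W j)\<star>) psi)) (bas X k i))) = ?p j"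
        using bas_expand[OF k W(2)[OF j]] W(3)[OF j] by simp
    qed
    finally show ?thesis .
  qed
  have "(\<Sum>k\<in>r ` {..<n}. \<Sum>i<bdim X k. fa (crd k tau (bas X k i) psi) (bas X k i)) = (\<Sum>k\<in>r ` {..<n}. \<Sum>j | j \<in> {..<n} \<and> r j = k. ?p j)"
    using in1 r by (intro sum.cong[OF refl]) auto
  also have "\<dots> = (\<Sum>j<n. ?p j)" by (rule sum.group) auto
  also have "\<dots> = fa (arr_sum tau tau (\<lambda>i. W i oo (W i)\<star>) {..<n}) psi"
    using decompD(2)[OF d] by (intro fa_arr_sum[OF t t _ p, symmetric]) (auto intro!: homs_intros)
  also have "\<dots> = psi" using d t p by (simp add: decE_def)
  finally show ?thesis .
qed

text \<open>
  For \<open>T\<close> in \<open>Hom(tau rho, sigma)\<close> with an arbitrary degenerate \<open>tau\<close> and a vector \<open>psi\<close> of \<open>F(tau)\<close>, this family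
  of components plays the role of the elementary tensor of \<open>T\<close> and \<open>psi\<close>, which it is for irreducible \<open>tau\<close>
  (\<open>elem_ev\<close>). In these terms, in contrast to the defining formulas, neither irreducible objects nor bases of arrows
  occur in the composition, the product and the adjoint.
\<close>

definition ev :: "'o \<Rightarrow> 'o \<Rightarrow> ('o, 'a) arrow \<Rightarrow> 'v \<Rightarrow> ('o, 'a) cpvec" where
  "ev rho tau T psi = (\<lambda>m i. if m \<in> reps X \<and> i < bdim X m then vect (T oo (crd m tau (bas X m i) psi**idt rho)) else 0)"

definition trip :: "'o \<Rightarrow> 'o \<Rightarrow> 'o \<Rightarrow> ('o, 'a) arrow \<Rightarrow> 'v \<Rightarrow> bool" where
  "trip rho sigma tau T psi \<longleftrightarrow> ob rho \<and> ob sigma \<and> tau \<in> D \<and> T \<in> homs (tau\<odot>rho) sigma \<and> psi \<in> HH tau"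

lemma tripD: assumes "trip rho sigma tau T psi"
  shows "ob rho" "ob sigma" "tau \<in> D" "arr T" "src T = tau\<odot>rho" "tgt T = sigma" "psi \<in> HH tau"
  using assms by (auto simp: trip_def homs_iff)

lemma tripI: "ob rho \<Longrightarrow> ob sigma \<Longrightarrow> tau \<in> D \<Longrightarrow> arr T \<Longrightarrow> src T = tau\<odot>rho \<Longrightarrow> tgt T = sigma \<Longrightarrow> psi \<in> HH tau \<Longrightarrow> trip rho sigma tau T psi"
  by (simp add: trip_def homs_iff)

text \<open>
  The relation between triples: an arrow of degenerate objects acts either on \<open>T\<close> or on the vector.
\<close>

lemma ev_nat:
  assumes p: "trip rho sigma tau' T phi" and t: "tau \<in> D" and A: "A \<in> homs tau tau'" and m: "psi \<in> HH tau"
  shows "ev rho tau (T oo (A**idt rho)) psi = ev rho tau' T (fa A psi)"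
proof (intro ext)
  note [simp] = tripD[OF p] t m A[unfolded homs_iff]
  fix k i
  show "ev rho tau (T oo (A**idt rho)) psi k i = ev rho tau' T (fa A psi) k i"
    using crd_nat[of k tau tau' A "bas X k i" psi] A by (auto simp: ev_def ichg)
qed

lemma ev_add_vec: assumes p: "trip rho sigma tau T psi" and m: "phi \<in> HH tau"
  shows "ev rho tau T (psi + phi) = ev rho tau T psi + ev rho tau T phi"
proof (intro ext)
  note [simp] = tripD[OF p] m
  fix k i
  show "ev rho tau T (psi + phi) k i = (ev rho tau T psi + ev rho tau T phi) k i"
    by (auto simp: ev_def crd_add tp_add cp_add)
qed

lemma ev_lin: assumes p: "trip rho sigma tau T psi"
  shows "trip rho sigma tau S psi \<Longrightarrow> ev rho tau (T \<boxplus> S) psi = ev rho tau T psi + ev rho tau S psi"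
    "ev rho tau (z *> T) psi = (\<lambda>k i. scl C z (ev rho tau T psi k i))" "vect T = 0 \<Longrightarrow> ev rho tau T psi = 0"
proof -
  note [simp] = tripD[OF p]
  show "ev rho tau (T \<boxplus> S) psi = ev rho tau T psi + ev rho tau S psi" if "trip rho sigma tau S psi"
    using tripD[OF that] by (intro ext) (auto simp: ev_def cp_add)
  show "ev rho tau (z *> T) psi = (\<lambda>k i. scl C z (ev rho tau T psi k i))" by (intro ext) (auto simp: ev_def)
  assume "vect T = 0"
  then have "T = arr_zero (tau\<odot>rho) sigma" using vect_zero[of T] by simp
  then show "ev rho tau T psi = 0" by (intro ext) (auto simp: ev_def)
qed

lemma ev_supp:
  assumes p: "trip rho sigma tau T psi" and d: "decomp tau n r W" and r: "\<And>i. i < n \<Longrightarrow> r i \<in> reps X"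
  shows "cp_supp (ev rho tau T psi) \<subseteq> r ` {..<n}"
proof
  note [simp] = tripD[OF p]
  fix k assume "k \<in> cp_supp (ev rho tau T psi)"
  then obtain i where i: "ev rho tau T psi k i \<noteq> 0" by (auto simp: cp_supp_def)
  then have k: "k \<in> reps X" "i < bdim X k" by (auto simp: ev_def split: if_splits)
  show "k \<in> r ` {..<n}"
  proof (rule ccontr)
    assume "k \<notin> r ` {..<n}"
    then have "{j. j < n \<and> r j = k} = {}" by auto
    then have "crd k tau (bas X k i) psi = arr_zero k tau"
      using crd_onb[OF reps_onb[OF k(1) tripD(3)[OF p] d r] repsD(1)[OF k(1)] tripD(3)[OF p] bas_mem[OF k] tripD(7)[OF p]] by (simp only: arr_sum_empty)
    then show False using i k by (simp add: ev_def)
  qed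
qed

lemma ev_mem: assumes p: "trip rho sigma tau T psi" shows "ev rho tau T psi \<in> cp_HomV C X rho sigma"
proof -
  note [simp] = tripD[OF p]
  obtain n r W where d: "decomp tau n r W" "\<And>i. i < n \<Longrightarrow> r i \<in> reps X" using D_decomp[OF tripD(3)[OF p]] by blast
  have "finite (cp_supp (ev rho tau T psi))" by (rule finite_subset[OF ev_supp[OF p d]]) simp_all
  moreover have "ev rho tau T psi k i \<in> HomV C (k\<odot>rho) sigma" if "k \<in> reps X" "i < bdim X k" for k i
  proof -
    have "T oo (crd k tau (bas X k i) psi**idt rho) \<in> Hom C (k\<odot>rho) sigma" using that by simp
    then show ?thesis using that by (simp add: ev_def Hom_iff)
  qed
  ultimately show ?thesis by (auto simp: cp_HomV_def ev_def)
qed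

lemma Arrow_ev: assumes p: "trip rho sigma tau T psi" and k: "k \<in> reps X" "i < bdim X k"
  shows "Arrow (k\<odot>rho) sigma (ev rho tau T psi k i) = T oo (crd k tau (bas X k i) psi**idt rho)"
  using k tripD[OF p] by (intro arrow.expand) (simp add: ev_def)

text \<open>
  A quantity that is computed component by component and depends additively on the vector need not be
  decomposed, by \<open>crd_complete\<close>.
\<close>

lemma expand:
  fixes t :: "'o \<Rightarrow> nat \<Rightarrow> 'w::ab_group_add"
  assumes p: "trip sigma delta tau S psi"
    and tm: "\<And>k i. k \<in> reps X \<Longrightarrow> i < bdim X k \<Longrightarrow> t k i = P (fa (crd k tau (bas X k i) psi) (bas X k i))"
    and z: "\<And>k i. k \<in> reps X \<Longrightarrow> i < bdim X k \<Longrightarrow> ev sigma tau S psi k i = 0 \<Longrightarrow> t k i = 0"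
    and P: "\<And>u v. u \<in> HH tau \<Longrightarrow> v \<in> HH tau \<Longrightarrow> P (u + v) = P u + P v"
  shows "(\<Sum>k\<in>cp_supp (ev sigma tau S psi). \<Sum>i<bdim X k. t k i) = P psi"
proof -
  note t = tripD(3)[OF p] and ps = tripD(7)[OF p]
  obtain n r W where d: "decomp tau n r W" "\<And>i. i < n \<Longrightarrow> r i \<in> reps X" using D_decomp[OF t] by blast
  let ?A = "r ` {..<n}"
  have AX: "k \<in> reps X" if "k \<in> ?A" for k using that d(2) by auto
  have m: "fa (crd k tau (bas X k i) psi) (bas X k i) \<in> HH tau" if "k \<in> reps X" "i \<in> {..<bdim X k}" for k i
    using that t ps by (intro fa_rules(1)[of k] crd(1)) auto
  note as = additive_sum[of "HH tau" P, OF H_closed(1,2)[OF t] P]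
  have "(\<Sum>k\<in>cp_supp (ev sigma tau S psi). \<Sum>i<bdim X k. t k i) = (\<Sum>k\<in>?A. \<Sum>i<bdim X k. t k i)"
    using z AX by (intro sum.mono_neutral_left ev_supp[OF p d] ballI sum.neutral) (auto simp: cp_supp_def)
  also have "\<dots> = (\<Sum>k\<in>?A. P (\<Sum>i<bdim X k. fa (crd k tau (bas X k i) psi) (bas X k i)))"
    using AX tm by (intro sum.cong[OF refl], subst as(1)) (auto intro!: m)
  also have "\<dots> = P (\<Sum>k\<in>?A. \<Sum>i<bdim X k. fa (crd k tau (bas X k i) psi) (bas X k i))"
    by (rule as(1)[symmetric]) (auto intro!: as(2) m AX)
  also have "\<dots> = P psi" using crd_complete[OF t d ps] by simp
  finally show ?thesis .
qed

text \<open>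
  The defining formulas extend an operation \<open>E\<close> on elementary tensors bilinearly to all components. If the arrow
  \<open>M\<close> of the result is natural in the two degenerate objects, then both sums collapse by \<open>expand\<close>.
\<close>

lemma expand2:
  assumes f: "trip sigma delta tau S psi" and g: "trip rho sigma' tau' T phi" and u: "ob ups" "ob \<pi>"
    and Mt: "\<And>k l U V. k \<in> D \<Longrightarrow> l \<in> D \<Longrightarrow> U \<in> homs (k\<odot>sigma) delta \<Longrightarrow> V \<in> homs (l\<odot>rho) sigma' \<Longrightarrow> M k l U V \<in> homs (k\<odot>(l\<odot>ups)) \<pi>"
    and M0: "\<And>k l U V. k \<in> D \<Longrightarrow> l \<in> D \<Longrightarrow> U \<in> homs (k\<odot>sigma) delta \<Longrightarrow> V \<in> homs (l\<odot>rho) sigma' \<Longrightarrow> U = arr_zero (k\<odot>sigma) delta \<or> V = arr_zero (l\<odot>rho) sigma' \<Longrightarrow> vect (M k l U V) = 0"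
    and Mn: "\<And>k l k' l' U V g h. \<lbrakk>k \<in> D; l \<in> D; k' \<in> D; l' \<in> D; g \<in> homs k k'; h \<in> homs l l'; U \<in> homs (k'\<odot>sigma) delta; V \<in> homs (l'\<odot>rho) sigma'\<rbrakk>
      \<Longrightarrow> M k l (U oo (g**idt sigma)) (V oo (h**idt rho)) = M k' l' U V oo ((g**h)**idt ups)"
    and E: "\<And>k l U V a b. \<lbrakk>k \<in> reps X; l \<in> reps X; U \<in> homs (k\<odot>sigma) delta; V \<in> homs (l\<odot>rho) sigma'; a \<in> HH k; b \<in> HH l\<rbrakk>
      \<Longrightarrow> E k U a l V b = ev ups (k\<odot>l) (M k l U V) (bx k l a b)"
  shows "(\<Sum>k\<in>cp_supp (ev sigma tau S psi). \<Sum>i<bdim X k. \<Sum>l\<in>cp_supp (ev rho tau' T phi). \<Sum>j<bdim X l.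
      E k (Arrow (k\<odot>sigma) delta (ev sigma tau S psi k i)) (bas X k i) l (Arrow (l\<odot>rho) sigma' (ev rho tau' T phi l j)) (bas X l j))
    = ev ups (tau\<odot>tau') (M tau tau' S T) (bx tau tau' psi phi)"
proof -
  note [simp] = tripD[OF f] tripD[OF g] u
  have Mtrip: "trip ups \<pi> (k\<odot>l) (M k l U V) w" if "k \<in> D" "l \<in> D" "U \<in> homs (k\<odot>sigma) delta" "V \<in> homs (l\<odot>rho) sigma'" "w \<in> HH (k\<odot>l)" for k l U V w
    using Mt[OF that(1-4)] that by (simp add: trip_def)
  have H: "U oo (g**idt rho') \<in> homs (k\<odot>rho') d" if "U \<in> homs (k'\<odot>rho') d" "g \<in> homs k k'" "ob rho'" for U g k k' rho' d
    using that by (auto simp: homs_iff)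
  have mv: "ev ups (k\<odot>l) (M k l (U oo (g**idt sigma)) (V oo (h**idt rho))) (bx k l a b) = ev ups (k'\<odot>l') (M k' l' U V) (bx k' l' (fa g a) (fa h b))"
    if "k \<in> D" "l \<in> D" "k' \<in> D" "l' \<in> D" "g \<in> homs k k'" "h \<in> homs l l'" "U \<in> homs (k'\<odot>sigma) delta" "V \<in> homs (l'\<odot>rho) sigma'" "a \<in> HH k" "b \<in> HH l" for k l k' l' U V g h a b
  proof -
    have "bx k' l' (fa g a) (fa h b) \<in> HH (k'\<odot>l')" using that by (intro box_mem fa_rules(1)) auto
    note n = ev_nat[OF Mtrip[OF that(3,4,7,8) this] D_tob[OF that(1,2)] homs_intros(3)[OF that(5,6)] box_mem[OF that(1,2,9,10)]]
    show ?thesis unfolding Mn[OF that(1-8)] n using fa_tp[OF that(1,3,2,4,5,6,9,10)] by simp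
  qed
  have zero: "ev ups (k\<odot>l) (M k l U V) (bx k l a b) = 0"
    if "k \<in> D" "l \<in> D" "U \<in> homs (k\<odot>sigma) delta" "V \<in> homs (l\<odot>rho) sigma'" "a \<in> HH k" "b \<in> HH l" "vect U = 0 \<or> vect V = 0" for k l U V a b
  proof (rule ev_lin(3)[OF Mtrip[OF that(1-4) box_mem[OF that(1,2,5,6)]]], rule M0[OF that(1-4)])
    show "U = arr_zero (k\<odot>sigma) delta \<or> V = arr_zero (l\<odot>rho) sigma'" using that vect_zero[of U] vect_zero[of V] by (auto simp: homs_iff)
  qed
  have inner: "(\<Sum>l\<in>cp_supp (ev rho tau' T phi). \<Sum>j<bdim X l. E k U a l (Arrow (l\<odot>rho) sigma' (ev rho tau' T phi l j)) (bas X l j))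
      = ev ups (k\<odot>tau') (M k tau' U T) (bx k tau' a phi)" if k: "k \<in> reps X" and U: "U \<in> homs (k\<odot>sigma) delta" and a: "a \<in> HH k" for k U a
  proof (rule expand[OF g])
    note kD = repsD(1)[OF k]
    have T: "T \<in> homs (tau'\<odot>rho) sigma'" by (simp add: homs_iff)
    fix l j assume l: "l \<in> reps X" "j < bdim X l"
    let ?h = "crd l tau' (bas X l j) phi"
    have h: "?h \<in> homs l tau'" using l by (intro crd) auto
    have V: "T oo (?h**idt rho) \<in> homs (l\<odot>rho) sigma'" by (rule H[OF T h]) simp
    have e: "E k U a l (Arrow (l\<odot>rho) sigma' (ev rho tau' T phi l j)) (bas X l j) = ev ups (k\<odot>l) (M k l U (T oo (?h**idt rho))) (bx k l a (bas X l j))"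
      unfolding Arrow_ev[OF g l] by (rule E[OF k l(1) U V a bas_mem[OF l]])
    have "U oo (idt k**idt sigma) = U" using U kD by (simp add: homs_iff)
    then show "E k U a l (Arrow (l\<odot>rho) sigma' (ev rho tau' T phi l j)) (bas X l j) = ev ups (k\<odot>tau') (M k tau' U T) (bx k tau' a (fa ?h (bas X l j)))"
      unfolding e using mv[OF kD repsD(1)[OF l(1)] kD tripD(3)[OF g] homs_simps(1) h U T a bas_mem[OF l]] kD a by simp
    show "E k U a l (Arrow (l\<odot>rho) sigma' (ev rho tau' T phi l j)) (bas X l j) = 0" if z: "ev rho tau' T phi l j = 0"
      unfolding e
    proof (rule zero[OF kD repsD(1)[OF l(1)] U V a bas_mem[OF l]])
      show "vect U = 0 \<or> vect (T oo (?h**idt rho)) = 0" using Arrow_ev[OF g l] z by (metis arrow.sel(3))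
    qed
  next
    note kD = repsD(1)[OF k]
    fix v w assume vw: "v \<in> HH tau'" "w \<in> HH tau'"
    show "ev ups (k\<odot>tau') (M k tau' U T) (bx k tau' a (v + w)) = ev ups (k\<odot>tau') (M k tau' U T) (bx k tau' a v) + ev ups (k\<odot>tau') (M k tau' U T) (bx k tau' a w)"
      using ev_add_vec[OF Mtrip[OF kD tripD(3)[OF g] U]] g vw a kD by (simp add: box_add_right box_mem trip_def)
  qed
  have S: "S \<in> homs (tau\<odot>sigma) delta" and T: "T \<in> homs (tau'\<odot>rho) sigma'" by (simp_all add: homs_iff)
  show ?thesis
  proof (rule expand[OF f])
    fix k i assume k: "k \<in> reps X" "i < bdim X k"
    note kD = repsD(1)[OF k(1)]
    let ?g = "crd k tau (bas X k i) psi"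
    have h: "?g \<in> homs k tau" using k by (intro crd) auto
    have V: "S oo (?g**idt sigma) \<in> homs (k\<odot>sigma) delta" by (rule H[OF S h]) simp
    note e = inner[OF k(1) V bas_mem[OF k]]
    have "T oo (idt tau'**idt rho) = T" by simp
    then show "(\<Sum>l\<in>cp_supp (ev rho tau' T phi). \<Sum>j<bdim X l. E k (Arrow (k\<odot>sigma) delta (ev sigma tau S psi k i)) (bas X k i) l (Arrow (l\<odot>rho) sigma' (ev rho tau' T phi l j)) (bas X l j))
      = ev ups (tau\<odot>tau') (M tau tau' S T) (bx tau tau' (fa ?g (bas X k i)) phi)"
      unfolding Arrow_ev[OF f k] e using mv[OF kD tripD(3)[OF g] tripD(3)[OF f] tripD(3)[OF g] h homs_simps(1) S T bas_mem[OF k] tripD(7)[OF g]] by simp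
    show "(\<Sum>l\<in>cp_supp (ev rho tau' T phi). \<Sum>j<bdim X l. E k (Arrow (k\<odot>sigma) delta (ev sigma tau S psi k i)) (bas X k i) l (Arrow (l\<odot>rho) sigma' (ev rho tau' T phi l j)) (bas X l j)) = 0"
      if z: "ev sigma tau S psi k i = 0"
      unfolding Arrow_ev[OF f k] e
    proof (rule zero[OF kD tripD(3)[OF g] V T bas_mem[OF k] tripD(7)[OF g]])
      show "vect (S oo (?g**idt sigma)) = 0 \<or> vect T = 0" using Arrow_ev[OF f k] z by (metis arrow.sel(3))
    qed
  next
    fix v w assume vw: "v \<in> HH tau" "w \<in> HH tau"
    show "ev ups (tau\<odot>tau') (M tau tau' S T) (bx tau tau' (v + w) phi) = ev ups (tau\<odot>tau') (M tau tau' S T) (bx tau tau' v phi) + ev ups (tau\<odot>tau') (M tau tau' S T) (bx tau tau' w phi)"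
      using ev_add_vec[OF Mtrip[OF tripD(3)[OF f] tripD(3)[OF g] S T]] vw by (simp add: box_add_left box_mem)
  qed
qed

lemma elem_ev: assumes k: "k \<in> reps X" and p: "trip rho sigma k T psi" shows "elem_tensor C F X k T psi = ev rho k T psi"
proof (intro ext)
  note [simp] = tripD[OF p] k
  fix m i
  show "elem_tensor C F X k T psi m i = ev rho k T psi m i"
    by (auto simp: elem_tensor_def ev_def crd_irr)
qed

lemma fus_onb: assumes k: "k \<in> reps X" and l: "l \<in> reps X" and m: "m \<in> reps X"
  shows "onb m (k\<odot>l) {..<fmul X k l m} (fus X k l m)"
proof -
  note [simp] = k l m
  have h: "fus X k l m \<alpha> \<in> homs m (k\<odot>l)" if "\<alpha> < fmul X k l m" for \<alpha> using fus_Hom[OF k l m that] by (simp add: homs_Hom)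
  have "(fus X k l m \<alpha>)\<star> oo fus X k l m \<beta> = (if \<alpha> = \<beta> then 1 else 0) *> idt m" if "\<alpha> < fmul X k l m" "\<beta> < fmul X k l m" for \<alpha> \<beta>
    using fus_orthonormal[OF k l m that] h[OF that(1)] h[OF that(2)] by (simp add: homs_iff adj_eq cp_eq idt_eq)
  moreover have "vect Y \<in> V.span ((\<lambda>i. vect (fus X k l m i)) ` {..<fmul X k l m})" if "Y \<in> homs m (k\<odot>l)" for Y
    using that fus_span[OF k l m] by (simp add: homs_Hom Hom_iff)
  ultimately show ?thesis using h by (simp add: onb_def)
qed

text \<open>
  The basis of \<open>Hom(m, k l)\<close> in the defining formulas serves to write down the components of a triple with
  object \<open>k l\<close>.
\<close>

lemma fus_sum:
  assumes k: "k \<in> reps X" and l: "l \<in> reps X" and m: "m \<in> reps X" and p: "trip rho sigma (k\<odot>l) N u"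
  shows "(\<Sum>\<alpha><fmul X k l m. elem_tensor C F X m (N oo (fus X k l m \<alpha>**idt rho)) (fa ((fus X k l m \<alpha>)\<star>) u) m) = ev rho (k\<odot>l) N u m"
proof (rule ext)
  fix i
  note N = tripD[OF p] and o = fus_onb[OF k l m]
  let ?I = "{..<fmul X k l m}" and ?V = "fus X k l m"
  have h: "?V \<alpha> \<in> homs m (k\<odot>l)" if "\<alpha> \<in> ?I" for \<alpha> using o that by (simp add: onb_def)
  have N': "N \<in> homs ((k\<odot>l)\<odot>rho) sigma" using N by (simp add: homs_iff)
  have ob: "ob m" "ob (k\<odot>l)" using k l m by simp_all
  have "(\<Sum>\<alpha>\<in>?I. elem_tensor C F X m (N oo (?V \<alpha>**idt rho)) (fa ((?V \<alpha>)\<star>) u) m i) = ev rho (k\<odot>l) N u m i"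
  proof (cases "i < bdim X m")
    case True
    note b = bas_mem[OF m True]
    let ?c = "\<lambda>\<alpha>. ip (k\<odot>l) (fa (?V \<alpha>) (bas X m i)) u"
    have hc: "?c \<alpha> *> ?V \<alpha> \<in> homs m (k\<odot>l)" if "\<alpha> \<in> ?I" for \<alpha> by (rule homs_intros(4)[OF h[OF that]])
    have c: "crd m (k\<odot>l) (bas X m i) u = arr_sum m (k\<odot>l) (\<lambda>\<alpha>. ?c \<alpha> *> ?V \<alpha>) ?I"
      by (rule crd_onb[OF o repsD(1)[OF m] N(3) b N(7)])
    have 1: "crd m (k\<odot>l) (bas X m i) u**idt rho = arr_sum (m\<odot>rho) ((k\<odot>l)\<odot>rho) (\<lambda>\<alpha>. (?c \<alpha> *> ?V \<alpha>)**idt rho) ?I"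
      unfolding c using tp_sum(1)[of ?I "\<lambda>\<alpha>. ?c \<alpha> *> ?V \<alpha>" m "k\<odot>l" "idt rho", OF hc ob arr_idt[OF N(1)]] by (simp only: src_tgt)
    have hi: "(?c \<alpha> *> ?V \<alpha>)**idt rho \<in> homs (m\<odot>rho) ((k\<odot>l)\<odot>rho)" if "\<alpha> \<in> ?I" for \<alpha>
      by (rule homs_intros(3)[OF hc[OF that] homs_simps(1)[OF N(1)]])
    have 2: "N oo arr_sum (m\<odot>rho) ((k\<odot>l)\<odot>rho) (\<lambda>\<alpha>. (?c \<alpha> *> ?V \<alpha>)**idt rho) ?I = arr_sum (m\<odot>rho) sigma (\<lambda>\<alpha>. N oo ((?c \<alpha> *> ?V \<alpha>)**idt rho)) ?I"
      using cp_sum(2)[of ?I "\<lambda>\<alpha>. (?c \<alpha> *> ?V \<alpha>)**idt rho" "m\<odot>rho" "(k\<odot>l)\<odot>rho" N, OF hi tob_Obj[OF ob(1) N(1)] N(4,5)] by (simp only: N(6))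
    have 3: "vect (N oo ((?c \<alpha> *> ?V \<alpha>)**idt rho)) = elem_tensor C F X m (N oo (?V \<alpha>**idt rho)) (fa ((?V \<alpha>)\<star>) u) m i" if "\<alpha> \<in> ?I" for \<alpha>
    proof -
      note a = h[OF that]
      have t: "ip m (bas X m i) (fa ((?V \<alpha>)\<star>) u) = ?c \<alpha>" by (rule fa_rules(6)[OF repsD(1)[OF m] N(3) a b N(7)])
      have "N oo ((?c \<alpha> *> ?V \<alpha>)**idt rho) = ?c \<alpha> *> (N oo (?V \<alpha>**idt rho))" using N(1,4,5) a by (simp add: homs_iff)
      then show ?thesis using True by (simp add: elem_tensor_def t)
    qed
    show ?thesis using m True by (simp add: ev_def 1 2 3)
  qed (simp add: elem_tensor_def ev_def)
  moreover have "(\<Sum>\<alpha>\<in>A. f \<alpha>) j = (\<Sum>\<alpha>\<in>A. f \<alpha> j)" for f :: "nat \<Rightarrow> nat \<Rightarrow> 'a" and A j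
    by (induction A rule: infinite_finite_induct) simp_all
  ultimately show "(\<Sum>\<alpha>\<in>?I. elem_tensor C F X m (N oo (?V \<alpha>**idt rho)) (fa ((?V \<alpha>)\<star>) u) m) i = ev rho (k\<odot>l) N u m i" by simp
qed

definition K where "K = crossed0 C F X"

definition tri :: "'o \<Rightarrow> 'o \<Rightarrow> ('o, 'a) arrow \<Rightarrow> 'v \<Rightarrow> ('o, ('o, 'a) cpvec) arrow" where
  "tri rho tau T psi = Arrow rho (tgt T) (ev rho tau T psi)"

lemma tri_simps [simp]: "src (tri rho tau T psi) = rho" "tgt (tri rho tau T psi) = tgt T" "vect (tri rho tau T psi) = ev rho tau T psi"
  by (simp_all add: tri_def)

lemma K_simps [simp]: "Obj K = Obj C" "HomV K = cp_HomV C X" "scl K = (\<lambda>z x k i. scl C z (x k i))"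
  "unt K = unt C" "tob K = tob C"
  by (simp_all add: K_def crossed0_def)

lemma K_Hom: "f \<in> Hom K rho sigma \<longleftrightarrow> src f = rho \<and> tgt f = sigma \<and> vect f \<in> cp_HomV C X rho sigma"
  by (cases f) (auto simp: Hom_def)

lemma K_src_tgt [simp]: "src (cmp K f g) = src g" "tgt (cmp K f g) = tgt f" "src (star K f) = tgt f" "tgt (star K f) = src f"
  "src (tar K f g) = src f\<odot>src g" "tgt (tar K f g) = tgt f\<odot>tgt g" "src (idn K rho) = rho" "tgt (idn K rho) = rho"
  "src (brd K rho sigma) = rho\<odot>sigma" "tgt (brd K rho sigma) = sigma\<odot>rho" "src (arr_scl K c f) = src f" "tgt (arr_scl K c f) = tgt f"
  by (simp_all add: K_def crossed0_def arr_scl_def)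

lemma tri_Hom: "trip rho sigma tau T psi \<Longrightarrow> tri rho tau T psi \<in> Hom K rho sigma"
  using ev_mem[of rho sigma tau T psi] tripD[of rho sigma tau T psi] by (simp add: K_Hom)

lemma tri_nat:
  assumes "trip rho sigma tau' T phi" and "tau \<in> D" and "A \<in> homs tau tau'" and "psi \<in> HH tau"
  shows "tri rho tau (T oo (A**idt rho)) psi = tri rho tau' T (fa A psi)"
  by (simp add: tri_def ev_nat[OF assms])

text \<open>
  The three operations on triples. Their vectors are the products of the vectors and the conjugate vector, and for
  the adjoint any solution of the conjugate equations may be used.
\<close>

lemma K_cmp:
  assumes f: "trip sigma delta tau S psi" and g: "trip rho sigma tau' T phi"
  shows "cmp K (tri sigma tau S psi) (tri rho tau' T phi) = tri rho (tau\<odot>tau') (S oo (idt tau**T)) (bx tau tau' psi phi)"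
    "trip rho delta (tau\<odot>tau') (S oo (idt tau**T)) (bx tau tau' psi phi)"
proof -
  note [simp] = tripD[OF f] tripD[OF g]
  show p: "trip rho delta (tau\<odot>tau') (S oo (idt tau**T)) (bx tau tau' psi phi)" by (rule tripI) (auto intro: box_mem)
  have "(\<Sum>k\<in>cp_supp (ev sigma tau S psi). \<Sum>i<bdim X k. \<Sum>l\<in>cp_supp (ev rho tau' T phi). \<Sum>j<bdim X l.
      elem_cmp C F X rho k (Arrow (k\<odot>sigma) delta (ev sigma tau S psi k i)) (bas X k i) l (Arrow (l\<odot>rho) sigma (ev rho tau' T phi l j)) (bas X l j))
    = ev rho (tau\<odot>tau') (S oo (idt tau**T)) (bx tau tau' psi phi)"
  proof (rule expand2[OF f g, where \<pi> = delta and M = "\<lambda>k l U V. U oo (idt k**V)"])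
    fix k l U V assume h: "k \<in> D" "l \<in> D" "U \<in> homs (k\<odot>sigma) delta" "V \<in> homs (l\<odot>rho) sigma"
    note [simp] = h(1,2) h(3,4)[unfolded homs_iff]
    show "U oo (idt k**V) \<in> homs (k\<odot>(l\<odot>rho)) delta" by (simp add: homs_iff)
    show "vect (U oo (idt k**V)) = 0" if "U = arr_zero (k\<odot>sigma) delta \<or> V = arr_zero (l\<odot>rho) sigma" using that by auto
  next
    fix k l k' l' U V g h assume h: "k \<in> D" "l \<in> D" "k' \<in> D" "l' \<in> D" "g \<in> homs k k'" "h \<in> homs l l'" "U \<in> homs (k'\<odot>sigma) delta" "V \<in> homs (l'\<odot>rho) sigma"
    note [simp] = h(1-4) h(5-8)[unfolded homs_iff]
    have "(g**idt sigma) oo (idt k**(V oo (h**idt rho))) = (idt k'**V) oo (g**h**idt rho)"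
      by (simp add: ichg)
    then show "(U oo (g**idt sigma)) oo (idt k**(V oo (h**idt rho))) = (U oo (idt k'**V)) oo ((g**h)**idt rho)" by simp
  next
    fix k l U V a b assume h: "k \<in> reps X" "l \<in> reps X" "U \<in> homs (k\<odot>sigma) delta" "V \<in> homs (l\<odot>rho) sigma" "a \<in> HH k" "b \<in> HH l"
    note [simp] = h(1,2) h(3,4)[unfolded homs_iff]
    have p': "trip rho delta (k\<odot>l) (U oo (idt k**V)) (bx k l a b)" using h by (intro tripI) (auto intro: box_mem)
    have "elem_cmp C F X rho k U a l V b m = ev rho (k\<odot>l) (U oo (idt k**V)) (bx k l a b) m" for m
    proof (cases "m \<in> reps X")
      case True
      have e: "(U \<cdot> (idn C k \<boxtimes> V)) \<cdot> (fus X k l m \<alpha> \<boxtimes> idn C rho) = (U oo (idt k**V)) oo (fus X k l m \<alpha>**idt rho)" "star C (fus X k l m \<alpha>) = (fus X k l m \<alpha>)\<star>"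
        if "\<alpha> < fmul X k l m" for \<alpha>
      proof -
        have "fus X k l m \<alpha> \<in> homs m (k\<odot>l)" using fus_onb[OF h(1,2) True] that by (simp add: onb_def)
        note [simp] = this[unfolded homs_iff]
        show "(U \<cdot> (idn C k \<boxtimes> V)) \<cdot> (fus X k l m \<alpha> \<boxtimes> idn C rho) = (U oo (idt k**V)) oo (fus X k l m \<alpha>**idt rho)" by (simp add: cp_eq tp_eq idt_eq del: cp_assoc)
        show "star C (fus X k l m \<alpha>) = (fus X k l m \<alpha>)\<star>" by (simp add: adj_eq)
      qed
      have "elem_cmp C F X rho k U a l V b m = (\<Sum>\<alpha><fmul X k l m. elem_tensor C F X m ((U oo (idt k**V)) oo (fus X k l m \<alpha>**idt rho)) (fa ((fus X k l m \<alpha>)\<star>) (bx k l a b)) m)"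
        unfolding elem_cmp_def using True by (simp only: if_True) (intro sum.cong[OF refl], simp only: e lessThan_iff)
      then show ?thesis unfolding fus_sum[OF h(1,2) True p'] .
    qed (auto simp: elem_cmp_def ev_def)
    then show "elem_cmp C F X rho k U a l V b = ev rho (k\<odot>l) (U oo (idt k**V)) (bx k l a b)" by blast
  qed simp_all
  then show "cmp K (tri sigma tau S psi) (tri rho tau' T phi) = tri rho (tau\<odot>tau') (S oo (idt tau**T)) (bx tau tau' psi phi)"
    by (simp add: K_def crossed0_def tri_def)
qed

lemma K_tar:
  assumes f: "trip rho sigma tau S psi" and g: "trip rho' sigma' tau' T phi"
  shows "tar K (tri rho tau S psi) (tri rho' tau' T phi) = tri (rho\<odot>rho') (tau\<odot>tau') ((S**T) oo (idt tau**br tau' rho**idt rho')) (bx tau tau' psi phi)"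
    "trip (rho\<odot>rho') (sigma\<odot>sigma') (tau\<odot>tau') ((S**T) oo (idt tau**br tau' rho**idt rho')) (bx tau tau' psi phi)"
proof -
  note [simp] = tripD[OF f] tripD[OF g]
  show p: "trip (rho\<odot>rho') (sigma\<odot>sigma') (tau\<odot>tau') ((S**T) oo (idt tau**br tau' rho**idt rho')) (bx tau tau' psi phi)" by (rule tripI) (auto intro: box_mem)
  have "(\<Sum>k\<in>cp_supp (ev rho tau S psi). \<Sum>i<bdim X k. \<Sum>l\<in>cp_supp (ev rho' tau' T phi). \<Sum>j<bdim X l.
      elem_tar C F X rho rho' k (Arrow (k\<odot>rho) sigma (ev rho tau S psi k i)) (bas X k i) l (Arrow (l\<odot>rho') sigma' (ev rho' tau' T phi l j)) (bas X l j))
    = ev (rho\<odot>rho') (tau\<odot>tau') ((S**T) oo (idt tau**br tau' rho**idt rho')) (bx tau tau' psi phi)"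
  proof (rule expand2[OF f g, where \<pi> = "sigma\<odot>sigma'" and M = "\<lambda>k l U V. (U**V) oo (idt k**br l rho**idt rho')"])
    fix k l U V assume h: "k \<in> D" "l \<in> D" "U \<in> homs (k\<odot>rho) sigma" "V \<in> homs (l\<odot>rho') sigma'"
    note [simp] = h(1,2) h(3,4)[unfolded homs_iff]
    show "(U**V) oo (idt k**br l rho**idt rho') \<in> homs (k\<odot>(l\<odot>(rho\<odot>rho'))) (sigma\<odot>sigma')" by (simp add: homs_iff)
    show "vect ((U**V) oo (idt k**br l rho**idt rho')) = 0" if "U = arr_zero (k\<odot>rho) sigma \<or> V = arr_zero (l\<odot>rho') sigma'" using that by auto
  next
    fix k l k' l' U V g h assume h: "k \<in> D" "l \<in> D" "k' \<in> D" "l' \<in> D" "g \<in> homs k k'" "h \<in> homs l l'" "U \<in> homs (k'\<odot>rho) sigma" "V \<in> homs (l'\<odot>rho') sigma'"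
    note [simp] = h(1-4) h(5-8)[unfolded homs_iff]
    have "((U oo (g**idt rho))**(V oo (h**idt rho'))) oo (idt k**br l rho**idt rho') = (U**V) oo (g**(idt rho**h)**idt rho') oo (idt k**br l rho**idt rho')"
      by (subst ichg[symmetric]) simp_all
    also have "(g**(idt rho**h)**idt rho') oo (idt k**br l rho**idt rho') = g**((idt rho**h) oo br l rho)**idt rho'" by (simp add: ichg del: tp_assoc)
    also have "(idt rho**h) oo br l rho = br l' rho oo (h**idt rho)" by (simp add: br_nat)
    also have "g**(br l' rho oo (h**idt rho))**idt rho' = (idt k'**br l' rho**idt rho') oo (g**(h**idt rho)**idt rho')" by (simp add: ichg del: tp_assoc)
    finally show "((U oo (g**idt rho))**(V oo (h**idt rho'))) oo (idt k**br l rho**idt rho') = ((U**V) oo (idt k'**br l' rho**idt rho')) oo ((g**h)**idt (rho\<odot>rho'))" by simp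
  next
    fix k l U V a b assume h: "k \<in> reps X" "l \<in> reps X" "U \<in> homs (k\<odot>rho) sigma" "V \<in> homs (l\<odot>rho') sigma'" "a \<in> HH k" "b \<in> HH l"
    note [simp] = h(1,2) h(3,4)[unfolded homs_iff]
    let ?M = "(U**V) oo (idt k**br l rho**idt rho')"
    have p': "trip (rho\<odot>rho') (sigma\<odot>sigma') (k\<odot>l) ?M (bx k l a b)" using h by (intro tripI) (auto intro: box_mem)
    have "elem_tar C F X rho rho' k U a l V b m = ev (rho\<odot>rho') (k\<odot>l) ?M (bx k l a b) m" for m
    proof (cases "m \<in> reps X")
      case True
      have e: "((U \<boxtimes> V) \<cdot> (idn C k \<boxtimes> brd C l rho \<boxtimes> idn C rho')) \<cdot> (fus X k l m \<alpha> \<boxtimes> idn C (rho\<odot>rho')) = ?M oo (fus X k l m \<alpha>**idt (rho\<odot>rho'))" "star C (fus X k l m \<alpha>) = (fus X k l m \<alpha>)\<star>"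
        if "\<alpha> < fmul X k l m" for \<alpha>
      proof -
        have "fus X k l m \<alpha> \<in> homs m (k\<odot>l)" using fus_onb[OF h(1,2) True] that by (simp add: onb_def)
        note [simp] = this[unfolded homs_iff]
        show "((U \<boxtimes> V) \<cdot> (idn C k \<boxtimes> brd C l rho \<boxtimes> idn C rho')) \<cdot> (fus X k l m \<alpha> \<boxtimes> idn C (rho\<odot>rho')) = ?M oo (fus X k l m \<alpha>**idt (rho\<odot>rho'))"
          by (simp add: cp_eq tp_eq idt_eq br_eq del: cp_assoc)
        show "star C (fus X k l m \<alpha>) = (fus X k l m \<alpha>)\<star>" by (simp add: adj_eq)
      qed
      have "elem_tar C F X rho rho' k U a l V b m = (\<Sum>\<alpha><fmul X k l m. elem_tensor C F X m (?M oo (fus X k l m \<alpha>**idt (rho\<odot>rho'))) (fa ((fus X k l m \<alpha>)\<star>) (bx k l a b)) m)"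
        unfolding elem_tar_def using True by (simp only: if_True) (intro sum.cong[OF refl], simp only: e lessThan_iff)
      then show ?thesis unfolding fus_sum[OF h(1,2) True p'] .
    qed (auto simp: elem_tar_def ev_def)
    then show "elem_tar C F X rho rho' k U a l V b = ev (rho\<odot>rho') (k\<odot>l) ?M (bx k l a b)" by blast
  qed simp_all
  then show "tar K (tri rho tau S psi) (tri rho' tau' T phi) = tri (rho\<odot>rho') (tau\<odot>tau') ((S**T) oo (idt tau**br tau' rho**idt rho')) (bx tau tau' psi phi)"
    by (simp add: K_def crossed0_def tri_def)
qed

lemma c_csol: "k \<in> reps X \<Longrightarrow> csol k (cjg X k) (cR X k) (cRb X k)"
  using cR_solution[of k] by (simp add: normalized_solution_def csol_iff)

lemma K_star:
  assumes f: "trip rho sigma tau T psi" and c: "csol tau taub R Rb"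
  shows "star K (tri rho tau T psi) = tri sigma taub ((R\<star>**idt rho) oo (idt taub**T\<star>)) (bar tau taub Rb psi)"
    "trip sigma rho taub ((R\<star>**idt rho) oo (idt taub**T\<star>)) (bar tau taub Rb psi)"
proof -
  note [simp] = tripD[OF f] csol_t[OF c]
  note tb = D_conj[OF tripD(3)[OF f] c]
  have p: "trip sigma rho taub ((R\<star>**idt rho) oo (idt taub**T\<star>)) (bar tau taub Rb u)" if u: "u \<in> HH tau" for u
    by (rule tripI) (use tb bar_mem(1)[OF tripD(3)[OF f] c u] in auto)
  then show "trip sigma rho taub ((R\<star>**idt rho) oo (idt taub**T\<star>)) (bar tau taub Rb psi)" by simp
  have "(\<Sum>k\<in>cp_supp (ev rho tau T psi). \<Sum>i<bdim X k. elem_star C F X rho k (Arrow (k\<odot>rho) sigma (ev rho tau T psi k i)) (bas X k i))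
    = ev sigma taub ((R\<star>**idt rho) oo (idt taub**T\<star>)) (bar tau taub Rb psi)"
  proof (rule expand[OF f, where P = "\<lambda>u. ev sigma taub ((R\<star>**idt rho) oo (idt taub**T\<star>)) (bar tau taub Rb u)"])
    fix k i assume k: "k \<in> reps X" "i < bdim X k"
    note kD = repsD(1)[OF k(1)] and ck = c_csol[OF k(1)] and b = bas_mem[OF k]
    note kb = D_conj[OF kD ck]
    let ?kb = "cjg X k" and ?Q = "cR X k" and ?g = "crd k tau (bas X k i) psi"
    have g: "?g \<in> homs k tau" using k by (intro crd) auto
    define U where "U = T oo (?g**idt rho)"
    have U: "arr U" "src U = k\<odot>rho" "tgt U = sigma" using g by (simp_all add: U_def homs_iff)
    note [simp] = csol_t[OF ck] g[unfolded homs_iff] U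
    have pe: "trip sigma rho ?kb ((?Q\<star>**idt rho) oo (idt ?kb**U\<star>)) (bar k ?kb (cRb X k) (bas X k i))"
      by (rule tripI) (use kb bar_mem(1)[OF kD ck b] in auto)
    have "elem_star C F X rho k U (bas X k i) = elem_tensor C F X ?kb ((?Q\<star>**idt rho) oo (idt ?kb**U\<star>)) (bar k ?kb (cRb X k) (bas X k i))"
      by (simp add: elem_star_def cp_bar_def bar_def ctr_def cp_eq tp_eq idt_eq adj_eq)
    also have "\<dots> = ev sigma ?kb ((?Q\<star>**idt rho) oo (idt ?kb**U\<star>)) (bar k ?kb (cRb X k) (bas X k i))"
      using k cjg_reps by (intro elem_ev[OF _ pe]) blast
    finally have e: "elem_star C F X rho k (Arrow (k\<odot>rho) sigma (ev rho tau T psi k i)) (bas X k i) = ev sigma ?kb ((?Q\<star>**idt rho) oo (idt ?kb**U\<star>)) (bar k ?kb (cRb X k) (bas X k i))"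
      using Arrow_ev[OF f k] by (simp add: U_def)
    define s where "s = tps ?kb ?Q (?g\<star>) Rb taub"
    have gd: "?g\<star> \<in> homs tau k" by (rule homs_intros(2)[OF g])
    note s = tps[OF c ck gd, folded s_def]
    note [simp] = s(1)[unfolded homs_iff]
    have "(?Q\<star>**idt rho) oo (idt ?kb**U\<star>) = ((?Q\<star> oo (idt ?kb**?g\<star>))**idt rho) oo (idt ?kb**T\<star>)" by (simp add: U_def tp_cp)
    also have "\<dots> = ((R\<star>**idt rho) oo (idt taub**T\<star>)) oo (s**idt sigma)" unfolding s(2)[symmetric] by (simp add: tp_cp slide)
    finally have "ev sigma ?kb ((?Q\<star>**idt rho) oo (idt ?kb**U\<star>)) (bar k ?kb (cRb X k) (bas X k i))
        = ev sigma taub ((R\<star>**idt rho) oo (idt taub**T\<star>)) (fa s (bar k ?kb (cRb X k) (bas X k i)))"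
      using ev_nat[OF p[OF tripD(7)[OF f]] kb s(1) bar_mem(1)[OF kD ck b]] by simp
    then show "elem_star C F X rho k (Arrow (k\<odot>rho) sigma (ev rho tau T psi k i)) (bas X k i) = ev sigma taub ((R\<star>**idt rho) oo (idt taub**T\<star>)) (bar tau taub Rb (fa ?g (bas X k i)))"
      unfolding e using bar_fa[OF tripD(3)[OF f] kD c ck g b] by (simp add: s_def)
    assume "ev rho tau T psi k i = 0"
    then have "vect U = 0" using Arrow_ev[OF f k] unfolding U_def by (metis arrow.sel(3))
    then have "U = arr_zero (k\<odot>rho) sigma" using vect_zero[of U] by simp
    then show "elem_star C F X rho k (Arrow (k\<odot>rho) sigma (ev rho tau T psi k i)) (bas X k i) = 0"
      unfolding e by (intro ev_lin(3)[OF pe]) simp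
  next
    fix u v assume uv: "u \<in> HH tau" "v \<in> HH tau"
    show "ev sigma taub ((R\<star>**idt rho) oo (idt taub**T\<star>)) (bar tau taub Rb (u + v)) =
      ev sigma taub ((R\<star>**idt rho) oo (idt taub**T\<star>)) (bar tau taub Rb u) + ev sigma taub ((R\<star>**idt rho) oo (idt taub**T\<star>)) (bar tau taub Rb v)"
      unfolding bar_add[OF tripD(3)[OF f] c uv] by (rule ev_add_vec[OF p[OF uv(1)] bar_mem(1)[OF tripD(3)[OF f] c uv(2)]])
  qed
  then show "star K (tri rho tau T psi) = tri sigma taub ((R\<star>**idt rho) oo (idt taub**T\<star>)) (bar tau taub Rb psi)"
    by (simp add: K_def crossed0_def tri_def)
qed

end


section \<open>The tensor star-category of triples\<close>

context pre_BTC_star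
begin

lemma csol_ex: "ob rho \<Longrightarrow> \<exists>rhob R Rb. csol rho rhob R Rb"
  using conj_ex[of rho] by (simp add: csol_iff)

text \<open>
  The following identities between arrows of \<open>C\<close> are what remains of the interchange law, the associativity of the
  product and the rules for the adjoint of a composition and of a product when both sides are written as triples. If
  the vectors of the two triples have their factors in a different order, the braiding of the degenerate
  objects appears on one side and is then moved to the vector.
\<close>

lemma interchange_arrow:
  assumes [simp]: "arr S" "src S = tau\<odot>sigma" "arr S'" "src S' = tau'\<odot>sigma'" "arr T" "src T = ups\<odot>rho" "tgt T = sigma" "arr T'" "src T' = ups'\<odot>rho'" "tgt T' = sigma'"
    and [simp]: "ob tau" "ob tau'" "ob ups" "ob ups'" "ob rho" "ob rho'" "ob sigma" "ob sigma'"
  shows "((S**S') oo (idt tau**br tau' sigma**idt sigma')) oo (idt (tau\<odot>tau')**((T**T') oo (idt ups**br ups' rho**idt rho')))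
    = (((S oo (idt tau**T))**(S' oo (idt tau'**T'))) oo (idt (tau\<odot>ups)**br (tau'\<odot>ups') rho**idt rho')) oo ((idt tau**br tau' ups**idt ups')**idt (rho\<odot>rho'))"
proof -
  have 1: "(br tau' sigma**idt sigma') oo (idt tau'**T**T') = ((T**idt tau')**T') oo (br tau' (ups\<odot>rho)**idt (ups'\<odot>rho'))"
  proof -
    have "(br tau' sigma**idt sigma') oo ((idt tau'**T)**T') = (br tau' sigma oo (idt tau'**T))**T'" by (simp add: ichg del: tp_assoc)
    also have "\<dots> = ((T**idt tau') oo br tau' (ups\<odot>rho))**T'" by (simp add: br_nat)
    also have "\<dots> = ((T**idt tau')**T') oo (br tau' (ups\<odot>rho)**idt (ups'\<odot>rho'))" by (simp add: ichg del: tp_assoc)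
    finally show ?thesis by simp
  qed
  have 2: "(br tau' (ups\<odot>rho)**idt (ups'\<odot>rho')) oo (idt (tau'\<odot>ups)**br ups' rho**idt rho') = (idt ups**br (tau'\<odot>ups') rho**idt rho') oo (br tau' ups**idt (ups'\<odot>(rho\<odot>rho')))"
  proof -
    have "br tau' (ups\<odot>rho)**idt (ups'\<odot>rho') = (idt ups**br tau' rho**idt (ups'\<odot>rho')) oo (br tau' ups**idt (rho\<odot>(ups'\<odot>rho')))"
      unfolding br_right[of tau' ups rho, simplified] by (simp add: tp_cp)
    moreover have "(br tau' ups**idt (rho\<odot>(ups'\<odot>rho'))) oo (idt (tau'\<odot>ups)**br ups' rho**idt rho') = (idt (ups\<odot>tau')**br ups' rho**idt rho') oo (br tau' ups**idt (ups'\<odot>(rho\<odot>rho')))"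
      using slide[of "br tau' ups" "br ups' rho**idt rho'", OF _ _ refl refl refl refl] by simp
    moreover have "idt ups**br (tau'\<odot>ups') rho**idt rho' = (idt ups**br tau' rho**idt (ups'\<odot>rho')) oo (idt (ups\<odot>tau')**br ups' rho**idt rho')"
      unfolding br_left[of tau' ups' rho, simplified] by (simp add: tp_cp)
    ultimately show ?thesis by simp
  qed
  let ?X = "(br tau' sigma**idt sigma') oo (idt tau'**T**T') oo (idt (tau'\<odot>ups)**br ups' rho**idt rho')"
  let ?Y = "((T**idt tau')**T') oo (idt ups**br (tau'\<odot>ups') rho**idt rho') oo (br tau' ups**idt (ups'\<odot>(rho\<odot>rho')))"
  have "?X = ?Y" using cp_subst[OF 1, of "idt (tau'\<odot>ups)**br ups' rho**idt rho'"] 2 by simp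
  then have "(S**S') oo (idt tau**?X) = (S**S') oo (idt tau**?Y)" by (simp only:)
  moreover have "(S**S') oo (idt tau**(T**idt tau')**T') = (S oo (idt tau**T))**(S' oo (idt tau'**T'))"
    using ichg[of S "idt tau**T" S' "idt tau'**T'"] by simp
  then have "(S**S') oo (idt tau**?Y) = (((S oo (idt tau**T))**(S' oo (idt tau'**T'))) oo (idt (tau\<odot>ups)**br (tau'\<odot>ups') rho**idt rho')) oo ((idt tau**br tau' ups**idt ups')**idt (rho\<odot>rho'))"
    using cp_subst[of "S**S'" "idt tau**(T**idt tau')**T'" _ "(idt (tau\<odot>ups)**br (tau'\<odot>ups') rho**idt rho') oo (idt tau**br tau' ups**idt (ups'\<odot>(rho\<odot>rho')))"]
    by (simp add: tp_cp)
  ultimately show ?thesis by (simp add: tp_cp)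
qed

lemma tensor_assoc_arrow:
  assumes [simp]: "arr T1" "src T1 = tau1\<odot>rho1" "arr T2" "src T2 = tau2\<odot>rho2" "arr T3" "src T3 = tau3\<odot>rho3"
    and [simp]: "ob tau1" "ob tau2" "ob tau3" "ob rho1" "ob rho2" "ob rho3"
  shows "(((T1**T2) oo (idt tau1**br tau2 rho1**idt rho2))**T3) oo (idt (tau1\<odot>tau2)**br tau3 (rho1\<odot>rho2)**idt rho3)
    = (T1**((T2**T3) oo (idt tau2**br tau3 rho2**idt rho3))) oo (idt tau1**br (tau2\<odot>tau3) rho1**idt (rho2\<odot>rho3))"
proof -
  have 1: "((T1**T2) oo (idt tau1**br tau2 rho1**idt rho2))**T3 = (T1**T2**T3) oo (idt tau1**br tau2 rho1**idt (rho2\<odot>(tau3\<odot>rho3)))"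
    using ichg[of "T1**T2" "idt tau1**br tau2 rho1**idt rho2" T3 "idt (tau3\<odot>rho3)"] by simp
  have 2: "idt (tau1\<odot>tau2)**br tau3 (rho1\<odot>rho2)**idt rho3 = (idt (tau1\<odot>(tau2\<odot>rho1))**br tau3 rho2**idt rho3) oo (idt (tau1\<odot>tau2)**br tau3 rho1**idt (rho2\<odot>rho3))"
    unfolding br_right[of tau3 rho1 rho2, simplified] by (simp add: tp_cp)
  have 3: "T1**((T2**T3) oo (idt tau2**br tau3 rho2**idt rho3)) = (T1**T2**T3) oo (idt (tau1\<odot>(rho1\<odot>tau2))**br tau3 rho2**idt rho3)"
    using ichg[of T1 "idt (tau1\<odot>rho1)" "T2**T3" "idt tau2**br tau3 rho2**idt rho3"] by simp
  have 4: "idt tau1**br (tau2\<odot>tau3) rho1**idt (rho2\<odot>rho3) = (idt tau1**br tau2 rho1**idt (tau3\<odot>(rho2\<odot>rho3))) oo (idt (tau1\<odot>tau2)**br tau3 rho1**idt (rho2\<odot>rho3))"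
    unfolding br_left[of tau2 tau3 rho1, simplified] by (simp add: tp_cp)
  have 5: "(idt tau1**br tau2 rho1**idt (rho2\<odot>(tau3\<odot>rho3))) oo (idt (tau1\<odot>(tau2\<odot>rho1))**br tau3 rho2**idt rho3)
      = (idt (tau1\<odot>(rho1\<odot>tau2))**br tau3 rho2**idt rho3) oo (idt tau1**br tau2 rho1**idt (tau3\<odot>(rho2\<odot>rho3)))"
    using exch[of "br tau2 rho1" "br tau3 rho2" _ _ _ _ tau1 "unt C" rho3, OF _ _ refl refl refl refl] by simp
  show ?thesis unfolding 1 2 3 4 using cp_subst[OF 5, of "idt (tau1\<odot>tau2)**br tau3 rho1**idt (rho2\<odot>rho3)"] by simp
qed

lemma adjoint_cp_arrow:
  assumes c: "csol tau taub R Rb" and c': "csol tau' taub' R' Rb'"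
    and [simp]: "arr S" "src S = tau\<odot>sigma" "tgt S = delta" "arr T" "src T = tau'\<odot>rho" "tgt T = sigma" "ob rho" "ob sigma"
  shows "((((idt taub'**R**idt tau') oo R')\<star>)**idt rho) oo (idt (taub'\<odot>taub)**(S oo (idt tau**T))\<star>)
    = ((R'\<star>**idt rho) oo (idt taub'**T\<star>)) oo (idt taub'**((R\<star>**idt sigma) oo (idt taub**S\<star>)))"
proof -
  note [simp] = csol_t[OF c] csol_t[OF c']
  have "(idt taub'**R\<star>**idt (tau'\<odot>rho)) oo (idt (taub'\<odot>(taub\<odot>tau))**T\<star>) = (idt taub'**T\<star>) oo (idt taub'**R\<star>**idt sigma)"
    using slide[of "idt taub'**R\<star>" "T\<star>", OF _ _ refl refl refl refl] by simp
  note e = cp_subst[OF this, of "idt (taub'\<odot>taub)**S\<star>"]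
  show ?thesis using e by (simp add: tp_cp)
qed

lemma adjoint_tp_arrow:
  assumes c: "csol tau taub R Rb" and c': "csol tau' taub' R' Rb'"
    and [simp]: "arr S" "src S = tau\<odot>rho" "tgt S = sigma" "arr T" "src T = tau'\<odot>rho'" "tgt T = sigma'" "ob rho" "ob sigma" "ob rho'" "ob sigma'"
  shows "((((idt taub'**R**idt tau') oo R')\<star>)**idt (rho\<odot>rho')) oo (idt (taub'\<odot>taub)**((S**T) oo (idt tau**br tau' rho**idt rho'))\<star>)
    = ((((R\<star>**idt rho) oo (idt taub**S\<star>))**((R'\<star>**idt rho') oo (idt taub'**T\<star>))) oo (idt taub**br taub' sigma**idt sigma')) oo (br taub' taub**idt (sigma\<odot>sigma'))"
proof -
  note [simp] = csol_t[OF c] csol_t[OF c']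
  define H where "H = (R\<star>**idt rho) oo (idt taub**S\<star>)"
  have H [simp]: "arr H" "src H = taub\<odot>sigma" "tgt H = rho" by (simp_all add: H_def)
  let ?B = "br tau' rho"
  have "idt (taub'\<odot>taub)**((S**T) oo (idt tau**?B**idt rho'))\<star> = (idt (taub'\<odot>(taub\<odot>tau))**?B\<star>**idt rho') oo (idt (taub'\<odot>taub)**S\<star>**T\<star>)"
    by (simp add: tp_cp)
  have "(idt taub'**R\<star>**idt (tau'\<odot>(rho\<odot>rho'))) oo (idt (taub'\<odot>(taub\<odot>tau))**?B\<star>**idt rho') = (idt taub'**?B\<star>**idt rho') oo (idt taub'**R\<star>**idt (rho\<odot>(tau'\<odot>rho')))"
    using slide[of "idt taub'**R\<star>" "?B\<star>**idt rho'", OF _ _ refl refl refl refl] by simp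
  note e1 = cp_subst[OF this, of "idt (taub'\<odot>taub)**S\<star>**T\<star>"]
  have e2: "(idt taub'**R\<star>**idt (rho\<odot>(tau'\<odot>rho'))) oo (idt (taub'\<odot>taub)**S\<star>**T\<star>) = idt taub'**H**T\<star>"
    using ichg[of "R\<star>**idt rho" "idt taub**S\<star>" "idt (tau'\<odot>rho')" "T\<star>"] tp_cp(1)[of "R\<star>**idt (rho\<odot>(tau'\<odot>rho'))" "idt taub**S\<star>**T\<star>" taub'] by (simp add: H_def)
  have e12: "((((idt taub'**R**idt tau') oo R')\<star>)**idt (rho\<odot>rho')) oo (idt (taub'\<odot>taub)**((S**T) oo (idt tau**?B**idt rho'))\<star>)
      = ((R'\<star>**idt (rho\<odot>rho')) oo (idt taub'**?B\<star>**idt rho')) oo (idt taub'**H**T\<star>)"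
    using e1 e2 by (simp add: tp_cp)
  have e3: "(R'\<star>**idt (rho\<odot>rho')) oo (idt taub'**?B\<star>**idt rho') = (idt rho**R'\<star>**idt rho') oo (br taub' rho**idt (tau'\<odot>rho'))"
    using arg_cong[OF br_conj(1)[OF c' \<open>ob rho\<close>], of "\<lambda>f. f**idt rho'"] by (simp add: tp_cp)
  from e12 e3 have L: "((((idt taub'**R**idt tau') oo R')\<star>)**idt (rho\<odot>rho')) oo (idt (taub'\<odot>taub)**((S**T) oo (idt tau**?B**idt rho'))\<star>)
      = ((idt rho**R'\<star>**idt rho') oo (br taub' rho**idt (tau'\<odot>rho'))) oo (idt taub'**H**T\<star>)" by (simp only:)
  define G where "G = (R'\<star>**idt rho') oo (idt taub'**T\<star>)"
  have G [simp]: "arr G" "src G = taub'\<odot>sigma'" "tgt G = rho'" by (simp_all add: G_def)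
  have e4: "H**G = (idt rho**R'\<star>**idt rho') oo ((H**idt taub')**T\<star>)"
    using ichg[of "idt rho" H "R'\<star>**idt rho'" "idt taub'**T\<star>"] by (simp add: G_def)
  have e5: "((H**idt taub')**T\<star>) oo (br taub' (taub\<odot>sigma)**idt sigma') = (br taub' rho**idt (tau'\<odot>rho')) oo ((idt taub'**H)**T\<star>)"
    using br_nat[of "idt taub'" H taub' rho] by (simp add: ichg del: tp_assoc)
  have e6: "(idt taub**br taub' sigma**idt sigma') oo (br taub' taub**idt (sigma\<odot>sigma')) = br taub' (taub\<odot>sigma)**idt sigma'"
    using br_right[of taub' taub sigma] by (simp add: tp_cp)
  have "((H**G) oo (idt taub**br taub' sigma**idt sigma')) oo (br taub' taub**idt (sigma\<odot>sigma')) = (H**G) oo (br taub' (taub\<odot>sigma)**idt sigma')"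
    unfolding e6[symmetric] by (subst cp_assoc) simp_all
  also have "\<dots> = (idt rho**R'\<star>**idt rho') oo ((H**idt taub')**T\<star>) oo (br taub' (taub\<odot>sigma)**idt sigma')"
    unfolding e4 by (subst cp_assoc) simp_all
  finally show ?thesis unfolding L H_def[symmetric] G_def[symmetric] e5 by simp
qed

text \<open>
  A finite sum of arrows \<open>Y\<star> oo Y\<close> is of the same form, with a direct sum as the target.
\<close>

lemma sum_adj_cp:
  assumes "finite P" and [simp]: "ob rho" and "\<And>p. p \<in> P \<Longrightarrow> arr (Y p) \<and> src (Y p) = rho"
  shows "\<exists>Z. arr Z \<and> src Z = rho \<and> vect (Z\<star> oo Z) = (\<Sum>p\<in>P. vect ((Y p)\<star> oo Y p))"
  using assms(1,3)
proof (induction P)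
  case empty show ?case by (rule exI[of _ "arr_zero rho rho"]) simp
next
  case (insert p P)
  then obtain Z where Z: "arr Z" "src Z = rho" "vect (Z\<star> oo Z) = (\<Sum>p\<in>P. vect ((Y p)\<star> oo Y p))" by auto
  have Y: "arr (Y p)" "src (Y p) = rho" using insert.prems by auto
  note [simp] = Z(1,2) Y
  obtain tau V W where d: "ob tau" "V \<in> homs (tgt (Y p)) tau" "W \<in> homs (tgt Z) tau" "V\<star> oo V = idt (tgt (Y p))" "W\<star> oo W = idt (tgt Z)"
    "W\<star> oo V = arr_zero (tgt (Y p)) (tgt Z)" "V\<star> oo W = arr_zero (tgt Z) (tgt (Y p))"
    by (rule dsum[of "tgt (Y p)" "tgt Z"]) simp_all
  note [simp] = d(2,3)[unfolded homs_iff]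
  have s: "V\<star> oo V oo Y p = Y p" "W\<star> oo W oo Z = Z" "W\<star> oo V oo Y p = arr_zero rho (tgt Z)" "V\<star> oo W oo Z = arr_zero rho (tgt (Y p))"
    using cp_subst[OF d(4), of "Y p"] cp_subst[OF d(5), of Z] cp_subst[OF d(6), of "Y p"] cp_subst[OF d(7), of Z] by simp_all
  have "vect (((V oo Y p) \<boxplus> (W oo Z))\<star> oo ((V oo Y p) \<boxplus> (W oo Z))) = vect ((Y p)\<star> oo Y p) + vect (Z\<star> oo Z)"
    by (simp add: adj_add cp_add s)
  then show ?case using insert.hyps Z(3) by (intro exI[of _ "(V oo Y p) \<boxplus> (W oo Z)"]) simp
qed

lemma sum_adj_zero:
  assumes "finite P" "ob rho" and Y: "\<And>p. p \<in> P \<Longrightarrow> arr (Y p) \<and> src (Y p) = rho"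
    and z: "(\<Sum>p\<in>P. vect ((Y p)\<star> oo Y p)) = 0" and q: "q \<in> P"
  shows "vect (Y q) = 0"
proof -
  obtain Z where Z: "arr Z" "src Z = rho" "vect (Z\<star> oo Z) = (\<Sum>p\<in>P - {q}. vect ((Y p)\<star> oo Y p))"
    using sum_adj_cp[of "P - {q}" rho Y] assms by auto
  have "vect ((Y q)\<star> oo Y q) + vect (Z\<star> oo Z) = 0" using z assms(1) q Z(3) by (simp add: sum.remove)
  then show ?thesis using Y[OF q] Z(1,2) assms(2) by (intro adj_sum_zero[of "Y q" rho "tgt (Y q)" Z "tgt Z"]) (auto simp: homs_iff)
qed

end

context crossed
begin

lemma cp_HomV_0: "ob rho \<Longrightarrow> ob sigma \<Longrightarrow> 0 \<in> cp_HomV C X rho sigma"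
  using V.subspace_0[OF HomV_sub] by (auto simp: cp_HomV_def cp_supp_def)

text \<open>
  Two triples are brought to the same object and the same vector by passing to the direct sum of their objects and
  the sum of their vectors there. In this form arrows can be added.
\<close>

lemma pair:
  assumes p: "trip rho sigma tau T psi" and q: "trip rho' sigma' tau' T' phi"
  obtains ups w S S' where "trip rho sigma ups S w" "trip rho' sigma' ups S' w" "tri rho tau T psi = tri rho ups S w" "tri rho' tau' T' phi = tri rho' ups S' w"
proof -
  note [simp] = tripD[OF p] tripD[OF q]
  obtain ups V W where d: "ob ups" "V \<in> homs tau ups" "W \<in> homs tau' ups" "V\<star> oo V = idt tau" "W\<star> oo W = idt tau'"
    "W\<star> oo V = arr_zero tau tau'" "V\<star> oo W = arr_zero tau' tau" "(V oo V\<star>) \<boxplus> (W oo W\<star>) = idt ups"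
    by (rule dsum[of tau tau']) simp_all
  note [simp] = d(2,3)[unfolded homs_iff]
  note t = tripD(3)[OF p] and t' = tripD(3)[OF q] and u = D_dsum[OF tripD(3)[OF p] tripD(3)[OF q] d(2,3,8)]
  note vd = homs_intros(2)[OF d(2)] homs_intros(2)[OF d(3)] and m = tripD(7)[OF p] tripD(7)[OF q]
  have vm: "fa V psi \<in> HH ups" "fa W phi \<in> HH ups" using fa_rules(1)[OF t u d(2) m(1)] fa_rules(1)[OF t' u d(3) m(2)] by auto
  define w where "w = fa V psi + fa W phi"
  have w: "w \<in> HH ups" using vm H_closed(2)[OF u] by (simp add: w_def)
  have "fa (V\<star>) w = fa (V\<star> oo V) psi + fa (V\<star> oo W) phi"
    using fa_rules(2)[OF u t vd(1) vm] fa_cp[OF t u t vd(1) d(2) m(1)] fa_cp[OF t' u t vd(1) d(3) m(2)] by (simp add: w_def)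
  then have 1: "fa (V\<star>) w = psi" using m t t' by (simp add: d fa_zero)
  have "fa (W\<star>) w = fa (W\<star> oo V) psi + fa (W\<star> oo W) phi"
    using fa_rules(2)[OF u t' vd(2) vm] fa_cp[OF t u t' vd(2) d(2) m(1)] fa_cp[OF t' u t' vd(2) d(3) m(2)] by (simp add: w_def)
  then have 2: "fa (W\<star>) w = phi" using m t t' by (simp add: d fa_zero)
  show ?thesis
  proof (rule that)
    show "trip rho sigma ups (T oo (V\<star>**idt rho)) w" "trip rho' sigma' ups (T' oo (W\<star>**idt rho')) w"
      using w u by (auto intro!: tripI)
    show "tri rho tau T psi = tri rho ups (T oo (V\<star>**idt rho)) w" using tri_nat[OF p u vd(1) w] 1 by simp
    show "tri rho' tau' T' phi = tri rho' ups (T' oo (W\<star>**idt rho')) w" using tri_nat[OF q u vd(2) w] 2 by simp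
  qed
qed

lemma tri_add: assumes p: "trip rho sigma tau S psi" and q: "trip rho sigma tau T psi"
  shows "arr_add (tri rho tau S psi) (tri rho tau T psi) = tri rho tau (S \<boxplus> T) psi" "trip rho sigma tau (S \<boxplus> T) psi"
proof -
  show "trip rho sigma tau (S \<boxplus> T) psi" using tripD[OF p] tripD[OF q] by (intro tripI) auto
  show "arr_add (tri rho tau S psi) (tri rho tau T psi) = tri rho tau (S \<boxplus> T) psi"
    unfolding arr_add_def[of "tri rho tau S psi"] by (rule arrow.expand) (simp add: ev_lin(1)[OF p q])
qed

lemma tri_scl: assumes p: "trip rho sigma tau S psi"
  shows "arr_scl K z (tri rho tau S psi) = tri rho tau (z *> S) psi" "trip rho sigma tau (z *> S) psi"
proof -
  show "trip rho sigma tau (z *> S) psi" using tripD[OF p] by (intro tripI) auto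
  show "arr_scl K z (tri rho tau S psi) = tri rho tau (z *> S) psi"
    unfolding arr_scl_def[of K] by (rule arrow.expand) (simp add: ev_lin(2)[OF p])
qed

lemma cp_HomV_D: "x \<in> cp_HomV C X rho sigma \<Longrightarrow> k \<in> reps X \<Longrightarrow> i < bdim X k \<Longrightarrow> x k i \<in> HomV C (k\<odot>rho) sigma"
  "x \<in> cp_HomV C X rho sigma \<Longrightarrow> \<not> (k \<in> reps X \<and> i < bdim X k) \<Longrightarrow> x k i = 0"
proof -
  assume "x \<in> cp_HomV C X rho sigma"
  then have "if k \<in> reps X \<and> i < bdim X k then x k i \<in> HomV C (k\<odot>rho) sigma else x k i = 0" unfolding cp_HomV_def by blast
  then show "k \<in> reps X \<Longrightarrow> i < bdim X k \<Longrightarrow> x k i \<in> HomV C (k\<odot>rho) sigma" "\<not> (k \<in> reps X \<and> i < bdim X k) \<Longrightarrow> x k i = 0" by simp_all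
qed

lemma ev_tensor_trip:
  assumes x: "x \<in> cp_HomV C X rho sigma" and o: "ob rho" "ob sigma" and k: "k \<in> reps X" "i < bdim X k"
  shows "trip rho sigma k (Arrow (k\<odot>rho) sigma (x k i)) (bas X k i)"
proof -
  have "x k i \<in> HomV C (k\<odot>rho) sigma" by (rule cp_HomV_D(1)[OF x k])
  then show ?thesis using o k by (simp add: trip_def homs_Arrow)
qed

lemma cp_HomV_supp: "x \<in> cp_HomV C X rho sigma \<Longrightarrow> finite (cp_supp x)" "x \<in> cp_HomV C X rho sigma \<Longrightarrow> k \<in> cp_supp x \<Longrightarrow> k \<in> reps X"
proof -
  show "x \<in> cp_HomV C X rho sigma \<Longrightarrow> finite (cp_supp x)" unfolding cp_HomV_def by blast
  assume x: "x \<in> cp_HomV C X rho sigma" and "k \<in> cp_supp x"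
  then obtain i where "x k i \<noteq> 0" by (auto simp: cp_supp_def)
  then show "k \<in> reps X" using cp_HomV_D(2)[OF x, of k i] by blast
qed

lemma sum_apply2: "(\<Sum>a\<in>A. f a) k i = (\<Sum>a\<in>A. (f a k i :: 'w::ab_group_add))"
  by (induction A rule: infinite_finite_induct) simp_all

lemma ev_expansion:
  assumes x: "x \<in> cp_HomV C X rho sigma" and o: "ob rho" "ob sigma"
  shows "x = (\<Sum>p\<in>Sigma (cp_supp x) (\<lambda>k. {..<bdim X k}). ev rho (fst p) (Arrow (fst p\<odot>rho) sigma (x (fst p) (snd p))) (bas X (fst p) (snd p)))"
    (is "x = (\<Sum>p\<in>?P. ?e p)")
proof (intro ext)
  fix m j
  note s = cp_HomV_supp[OF x]
  have "?e p m j = (if p = (m, j) then x m j else 0)" if "p \<in> ?P" for p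
  proof -
    obtain k i where p: "p = (k, i)" "k \<in> reps X" "i < bdim X k" using \<open>p \<in> ?P\<close> s(2) by auto
    have "?e p = elem_tensor C F X k (Arrow (k\<odot>rho) sigma (x k i)) (bas X k i)"
      using elem_ev[OF p(2) ev_tensor_trip[OF x o p(2,3)]] by (simp add: p(1))
    then show ?thesis using bas_orthonormal[OF p(2)] p by (auto simp: elem_tensor_def)
  qed
  then have "(\<Sum>p\<in>?P. ?e p) m j = (\<Sum>p\<in>?P. if p = (m, j) then x m j else 0)" by (simp add: sum_apply2)
  also have "\<dots> = (if (m, j) \<in> ?P then x m j else 0)" using s(1) by (subst sum.delta) auto
  also have "\<dots> = x m j"
  proof (cases "(m, j) \<in> ?P")
    case False
    then have "m \<notin> cp_supp x \<or> \<not> j < bdim X m" by simp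
    then have "x m j = 0" using cp_HomV_D(2)[OF x, of m j] by (auto simp: cp_supp_def)
    then show ?thesis by simp
  qed simp
  finally show "x m j = (\<Sum>p\<in>?P. ?e p) m j" by simp
qed

text \<open>
  An arrow is the sum of its components, and sums of triples are triples by \<open>pair\<close>.
\<close>

lemma K_rep:
  assumes f: "f \<in> Hom K rho sigma" and o: "ob rho" "ob sigma"
  obtains tau T psi where "trip rho sigma tau T psi" "f = tri rho tau T psi"
proof -
  have x: "vect f \<in> cp_HomV C X rho sigma" using f by (simp add: K_Hom)
  let ?A = "{x. \<exists>tau T psi. trip rho sigma tau T psi \<and> x = ev rho tau T psi}"
  have "0 \<in> ?A"
  proof -
    have "trip rho sigma (unt C) (arr_zero rho sigma) Om" using o by (intro tripI) simp_all
    then show ?thesis using ev_lin(3)[of rho sigma "unt C" "arr_zero rho sigma" Om] by fastforce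
  qed
  moreover have "x + y \<in> ?A" if xy: "x \<in> ?A" "y \<in> ?A" for x y
  proof -
    from xy obtain tau T psi tau' T' phi where h: "trip rho sigma tau T psi" "x = ev rho tau T psi" "trip rho sigma tau' T' phi" "y = ev rho tau' T' phi" by blast
    obtain ups w S S' where p: "trip rho sigma ups S w" "trip rho sigma ups S' w" "tri rho tau T psi = tri rho ups S w" "tri rho tau' T' phi = tri rho ups S' w"
      by (rule pair[OF h(1,3)])
    have "x + y = ev rho ups (S \<boxplus> S') w" using ev_lin(1)[OF p(1,2)] p(3,4) h by (simp add: tri_def)
    then show ?thesis using tri_add(2)[OF p(1,2)] by blast
  qed
  moreover have "ev rho (fst p) (Arrow (fst p\<odot>rho) sigma (vect f (fst p) (snd p))) (bas X (fst p) (snd p)) \<in> ?A"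
    if "p \<in> Sigma (cp_supp (vect f)) (\<lambda>k. {..<bdim X k})" for p
    using that ev_tensor_trip[OF x o, of "fst p" "snd p"] cp_HomV_supp(2)[OF x, of "fst p"] by (cases p) auto
  ultimately have "(\<Sum>p\<in>Sigma (cp_supp (vect f)) (\<lambda>k. {..<bdim X k}). ev rho (fst p) (Arrow (fst p\<odot>rho) sigma (vect f (fst p) (snd p))) (bas X (fst p) (snd p))) \<in> ?A"
    by (intro additive_sum(2)[where P = id]) auto
  then obtain tau T psi where t: "trip rho sigma tau T psi" "vect f = ev rho tau T psi" using ev_expansion[OF x o] by auto
  show ?thesis
  proof (rule that[OF t(1)])
    show "f = tri rho tau T psi" using f t tripD(6)[OF t(1)] by (intro arrow.expand) (simp add: K_Hom)
  qed
qed

lemma K_rep2: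
  assumes f: "f \<in> Hom K rho sigma" and g: "g \<in> Hom K rho sigma" and o: "ob rho" "ob sigma"
  obtains tau S T psi where "trip rho sigma tau S psi" "trip rho sigma tau T psi" "f = tri rho tau S psi" "g = tri rho tau T psi"
proof -
  obtain tau S psi where p: "trip rho sigma tau S psi" "f = tri rho tau S psi" by (rule K_rep[OF f o])
  obtain tau' T phi where q: "trip rho sigma tau' T phi" "g = tri rho tau' T phi" by (rule K_rep[OF g o])
  show ?thesis by (rule pair[OF p(1) q(1)]) (use p q that in metis)
qed

text \<open>
  The inclusion of \<open>C\<close> into the crossed product, with the vacuum vector of the trivial representation.
\<close>

definition emb :: "('o, 'a) arrow \<Rightarrow> ('o, ('o, 'a) cpvec) arrow" where
  "emb f = tri (src f) (unt C) f Om"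

lemma emb_trip: "arr f \<Longrightarrow> src f = rho \<Longrightarrow> tgt f = sigma \<Longrightarrow> trip rho sigma (unt C) f Om"
  by (intro tripI) auto

lemma emb_src_tgt [simp]: "src (emb f) = src f" "tgt (emb f) = tgt f" by (simp_all add: emb_def)

lemma emb_idn: "ob rho \<Longrightarrow> idn K rho = emb (idt rho)"
  using elem_ev[OF reps_unt emb_trip[OF arr_idt]] by (simp add: K_def crossed0_def emb_def tri_def idt_eq)

lemma emb_br: "ob rho \<Longrightarrow> ob sigma \<Longrightarrow> brd K rho sigma = emb (br rho sigma)"
  using elem_ev[OF reps_unt emb_trip[OF arr_br]] by (simp add: K_def crossed0_def emb_def tri_def br_eq)

lemma bx_Om: "tau \<in> D \<Longrightarrow> a \<in> HH tau \<Longrightarrow> bx (unt C) tau Om a = a" "tau \<in> D \<Longrightarrow> a \<in> HH tau \<Longrightarrow> bx tau (unt C) a Om = a"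
  by (auto simp: box_vac_left box_vac_right)

lemma emb_cmp: assumes [simp]: "arr f" "arr g" "src f = tgt g" shows "cmp K (emb f) (emb g) = emb (f oo g)"
  using K_cmp(1)[OF emb_trip emb_trip, of f "tgt g" "tgt f" g "src g"] by (simp add: emb_def bx_Om)

lemma emb_tar: assumes [simp]: "arr f" "arr g" shows "tar K (emb f) (emb g) = emb (f**g)"
  using K_tar(1)[OF emb_trip emb_trip, of f "src f" "tgt f" g "src g" "tgt g"] by (simp add: emb_def bx_Om)

lemma csol_unt: "csol (unt C) (unt C) (idt (unt C)) (idt (unt C))" by (simp add: csol_def homs_iff)

lemma bar_Om: "bar (unt C) (unt C) (idt (unt C)) Om = Om"
proof -
  have "bar (unt C) (unt C) (idt (unt C)) Om = ctr (unt C) (unt C) Om (bx (unt C) (unt C) Om Om)" by (simp add: bar_def bx_Om)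
  also have "\<dots> = rs (unt C) (ip (unt C) Om Om) Om" by (rule ctr_simple) simp_all
  finally show ?thesis using vac_unit H_closed(6)[OF D_unt] by simp
qed

lemma emb_star: assumes [simp]: "arr f" shows "star K (emb f) = emb (f\<star>)"
  using K_star(1)[OF emb_trip csol_unt, of f "src f" "tgt f"] by (simp add: emb_def bar_Om)

lemma emb_add: assumes [simp]: "arr f" "arr g" "src f = src g" "tgt f = tgt g" shows "arr_add (emb f) (emb g) = emb (f \<boxplus> g)"
  using tri_add(1)[OF emb_trip emb_trip, of f "src g" "tgt g" g] by (simp add: emb_def)

lemma emb_scl: assumes [simp]: "arr f" shows "arr_scl K z (emb f) = emb (z *> f)"
  using tri_scl(1)[OF emb_trip, of f "src f" "tgt f"] by (simp add: emb_def)

lemma emb_Hom: "f \<in> homs rho sigma \<Longrightarrow> emb f \<in> Hom K rho sigma"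
  using tri_Hom[OF emb_trip, of f rho sigma] by (simp add: emb_def homs_iff)

lemma Om_ne: "Om \<noteq> 0" using vac_unit ip_rules(6)[OF D_unt Om_mem] ip_rules(7)[OF D_unt Om_mem] by auto

text \<open>
  Bilinearity is immediate for summands with the same object and vector.
\<close>

lemma K_cmp_add:
  assumes o: "ob rho" "ob sigma" "ob delta" and f: "f \<in> Hom K sigma delta" and g: "g \<in> Hom K rho sigma"
  shows "f' \<in> Hom K sigma delta \<Longrightarrow> cmp K (arr_add f f') g = arr_add (cmp K f g) (cmp K f' g)"
    "g' \<in> Hom K rho sigma \<Longrightarrow> cmp K f (arr_add g g') = arr_add (cmp K f g) (cmp K f g')"
    "cmp K (arr_scl K z f) g = arr_scl K z (cmp K f g)" "cmp K f (arr_scl K z g) = arr_scl K z (cmp K f g)"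
    "cmp K f g \<in> Hom K rho delta"
proof -
  obtain tau S psi where p: "trip sigma delta tau S psi" "f = tri sigma tau S psi" by (rule K_rep[OF f o(2,3)])
  obtain tau' T phi where q: "trip rho sigma tau' T phi" "g = tri rho tau' T phi" by (rule K_rep[OF g o(1,2)])
  note [simp] = tripD[OF p(1)] tripD[OF q(1)]
  show "cmp K f g \<in> Hom K rho delta" using K_cmp[OF p(1) q(1)] p q tri_Hom by simp
  show "cmp K (arr_scl K z f) g = arr_scl K z (cmp K f g)" "cmp K f (arr_scl K z g) = arr_scl K z (cmp K f g)"
    using K_cmp[OF p(1) q(1)] K_cmp(1)[OF tri_scl(2)[OF p(1)] q(1)] K_cmp(1)[OF p(1) tri_scl(2)[OF q(1)]] tri_scl(1)[OF K_cmp(2)[OF p(1) q(1)]]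
    by (simp_all add: p(2) q(2) tri_scl(1)[OF p(1)] tri_scl(1)[OF q(1)])
  show "cmp K (arr_add f f') g = arr_add (cmp K f g) (cmp K f' g)" if f': "f' \<in> Hom K sigma delta"
  proof -
    obtain tau S S' psi where r: "trip sigma delta tau S psi" "trip sigma delta tau S' psi" "f = tri sigma tau S psi" "f' = tri sigma tau S' psi" by (rule K_rep2[OF f f' o(2,3)])
    show ?thesis
      using K_cmp(1)[OF r(1) q(1)] K_cmp(1)[OF r(2) q(1)] K_cmp(1)[OF tri_add(2)[OF r(1,2)] q(1)] tri_add(1)[OF K_cmp(2)[OF r(1) q(1)] K_cmp(2)[OF r(2) q(1)]] tripD[OF r(1)] tripD[OF r(2)]
      by (simp add: r(3,4) q(2) tri_add(1)[OF r(1,2)] cp_add)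
  qed
  show "cmp K f (arr_add g g') = arr_add (cmp K f g) (cmp K f g')" if g': "g' \<in> Hom K rho sigma"
  proof -
    obtain tau' T T' phi where r: "trip rho sigma tau' T phi" "trip rho sigma tau' T' phi" "g = tri rho tau' T phi" "g' = tri rho tau' T' phi" by (rule K_rep2[OF g g' o(1,2)])
    show ?thesis
      using K_cmp(1)[OF p(1) r(1)] K_cmp(1)[OF p(1) r(2)] K_cmp(1)[OF p(1) tri_add(2)[OF r(1,2)]] tri_add(1)[OF K_cmp(2)[OF p(1) r(1)] K_cmp(2)[OF p(1) r(2)]] tripD[OF r(1)] tripD[OF r(2)]
      by (simp add: r(3,4) p(2) tri_add(1)[OF r(1,2)] cp_add tp_add)
  qed
qed

lemma K_tar_add:
  assumes o: "ob rho" "ob sigma" "ob rho'" "ob sigma'" and f: "f \<in> Hom K rho sigma" and g: "g \<in> Hom K rho' sigma'"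
  shows "f' \<in> Hom K rho sigma \<Longrightarrow> tar K (arr_add f f') g = arr_add (tar K f g) (tar K f' g)"
    "g' \<in> Hom K rho' sigma' \<Longrightarrow> tar K f (arr_add g g') = arr_add (tar K f g) (tar K f g')"
    "tar K (arr_scl K z f) g = arr_scl K z (tar K f g)" "tar K f (arr_scl K z g) = arr_scl K z (tar K f g)"
    "tar K f g \<in> Hom K (rho\<odot>rho') (sigma\<odot>sigma')"
proof -
  obtain tau S psi where p: "trip rho sigma tau S psi" "f = tri rho tau S psi" by (rule K_rep[OF f o(1,2)])
  obtain tau' T phi where q: "trip rho' sigma' tau' T phi" "g = tri rho' tau' T phi" by (rule K_rep[OF g o(3,4)])
  note [simp] = tripD[OF p(1)] tripD[OF q(1)]
  show "tar K f g \<in> Hom K (rho\<odot>rho') (sigma\<odot>sigma')" using K_tar[OF p(1) q(1)] p q tri_Hom by simp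
  show "tar K (arr_scl K z f) g = arr_scl K z (tar K f g)" "tar K f (arr_scl K z g) = arr_scl K z (tar K f g)"
    using K_tar[OF p(1) q(1)] K_tar(1)[OF tri_scl(2)[OF p(1)] q(1)] K_tar(1)[OF p(1) tri_scl(2)[OF q(1)]] tri_scl(1)[OF K_tar(2)[OF p(1) q(1)]]
    by (simp_all add: p(2) q(2) tri_scl(1)[OF p(1)] tri_scl(1)[OF q(1)])
  show "tar K (arr_add f f') g = arr_add (tar K f g) (tar K f' g)" if f': "f' \<in> Hom K rho sigma"
  proof -
    obtain tau S S' psi where r: "trip rho sigma tau S psi" "trip rho sigma tau S' psi" "f = tri rho tau S psi" "f' = tri rho tau S' psi" by (rule K_rep2[OF f f' o(1,2)])
    show ?thesis
      using K_tar(1)[OF r(1) q(1)] K_tar(1)[OF r(2) q(1)] K_tar(1)[OF tri_add(2)[OF r(1,2)] q(1)] tri_add(1)[OF K_tar(2)[OF r(1) q(1)] K_tar(2)[OF r(2) q(1)]] tripD[OF r(1)] tripD[OF r(2)]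
      by (simp add: r(3,4) q(2) tri_add(1)[OF r(1,2)] cp_add tp_add)
  qed
  show "tar K f (arr_add g g') = arr_add (tar K f g) (tar K f g')" if g': "g' \<in> Hom K rho' sigma'"
  proof -
    obtain tau' T T' phi where r: "trip rho' sigma' tau' T phi" "trip rho' sigma' tau' T' phi" "g = tri rho' tau' T phi" "g' = tri rho' tau' T' phi" by (rule K_rep2[OF g g' o(3,4)])
    show ?thesis
      using K_tar(1)[OF p(1) r(1)] K_tar(1)[OF p(1) r(2)] K_tar(1)[OF p(1) tri_add(2)[OF r(1,2)]] tri_add(1)[OF K_tar(2)[OF p(1) r(1)] K_tar(2)[OF p(1) r(2)]] tripD[OF r(1)] tripD[OF r(2)]
      by (simp add: r(3,4) p(2) tri_add(1)[OF r(1,2)] cp_add tp_add)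
  qed
qed

lemma K_star_add:
  assumes o: "ob rho" "ob sigma" and f: "f \<in> Hom K rho sigma"
  shows "g \<in> Hom K rho sigma \<Longrightarrow> star K (arr_add f g) = arr_add (star K f) (star K g)"
    "star K (arr_scl K z f) = arr_scl K (cnj z) (star K f)" "star K f \<in> Hom K sigma rho" "star K (star K f) = f"
proof -
  obtain tau S psi where p: "trip rho sigma tau S psi" "f = tri rho tau S psi" by (rule K_rep[OF f o])
  note [simp] = tripD[OF p(1)]
  obtain taub R Rb where c: "csol tau taub R Rb" using csol_ex[of tau] by auto
  note [simp] = csol_t[OF c]
  show "star K f \<in> Hom K sigma rho" using K_star[OF p(1) c] p tri_Hom by simp
  show "star K (arr_scl K z f) = arr_scl K (cnj z) (star K f)"
    using K_star(1)[OF p(1) c] K_star(1)[OF tri_scl(2)[OF p(1)] c] tri_scl(1)[OF K_star(2)[OF p(1) c]] by (simp add: p(2) tri_scl(1)[OF p(1)])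
  have "star K (star K f) = tri rho tau ((Rb\<star>**idt sigma) oo (idt tau**((idt taub**S) oo (R**idt rho)))) (bar taub tau R (bar tau taub Rb psi))"
    using K_star(1)[OF K_star(2)[OF p(1) c] csol_sym[OF c]] K_star(1)[OF p(1) c] by (simp add: p(2))
  then show "star K (star K f) = f"
    using bar_bar[OF tripD(3)[OF p(1)] c tripD(7)[OF p(1)]] frobenius_left[OF c tripD(4-6)[OF p(1)] o(1)] by (simp add: p(2))
  show "star K (arr_add f g) = arr_add (star K f) (star K g)" if g: "g \<in> Hom K rho sigma"
  proof -
    obtain tau S T psi where r: "trip rho sigma tau S psi" "trip rho sigma tau T psi" "f = tri rho tau S psi" "g = tri rho tau T psi" by (rule K_rep2[OF f g o])
    obtain taub R Rb where c: "csol tau taub R Rb" using csol_ex[of tau] tripD(3)[OF r(1)] by auto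
    show ?thesis
      using K_star(1)[OF r(1) c] K_star(1)[OF r(2) c] K_star(1)[OF tri_add(2)[OF r(1,2)] c] tri_add(1)[OF K_star(2)[OF r(1) c] K_star(2)[OF r(2) c]] tripD[OF r(1)] tripD[OF r(2)] csol_t[OF c]
      by (simp add: r(3,4) tri_add(1)[OF r(1,2)] cp_add tp_add adj_add)
  qed
qed

text \<open>
  Arrows from the unit to the conjugate of \<open>\<gamma>\<^sub>k\<close> times \<open>\<gamma>\<^sub>l\<close> vanish for \<open>k \<noteq> l\<close> and are multiples of
  \<open>R\<^sub>k\<close> otherwise. The factor is the inner product of the two basis vectors, by \<open>bar_inner\<close>.
\<close>

lemma crd_unt:
  assumes k: "k \<in> reps X" and l: "l \<in> reps X" and n: "nsol k kb R Rb d" and ij: "i < bdim X k" "j < bdim X l"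
    and a: "a = rs (unt C) z Om"
  shows "crd (unt C) (kb\<odot>l) a (bx kb l (bar k kb Rb (bas X k i)) (bas X l j))
    = (if (k, i) = (l, j) then (cnj z / complex_of_real d) *> R else arr_zero (unt C) (kb\<odot>l))"
proof -
  have c: "csol k kb R Rb" and Rn: "R\<star> oo R = complex_of_real d *> idt (unt C)" and d: "d > 0" using n nsol_pos by (auto simp: nsol_def)
  note [simp] = csol_t[OF c] k l
  note kD = repsD(1)[OF k] and lD = repsD(1)[OF l]
  note kb = D_conj[OF kD c]
  note b = bas_mem[OF k ij(1)] bas_mem[OF l ij(2)]
  let ?w = "bx kb l (bar k kb Rb (bas X k i)) (bas X l j)"
  have am: "a \<in> HH (unt C)" unfolding a by (rule H_closed(3)[OF D_unt Om_mem])
  have w: "?w \<in> HH (kb\<odot>l)" by (rule box_mem[OF kb lD bar_mem(1)[OF kD c b(1)] b(2)])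
  let ?g = "crd (unt C) (kb\<odot>l) a ?w"
  have g: "?g \<in> homs (unt C) (kb\<odot>l)" using kb lD am w by (intro crd reps_unt) auto
  note [simp] = g[unfolded homs_iff]
  let ?t = "(Rb\<star>**idt l) oo (idt k**?g)"
  have t: "?t \<in> homs k l" by (simp add: homs_iff)
  have tg: "(idt kb**?t) oo R = ?g" using frobenius_left'[OF c, of ?g "unt C" l] by simp
  show ?thesis
  proof (cases "k = l")
    case False
    then have "?t = arr_zero k l" using reps_zero[OF k l _ t] by simp
    then show ?thesis using tg False by simp
  next
    case True
    obtain e where e: "?t = e *> idt k" using irr_ex[OF repsD(2)[OF k]] t True by auto
    have ge: "?g = e *> R" using tg e True by simp
    have R: "R \<in> homs (unt C) (kb\<odot>l)" using True by (simp add: homs_iff)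
    have kl: "kb\<odot>l \<in> D" using kb lD by simp
    have Rm: "fa R Om \<in> HH (kb\<odot>l)" by (rule fa_rules(1)[OF D_unt kl R Om_mem])
    have "R\<star> oo ?g = ip (kb\<odot>l) (fa R a) ?w *> idt (unt C)" by (rule crd(2)[OF reps_unt kl am w R])
    also have "ip (kb\<odot>l) (fa R a) ?w = cnj z * ip (kb\<odot>l) (fa R Om) ?w"
      unfolding a fa_rules(3)[OF D_unt kl R Om_mem] by (rule ip_rules(5)[OF kl Rm w])
    also have "ip (kb\<odot>l) (fa R Om) ?w = ip k (bas X k i) (bas X l j)"
      using bar_inner[OF kD c b(1), of "bas X l j"] b(2) True by simp
    also have "\<dots> = (if i = j then 1 else 0)" using bas_orthonormal[OF k] ij True by simp
    finally have "(e * complex_of_real d) *> idt (unt C) = (cnj z * (if i = j then 1 else 0)) *> idt (unt C)" using ge Rn by simp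
    then have "e * complex_of_real d = cnj z * (if i = j then 1 else 0)" by (rule irr_scl_eq[OF unt_irr])
    then have "e = (if i = j then cnj z / complex_of_real d else 0)" using d by (simp add: field_simps split: if_splits)
    then show ?thesis using ge True by simp
  qed
qed

text \<open>
  With respect to the orthonormal bases, the unit component of \<open>f\<^sup>* \<circ> f\<close> is, up to a phase, the sum of the
  \<open>Y\<^sup>* \<circ> Y\<close>, where \<open>Y\<close> is obtained from a component of \<open>f\<close> by Frobenius reciprocity and
  multiplication with \<open>d(\<gamma>\<^sub>k)\<close> to the power \<open>-1/2\<close>. Mixed terms do not contribute, by \<open>crd_unt\<close>. So
  positivity of \<open>C\<close> applies to each component.
\<close>

lemma K_positive:
  assumes o: "ob rho" "ob sigma" and f: "f \<in> Hom K rho sigma" and z0: "cmp K (star K f) f = arr_zero rho rho"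
  shows "f = arr_zero rho sigma"
proof -
  define x where "x = vect f"
  have f_x: "f = Arrow rho sigma x" using f by (cases f) (simp add: K_Hom x_def)
  have x: "x \<in> cp_HomV C X rho sigma" using f by (simp add: K_Hom x_def)
  note s = cp_HomV_supp[OF x]
  let ?P = "Sigma (cp_supp x) (\<lambda>k. {..<bdim X k})"
  have P: "fst p \<in> reps X \<and> snd p < bdim X (fst p)" if "p \<in> ?P" for p using that s(2) by auto
  have finP: "finite ?P" using s(1) by auto
  define T where "T p = Arrow (fst p\<odot>rho) sigma (x (fst p) (snd p))" for p
  let ?e = "\<lambda>p. ev rho (fst p) (T p) (bas X (fst p) (snd p))"
  have tp: "trip rho sigma (fst p) (T p) (bas X (fst p) (snd p))" if "p \<in> ?P" for p
    unfolding T_def using ev_tensor_trip[OF x o] P[OF that] by blast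
  have xe: "x = (\<Sum>p\<in>?P. ?e p)" using ev_expansion[OF x o] by (simp add: T_def)
  let ?H = "cp_HomV C X rho sigma"
  have HH: "Arrow rho sigma u \<in> Hom K rho sigma" if "u \<in> ?H" for u using that by (simp add: K_Hom)
  have Hadd: "Arrow rho sigma (u + v) = arr_add (Arrow rho sigma u) (Arrow rho sigma v)" for u v by (simp add: arr_add_def)
  have H: "0 \<in> ?H" "u + v \<in> ?H" if uv: "u \<in> ?H" "v \<in> ?H" for u v
  proof -
    show "0 \<in> ?H" by (rule cp_HomV_0[OF o])
    obtain tau S T psi where r: "trip rho sigma tau S psi" "trip rho sigma tau T psi" "Arrow rho sigma u = tri rho tau S psi" "Arrow rho sigma v = tri rho tau T psi"
      by (rule K_rep2[OF HH[OF uv(1)] HH[OF uv(2)] o])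
    then show "u + v \<in> ?H" using tri_Hom[OF tri_add(2)[OF r(1,2)]] tri_add(1)[OF r(1,2)] Hadd[of u v] by (metis K_Hom arrow.sel(3))
  qed
  have e: "?e p \<in> ?H" if "p \<in> ?P" for p by (rule ev_mem[OF tp[OF that]])
  \<comment> \<open>The biadditive form \<open>u\<^sup>* \<circ> v\<close>, which allows to expand \<open>f\<^sup>* \<circ> f\<close> into pairs of components.\<close>
  define B where "B u v = vect (cmp K (star K (Arrow rho sigma u)) (Arrow rho sigma v))" for u v
  have Br: "B u (v + w) = B u v + B u w" if "u \<in> ?H" "v \<in> ?H" "w \<in> ?H" for u v w
    unfolding B_def Hadd K_cmp_add(2)[OF o(1,2,1) K_star_add(3)[OF o HH[OF that(1)]] HH[OF that(2)] HH[OF that(3)]] by (simp add: arr_add_def)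
  have Bl: "B (u + v) w = B u w + B v w" if "u \<in> ?H" "v \<in> ?H" "w \<in> ?H" for u v w
    unfolding B_def Hadd K_star_add(1)[OF o HH[OF that(1)] HH[OF that(2)]]
      K_cmp_add(1)[OF o(1,2,1) K_star_add(3)[OF o HH[OF that(1)]] HH[OF that(3)] K_star_add(3)[OF o HH[OF that(2)]]] by (simp add: arr_add_def)
  have "B x x = 0" using z0 by (simp add: B_def f_x arr_zero_def)
  moreover have "B x x = (\<Sum>p\<in>?P. B (?e p) x)"
    using additive_sum(1)[of ?H "\<lambda>u. B u x" ?P ?e] H Bl x e cp_HomV_0[OF o] xe by simp
  moreover have "B u x = (\<Sum>q\<in>?P. B u (?e q))" if "u \<in> ?H" for u
    using additive_sum(1)[of ?H "B u" ?P ?e] H Br[OF that] e cp_HomV_0[OF o] xe by simp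
  ultimately have sum0: "(\<Sum>p\<in>?P. \<Sum>q\<in>?P. B (?e p) (?e q)) = 0" using e by simp
  have u0: "bdim X (unt C) > 0" using bas_expand[OF reps_unt Om_mem] Om_ne by (cases "bdim X (unt C)") auto
  \<comment> \<open>The chosen basis vector of the trivial representation may differ from the vacuum by the phase \<open>z\<close>.\<close>
  define b0 where "b0 = bas X (unt C) 0"
  have b0: "b0 \<in> HH (unt C)" using u0 reps_unt by (simp add: b0_def)
  obtain z where z: "b0 = rs (unt C) z Om" using b0 vac_hilb by auto
  have zne: "z \<noteq> 0"
  proof
    assume "z = 0"
    then have "b0 = 0" using z H_closed(7)[OF D_unt] by simp
    then show False using bas_orthonormal[OF reps_unt u0 u0] ip_rules(6)[OF D_unt b0] by (simp add: b0_def)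
  qed
  have "\<exists>d. nsol (fst p) (cjg X (fst p)) (cR X (fst p)) (cRb X (fst p)) d" if "p \<in> ?P" for p
    using cR_solution[of "fst p"] nsol_iff[OF repsD(2)] P[OF that] by blast
  then obtain d where d: "\<And>p. p \<in> ?P \<Longrightarrow> nsol (fst p) (cjg X (fst p)) (cR X (fst p)) (cRb X (fst p)) (d p)" by metis
  define Y where "Y p = complex_of_real (1 / sqrt (d p)) *> ((idt (cjg X (fst p))**T p) oo (cR X (fst p)**idt rho))" for p
  have Yt: "arr (Y p) \<and> src (Y p) = rho" if "p \<in> ?P" for p
    using tripD[OF tp[OF that]] csol_t[OF c_csol[of "fst p"]] P[OF that] o by (simp add: Y_def)
  have coord: "B (?e p) (?e q) (unt C) 0 = (if p = q then scl C (cnj z) (vect ((Y p)\<star> oo Y p)) else 0)" if pq: "p \<in> ?P" "q \<in> ?P" for p q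
  proof -
    obtain k i l j where pe: "p = (k, i)" and qe: "q = (l, j)" by (cases p, cases q) auto
    have kl: "k \<in> reps X" "i < bdim X k" "l \<in> reps X" "j < bdim X l" using P[OF pq(1)] P[OF pq(2)] by (auto simp: pe qe)
    define S' T' where "S' = T p" and "T' = T q"
    let ?kb = "cjg X k" and ?R = "cR X k"
    note n = d[OF pq(1), unfolded pe fst_conv]
    have c: "csol k ?kb ?R (cRb X k)" by (rule c_csol[OF kl(1)])
    have t: "trip rho sigma k S' (bas X k i)" "trip rho sigma l T' (bas X l j)" using tp[OF pq(1)] tp[OF pq(2)] by (simp_all add: pe qe S'_def T'_def)
    note [simp] = csol_t[OF c] tripD[OF t(1)] tripD[OF t(2)]
    let ?M = "((?R\<star>**idt rho) oo (idt ?kb**S'\<star>)) oo (idt ?kb**T')" and ?w = "bx ?kb l (bar k ?kb (cRb X k) (bas X k i)) (bas X l j)"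
    have A: "Arrow rho sigma (?e p) = tri rho k S' (bas X k i)" "Arrow rho sigma (?e q) = tri rho l T' (bas X l j)" by (simp_all add: tri_def pe qe T_def S'_def T'_def)
    have "B (?e p) (?e q) = ev rho (?kb\<odot>l) ?M ?w"
      unfolding B_def A K_star(1)[OF t(1) c] K_cmp(1)[OF K_star(2)[OF t(1) c] t(2)] by simp
    then have "B (?e p) (?e q) (unt C) 0 = vect (?M oo (crd (unt C) (?kb\<odot>l) b0 ?w**idt rho))"
      using u0 reps_unt by (simp add: ev_def b0_def)
    also have "crd (unt C) (?kb\<odot>l) b0 ?w = (if (k, i) = (l, j) then (cnj z / complex_of_real (d p)) *> ?R else arr_zero (unt C) (?kb\<odot>l))"
      using crd_unt[OF kl(1,3) n kl(2,4) z] by (simp add: pe)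
    finally have e: "B (?e p) (?e q) (unt C) 0 = vect (?M oo ((if (k, i) = (l, j) then (cnj z / complex_of_real (d p)) *> ?R else arr_zero (unt C) (?kb\<odot>l))**idt rho))" .
    show ?thesis
    proof (cases "p = q")
      case False
      then have "((k, i) = (l, j)) = False" by (simp only: pe qe simp_thms)
      then show ?thesis unfolding e using False by (simp only: if_False) simp
    next
      case True
      then have l: "l = k" "T' = S'" "((k, i) = (l, j)) = True" by (simp_all add: pe qe S'_def T'_def)
      have dp: "d p > 0" using nsol_pos[OF d[OF pq(1)]] .
      define r where "r = 1 / sqrt (d p)"
      have "r * r = 1 / d p" using dp by (simp add: r_def)
      then have rr: "complex_of_real r * complex_of_real r = 1 / complex_of_real (d p)" by (simp flip: of_real_mult)
      have Yp: "Y p = complex_of_real r *> ((idt ?kb**S') oo (?R**idt rho))" by (simp only: Y_def r_def S'_def pe fst_conv)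
      have "(Y p)\<star> oo Y p = (1 / complex_of_real (d p)) *> (?M oo (?R**idt rho))"
        using o by (simp add: Yp l(2) rr)
      then have "vect (?M oo (((cnj z / complex_of_real (d p)) *> ?R)**idt rho)) = scl C (cnj z) (vect ((Y p)\<star> oo Y p))"
        using o by (simp add: l)
      then show ?thesis using e True by (simp only: l(3) if_True simp_thms)
    qed
  qed
  have "0 = (\<Sum>p\<in>?P. \<Sum>q\<in>?P. B (?e p) (?e q)) (unt C) 0" using sum0 by simp
  also have "\<dots> = (\<Sum>p\<in>?P. \<Sum>q\<in>?P. if p = q then scl C (cnj z) (vect ((Y p)\<star> oo Y p)) else 0)"
    unfolding sum_apply2 by (intro sum.cong[OF refl] coord)
  also have "\<dots> = (\<Sum>p\<in>?P. scl C (cnj z) (vect ((Y p)\<star> oo Y p)))" using finP by simp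
  also have "\<dots> = scl C (cnj z) (\<Sum>p\<in>?P. vect ((Y p)\<star> oo Y p))" by (simp add: V.scale_sum_right)
  finally have "scl C (cnj z) (\<Sum>p\<in>?P. vect ((Y p)\<star> oo Y p)) = 0" by (rule sym)
  then have Y0: "(\<Sum>p\<in>?P. vect ((Y p)\<star> oo Y p)) = 0" using zne by (simp only: V.scale_eq_0_iff complex_cnj_zero_iff simp_thms)
  have "?e p = 0" if p: "p \<in> ?P" for p
  proof -
    have c: "csol (fst p) (cjg X (fst p)) (cR X (fst p)) (cRb X (fst p))" using c_csol P[OF p] by blast
    note [simp] = csol_t[OF c] tripD[OF tp[OF p]] o
    let ?Z = "(idt (cjg X (fst p))**T p) oo (cR X (fst p)**idt rho)"
    have "vect (Y p) = 0" by (rule sum_adj_zero[OF finP o(1) Yt Y0 p])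
    then have "vect ?Z = 0" using nsol_pos[OF d[OF p]] by (simp add: Y_def)
    then have "?Z = arr_zero rho (cjg X (fst p)\<odot>sigma)" using vect_zero[of ?Z] by simp
    then have "T p = arr_zero (fst p\<odot>rho) sigma" using frobenius_left[OF c, of "T p" rho sigma] by simp
    then show ?thesis using ev_lin(3)[OF tp[OF p]] by simp
  qed
  then have "x = 0" using xe by simp
  then show ?thesis by (simp add: f_x arr_zero_def)
qed

end


section \<open>The crossed product is a braided tensor star-category\<close>

context BTC_star
begin

lemma rationalI:
  assumes J: "finite J" "\<And>A. irr A \<Longrightarrow> \<exists>B\<in>J. isom C A B"
  shows "rational C"
proof -
  have "{{sigma. isom C rho sigma} | rho. irr rho} \<subseteq> (\<lambda>B. {sigma. isom C B sigma}) ` J"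
  proof
    fix c assume "c \<in> {{sigma. isom C rho sigma} | rho. irr rho}"
    then obtain rho where r: "c = {sigma. isom C rho sigma}" "irr rho" by blast
    obtain B where "B \<in> J" "isom C rho B" using J(2)[OF r(2)] by blast
    then show "c \<in> (\<lambda>B. {sigma. isom C B sigma}) ` J" using isom_trans isom_sym r(1) by blast
  qed
  then show ?thesis unfolding rational_def using finite_subset J(1) by blast
qed

lemma rationalE:
  assumes "rational C"
  obtains J where "finite J" "\<And>A. irr A \<Longrightarrow> \<exists>B\<in>J. irr B \<and> isom C A B"
proof -
  let ?Q = "{{sigma. isom C rho sigma} | rho. irr rho}"
  define rp where "rp c = (SOME rho. irr rho \<and> c = {sigma. isom C rho sigma})" for c
  have "\<exists>B\<in>rp ` ?Q. irr B \<and> isom C A B" if A: "irr A" for A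
  proof -
    let ?c = "{sigma. isom C A sigma}"
    have "irr (rp ?c) \<and> ?c = {sigma. isom C (rp ?c) sigma}" unfolding rp_def by (rule someI[of _ A]) (use A in simp)
    moreover have "A \<in> ?c" using isom_refl[of A] A by simp
    ultimately have "irr (rp ?c)" "isom C A (rp ?c)" using isom_sym by blast+
    then show ?thesis using A by blast
  qed
  then show ?thesis using that[of "rp ` ?Q"] assms unfolding rational_def by blast
qed

end

context crossed
begin

lemma K_vs: "vector_space (scl K)"
  by unfold_locales (simp_all add: fun_eq_iff V.scale_right_distrib V.scale_left_distrib)

lemma K_subspace: assumes o: "ob rho" "ob sigma" shows "module.subspace (scl K) (cp_HomV C X rho sigma)"
proof -
  interpret VK: vector_space "scl K" by (rule K_vs)
  have H: "Arrow rho sigma x \<in> Hom K rho sigma \<longleftrightarrow> x \<in> cp_HomV C X rho sigma" for x by (simp add: K_Hom)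
  show ?thesis
  proof (rule VK.subspaceI)
    show "0 \<in> cp_HomV C X rho sigma" by (rule cp_HomV_0[OF o])
  next
    fix x y assume "x \<in> cp_HomV C X rho sigma" "y \<in> cp_HomV C X rho sigma"
    then obtain tau S T psi where r: "trip rho sigma tau S psi" "trip rho sigma tau T psi" "Arrow rho sigma x = tri rho tau S psi" "Arrow rho sigma y = tri rho tau T psi"
      using K_rep2[of "Arrow rho sigma x" rho sigma "Arrow rho sigma y"] H o by metis
    then show "x + y \<in> cp_HomV C X rho sigma" using ev_mem[OF tri_add(2)[OF r(1,2)]] ev_lin(1)[OF r(1,2)] by (simp add: tri_def)
  next
    fix z x assume "x \<in> cp_HomV C X rho sigma"
    then obtain tau T psi where r: "trip rho sigma tau T psi" "Arrow rho sigma x = tri rho tau T psi"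
      using K_rep[of "Arrow rho sigma x" rho sigma] H o by metis
    then show "scl K z x \<in> cp_HomV C X rho sigma" using ev_mem[OF tri_scl(2)[OF r(1)], of z] ev_lin(2)[OF r(1), of z] by (simp add: tri_def)
  qed
qed

lemma bx_swap:
  assumes t: "tau \<in> D" "tau' \<in> D" "ups \<in> D" "ups' \<in> D" and m: "a \<in> HH tau" "a' \<in> HH tau'" "b \<in> HH ups" "b' \<in> HH ups'"
  shows "fa (idt tau**br tau' ups**idt ups') (bx (tau\<odot>tau') (ups\<odot>ups') (bx tau tau' a a') (bx ups ups' b b')) = bx (tau\<odot>ups) (tau'\<odot>ups') (bx tau ups a b) (bx tau' ups' a' b')"
proof -
  note [simp] = t m
  have B: "br tau' ups \<in> homs (tau'\<odot>ups) (ups\<odot>tau')" "br tau' ups**idt ups' \<in> homs ((tau'\<odot>ups)\<odot>ups') ((ups\<odot>tau')\<odot>ups')" by (simp_all add: homs_iff)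
  have d: "tau'\<odot>ups \<in> D" "ups\<odot>tau' \<in> D" "ups\<odot>ups' \<in> D" "(tau'\<odot>ups)\<odot>ups' \<in> D" "(ups\<odot>tau')\<odot>ups' \<in> D" "tau'\<odot>ups' \<in> D" using t by (simp_all only: D_tob)
  have M: "bx tau' ups a' b \<in> HH (tau'\<odot>ups)" "bx (tau'\<odot>ups) ups' (bx tau' ups a' b) b' \<in> HH ((tau'\<odot>ups)\<odot>ups')" "bx ups ups' b b' \<in> HH (ups\<odot>ups')" "bx tau' ups' a' b' \<in> HH (tau'\<odot>ups')"
    by (intro box_mem d t m)+
  have o: "(tau'\<odot>ups)\<odot>ups' = tau'\<odot>(ups\<odot>ups')" "(ups\<odot>tau')\<odot>ups' = ups\<odot>(tau'\<odot>ups')" by simp_all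
  have "bx (tau\<odot>tau') (ups\<odot>ups') (bx tau tau' a a') (bx ups ups' b b') = bx tau ((tau'\<odot>ups)\<odot>ups') a (bx (tau'\<odot>ups) ups' (bx tau' ups a' b) b')"
    unfolding o using box_assoc[OF t(1,2) d(3) m(1,2) M(3)] box_assoc[OF t(2,3,4) m(2,3,4)] by simp
  also have "fa (idt tau**br tau' ups**idt ups') \<dots> = bx tau ((ups\<odot>tau')\<odot>ups') (fa (idt tau) a) (fa (br tau' ups**idt ups') (bx (tau'\<odot>ups) ups' (bx tau' ups a' b) b'))"
    using fa_tp[OF t(1,1) d(4,5) homs_simps(1) B(2) m(1) M(2)] by simp
  also have "fa (br tau' ups**idt ups') (bx (tau'\<odot>ups) ups' (bx tau' ups a' b) b') = bx (ups\<odot>tau') ups' (bx ups tau' b a') b'"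
    using fa_tp[OF d(1,2) t(4,4) B(1) homs_simps(1) M(1) m(4)] fa_br[OF t(2,3) m(2,3)] by simp
  also have "bx tau ((ups\<odot>tau')\<odot>ups') (fa (idt tau) a) \<dots> = bx (tau\<odot>ups) (tau'\<odot>ups') (bx tau ups a b) (bx tau' ups' a' b')"
    unfolding o using box_assoc[OF t(1,3) d(6) m(1,3) M(4)] box_assoc[OF t(3,2,4) m(3,2,4)] by simp
  finally show ?thesis .
qed

lemma K_interchange:
  assumes f: "trip sigma delta tau S psi" and g: "trip rho sigma ups T phi" and f': "trip sigma' delta' tau' S' psi'" and g': "trip rho' sigma' ups' T' phi'"
  shows "cmp K (tar K (tri sigma tau S psi) (tri sigma' tau' S' psi')) (tar K (tri rho ups T phi) (tri rho' ups' T' phi'))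
    = tar K (cmp K (tri sigma tau S psi) (tri rho ups T phi)) (cmp K (tri sigma' tau' S' psi') (tri rho' ups' T' phi'))"
proof -
  note l = K_tar[OF f f'] K_tar[OF g g'] and r = K_cmp[OF f g] K_cmp[OF f' g']
  note L = K_cmp[OF l(2,4)] and R = K_tar[OF r(2,4)]
  note t = tripD(3)[OF f] tripD(3)[OF f'] tripD(3)[OF g] tripD(3)[OF g']
  note m = tripD(7)[OF f] tripD(7)[OF f'] tripD(7)[OF g] tripD(7)[OF g']
  let ?A = "idt tau**br tau' ups**idt ups'"
  have A: "?A \<in> homs ((tau\<odot>tau')\<odot>(ups\<odot>ups')) ((tau\<odot>ups)\<odot>(tau'\<odot>ups'))" using t by (simp add: homs_iff)
  show ?thesis unfolding l(1,3) r(1,3) L(1) R(1)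
    unfolding interchange_arrow[OF tripD(4,5)[OF f] tripD(4,5)[OF f'] tripD(4,5,6)[OF g] tripD(4,5,6)[OF g'] D_ob[OF t(1)] D_ob[OF t(2)] D_ob[OF t(3)] D_ob[OF t(4)] tripD(1)[OF g] tripD(1)[OF g'] tripD(1)[OF f] tripD(1)[OF f']]
      tri_nat[OF R(2) tripD(3)[OF L(2)] A tripD(7)[OF L(2)]] bx_swap[OF t m] ..
qed

lemma K_star_cmp:
  assumes f: "trip sigma delta tau S psi" and g: "trip rho sigma tau' T phi"
  shows "star K (cmp K (tri sigma tau S psi) (tri rho tau' T phi)) = cmp K (star K (tri rho tau' T phi)) (star K (tri sigma tau S psi))"
proof -
  obtain taub R Rb where c: "csol tau taub R Rb" using csol_ex tripD(3)[OF f] D_ob by blast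
  obtain taub' R' Rb' where c': "csol tau' taub' R' Rb'" using csol_ex tripD(3)[OF g] D_ob by blast
  note s = K_star[OF f c] and s' = K_star[OF g c']
  show ?thesis unfolding s(1) s'(1) K_cmp(1)[OF f g] K_cmp(1)[OF s'(2) s(2)] K_star(1)[OF K_cmp(2)[OF f g] csol_product[OF c c']]
    unfolding bar_product[OF tripD(3)[OF f] tripD(3)[OF g] c c' tripD(7)[OF f] tripD(7)[OF g]]
      adjoint_cp_arrow[OF c c' tripD(4-6)[OF f] tripD(4-6)[OF g] tripD(1)[OF g] tripD(1)[OF f]] ..
qed

lemma K_star_tar:
  assumes f: "trip rho sigma tau S psi" and g: "trip rho' sigma' tau' T phi"
  shows "star K (tar K (tri rho tau S psi) (tri rho' tau' T phi)) = tar K (star K (tri rho tau S psi)) (star K (tri rho' tau' T phi))"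
proof -
  note t = tripD(3)[OF f] tripD(3)[OF g]
  obtain taub R Rb where c: "csol tau taub R Rb" using csol_ex t D_ob by blast
  obtain taub' R' Rb' where c': "csol tau' taub' R' Rb'" using csol_ex t D_ob by blast
  note s = K_star[OF f c] and s' = K_star[OF g c']
  note tb = D_conj[OF t(1) c] D_conj[OF t(2) c']
  note R = K_tar[OF s(2) s'(2)] and L = K_star[OF K_tar(2)[OF f g] csol_product[OF c c']]
  note bm = bar_mem(1)[OF t(1) c tripD(7)[OF f]] bar_mem(1)[OF t(2) c' tripD(7)[OF g]]
  have A: "br taub' taub \<in> homs (taub'\<odot>taub) (taub\<odot>taub')" using tb by (simp add: homs_iff)
  have B: "fa (br taub' taub) (bx taub' taub (bar tau' taub' Rb' phi) (bar tau taub Rb psi)) = bx taub taub' (bar tau taub Rb psi) (bar tau' taub' Rb' phi)"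
    by (rule fa_br[OF tb(2,1) bm(2,1)])
  show ?thesis unfolding s(1) s'(1) R(1) K_tar(1)[OF f g] L(1)
    unfolding bar_product[OF t c c' tripD(7)[OF f] tripD(7)[OF g]]
      adjoint_tp_arrow[OF c c' tripD(4-6)[OF f] tripD(4-6)[OF g] tripD(1,2)[OF f] tripD(1,2)[OF g]]
      tri_nat[OF R(2) D_tob[OF tb(2,1)] A box_mem[OF tb(2,1) bm(2,1)]] B ..
qed

lemma tsc_K: "tensor_star_category K"
proof (unfold_locales, unfold K_simps, goal_cases)
  case (1 a x y) show ?case by (simp add: fun_eq_iff V.scale_right_distrib)
next
  case (2 a b x) show ?case by (simp add: fun_eq_iff V.scale_left_distrib)
next
  case (3 a b x) show ?case by simp
next
  case (4 x) show ?case by simp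
next
  case (5 rho sigma) then show ?case using K_subspace[of rho sigma] by (simp only: K_simps)
next
  case (6 rho) then show ?case using emb_Hom[of "idt rho" rho rho] by (simp add: emb_idn)
next
  case (7 rho sigma delta f g) then show ?case using K_cmp_add(5) by blast
next
  case (8 rho sigma f)
  obtain tau T psi where p: "trip rho sigma tau T psi" "f = tri rho tau T psi" by (rule K_rep[OF 8(3,1,2)])
  show ?case using K_cmp(1)[OF emb_trip[OF arr_idt[OF 8(2)]] p(1)] tripD[OF p(1)] by (simp add: p(2) emb_idn emb_def bx_Om)
next
  case (9 rho sigma f)
  obtain tau T psi where p: "trip rho sigma tau T psi" "f = tri rho tau T psi" by (rule K_rep[OF 9(3,1,2)])
  show ?case using K_cmp(1)[OF p(1) emb_trip[OF arr_idt[OF 9(1)]]] tripD[OF p(1)] by (simp add: p(2) emb_idn emb_def bx_Om)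
next
  case (10 rho sigma tau delta f g h)
  obtain tau1 T1 psi1 where p: "trip tau delta tau1 T1 psi1" "f = tri tau tau1 T1 psi1" by (rule K_rep[OF 10(5,3,4)])
  obtain tau2 T2 psi2 where q: "trip sigma tau tau2 T2 psi2" "g = tri sigma tau2 T2 psi2" by (rule K_rep[OF 10(6,2,3)])
  obtain tau3 T3 psi3 where r: "trip rho sigma tau3 T3 psi3" "h = tri rho tau3 T3 psi3" by (rule K_rep[OF 10(7,1,2)])
  note [simp] = tripD[OF p(1)] tripD[OF q(1)] tripD[OF r(1)]
  show ?case unfolding p(2) q(2) r(2) K_cmp(1)[OF p(1) q(1)] K_cmp(1)[OF q(1) r(1)] K_cmp(1)[OF K_cmp(2)[OF p(1) q(1)] r(1)] K_cmp(1)[OF p(1) K_cmp(2)[OF q(1) r(1)]]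
    by (simp add: box_assoc tp_cp)
next
  case (11 rho sigma delta f f' g) then show ?case using K_cmp_add(1) by blast
next
  case (12 rho sigma delta f g g') then show ?case using K_cmp_add(2) by blast
next
  case (13 rho sigma delta f g c) then show ?case using K_cmp_add(3) by blast
next
  case (14 rho sigma delta f g c) then show ?case using K_cmp_add(4) by blast
next
  case 15 show ?case by simp
next
  case (16 rho sigma) then show ?case by simp
next
  case (17 rho sigma tau) then show ?case by simp
next
  case (18 rho) then show ?case by simp
next
  case (19 rho) then show ?case by simp
next
  case (20 rho sigma rho' sigma' f g) then show ?case using K_tar_add(5) by blast
next
  case (21 rho1 sigma1 rho2 sigma2 rho3 sigma3 f g h)
  obtain tau1 T1 psi1 where p: "trip rho1 sigma1 tau1 T1 psi1" "f = tri rho1 tau1 T1 psi1" by (rule K_rep[OF 21(7,1,2)])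
  obtain tau2 T2 psi2 where q: "trip rho2 sigma2 tau2 T2 psi2" "g = tri rho2 tau2 T2 psi2" by (rule K_rep[OF 21(8,3,4)])
  obtain tau3 T3 psi3 where r: "trip rho3 sigma3 tau3 T3 psi3" "h = tri rho3 tau3 T3 psi3" by (rule K_rep[OF 21(9,5,6)])
  note t = tripD[OF p(1)] tripD[OF q(1)] tripD[OF r(1)]
  note d = D_ob[OF t(3)] D_ob[OF t(10)] D_ob[OF t(17)]
  show ?case unfolding p(2) q(2) r(2) K_tar(1)[OF p(1) q(1)] K_tar(1)[OF q(1) r(1)] K_tar(1)[OF K_tar(2)[OF p(1) q(1)] r(1)] K_tar(1)[OF p(1) K_tar(2)[OF q(1) r(1)]]
      tensor_assoc_arrow[OF t(4,5,11,12,18,19) d t(1,8,15)]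
    using t d by (simp add: box_assoc)
next
  case (22 rho sigma f)
  obtain tau T psi where p: "trip rho sigma tau T psi" "f = tri rho tau T psi" by (rule K_rep[OF 22(3,1,2)])
  show ?case using K_tar(1)[OF emb_trip[OF arr_idt[of "unt C"]] p(1)] tripD[OF p(1)] by (simp add: p(2) emb_idn emb_def bx_Om)
next
  case (23 rho sigma f)
  obtain tau T psi where p: "trip rho sigma tau T psi" "f = tri rho tau T psi" by (rule K_rep[OF 23(3,1,2)])
  show ?case using K_tar(1)[OF p(1) emb_trip[OF arr_idt[of "unt C"]]] tripD[OF p(1)] by (simp add: p(2) emb_idn emb_def bx_Om)
next
  case (24 rho sigma) then show ?case using emb_tar[of "idt rho" "idt sigma"] by (simp add: emb_idn)
next
  case (25 rho sigma delta rho' sigma' delta' f g f' g')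
  obtain tau1 T1 psi1 where p: "trip sigma delta tau1 T1 psi1" "f = tri sigma tau1 T1 psi1" by (rule K_rep[OF 25(7,2,3)])
  obtain tau2 T2 psi2 where q: "trip rho sigma tau2 T2 psi2" "g = tri rho tau2 T2 psi2" by (rule K_rep[OF 25(8,1,2)])
  obtain tau3 T3 psi3 where r: "trip sigma' delta' tau3 T3 psi3" "f' = tri sigma' tau3 T3 psi3" by (rule K_rep[OF 25(9,5,6)])
  obtain tau4 T4 psi4 where s: "trip rho' sigma' tau4 T4 psi4" "g' = tri rho' tau4 T4 psi4" by (rule K_rep[OF 25(10,4,5)])
  show ?case unfolding p(2) q(2) r(2) s(2) by (rule K_interchange[OF p(1) q(1) r(1) s(1)])
next
  case (26 rho sigma rho' sigma' f f' g) then show ?case using K_tar_add(1) by blast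
next
  case (27 rho sigma rho' sigma' f g g') then show ?case using K_tar_add(2) by blast
next
  case (28 rho sigma rho' sigma' f g c) then show ?case using K_tar_add(3) by blast
next
  case (29 rho sigma rho' sigma' f g c) then show ?case using K_tar_add(4) by blast
next
  case (30 rho sigma f) then show ?case using K_star_add(3) by blast
next
  case (31 rho sigma f) then show ?case using K_star_add(4) by blast
next
  case (32 rho sigma f g) then show ?case using K_star_add(1) by blast
next
  case (33 rho sigma f c) then show ?case using K_star_add(2) by blast
next
  case (34 rho sigma delta f g)
  obtain tau1 T1 psi1 where p: "trip sigma delta tau1 T1 psi1" "f = tri sigma tau1 T1 psi1" by (rule K_rep[OF 34(4,2,3)])
  obtain tau2 T2 psi2 where q: "trip rho sigma tau2 T2 psi2" "g = tri rho tau2 T2 psi2" by (rule K_rep[OF 34(5,1,2)])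
  show ?case unfolding p(2) q(2) by (rule K_star_cmp[OF p(1) q(1)])
next
  case (35 rho sigma rho' sigma' f g)
  obtain tau1 T1 psi1 where p: "trip rho sigma tau1 T1 psi1" "f = tri rho tau1 T1 psi1" by (rule K_rep[OF 35(5,1,2)])
  obtain tau2 T2 psi2 where q: "trip rho' sigma' tau2 T2 psi2" "g = tri rho' tau2 T2 psi2" by (rule K_rep[OF 35(6,3,4)])
  show ?case unfolding p(2) q(2) by (rule K_star_tar[OF p(1) q(1)])
next
  case (36 rho sigma f) then show ?case using K_positive by blast
qed

lemma K_csol: assumes c: "csol rho rhob R Rb" shows "conj_solution K rho rhob (emb R) (emb Rb)"
proof -
  note [simp] = csol_t[OF c]
  have "emb R \<in> Hom K (unt C) (rhob\<odot>rho)" "emb Rb \<in> Hom K (unt C) (rho\<odot>rhob)" by (auto intro!: emb_Hom simp: homs_iff)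
  then show ?thesis using csol_zz(1,2)[OF c] by (simp add: conj_solution_def emb_star emb_idn emb_tar emb_cmp)
qed

lemma K_isometry: "V \<in> homs sigma tau \<Longrightarrow> V\<star> oo V = idt sigma \<Longrightarrow> isometry K sigma tau (emb V)"
  using emb_Hom[of V sigma tau] by (simp add: isometry_def emb_star emb_cmp emb_idn homs_iff)

text \<open>
  By Frobenius reciprocity the \<open>\<gamma>\<^sub>k\<close> with nonzero arrows from \<open>\<gamma>\<^sub>k rho\<close> to \<open>sigma\<close> are the summands of
  \<open>sigma\<close> times the conjugate of \<open>rho\<close>.
\<close>

lemma finite_contributions:
  assumes [simp]: "ob rho" "ob sigma"
  shows "\<exists>N. finite N \<and> (\<forall>k\<in>reps X. \<forall>T\<in>homs (k\<odot>rho) sigma. vect T \<noteq> 0 \<longrightarrow> k \<in> N)"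
proof -
  obtain rhob R Rb where c: "csol rho rhob R Rb" using csol_ex[of rho] by auto
  note [simp] = csol_t[OF c]
  obtain n r W where d: "decomp (sigma\<odot>rhob) n r W" using decomp_ex[of "sigma\<odot>rhob"] by auto
  let ?N = "\<Union>i<n. {k \<in> reps X. isom C k (r i)}"
  have "finite {k \<in> reps X. isom C k (r i)}" for i
  proof (cases "\<exists>k. k \<in> reps X \<and> isom C k (r i)")
    case True
    then obtain k where k: "k \<in> reps X" "isom C k (r i)" by blast
    have "{k \<in> reps X. isom C k (r i)} \<subseteq> {k}" using k reps_unique isom_sym isom_trans by blast
    then show ?thesis by (rule finite_subset) simp
  next
    case False
    then have "{k \<in> reps X. isom C k (r i)} = {}" by blast
    then show ?thesis by (simp only: finite.emptyI)
  qed
  then have "finite ?N" by simp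
  moreover have "k \<in> ?N" if k: "k \<in> reps X" and T: "T \<in> homs (k\<odot>rho) sigma" "vect T \<noteq> 0" for k T
  proof -
    note [simp] = k T(1)[unfolded homs_iff]
    let ?T = "(T**idt rhob) oo (idt k**Rb)"
    have t: "?T \<in> homs k (sigma\<odot>rhob)" by (simp add: homs_iff)
    have "vect ?T \<noteq> 0"
    proof
      assume "vect ?T = 0"
      then have "?T = arr_zero k (sigma\<odot>rhob)" using vect_zero[of ?T] t by (simp add: homs_iff)
      then have "T = arr_zero (k\<odot>rho) sigma" using frobenius_right[OF c, of T k sigma] by simp
      then show False using T(2) by simp
    qed
    then obtain i where "i < n" "isom C k (r i)" using irr_isom_summand[OF repsD(2)[OF k] t _ d] by blast
    then show ?thesis using k by blast
  qed
  ultimately show ?thesis by blast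
qed

lemma K_fin_dim:
  assumes o [simp]: "ob rho" "ob sigma"
  shows "\<exists>B. finite B \<and> cp_HomV C X rho sigma = module.span (scl K) B"
proof -
  interpret VK: vector_space "scl K" by (rule K_vs)
  note K_simps(3) [simp del]
  obtain N where N: "finite N" "\<And>k T. k \<in> reps X \<Longrightarrow> T \<in> homs (k\<odot>rho) sigma \<Longrightarrow> vect T \<noteq> 0 \<Longrightarrow> k \<in> N"
    using finite_contributions[OF o] by blast
  define dl where "dl k i v = (\<lambda>k' j. if k' = k \<and> j = i then v else 0)" for k :: 'o and i :: nat and v :: 'a
  have "\<exists>B. finite B \<and> HomV C (k\<odot>rho) sigma = V.span B" if "k \<in> reps X" for k using that fin_dim[of "k\<odot>rho" sigma] by simp
  then obtain Bk where Bk: "\<And>k. k \<in> reps X \<Longrightarrow> finite (Bk k) \<and> HomV C (k\<odot>rho) sigma = V.span (Bk k)" by metis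
  let ?N = "N \<inter> reps X"
  let ?B = "\<Union>k\<in>?N. \<Union>i<bdim X k. dl k i ` Bk k"
  have fin: "finite ?B" using N(1) Bk by auto
  have mem: "dl k i v \<in> cp_HomV C X rho sigma" if "k \<in> reps X" "i < bdim X k" "v \<in> HomV C (k\<odot>rho) sigma" for k i v
  proof -
    have "cp_supp (dl k i v) \<subseteq> {k}" by (auto simp: cp_supp_def dl_def split: if_splits)
    then have "finite (cp_supp (dl k i v))" by (rule finite_subset) simp
    moreover have "0 \<in> HomV C (k'\<odot>rho) sigma" if "k' \<in> reps X" for k' using that V.subspace_0[OF HomV_sub] by simp
    ultimately show ?thesis using that by (auto simp: cp_HomV_def dl_def)
  qed
  have dsp: "dl k i v \<in> VK.span ?B" if k: "k \<in> ?N" "i < bdim X k" and v: "v \<in> HomV C (k\<odot>rho) sigma" for k i v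
  proof -
    have "v \<in> V.span (Bk k)" using v Bk k by blast
    then show ?thesis
    proof (induction rule: V.span_induct_alt)
      case base
      have "dl k i 0 = 0" by (auto simp: dl_def fun_eq_iff)
      then show ?case using VK.span_zero by (simp only:)
    next
      case (step c x y)
      have e: "dl k i (scl C c x + y) = scl K c (dl k i x) + dl k i y" by (auto simp: dl_def fun_eq_iff K_simps(3))
      have "dl k i x \<in> VK.span ?B" using step.hyps k by (intro VK.span_base) blast
      then show ?case unfolding e by (intro VK.span_add VK.span_scale step.IH)
    qed
  qed
  have "x \<in> VK.span ?B" if x: "x \<in> cp_HomV C X rho sigma" for x
  proof -
    have xN: "m \<in> ?N \<and> j < bdim X m" if "x m j \<noteq> 0" for m j
    proof -
      have mj: "m \<in> reps X" "j < bdim X m" using cp_HomV_D(2)[OF x, of m j] that by auto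
      then show ?thesis using N(2)[OF mj(1), of "Arrow (m\<odot>rho) sigma (x m j)"] cp_HomV_D(1)[OF x mj] that by (simp add: homs_Arrow)
    qed
    have "x = (\<Sum>p\<in>Sigma ?N (\<lambda>k. {..<bdim X k}). dl (fst p) (snd p) (x (fst p) (snd p)))"
    proof (intro ext)
      fix m j
      have "(\<Sum>p\<in>Sigma ?N (\<lambda>k. {..<bdim X k}). dl (fst p) (snd p) (x (fst p) (snd p))) m j = (\<Sum>p\<in>Sigma ?N (\<lambda>k. {..<bdim X k}). if p = (m, j) then x m j else 0)"
        unfolding sum_apply2 by (rule sum.cong) (auto simp: dl_def)
      also have "\<dots> = x m j" using N(1) xN[of m j] by (subst sum.delta) auto
      finally show "x m j = (\<Sum>p\<in>Sigma ?N (\<lambda>k. {..<bdim X k}). dl (fst p) (snd p) (x (fst p) (snd p))) m j" by simp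
    qed
    moreover have "(\<Sum>p\<in>Sigma ?N (\<lambda>k. {..<bdim X k}). dl (fst p) (snd p) (x (fst p) (snd p))) \<in> VK.span ?B"
    proof (rule VK.span_sum)
      fix p assume "p \<in> Sigma ?N (\<lambda>k. {..<bdim X k})"
      then have h: "fst p \<in> ?N" "snd p < bdim X (fst p)" "fst p \<in> reps X" by auto
      show "dl (fst p) (snd p) (x (fst p) (snd p)) \<in> VK.span ?B" by (rule dsp[OF h(1,2) cp_HomV_D(1)[OF x h(3,2)]])
    qed
    ultimately show ?thesis by simp
  qed
  moreover have "VK.span ?B \<subseteq> cp_HomV C X rho sigma"
  proof (rule VK.span_minimal[OF _ K_subspace[OF o]])
    have "Bk k \<subseteq> HomV C (k\<odot>rho) sigma" if "k \<in> reps X" for k using Bk[OF that] V.span_superset by blast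
    then show "?B \<subseteq> cp_HomV C X rho sigma" using mem by blast
  qed
  ultimately show ?thesis using fin by (intro exI[of _ ?B]) blast
qed

text \<open>
  For an endomorphism of the unit, \<open>T\<close> is an arrow from \<open>tau\<close> to the unit and can be moved to the vector, which is
  then a multiple of the vacuum.
\<close>

lemma K_unt_irr: "irreducible_obj K (unt C)"
proof -
  have "idn K (unt C) \<noteq> arr_zero (unt C) (unt C)"
  proof
    assume "idn K (unt C) = arr_zero (unt C) (unt C)"
    then have z: "ev (unt C) (unt C) (idt (unt C)) Om = 0" by (simp add: emb_idn emb_def tri_def arr_zero_def)
    have "ip (unt C) (bas X (unt C) i) Om = 0" if i: "i < bdim X (unt C)" for i
    proof -
      have "ev (unt C) (unt C) (idt (unt C)) Om (unt C) i = scl C (ip (unt C) (bas X (unt C) i) Om) (vect (idt (unt C)))"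
        using i reps_unt crd_irr[OF reps_unt reps_unt bas_mem[OF reps_unt i] Om_mem] by (simp add: ev_def)
      then show ?thesis using z irr_ne[OF unt_irr] by simp
    qed
    then have "Om = 0" using bas_expand[OF reps_unt Om_mem] H_closed(7)[OF D_unt] by simp
    then show False using Om_ne by simp
  qed
  moreover have "f \<in> range (\<lambda>c. arr_scl K c (idn K (unt C)))" if f: "f \<in> Hom K (unt C) (unt C)" for f
  proof -
    obtain tau T psi where p: "trip (unt C) (unt C) tau T psi" "f = tri (unt C) tau T psi" by (rule K_rep[OF f]) auto
    note [simp] = tripD[OF p(1)]
    have T: "T \<in> homs tau (unt C)" by (simp add: homs_iff)
    have i: "trip (unt C) (unt C) (unt C) (idt (unt C)) Om" by (rule emb_trip) simp_all
    have "f = tri (unt C) (unt C) (idt (unt C)) (fa T psi)" using tri_nat[OF i tripD(3)[OF p(1)] T tripD(7)[OF p(1)]] by (simp add: p(2))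
    moreover obtain z where "fa T psi = rs (unt C) z Om" using fa_rules(1)[OF tripD(3)[OF p(1)] D_unt T tripD(7)[OF p(1)]] vac_hilb by auto
    moreover have "rs (unt C) z Om = fa (z *> idt (unt C)) Om" using fa_rules(5)[OF D_unt D_unt homs_simps(1) Om_mem] by simp
    moreover have "tri (unt C) (unt C) (idt (unt C)) (fa (z *> idt (unt C)) Om) = tri (unt C) (unt C) (z *> idt (unt C)) Om"
      using tri_nat[OF i D_unt, of "z *> idt (unt C)" Om] by (simp add: homs_iff)
    ultimately have "f = arr_scl K z (idn K (unt C))" by (simp add: emb_idn emb_scl) (simp add: emb_def)
    then show ?thesis by blast
  qed
  moreover have "arr_scl K c (idn K (unt C)) \<in> Hom K (unt C) (unt C)" for c by (simp add: emb_idn emb_scl emb_Hom homs_iff)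
  ultimately show ?thesis unfolding irreducible_obj_def by auto
qed

text \<open>
  The place where the degeneracy of \<open>tau'\<close> is essential: the braidings \<open>br tau' rho\<close> and \<open>br rho tau'\<close> meet
  and have to cancel. The braiding of \<open>tau\<close> and \<open>tau'\<close> that remains is moved to the vector.
\<close>

lemma braid_nat_arrow:
  assumes t: "tau \<in> D" "tau' \<in> D" and [simp]: "arr S" "src S = tau\<odot>rho" "tgt S = rho'" "arr T" "src T = tau'\<odot>sigma" "tgt T = sigma'" "ob rho" "ob sigma"
  shows "br rho' sigma' oo (S**T) oo (idt tau**br tau' rho**idt sigma) = (((T**S) oo (idt tau'**br tau sigma**idt rho)) oo (idt (tau'\<odot>tau)**br rho sigma)) oo (br tau tau'**idt (rho\<odot>sigma))"
proof -
  note [simp] = t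
  have 1: "(br rho tau'**idt sigma) oo (br tau' rho**idt sigma) = idt (tau'\<odot>(rho\<odot>sigma))" using D_br(1)[OF t(2), of rho] by (simp add: ichg)
  have 2: "br (tau\<odot>rho) tau' = (br tau tau'**idt rho) oo (idt tau**br rho tau')" "br (tau\<odot>rho) sigma = (br tau sigma**idt rho) oo (idt tau**br rho sigma)"
    "br (tau\<odot>rho) (tau'\<odot>sigma) = (idt tau'**br (tau\<odot>rho) sigma) oo (br (tau\<odot>rho) tau'**idt sigma)"
    by (rule br_left br_right; simp)+
  have 3: "(idt tau**br rho tau'**idt sigma) oo (idt tau**br tau' rho**idt sigma) = idt (tau\<odot>(tau'\<odot>(rho\<odot>sigma)))"
    using arg_cong[OF 1, of "\<lambda>f. idt tau**f"] by (simp add: tp_cp)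
  have 4: "br (tau\<odot>rho) (tau'\<odot>sigma) oo (idt tau**br tau' rho**idt sigma) = (idt tau'**br tau sigma**idt rho) oo (idt (tau'\<odot>tau)**br rho sigma) oo (br tau tau'**idt (rho\<odot>sigma))"
    unfolding 2(3) unfolding 2(1,2) using 3 by (simp add: tp_cp)
  have "br rho' sigma' oo (S**T) = (T**S) oo br (tau\<odot>rho) (tau'\<odot>sigma)" using br_nat[of S T rho' sigma'] by simp
  from cp_subst[OF this, of "idt tau**br tau' rho**idt sigma"] show ?thesis using 4 arr_ob(2)[of S] arr_ob(2)[of T] by simp
qed

lemma K_br_nat:
  assumes f: "trip rho rho' tau S psi" and g: "trip sigma sigma' tau' T phi"
  shows "cmp K (emb (br rho' sigma')) (tar K (tri rho tau S psi) (tri sigma tau' T phi)) = cmp K (tar K (tri sigma tau' T phi) (tri rho tau S psi)) (emb (br rho sigma))"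
proof -
  note t = tripD(3)[OF f] tripD(3)[OF g] and m = tripD(7)[OF f] tripD(7)[OF g]
  note [simp] = tripD[OF f] tripD[OF g]
  have e: "trip (rho'\<odot>sigma') (sigma'\<odot>rho') (unt C) (br rho' sigma') Om" "trip (rho\<odot>sigma) (sigma\<odot>rho) (unt C) (br rho sigma) Om" by (rule emb_trip; simp)+
  have b: "bx tau tau' psi phi \<in> HH (tau\<odot>tau')" "bx tau' tau phi psi \<in> HH (tau'\<odot>tau)" using t m by (auto intro: box_mem)
  let ?N = "((T**S) oo (idt tau'**br tau sigma**idt rho)) oo (idt (tau'\<odot>tau)**br rho sigma)"
  have L: "cmp K (emb (br rho' sigma')) (tar K (tri rho tau S psi) (tri sigma tau' T phi)) = tri (rho\<odot>sigma) (tau\<odot>tau') (br rho' sigma' oo (S**T) oo (idt tau**br tau' rho**idt sigma)) (bx tau tau' psi phi)"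
    using K_cmp(1)[OF e(1) K_tar(2)[OF f g]] b by (simp add: K_tar(1)[OF f g] emb_def bx_Om)
  note N = K_cmp[OF K_tar(2)[OF g f] e(2)]
  have N2: "trip (rho\<odot>sigma) (sigma'\<odot>rho') (tau'\<odot>tau) ?N (bx tau' tau phi psi)" using N(2) b by (simp add: bx_Om)
  have R: "cmp K (tar K (tri sigma tau' T phi) (tri rho tau S psi)) (emb (br rho sigma)) = tri (rho\<odot>sigma) (tau'\<odot>tau) ?N (bx tau' tau phi psi)"
    using N(1) b by (simp add: K_tar(1)[OF g f] emb_def bx_Om)
  have A: "br tau tau' \<in> homs (tau\<odot>tau') (tau'\<odot>tau)" by (simp add: homs_iff)
  show ?thesis unfolding L R
    unfolding braid_nat_arrow[OF t tripD(4-6)[OF f] tripD(4-6)[OF g] tripD(1)[OF f] tripD(1)[OF g]]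
      tri_nat[OF N2 D_tob[OF t] A b(1)] fa_br[OF t m] ..
qed

theorem pre_K: "pre_BTC_star K"
proof -
  interpret T: tensor_star_category K by (rule tsc_K)
  show ?thesis
  proof (unfold_locales, unfold K_simps(1,2,4,5), goal_cases)
    case (1 rho) then show ?case using csol_ex[of rho] K_csol by blast
  next
    case (2 rho sigma)
    obtain tau V W where d: "ob tau" "V \<in> homs rho tau" "W \<in> homs sigma tau" "V\<star> oo V = idt rho" "W\<star> oo W = idt sigma" "(V oo V\<star>) \<boxplus> (W oo W\<star>) = idt tau"
      using dsum[OF 2] by metis
    note [simp] = d(1) d(2,3)[unfolded homs_iff]
    have "arr_add (cmp K (emb V) (star K (emb V))) (cmp K (emb W) (star K (emb W))) = idn K tau"
      using d(6) by (simp add: emb_star emb_cmp emb_add emb_idn)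
    then show ?case using K_isometry[OF d(2,4)] K_isometry[OF d(3,5)] d(1) by blast
  next
    case (3 rho sigma) then show ?case by (rule K_fin_dim)
  next
    case 4 show ?case by (rule K_unt_irr)
  next
    case (5 rho sigma) then show ?case by (simp add: emb_br emb_Hom homs_iff)
  next
    case (6 rho sigma) then show ?case by (simp add: emb_br emb_star emb_cmp emb_idn)
  next
    case (7 rho sigma rho' sigma' f g)
    obtain tau1 T1 psi1 where p: "trip rho rho' tau1 T1 psi1" "f = tri rho tau1 T1 psi1" by (rule K_rep[OF 7(5,1,3)])
    obtain tau2 T2 psi2 where q: "trip sigma sigma' tau2 T2 psi2" "g = tri sigma tau2 T2 psi2" by (rule K_rep[OF 7(6,2,4)])
    show ?case unfolding p(2) q(2) emb_br[OF 7(3,4)] emb_br[OF 7(1,2)] by (rule K_br_nat[OF p(1) q(1)])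
  next
    case (8 rho sigma tau) then show ?case using br_right[of rho sigma tau] by (simp add: emb_br emb_idn emb_tar emb_cmp)
  next
    case (9 rho sigma tau) then show ?case using br_left[of rho sigma tau] by (simp add: emb_br emb_idn emb_tar emb_cmp)
  qed
qed

end


section \<open>Degenerate objects of the crossed product\<close>

context pre_BTC
begin

lemma so_embed: "ob sigma \<Longrightarrow> so (sigma, idn C sigma)"
  by (simp add: so_def proj_def idt_eq)

lemma irr_snd:
  assumes "irreducible_obj Sc A" shows "so A" "vect (snd A) \<noteq> 0"
  using assms unfolding irreducible_obj_def so_Obj by (auto simp: Sc_simps arr_zero_def)

lemma lift_arrow:
  assumes a: "so A" and g: "g \<in> Hom C (fst A) sigma" and o: "ob sigma" and n: "vect (g \<cdot> snd A) \<noteq> 0"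
  shows "\<exists>h\<in>Hom Sc A (sigma, idn C sigma). vect h \<noteq> 0"
proof -
  note [simp] = soD[OF a] o
  have "g \<in> homs (fst A) sigma" using g by (simp add: homs_Hom)
  note [simp] = this[unfolded homs_iff]
  have e: "g \<cdot> snd A = g oo snd A" by (simp add: cp_eq)
  define h where "h = Arrow A (sigma, idn C sigma) (vect (g oo snd A))"
  have u: "under h = g oo snd A" by (rule arrow.expand) (simp add: h_def under_def)
  have "uh A (sigma, idn C sigma) h" unfolding uh_def u by (simp add: h_def idt_eq)
  then have "h \<in> Hom Sc A (sigma, idn C sigma)" using uh_Hom[OF a so_embed[OF o]] by blast
  moreover have "vect h \<noteq> 0" using n e by (simp add: h_def)
  ultimately show ?thesis by blast
qed

text \<open>
  By naturality \<open>E\<close> passes through the braiding, so trivial monodromy of \<open>(rho, E)\<close> with \<open>(sigma, id)\<close> means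
  that the monodromy of \<open>rho\<close> with \<open>sigma\<close> fixes \<open>E\<close>.
\<close>

lemma degenerate_closure:
  assumes a: "so A" and d: "degenerate_obj Sc A" and o: "ob sigma"
  shows "(brd C sigma (fst A) \<cdot> brd C (fst A) sigma) \<cdot> (snd A \<boxtimes> idn C sigma) = snd A \<boxtimes> idn C sigma"
proof -
  let ?B = "(sigma, idn C sigma)"
  note b = so_embed[OF o]
  note [simp] = soD[OF a] o
  have s: "fst ?B = sigma" "snd ?B = idt sigma" using o by (simp_all add: idt_eq)
  have "monodromy Sc A ?B = idn Sc (tob Sc A ?B)" using d b so_Obj unfolding degenerate_obj_def by blast
  then have "under (cmp Sc (brd Sc ?B A) (brd Sc A ?B)) = under (idn Sc (sub_tob C A ?B))" unfolding monodromy_def Sc_simps(7) by simp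
  then have e: "(br sigma (fst A) oo (idt sigma**snd A)) oo (br (fst A) sigma oo (snd A**idt sigma)) = snd A**idt sigma"
    unfolding under_ops(1) under_brd(2)[OF a b] under_brd(2)[OF b a] under_ops(7)[OF sub_tob_simps(2)[OF a b]] sub_tob_simps(1)[OF a b] s .
  have 1: "(idt sigma**snd A) oo br (fst A) sigma = br (fst A) sigma oo (snd A**idt sigma)" using br_nat[of "snd A" "idt sigma" "fst A" sigma] by simp
  have 2: "(snd A**idt sigma) oo (snd A**idt sigma) = snd A**idt sigma" by (simp add: ichg)
  have "(br sigma (fst A) oo br (fst A) sigma) oo (snd A**idt sigma) = snd A**idt sigma"
    using e cp_subst[OF 1, of "snd A**idt sigma"] 2 by simp
  then show ?thesis by (simp add: br_eq cp_eq tp_eq idt_eq)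
qed

end

context crossed
begin

lemma emb_cmp_tri: assumes p: "trip rho sigma tau T psi" and [simp]: "arr g" "src g = sigma"
  shows "cmp K (emb g) (tri rho tau T psi) = tri rho tau (g oo T) psi" "trip rho (tgt g) tau (g oo T) psi"
  using K_cmp[OF emb_trip[of g sigma "tgt g"] p] tripD[OF p] by (simp_all add: emb_def bx_Om)

lemma K_cmp_zero: assumes o: "ob rho" "ob sigma" "ob delta" and f: "f \<in> Hom K sigma delta"
  shows "cmp K f (arr_zero rho sigma) = arr_zero rho delta"
proof -
  have z: "arr_scl K 0 g = arr_zero (src g) (tgt g)" for g by (rule arrow.expand) (simp add: arr_scl_def arr_zero_def fun_eq_iff)
  have "arr_zero rho sigma \<in> Hom K rho sigma" using o by (simp add: K_Hom arr_zero_def cp_HomV_0)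
  from K_cmp_add(4)[OF o f this, of 0] show ?thesis using f unfolding z by (simp add: arr_zero_def K_Hom)
qed

lemma component_nonzero:
  assumes p: "trip rho' rho tau T psi" and n: "ev rho' tau T psi \<noteq> 0" and d: "decomp rho n r W"
  obtains k i j where "k \<in> reps X" "i < bdim X k" "j < n"
    "vect ((W j)\<star> oo T oo (crd k tau (bas X k i) psi**idt rho')) \<noteq> 0" "ev rho' tau ((W j)\<star> oo T) psi \<noteq> 0"
proof -
  note [simp] = tripD[OF p]
  obtain k i where ki: "ev rho' tau T psi k i \<noteq> 0" using n by (auto simp: fun_eq_iff)
  then have k: "k \<in> reps X" "i < bdim X k" by (auto simp: ev_def split: if_splits)
  let ?f = "T oo (crd k tau (bas X k i) psi**idt rho')"
  have f: "?f \<in> homs (k\<odot>rho') rho" using k by (simp add: homs_iff)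
  have "vect ?f \<noteq> 0" using ki k by (simp add: ev_def)
  then obtain j where j: "j < n" "vect ((W j)\<star> oo ?f) \<noteq> 0" using decomp_component[OF d f] by blast
  note [simp] = decompD(2)[OF d j(1), unfolded homs_iff]
  have "ev rho' tau ((W j)\<star> oo T) psi k i = vect ((W j)\<star> oo ?f)" using k by (simp add: ev_def)
  then have "ev rho' tau ((W j)\<star> oo T) psi \<noteq> 0" using j(2) by (metis zero_fun_apply)
  then show ?thesis using that k j by blast
qed

text \<open>
  In the crossed product \<open>\<gamma>\<^sub>k\<close> is a multiple of the unit: the vectors of an orthonormal basis of
  \<open>F(\<gamma>\<^sub>k)\<close> are arrows \<open>g\<^sub>i\<close> from the unit, and the sum of the \<open>g\<^sub>i \<circ> g\<^sub>i\<^sup>*\<close> is the identity. On the level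
  of vectors, the reason is the following.
\<close>

lemma sum_bas_bar:
  assumes k: "k \<in> reps X" and c: "csol k kb R Rb"
  shows "(\<Sum>i<bdim X k. bx k kb (bas X k i) (bar k kb Rb (bas X k i))) = fa Rb Om"
proof -
  note kD = repsD(1)[OF k]
  note kb = D_conj[OF kD c]
  have bm: "bar k kb Rb (bas X k i) \<in> HH kb" if "i \<in> {..<bdim X k}" for i using that k bar_mem(1)[OF kD c] by simp
  have m: "bx k kb (bas X k i) (bar k kb Rb (bas X k i)) \<in> HH (k\<odot>kb)" if "i \<in> {..<bdim X k}" for i
    using box_mem[OF kD kb _ bm[OF that]] that k by simp
  have t: "k\<odot>kb \<in> D" by (rule D_tob[OF kD kb])
  have Rm: "fa Rb Om \<in> HH (k\<odot>kb)" if "a \<in> HH k" for a by (rule bar_mem(2)[OF kD c that])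
  have Om': "fa Rb Om \<in> HH (k\<odot>kb)" by (rule Rm[OF H_closed(1)[OF kD]])
  show ?thesis
  proof (rule box_ext[OF kD kb H_closed(5)[OF t m] Om'])
    fix a b assume a: "a \<in> HH k" and b: "b \<in> HH kb"
    have ci: "ip (k\<odot>kb) (bx k kb (bas X k i) b) (fa Rb Om) = ip kb b (bar k kb Rb (bas X k i))" if "i \<in> {..<bdim X k}" for i
      unfolding bar_def using ctr(2)[OF kD kb _ Om' b, of "bas X k i"] that k by simp
    have am: "rs k (ip k (bas X k i) a) (bas X k i) \<in> HH k" if "i \<in> {..<bdim X k}" for i using that k H_closed(3)[OF kD] by simp
    have "ip (k\<odot>kb) (bx k kb a b) (\<Sum>i<bdim X k. bx k kb (bas X k i) (bar k kb Rb (bas X k i)))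
      = (\<Sum>i<bdim X k. ip (k\<odot>kb) (bx k kb a b) (bx k kb (bas X k i) (bar k kb Rb (bas X k i))))"
      by (rule ip_sum(1)[OF t box_mem[OF kD kb a b] m])
    also have "\<dots> = (\<Sum>i<bdim X k. ip k a (bas X k i) * ip kb b (bar k kb Rb (bas X k i)))"
      using k bm by (intro sum.cong[OF refl] box_inner[OF kD kb a _ b]) auto
    also have "\<dots> = (\<Sum>i<bdim X k. ip (k\<odot>kb) (bx k kb (rs k (ip k (bas X k i) a) (bas X k i)) b) (fa Rb Om))"
    proof (rule sum.cong[OF refl])
      fix i assume i: "i \<in> {..<bdim X k}"
      have bi: "bas X k i \<in> HH k" using i k by simp
      show "ip k a (bas X k i) * ip kb b (bar k kb Rb (bas X k i)) = ip (k\<odot>kb) (bx k kb (rs k (ip k (bas X k i) a) (bas X k i)) b) (fa Rb Om)"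
        unfolding ci[OF i, symmetric] box_scl_left[OF kD kb bi b] ip_rules(5)[OF t box_mem[OF kD kb bi b] Om'] ip_rules(3)[OF kD bi a] by simp
    qed
    also have "\<dots> = ip (k\<odot>kb) (bx k kb (\<Sum>i<bdim X k. rs k (ip k (bas X k i) a) (bas X k i)) b) (fa Rb Om)"
    proof (rule additive_sum(1)[of "HH k" "\<lambda>x. ip (k\<odot>kb) (bx k kb x b) (fa Rb Om)", symmetric])
      fix x y assume "x \<in> HH k" "y \<in> HH k"
      then show "ip (k\<odot>kb) (bx k kb (x + y) b) (fa Rb Om) = ip (k\<odot>kb) (bx k kb x b) (fa Rb Om) + ip (k\<odot>kb) (bx k kb y b) (fa Rb Om)"
        using b box_mem[OF kD kb] by (simp add: box_add_left[OF kD kb] ip_rules(4)[OF t] Om')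
    qed (auto intro: H_closed(1,2)[OF kD] am)
    finally show "ip (k\<odot>kb) (bx k kb a b) (\<Sum>i<bdim X k. bx k kb (bas X k i) (bar k kb Rb (bas X k i))) = ip (k\<odot>kb) (bx k kb a b) (fa Rb Om)"
      using bas_expand[OF k a] by simp
  qed
qed

text \<open>
  A basis vector \<open>b\<^sub>i\<close> gives an arrow \<open>g\<^sub>i\<close> from the unit to \<open>\<gamma>\<^sub>k\<close>. If all \<open>g\<^sub>i\<^sup>* \<circ> f\<close> vanish, then so
  does the sum of the \<open>g\<^sub>i \<circ> g\<^sub>i\<^sup>* \<circ> f\<close>, which is \<open>f\<close> by \<open>sum_bas_bar\<close>.
\<close>

lemma arrow_to_unit:
  assumes k: "k \<in> reps X" and p: "trip rho k tau T psi" and n: "ev rho tau T psi \<noteq> 0"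
  shows "\<exists>h\<in>Hom K k (unt C). vect (cmp K h (tri rho tau T psi)) \<noteq> 0"
proof (rule ccontr)
  assume c0: "\<not> ?thesis"
  note kD = repsD(1)[OF k]
  note [simp] = tripD[OF p] kD
  obtain kb R Rb where c: "csol k kb R Rb" using csol_ex[of k] by auto
  note [simp] = csol_t[OF c]
  note kb = D_conj[OF kD c]
  note [simp] = kb
  let ?b = "bas X k"
  let ?M = "idt k**(R\<star> oo (idt kb**T))"
  let ?v = "\<lambda>i. bx k (kb\<odot>tau) (?b i) (bx kb tau (bar k kb Rb (?b i)) psi)"
  have Y: "trip (unt C) k k (idt k) (?b i)" if "i < bdim X k" for i by (rule tripI) (use that k in auto)
  have bm: "bar k kb Rb (?b i) \<in> HH kb" if "i < bdim X k" for i using that k bar_mem(1)[OF kD c] by simp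
  have Mt: "trip rho k (k\<odot>(kb\<odot>tau)) ?M v" if "v \<in> HH (k\<odot>(kb\<odot>tau))" for v by (rule tripI) (use that in simp_all)
  have vm: "?v i \<in> HH (k\<odot>(kb\<odot>tau))" if "i < bdim X k" for i using bm[OF that] that k by (intro box_mem) auto
  have z: "ev rho (k\<odot>(kb\<odot>tau)) ?M (?v i) = 0" if i: "i < bdim X k" for i
  proof -
    note s = K_star[OF Y[OF i] c]
    note h = K_cmp[OF s(2) p]
    note g = K_cmp[OF Y[OF i] h(2)]
    have "star K (tri (unt C) k (idt k) (?b i)) \<in> Hom K k (unt C)" using tri_Hom[OF s(2)] s(1) by simp
    then have "vect (cmp K (star K (tri (unt C) k (idt k) (?b i))) (tri rho tau T psi)) = 0" using c0 by blast
    then have z: "cmp K (star K (tri (unt C) k (idt k) (?b i))) (tri rho tau T psi) = arr_zero rho (unt C)" by (intro arrow.expand) (simp add: arr_zero_def)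
    have "vect (cmp K (tri (unt C) k (idt k) (?b i)) (arr_zero rho (unt C))) = 0"
      using K_cmp_zero[OF _ _ _ tri_Hom[OF Y[OF i]], of rho] by (simp add: arr_zero_def)
    then have "vect (cmp K (tri (unt C) k (idt k) (?b i)) (cmp K (star K (tri (unt C) k (idt k) (?b i))) (tri rho tau T psi))) = 0" unfolding z .
    then show ?thesis unfolding s(1) h(1) g(1) by simp
  qed
  have "(\<Sum>i<bdim X k. ?v i) = bx (k\<odot>kb) tau (fa Rb Om) psi"
  proof -
    have "(\<Sum>i<bdim X k. ?v i) = (\<Sum>i<bdim X k. bx (k\<odot>kb) tau (bx k kb (?b i) (bar k kb Rb (?b i))) psi)"
      using k bm by (intro sum.cong[OF refl]) (simp add: box_assoc)
    also have "\<dots> = bx (k\<odot>kb) tau (\<Sum>i<bdim X k. bx k kb (?b i) (bar k kb Rb (?b i))) psi"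
      using k bm by (intro additive_sum(1)[of "HH (k\<odot>kb)" "\<lambda>x. bx (k\<odot>kb) tau x psi", symmetric]) (auto intro: H_closed(1,2) box_add_left box_mem)
    finally show ?thesis unfolding sum_bas_bar[OF k c] .
  qed
  moreover have "ev rho (k\<odot>(kb\<odot>tau)) ?M (\<Sum>i<bdim X k. ?v i) = (\<Sum>i<bdim X k. ev rho (k\<odot>(kb\<odot>tau)) ?M (?v i))"
    by (rule additive_sum(1)[of "HH (k\<odot>(kb\<odot>tau))"]) (auto intro: H_closed(1,2) ev_add_vec[OF Mt] vm)
  ultimately have 0: "ev rho (k\<odot>(kb\<odot>tau)) ?M (bx (k\<odot>kb) tau (fa Rb Om) psi) = 0" using z by simp
  have Rh: "Rb \<in> homs (unt C) (k\<odot>kb)" and A: "Rb**idt tau \<in> homs tau (k\<odot>(kb\<odot>tau))" by (simp_all add: homs_iff)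
  have kk: "k\<odot>kb \<in> D" by (rule D_tob[OF kD kb])
  have "bx (k\<odot>kb) tau (fa Rb Om) psi = fa (Rb**idt tau) psi"
    using fa_tp[OF D_unt kk tripD(3)[OF p] tripD(3)[OF p] Rh homs_simps(1) Om_mem tripD(7)[OF p]] by (simp add: bx_Om)
  moreover have "?M oo ((Rb**idt tau)**idt rho) = T"
  proof -
    have "(idt (k\<odot>kb)**T) oo (Rb**idt (tau\<odot>rho)) = (Rb**idt k) oo T"
      using slide[of Rb T, OF _ _ refl refl refl refl] by (simp add: ichg)
    moreover have "(idt k**R\<star>) oo (Rb**idt k) oo T = T" using cp_subst[OF csol_zz(3)[OF c], of T] by simp
    ultimately show ?thesis by (simp add: tp_cp)
  qed
  moreover have "ev rho tau (?M oo ((Rb**idt tau)**idt rho)) psi = ev rho (k\<odot>(kb\<odot>tau)) ?M (fa (Rb**idt tau) psi)"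
    by (rule ev_nat[OF Mt tripD(3)[OF p] A tripD(7)[OF p]]) (rule fa_rules(1)[OF tripD(3)[OF p] _ A tripD(7)[OF p]], simp)
  ultimately show False using 0 n by simp
qed

text \<open>
  The components of an arrow that is fixed by the monodromy of its target are themselves fixed. Let \<open>Z\<close> be a nonzero
  component into an irreducible summand \<open>r j\<close> of \<open>rho\<close>. The monodromy of \<open>r j\<close> fixes \<open>Z\<close>, and \<open>Z oo Z\<star>\<close> is a
  nonzero scalar, so the monodromy of \<open>r j\<close> is trivial.
\<close>

lemma degenerate_summand:
  assumes p: "trip rho' rho tau T psi" and n: "ev rho' tau T psi \<noteq> 0"
    and m: "\<And>sigma. ob sigma \<Longrightarrow> cmp K (emb (br sigma rho oo br rho sigma)) (tar K (tri rho' tau T psi) (emb (idt sigma))) = tar K (tri rho' tau T psi) (emb (idt sigma))"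
  shows "\<exists>k\<in>reps X. \<exists>g\<in>homs rho k. vect (cmp K (emb g) (tri rho' tau T psi)) \<noteq> 0"
proof -
  note [simp] = tripD[OF p]
  obtain n' r W where d: "decomp rho n' r W" using decomp_ex[of rho] by auto
  obtain k i j where kij: "k \<in> reps X" "i < bdim X k" "j < n'" "vect ((W j)\<star> oo T oo (crd k tau (bas X k i) psi**idt rho')) \<noteq> 0"
    "ev rho' tau ((W j)\<star> oo T) psi \<noteq> 0" by (rule component_nonzero[OF p n d])
  note W = decompD[OF d kij(3)]
  note [simp] = W(2)[unfolded homs_iff]
  define e where "e = T oo (crd k tau (bas X k i) psi**idt rho')"
  have e [simp]: "arr e" "src e = k\<odot>rho'" "tgt e = rho" using kij(1,2) by (simp_all add: e_def)
  \<comment> \<open>A nonzero component of the arrow, followed by the projection onto the summand \<open>r j\<close>.\<close>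
  define Z where "Z = (W j)\<star> oo e"
  have Z [simp]: "arr Z" "src Z = k\<odot>rho'" "tgt Z = r j" by (simp_all add: Z_def)
  have Zn: "vect Z \<noteq> 0" using kij(4) by (simp add: Z_def e_def)
  have me: "(br sigma rho oo br rho sigma) oo (e**idt sigma) = e**idt sigma" if o: "ob sigma" for sigma
  proof -
    note [simp] = o
    have t: "tar K (tri rho' tau T psi) (emb (idt sigma)) = tri (rho'\<odot>sigma) tau (T**idt sigma) psi" "trip (rho'\<odot>sigma) (rho\<odot>sigma) tau (T**idt sigma) psi"
      using K_tar[OF p emb_trip[OF arr_idt[OF o]]] by (simp_all add: emb_def bx_Om)
    have "tri (rho'\<odot>sigma) tau ((br sigma rho oo br rho sigma) oo (T**idt sigma)) psi = tri (rho'\<odot>sigma) tau (T**idt sigma) psi"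
      using m[OF o] emb_cmp_tri(1)[OF t(2), of "br sigma rho oo br rho sigma"] unfolding t(1) by simp
    then have "ev (rho'\<odot>sigma) tau ((br sigma rho oo br rho sigma) oo (T**idt sigma)) psi k i = ev (rho'\<odot>sigma) tau (T**idt sigma) psi k i" by (metis tri_simps(3))
    then have "vect (((br sigma rho oo br rho sigma) oo (T**idt sigma)) oo (crd k tau (bas X k i) psi**idt (rho'\<odot>sigma))) = vect ((T**idt sigma) oo (crd k tau (bas X k i) psi**idt (rho'\<odot>sigma)))"
      using kij(1,2) by (simp add: ev_def)
    moreover have "(T**idt sigma) oo (crd k tau (bas X k i) psi**idt (rho'\<odot>sigma)) = e**idt sigma" using kij(1,2) by (simp add: e_def tp_cp)
    ultimately have "vect ((br sigma rho oo br rho sigma) oo (e**idt sigma)) = vect (e**idt sigma)" using kij(1,2) by simp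
    then show ?thesis by (intro arrow.expand) simp
  qed
  have mZ: "(br sigma (r j) oo br (r j) sigma) oo (Z**idt sigma) = Z**idt sigma" if o: "ob sigma" for sigma
  proof -
    note [simp] = o
    have 1: "((W j)\<star>**idt sigma) oo br sigma rho oo br rho sigma = (br sigma (r j) oo br (r j) sigma) oo ((W j)\<star>**idt sigma)"
      by (rule mon_nat[symmetric]) simp_all
    have "Z**idt sigma = ((W j)\<star>**idt sigma) oo (e**idt sigma)" by (simp add: Z_def tp_cp)
    moreover have "\<dots> = ((W j)\<star>**idt sigma) oo (br sigma rho oo br rho sigma) oo (e**idt sigma)" unfolding me[OF o] ..
    moreover have "\<dots> = (br sigma (r j) oo br (r j) sigma) oo ((W j)\<star>**idt sigma) oo (e**idt sigma)"
      using cp_subst[OF 1, of "e**idt sigma"] by simp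
    ultimately show ?thesis by simp
  qed
  obtain z where z: "Z oo Z\<star> = z *> idt (r j)" using irr_ex[OF W(1), of "Z oo Z\<star>"] by (auto simp: homs_iff)
  have zn: "z \<noteq> 0"
  proof
    assume "z = 0"
    then have "vect ((Z\<star>)\<star> oo Z\<star>) = 0" using z by simp
    then have "vect (Z\<star>) = 0" by (intro pos'[of "Z\<star>"]) simp_all
    then have "Z\<star> = arr_zero (r j) (k\<odot>rho')" using vect_zero[of "Z\<star>"] by simp
    then have "(Z\<star>)\<star> = arr_zero (k\<odot>rho') (r j)" using kij(1) W(1) by simp
    then show False using Zn by simp
  qed
  have "br sigma (r j) oo br (r j) sigma = idt (r j\<odot>sigma)" if o: "ob sigma" for sigma
  proof -
    note [simp] = o
    have q: "(Z**idt sigma) oo (Z\<star>**idt sigma) = z *> idt (r j\<odot>sigma)" by (simp add: ichg z)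
    have "z *> (br sigma (r j) oo br (r j) sigma) = (br sigma (r j) oo br (r j) sigma) oo (Z**idt sigma) oo (Z\<star>**idt sigma)" unfolding q by simp
    also have "\<dots> = (Z**idt sigma) oo (Z\<star>**idt sigma)" using cp_subst[OF mZ[OF o], of "Z\<star>**idt sigma"] by simp
    finally have "(1 / z) *> z *> (br sigma (r j) oo br (r j) sigma) = (1 / z) *> z *> idt (r j\<odot>sigma)" unfolding q by simp
    then show ?thesis using zn by simp
  qed
  then have "r j \<in> D" using irr_ob[OF W(1)] unfolding D_iff by blast
  then obtain s where s: "s \<in> reps X" "isom C s (r j)" using reps_ex[OF W(1)] by blast
  obtain u where u: "u \<in> homs s (r j)" "u\<star> oo u = idt s" "u oo u\<star> = idt (r j)" using isom_unitary[OF s(2) repsD(2)[OF s(1)] W(1)] by metis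
  note [simp] = u(1)[unfolded homs_iff]
  let ?g = "u\<star> oo (W j)\<star>"
  have g: "?g \<in> homs rho s" by (simp add: homs_iff)
  have "ev rho' tau (?g oo T) psi \<noteq> 0"
  proof
    assume z: "ev rho' tau (?g oo T) psi = 0"
    have "trip rho' s tau (?g oo T) psi" by (rule tripI) (use s in simp_all)
    note q = emb_cmp_tri(1)[OF this, of u]
    have "u oo ?g oo T = (W j)\<star> oo T" using cp_subst[OF u(3), of "(W j)\<star> oo T"] by simp
    moreover have "ev rho' tau (u oo ?g oo T) psi = 0"
    proof (intro ext)
      fix m l
      show "ev rho' tau (u oo ?g oo T) psi m l = 0 m l"
      proof (cases "m \<in> reps X \<and> l < bdim X m")
        case True
        let ?x = "crd m tau (bas X m l) psi**idt rho'"
        have "vect ((?g oo T) oo ?x) = 0" using True fun_cong[OF fun_cong[OF z], of m l] by (simp add: ev_def)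
        then have "(?g oo T) oo ?x = arr_zero (m\<odot>rho') s" using True vect_zero[of "(?g oo T) oo ?x"] by simp
        then have "u oo ((?g oo T) oo ?x) = arr_zero (m\<odot>rho') (r j)" using True by simp
        then show ?thesis using True by (simp add: ev_def)
      qed (auto simp: ev_def)
    qed
    ultimately show False using kij(5) by simp
  qed
  then have "vect (cmp K (emb ?g) (tri rho' tau T psi)) \<noteq> 0" using emb_cmp_tri(1)[OF p, of ?g] by simp
  then show ?thesis using s(1) g by blast
qed

text \<open>
  For a degenerate object \<open>(rho, E)\<close>, the arrow \<open>E\<close> is fixed by the monodromy of \<open>rho\<close>. It therefore reaches a
  degenerate \<open>\<gamma>\<^sub>k\<close> and from there the unit. This gives a nonzero arrow from \<open>(rho, E)\<close> to the unit, hence an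
  isomorphism if the object is irreducible. For rationality, any \<open>E\<close> reaches some irreducible object of \<open>C\<close>, and
  each of the finitely many classes of these has finitely many irreducible summands in the crossed product.
\<close>

theorem crossed_product_properties:
  defines "P \<equiv> crossed_product C F X"
  shows "BTC_star P"
    "irreducible_obj P A \<Longrightarrow> degenerate_obj P A \<Longrightarrow> isom P A (unt P)"
    "rational C \<Longrightarrow> rational P"
proof -
  interpret KI: pre_BTC K using pre_K by (simp add: pre_BTC_def)
  have P: "P = KI.Sc" by (simp only: P_def crossed_product_def KI.Sc_def) (simp only: K_def)
  show PB: "BTC_star P" unfolding P by (rule KI.subobject_closure_BTC)
  interpret B: BTC_star P by (rule PB)
  have lift: "\<exists>h\<in>B.homs A (sigma, idn K sigma). vect h \<noteq> 0"
    if a: "KI.so A" and g: "g \<in> Hom K (fst A) sigma" and o: "ob sigma" and nz: "vect (cmp K g (snd A)) \<noteq> 0" for A g sigma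
  proof -
    obtain h where "h \<in> Hom P A (sigma, idn K sigma)" "vect h \<noteq> 0" using KI.lift_arrow[OF a g _ nz] o P by auto
    moreover have "A \<in> Obj P" "(sigma, idn K sigma) \<in> Obj P" using a KI.so_embed[of sigma] o KI.so_Obj P by auto
    ultimately show ?thesis using B.homs_Hom by blast
  qed
  have rep: "\<exists>tau T psi. trip (fst A) (fst A) tau T psi \<and> snd A = tri (fst A) tau T psi \<and> ev (fst A) tau T psi \<noteq> 0 \<and> KI.so A"
    if "irreducible_obj P A" for A
  proof -
    have a: "KI.so A" "vect (snd A) \<noteq> 0" using KI.irr_snd that P by auto
    have o: "ob (fst A)" and e: "snd A \<in> Hom K (fst A) (fst A)" using KI.soD[OF a(1)] KI.arr_HomI by auto
    obtain tau T psi where p: "trip (fst A) (fst A) tau T psi" "snd A = tri (fst A) tau T psi" by (rule K_rep[OF e o o])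
    then show ?thesis using a by (metis tri_simps(3))
  qed
  show "isom P A (unt P)" if i: "irreducible_obj P A" and dg: "degenerate_obj P A"
  proof -
    obtain tau T psi where p: "trip (fst A) (fst A) tau T psi" "snd A = tri (fst A) tau T psi" "ev (fst A) tau T psi \<noteq> 0" and a: "KI.so A"
      using rep[OF i] by blast
    have o: "ob (fst A)" using tripD(1)[OF p(1)] .
    have "cmp K (emb (br sigma (fst A) oo br (fst A) sigma)) (tar K (tri (fst A) tau T psi) (emb (idt sigma))) = tar K (tri (fst A) tau T psi) (emb (idt sigma))"
      if s: "ob sigma" for sigma
      using KI.degenerate_closure[OF a, of sigma] dg s o P by (simp add: p(2) emb_br emb_idn emb_cmp)
    then obtain k g where k: "k \<in> reps X" "g \<in> homs (fst A) k" "vect (cmp K (emb g) (tri (fst A) tau T psi)) \<noteq> 0"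
      using degenerate_summand[OF p(1,3)] by blast
    note [simp] = k(2)[unfolded homs_iff]
    note q = emb_cmp_tri[OF p(1), of g, simplified]
    have "ev (fst A) tau (g oo T) psi \<noteq> 0" using k(3) q(1) by simp
    then obtain h where h: "h \<in> Hom K k (unt C)" "vect (cmp K h (tri (fst A) tau (g oo T) psi)) \<noteq> 0" using arrow_to_unit[OF k(1) q(2)] by blast
    have gH: "emb g \<in> Hom K (fst A) k" by (rule emb_Hom[OF k(2)])
    have "cmp K (cmp K h (emb g)) (snd A) = cmp K h (cmp K (emb g) (snd A))"
    proof (rule KI.cmp_assoc[OF _ _ _ _ h(1) gH])
      show "fst A \<in> Obj K" "fst A \<in> Obj K" "k \<in> Obj K" "unt C \<in> Obj K" using o k(1) by simp_all
      show "snd A \<in> Hom K (fst A) (fst A)" unfolding p(2) by (rule tri_Hom[OF p(1)])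
    qed
    then have "vect (cmp K (cmp K h (emb g)) (snd A)) \<noteq> 0" using h(2) q(1) p(2) by simp
    moreover have "cmp K h (emb g) \<in> Hom K (fst A) (unt C)" by (rule K_cmp_add(5)[OF o _ _ h(1) gH]) (use k(1) in auto)
    ultimately obtain f where f: "f \<in> B.homs A (unt C, idn K (unt C))" "vect f \<noteq> 0" using lift[OF a] by force
    have u: "unt P = (unt C, idn K (unt C))" unfolding P KI.Sc_simps by simp
    show ?thesis using B.isom_of_arrow[OF i B.unt_irr, of f] f u by simp
  qed
  show "rational P" if r: "rational C"
  proof -
    obtain J where J: "finite J" "\<And>r. irr r \<Longrightarrow> \<exists>s\<in>J. irr s \<and> isom C r s" using rationalE[OF r] by blast
    have "\<exists>N. finite N \<and> (\<forall>A f. irreducible_obj P A \<longrightarrow> f \<in> B.homs A (s, idn K s) \<longrightarrow> vect f \<noteq> 0 \<longrightarrow> (\<exists>B'\<in>N. isom P A B'))" if s: "ob s" for s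
    proof -
      have "(s, idn K s) \<in> Obj P" using KI.so_embed[of s] s KI.so_Obj P by auto
      then obtain n R W where d: "B.decomp (s, idn K s) n R W" using B.decomp_ex by blast
      show ?thesis
        by (rule exI[of _ "R ` {..<n}"]) (use B.irr_isom_summand[OF _ _ _ d] in blast)
    qed
    then obtain N where N: "\<And>s. ob s \<Longrightarrow> finite (N s)"
      "\<And>s A f. ob s \<Longrightarrow> irreducible_obj P A \<Longrightarrow> f \<in> B.homs A (s, idn K s) \<Longrightarrow> vect f \<noteq> 0 \<Longrightarrow> \<exists>B'\<in>N s. isom P A B'" by metis
    show "rational P"
    proof (rule B.rationalI)
      show "finite (\<Union>s\<in>{s \<in> J. ob s}. N s)" using J(1) N(1) by auto
      fix A assume i: "irreducible_obj P A"
      obtain tau T psi where p: "trip (fst A) (fst A) tau T psi" "snd A = tri (fst A) tau T psi" "ev (fst A) tau T psi \<noteq> 0" and a: "KI.so A"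
        using rep[OF i] by blast
      obtain n R W where d: "decomp (fst A) n R W" using decomp_ex tripD(1)[OF p(1)] by blast
      obtain j where j: "j < n" "ev (fst A) tau ((W j)\<star> oo T) psi \<noteq> 0" by (rule component_nonzero[OF p(1,3) d])
      obtain s where s: "s \<in> J" "irr s" "isom C (R j) s" using J(2)[OF decompD(1)[OF d j(1)]] by blast
      obtain u v where u: "u \<in> homs (R j) s" "v \<in> homs s (R j)" "v oo u = idt (R j)" using s(3) isom_iff by blast
      note [simp] = u(1,2)[unfolded homs_iff] decompD(2)[OF d j(1), unfolded homs_iff] tripD[OF p(1)]
      have g: "u oo (W j)\<star> \<in> homs (fst A) s" by (simp add: homs_iff)
      have "cmp K (emb v) (cmp K (emb (u oo (W j)\<star>)) (snd A)) = tri (fst A) tau ((W j)\<star> oo T) psi"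
        using emb_cmp_tri[OF p(1), of "u oo (W j)\<star>"] emb_cmp_tri(1)[of "fst A" s tau "(u oo (W j)\<star>) oo T" psi v] cp_subst[OF u(3), of "(W j)\<star> oo T"]
        by (simp add: p(2))
      then have ne: "vect (cmp K (emb v) (cmp K (emb (u oo (W j)\<star>)) (snd A))) \<noteq> 0" using j(2) by simp
      have "vect (cmp K (emb (u oo (W j)\<star>)) (snd A)) \<noteq> 0"
      proof
        assume "vect (cmp K (emb (u oo (W j)\<star>)) (snd A)) = 0"
        then have "cmp K (emb (u oo (W j)\<star>)) (snd A) = arr_zero (fst A) s" by (intro arrow.expand) (simp add: p(2) arr_zero_def)
        then show False using ne K_cmp_zero[OF _ _ _ emb_Hom[OF u(2)], of "fst A"] by (simp add: arr_zero_def)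
      qed
      then obtain f where "f \<in> B.homs A (s, idn K s)" "vect f \<noteq> 0" using lift[OF a emb_Hom[OF g]] s(2) by auto
      then show "\<exists>B'\<in>\<Union>s\<in>{s \<in> J. ob s}. N s. isom P A B'" using N(2)[OF _ i] s by force
    qed
  qed
qed

end

theorem theorem4p4:
  fixes C :: "('o, 'a::ab_group_add) tcat"
    and F :: "('o, 'a, 'g, 'v::ab_group_add) dr_iso"
    and X :: "('o, 'a, 'v) cp_choices"
  assumes "BTC_star C"
    and "even_subcat C (degenerates C)"
    and "doplicher_roberts C (degenerates C) F"
    and "crossed_product_choices C (degenerates C) F X"
  shows "BTC_star (crossed_product C F X) \<and>
    \<not> degenerate_category (crossed_product C F X) \<and>
    (\<forall>A. irreducible_obj (crossed_product C F X) A \<longrightarrow> degenerate_obj (crossed_product C F X) A \<longrightarrow>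
       isom (crossed_product C F X) A (unt (crossed_product C F X))) \<and>
    (rational C \<longrightarrow> rational (crossed_product C F X)) \<and>
    (rational (crossed_product C F X) \<longrightarrow> modular (crossed_product C F X))"
proof -
  interpret R: crossed C F X by (intro crossed.intro assms)
  note h = R.crossed_product_properties
  have nd: "\<not> degenerate_category (crossed_product C F X)"
    using h(2) unfolding degenerate_category_def by blast
  then show ?thesis using h BTC_star.nondegenerate_modular[OF h(1)] by blast
qed

end
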